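(* Let $N\ge 3$, $0<\gamma_2<\gamma_1<\min\{N,4\}$ and $\gamma_1>2$. Then there exists a constant $\hat c_1>0$ such that, for any $0<c<\hat c_1$, the problem $$-\Delta u+\lambda u=\left(|x|^{-\gamma_1}\ast|u|^2\right)u-\left(|x|^{-\gamma_2}\ast|u|^2\right)u\ \text{ in }\mathbb{R}^N,\qquad \int_{\mathbb{R}^N}|u|^2\,dx=c$$ has a ground state $u_c\in S(c)$ satisfying $E(u_c)=\Gamma(c)$.
   Context: For $\gamma\in(0,N)$ and $u\in H^1(\mathbb{R}^N)$ write $D_\gamma(u):=\int_{\mathbb{R}^N}\int_{\mathbb{R}^N}\frac{|u(x)|^2|u(y)|^2}{|x-y|^{\gamma}}\,dx\,dy$. Set $E(u):=\frac12\int_{\mathbb{R}^N}|\nabla u|^2\,dx+\frac14 D_{\gamma_2}(u)-\frac14 D_{\gamma_1}(u)$, $Q(u):=\int_{\mathbb{R}^N}|\nabla u|^2\,dx+\frac{\gamma_2}{4}D_{\gamma_2}(u)-\frac{\gamma_1}{4}D_{\gamma_1}(u)$, $S(c):=\{u\in H^1(\mathbb{R}^N):\int_{\mathbb{R}^N}|u|^2\,dx=c\}$, $P(c):=\{u\in S(c):Q(u)=0\}$ and $\Gamma(c):=\inf_{u\in P(c)}E(u)$. A solution of the problem is a function $u\in S(c)$ for which there is some $\lambda\in\mathbb{R}$ (unknown, a Lagrange multiplier) such that the equation holds (in the weak sense). A ground state is a solution in $S(c)$ whose energy $E$ is least among all solutions in $S(c)$. *)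

theory Defs
  imports "HOL-Analysis.Analysis"
begin

section \<open>The Sobolev space \<open>H\<^sup>1\<close> of functions on \<open>\<real>\<^sup>N\<close>\<close>

text \<open>
  Here \<open>\<real>\<^sup>N\<close> is \<^typ>\<open>real^'n\<close> with \<open>N = CARD('n)\<close>. Functions take values in a type \<open>'k\<close> that is
  both a real normed field and a Euclidean space; up to isomorphism these are exactly \<^typ>\<open>real\<close>
  and \<^typ>\<open>complex\<close>, so both usual readings of \<open>H\<^sup>1(\<real>\<^sup>N)\<close> are covered. The inner product
  \<open>a \<bullet> b\<close> on \<open>'k\<close> is \<open>a b\<close> in the real case and \<open>Re (a * cnj b)\<close> in the complex case.

  Elements of \<open>H\<^sup>1\<close> are functions rather than classes modulo null sets, and they are represented by
  Borel functions; every class has such a representative.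
\<close>

definition partial_deriv :: "'n::finite \<Rightarrow> (real^'n \<Rightarrow> real) \<Rightarrow> real^'n \<Rightarrow> real" where
  "partial_deriv i f x = frechet_derivative f (at x) (axis i 1)"

primrec C_k :: "nat \<Rightarrow> (real^'n::finite \<Rightarrow> real) \<Rightarrow> bool" where
  "C_k 0 f \<longleftrightarrow> continuous_on UNIV f"
| "C_k (Suc k) f \<longleftrightarrow> (\<forall>x. f differentiable at x) \<and> (\<forall>i. C_k k (partial_deriv i f))"

definition test_functions :: "(real^'n::finite \<Rightarrow> real) set" where
  "test_functions = {\<phi>. (\<forall>k. C_k k \<phi>) \<and> compact (closure (support_on UNIV \<phi>))}"

definition square_integrable :: "(real^'n::finite \<Rightarrow> 'b::euclidean_space) \<Rightarrow> bool" where
  "square_integrable f \<longleftrightarrow>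
     f \<in> borel_measurable lborel \<and> integrable lborel (\<lambda>x. (norm (f x))\<^sup>2)"

definition has_weak_gradient ::
  "(real^'n::finite \<Rightarrow> 'k::euclidean_space) \<Rightarrow> (real^'n \<Rightarrow> 'k^'n) \<Rightarrow> bool" where
  "has_weak_gradient u G \<longleftrightarrow>
     (\<forall>\<phi>\<in>test_functions. \<forall>i.
        (LINT x|lborel. partial_deriv i \<phi> x *\<^sub>R u x) = - (LINT x|lborel. \<phi> x *\<^sub>R (G x $ i)))"

definition H1 :: "(real^'n::finite \<Rightarrow> 'k::euclidean_space) set" where
  "H1 = {u. square_integrable u \<and> (\<exists>G. square_integrable G \<and> has_weak_gradient u G)}"

text \<open>The weak gradient is only determined up to null sets; \<^const>\<open>Eps\<close> picks a representative. The norm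
  on \<open>'k^'n\<close> is Euclidean, so \<open>(norm (weak_gradient u x))\<^sup>2\<close> is \<open>\<Sum>i. \<bar>\<partial>\<^sub>i u(x)\<bar>\<^sup>2\<close>.\<close>

definition weak_gradient ::
  "(real^'n::finite \<Rightarrow> 'k::euclidean_space) \<Rightarrow> real^'n \<Rightarrow> 'k^'n" where
  "weak_gradient u = (SOME G. square_integrable G \<and> has_weak_gradient u G)"


section \<open>The functionals and the constraint sets\<close>

text \<open>The Riesz-type potential \<open>|x|\<^bsup>-\<gamma>\<^esup> * |u|\<^sup>2\<close>. The value \<open>0\<close> which the integrand gets at \<open>y = x\<close>
  is irrelevant, as it concerns a null set. The same holds for the value \<open>0\<close> of the integral where
  it diverges: for \<open>u \<in> H\<^sup>1\<close> and \<open>0 < \<gamma> < min N 4\<close> the potential is finite almost everywhere, and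
  \<open>D \<gamma> u\<close> is finite by the Hardy-Littlewood-Sobolev inequality.\<close>

definition riesz_conv ::
  "real \<Rightarrow> (real^'n::finite \<Rightarrow> 'k::euclidean_space) \<Rightarrow> real^'n \<Rightarrow> real" where
  "riesz_conv \<gamma> u x = (LINT y|lborel. (norm (u y))\<^sup>2 / norm (x - y) powr \<gamma>)"

definition D :: "real \<Rightarrow> (real^'n::finite \<Rightarrow> 'k::euclidean_space) \<Rightarrow> real" where
  "D \<gamma> u = (LINT x|lborel. LINT y|lborel.
              (norm (u x))\<^sup>2 * (norm (u y))\<^sup>2 / norm (x - y) powr \<gamma>)"

definition E :: "real \<Rightarrow> real \<Rightarrow> (real^'n::finite \<Rightarrow> 'k::euclidean_space) \<Rightarrow> real" where
  "E \<gamma>1 \<gamma>2 u =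
     1/2 * (LINT x|lborel. (norm (weak_gradient u x))\<^sup>2) + 1/4 * D \<gamma>2 u - 1/4 * D \<gamma>1 u"

definition Q :: "real \<Rightarrow> real \<Rightarrow> (real^'n::finite \<Rightarrow> 'k::euclidean_space) \<Rightarrow> real" where
  "Q \<gamma>1 \<gamma>2 u =
     (LINT x|lborel. (norm (weak_gradient u x))\<^sup>2) + \<gamma>2/4 * D \<gamma>2 u - \<gamma>1/4 * D \<gamma>1 u"

definition S :: "real \<Rightarrow> (real^'n::finite \<Rightarrow> 'k::euclidean_space) set" where
  "S c = {u \<in> H1. (LINT x|lborel. (norm (u x))\<^sup>2) = c}"

definition P :: "real \<Rightarrow> real \<Rightarrow> real \<Rightarrow> (real^'n::finite \<Rightarrow> 'k::euclidean_space) set" where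
  "P \<gamma>1 \<gamma>2 c = {u \<in> S c. Q \<gamma>1 \<gamma>2 u = 0}"

text \<open>The infimum is taken in the extended reals, so that it is meaningful without knowing that
  \<open>P \<gamma>1 \<gamma>2 c\<close> is nonempty and that \<open>E\<close> is bounded below on it. The type argument fixes the
  underlying function space.\<close>

definition Gamma_inf ::
  "(real^'n::finite \<Rightarrow> 'k::euclidean_space) itself \<Rightarrow> real \<Rightarrow> real \<Rightarrow> real \<Rightarrow> ereal" where
  "Gamma_inf _ \<gamma>1 \<gamma>2 c =
     (INF u \<in> (P \<gamma>1 \<gamma>2 c :: (real^'n \<Rightarrow> 'k) set). ereal (E \<gamma>1 \<gamma>2 u))"


section \<open>Weak solutions and ground states\<close>

text \<open>The weak form of \<open>-\<Delta>u + \<lambda>u = (|x|\<^bsup>-\<gamma>1\<^esup> * |u|\<^sup>2)u - (|x|\<^bsup>-\<gamma>2\<^esup> * |u|\<^sup>2)u\<close> in \<open>H\<^sup>1\<close>, where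
  \<open>lam\<close> stands for \<open>\<lambda>\<close>. For
  complex-valued functions it is the real part of the usual sesquilinear identity; replacing \<open>v\<close> by
  \<open>\<i> v\<close> recovers the imaginary part.\<close>

definition weak_solution ::
  "real \<Rightarrow> real \<Rightarrow> real \<Rightarrow> (real^'n::finite \<Rightarrow> 'k::euclidean_space) \<Rightarrow> bool" where
  "weak_solution \<gamma>1 \<gamma>2 lam u \<longleftrightarrow> u \<in> H1 \<and>
     (\<forall>v\<in>H1.
        (LINT x|lborel. weak_gradient u x \<bullet> weak_gradient v x) + lam * (LINT x|lborel. u x \<bullet> v x)
        = (LINT x|lborel. (riesz_conv \<gamma>1 u x *\<^sub>R u x) \<bullet> v x)
          - (LINT x|lborel. (riesz_conv \<gamma>2 u x *\<^sub>R u x) \<bullet> v x))"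

definition normalized_solution ::
  "real \<Rightarrow> real \<Rightarrow> real \<Rightarrow> (real^'n::finite \<Rightarrow> 'k::euclidean_space) \<Rightarrow> bool" where
  "normalized_solution \<gamma>1 \<gamma>2 c u \<longleftrightarrow> u \<in> S c \<and> (\<exists>lam. weak_solution \<gamma>1 \<gamma>2 lam u)"

definition ground_state ::
  "real \<Rightarrow> real \<Rightarrow> real \<Rightarrow> (real^'n::finite \<Rightarrow> 'k::euclidean_space) \<Rightarrow> bool" where
  "ground_state \<gamma>1 \<gamma>2 c u \<longleftrightarrow> normalized_solution \<gamma>1 \<gamma>2 c u \<and>
     (\<forall>v :: real^'n \<Rightarrow> 'k. normalized_solution \<gamma>1 \<gamma>2 c v \<longrightarrow> E \<gamma>1 \<gamma>2 u \<le> E \<gamma>1 \<gamma>2 v)"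

end

theory Submission
  imports Defs "HOL-Library.Diagonal_Subsequence"
begin

text \<open>
  On \<open>H\<^sup>1\<close> the energy is \<open>E = I + Q/\<gamma>1\<close>, where \<open>I = (1/2 - 1/\<gamma>1) |\<nabla>u|\<^sup>2 + (1 - \<gamma>2/\<gamma>1) D\<^sub>2/4\<close> is coercive
  since \<open>\<gamma>1 > 2\<close>. One minimises \<open>I\<close> on the relaxed set of all \<open>u \<noteq> 0\<close> with mass at most \<open>c\<close> and \<open>Q u \<le> 0\<close>:
  there \<open>D\<^sub>1\<close> is bounded below, so a minimising sequence does not vanish and, after
  translation, has a nonzero weak limit, which lies in the relaxed set by the Brezis-Lieb splitting of
  \<open>D\<^sub>\<gamma>\<close>. Dilations show that a minimiser \<open>u\<close> satisfies \<open>Q u = 0\<close>, and varying it along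
  dilated lines (the dilation restores the constraint \<open>Q \<le> 0\<close>) gives the Euler-Lagrange equation, without
  a multiplier if the mass is less than \<open>c\<close>. In that case
  \<open>|\<nabla>u|\<^sup>2 + D\<^sub>2 = D\<^sub>1\<close>, which together with \<open>Q u = 0\<close> bounds \<open>|\<nabla>u|\<^sup>2\<close> by a multiple of the squared mass; this
  contradicts the scale-invariant bound for \<open>D\<^sub>1\<close> if \<open>c\<close> is small. So \<open>u\<close> has mass \<open>c\<close> and
  minimises \<open>E\<close> on \<open>P(c)\<close>. It is a ground state because every solution \<open>v\<close> satisfies \<open>Q v = 0\<close>:
  such a \<open>v\<close> lies in \<open>H\<^sup>2\<close>, so the equation can be tested with a truncation of \<open>x\<^sub>i \<partial>\<^sub>i v\<close> (Pohozaev).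
\<close>

text \<open>Two mechanisms carry the nonlocal estimates. First, \<open>H\<^sup>1\<close> regularity
  enters them only through the bound of \<open>u(x + h) - u(x)\<close> in L2 by \<open>|h|\<close>
  times the gradient norm. From this bound alone the Riesz energy is controlled by comparing masses
  in balls of geometrically decreasing radius: \<open>\<gamma> < N\<close> makes the comparison
  contract, and \<open>\<gamma> < 4\<close> makes the gradient errors summable over the scales.
  Second, both conditions are open, so a kernel can be compared with a slightly more singular one.
  Cutting by distance then yields a form bound with arbitrarily small constant, non-vanishing of
  minimising sequences and vanishing of mixed terms. The same cut, comparing D2 with D1, drives the
  argument for small mass. Subtracting \<open>Q/\<gamma>1\<close> is the combination that removes
  D1, the only negative term of the energy. Relaxing to inequalities is what makes the compactness
  argument close: were the weak limit to violate \<open>Q \<le> 0\<close>, the remainder would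
  satisfy both constraints, although its reduced energy tends to less than the infimum.\<close>

abbreviation "sq \<equiv> square_integrable"

section \<open>The L2 inner product of vector-valued functions\<close>

definition ip :: "(real^'n::finite \<Rightarrow> 'b::euclidean_space) \<Rightarrow> (real^'n \<Rightarrow> 'b) \<Rightarrow> real" where
  "ip f g = (LINT x|lborel. f x \<bullet> g x)"

lemma sq_measurable [measurable_dest]: "sq f \<Longrightarrow> f \<in> borel_measurable borel"
  by (simp add: square_integrable_def)

lemma sq_iff: "sq f \<longleftrightarrow> f \<in> borel_measurable borel \<and> integrable lborel (\<lambda>x. f x \<bullet> f x)"
  by (simp add: square_integrable_def power2_norm_eq_inner)

lemma ip_self: "ip f f = (LINT x|lborel. (norm (f x))\<^sup>2)"
  by (simp add: ip_def power2_norm_eq_inner)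

lemma ip_nonneg [simp]: "0 \<le> ip f f"
  by (simp add: ip_def)

lemma ip_commute: "ip f g = ip g f"
  by (simp add: ip_def inner_commute)

lemma abs_inner_le_squares: "\<bar>a \<bullet> b\<bar> \<le> a \<bullet> a / 2 + (b :: 'b::real_inner) \<bullet> b / 2"
  using inner_ge_zero[of "a + b"] inner_ge_zero[of "a - b"]
  by (simp add: inner_add inner_diff inner_commute abs_le_iff)

lemma sq_zero [simp]: "sq (\<lambda>x. 0)"
  by (simp add: sq_iff)

lemma sq_scaleR [simp]: "sq f \<Longrightarrow> sq (\<lambda>x. c *\<^sub>R f x)"
  by (auto simp: sq_iff intro!: borel_measurable_scaleR)

lemma sq_integrable [simp]: "sq f \<Longrightarrow> integrable lborel (\<lambda>x. f x \<bullet> f x)"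
  by (simp add: sq_iff)

lemma sq_integrable_norm [simp]: "sq f \<Longrightarrow> integrable lborel (\<lambda>x. (norm (f x))\<^sup>2)"
  by (simp add: square_integrable_def)

lemma integrable_inner [simp]:
  assumes [measurable]: "sq f" "sq g"
  shows "integrable lborel (\<lambda>x. f x \<bullet> g x)"
proof (rule Bochner_Integration.integrable_bound)
  show "integrable lborel (\<lambda>x. f x \<bullet> f x / 2 + g x \<bullet> g x / 2)" using assms by auto
  show "AE x in lborel. norm (f x \<bullet> g x) \<le> norm (f x \<bullet> f x / 2 + g x \<bullet> g x / 2)"
    using abs_inner_le_squares by (auto intro!: AE_I2)
qed measurable

lemma integrable_norm_mult:
  assumes [measurable]: "sq f" "sq g"
  shows "integrable lborel (\<lambda>x. norm (f x) * norm (g x))"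
proof (rule Bochner_Integration.integrable_bound)
  show "integrable lborel (\<lambda>x. f x \<bullet> f x / 2 + g x \<bullet> g x / 2)" using assms by auto
  have "norm a * norm b \<le> a \<bullet> a / 2 + b \<bullet> b / 2" for a :: 'b and b :: 'c
    using sum_squares_bound[of "norm a" "norm b"] by (simp add: power2_norm_eq_inner)
  then show "AE x in lborel. norm (norm (f x) * norm (g x)) \<le> norm (f x \<bullet> f x / 2 + g x \<bullet> g x / 2)"
    by (auto intro!: AE_I2)
qed measurable

lemma sq_add [simp]:
  assumes "sq f" "sq g" shows "sq (\<lambda>x. f x + g x)"
proof -
  have [measurable]: "f \<in> borel_measurable borel" "g \<in> borel_measurable borel" using assms by measurable
  have "integrable lborel (\<lambda>x. (f x + g x) \<bullet> (f x + g x))"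
    unfolding inner_add using assms by (intro Bochner_Integration.integrable_add integrable_inner)
  then show ?thesis unfolding sq_iff by simp
qed

lemma sq_diff [simp]:
  assumes "sq f" "sq g" shows "sq (\<lambda>x. f x - g x)"
  using sq_add[OF assms(1) sq_scaleR[OF assms(2), of "-1"]] by simp

lemma sq_dominated:
  assumes [measurable]: "sq g" "f \<in> borel_measurable borel" and le: "\<And>x. norm (f x) \<le> c * norm (g x)"
  shows "sq f"
proof -
  have "integrable lborel (\<lambda>x. (norm (f x))\<^sup>2)"
  proof (rule Bochner_Integration.integrable_bound)
    show "integrable lborel (\<lambda>x. c\<^sup>2 * (norm (g x))\<^sup>2)" using assms by auto
    show "AE x in lborel. norm ((norm (f x))\<^sup>2) \<le> norm (c\<^sup>2 * (norm (g x))\<^sup>2)"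
      using power_mono[OF le norm_ge_zero, where n = 2] by (auto intro!: AE_I2 simp: power_mult_distrib)
  qed measurable
  then show ?thesis by (simp add: square_integrable_def)
qed

lemma ip_add_left: "sq f \<Longrightarrow> sq g \<Longrightarrow> sq h \<Longrightarrow> ip (\<lambda>x. f x + g x) h = ip f h + ip g h"
  by (simp add: ip_def inner_add_left)
lemma ip_diff_left: "sq f \<Longrightarrow> sq g \<Longrightarrow> sq h \<Longrightarrow> ip (\<lambda>x. f x - g x) h = ip f h - ip g h"
  by (simp add: ip_def inner_diff_left)
lemma ip_scale_left [simp]: "ip (\<lambda>x. c *\<^sub>R f x) h = c * ip f h"
  by (simp add: ip_def)
lemma ip_add_right: "sq f \<Longrightarrow> sq g \<Longrightarrow> sq h \<Longrightarrow> ip h (\<lambda>x. f x + g x) = ip h f + ip h g"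
  by (simp add: ip_def inner_add_right)
lemma ip_diff_right: "sq f \<Longrightarrow> sq g \<Longrightarrow> sq h \<Longrightarrow> ip h (\<lambda>x. f x - g x) = ip h f - ip h g"
  by (simp add: ip_def inner_diff_right)
lemma ip_scale_right [simp]: "ip h (\<lambda>x. c *\<^sub>R f x) = c * ip h f"
  by (simp add: ip_def)

lemmas ip_linear = ip_add_left ip_diff_left ip_add_right ip_diff_right

lemma ip_self_add:
  "sq f \<Longrightarrow> sq g \<Longrightarrow> ip (\<lambda>x. f x + g x) (\<lambda>x. f x + g x) = ip f f + 2 * ip f g + ip g g"
  by (simp add: ip_linear ip_commute[of g f])

lemma ip_self_diff:
  "sq f \<Longrightarrow> sq g \<Longrightarrow> ip (\<lambda>x. f x - g x) (\<lambda>x. f x - g x) = ip f f - 2 * ip f g + ip g g"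
  by (simp add: ip_linear ip_commute[of g f])

text \<open>Parallelogram law for \<open>f - g = (f - h) + (h - g)\<close>; the discarded square is
  that of the difference of the two summands.\<close>

lemma ip_self_diff_le:
  assumes "sq f" "sq g" "sq h"
  shows "ip (\<lambda>x. f x - g x) (\<lambda>x. f x - g x)
    \<le> 2 * ip (\<lambda>x. f x - h x) (\<lambda>x. f x - h x) + 2 * ip (\<lambda>x. h x - g x) (\<lambda>x. h x - g x)"
  using assms ip_nonneg[of "\<lambda>x. (f x - h x) - (h x - g x)"]
  by (simp add: ip_linear ip_commute[of g f] ip_commute[of h f] ip_commute[of h g])

lemma ip_young:
  assumes "sq f" "sq g" "0 < s"
  shows "\<bar>ip f g\<bar> \<le> s / 2 * ip f f + 1 / (2 * s) * ip g g"
proof -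
  have "0 \<le> ip (\<lambda>x. s *\<^sub>R f x + c *\<^sub>R g x) (\<lambda>x. s *\<^sub>R f x + c *\<^sub>R g x)" for c by simp
  from this[of 1] this[of "-1"] assms have "2 * s * \<bar>ip f g\<bar> \<le> s\<^sup>2 * ip f f + ip g g"
    by (auto simp: ip_linear ip_commute[of g f] power2_eq_square abs_if algebra_simps)
  then show ?thesis using assms(3) by (simp add: field_simps power2_eq_square)
qed

text \<open>Besides Cauchy-Schwarz, this turns a minimality condition into an equality:
  \<open>L2_representation\<close> applies it with \<open>a = 0\<close>, where it forces the linear
  coefficient to vanish.\<close>

lemma quadratic_nonneg_discriminant:
  assumes "\<And>t::real. 0 \<le> a + 2 * b * t + c * t\<^sup>2" "0 \<le> c"
  shows "b\<^sup>2 \<le> a * c"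
proof (cases "c = 0")
  case True
  have "b = 0"
  proof (rule ccontr)
    assume "b \<noteq> 0"
    with assms(1)[of "- (a + 1) / (2 * b)"] True show False by (simp add: field_simps)
  qed
  then show ?thesis using True by simp
next
  case False
  with assms(2) have "c > 0" by simp
  with assms(1)[of "- b / c"] show ?thesis by (simp add: field_simps power2_eq_square)
qed

lemma ip_Cauchy_Schwarz:
  assumes "sq f" "sq g" shows "(ip f g)\<^sup>2 \<le> ip f f * ip g g"
proof (rule quadratic_nonneg_discriminant)
  fix t :: real
  have "0 \<le> ip (\<lambda>x. f x + t *\<^sub>R g x) (\<lambda>x. f x + t *\<^sub>R g x)" by simp
  then show "0 \<le> ip f f + 2 * ip f g * t + ip g g * t\<^sup>2"
    using assms by (simp add: ip_linear ip_commute[of g f] power2_eq_square algebra_simps)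
qed simp

lemma ip_Cauchy_Schwarz_sqrt:
  assumes "sq f" "sq g" shows "\<bar>ip f g\<bar> \<le> sqrt (ip f f) * sqrt (ip g g)"
  using ip_Cauchy_Schwarz[OF assms] real_le_rsqrt real_sqrt_mult
  by (metis abs_le_square_iff real_sqrt_abs real_sqrt_le_iff)

lemma ip_cong_AE:
  assumes "sq f" "sq f'" "sq g" "sq g'" "AE x in lborel. f x = f' x" "AE x in lborel. g x = g' x"
  shows "ip f g = ip f' g'"
proof -
  have [measurable]: "f \<in> borel_measurable borel" "f' \<in> borel_measurable borel"
     "g \<in> borel_measurable borel" "g' \<in> borel_measurable borel"
    using assms by measurable
  show ?thesis unfolding ip_def by (rule integral_cong_AE) (use assms in auto)
qed

lemma nn_integral_norm_square:
  "sq f \<Longrightarrow> (\<integral>\<^sup>+x. ennreal ((norm (f x))\<^sup>2) \<partial>lborel) = ennreal (ip f f)"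
  unfolding ip_self by (subst nn_integral_eq_integral) auto

lemma sq_nn_integralI:
  assumes [measurable]: "f \<in> borel_measurable borel"
    and "(\<integral>\<^sup>+x. ennreal ((norm (f x))\<^sup>2) \<partial>lborel) < \<infinity>"
  shows "sq f"
  using assms(2) by (auto simp: square_integrable_def intro!: integrableI_bounded)

section \<open>Completeness and weak compactness of \<open>L\<^sup>2\<close>\<close>

text \<open>Riesz-Fischer: a rapidly Cauchy subsequence converges almost everywhere, and Fatou's
  lemma turns this into L2 convergence of the whole sequence.\<close>

lemma L2_complete:
  fixes f :: "nat \<Rightarrow> real^'n::finite \<Rightarrow> 'b::euclidean_space"
  assumes f: "\<And>n. sq (f n)"
    and cauchy: "\<And>e. 0 < e \<Longrightarrow> \<exists>N. \<forall>m\<ge>N. \<forall>n\<ge>N. ip (\<lambda>x. f m x - f n x) (\<lambda>x. f m x - f n x) < e"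
  shows "\<exists>g. sq g \<and> (\<lambda>n. ip (\<lambda>x. f n x - g x) (\<lambda>x. f n x - g x)) \<longlonglongrightarrow> 0"
proof -
  have [measurable]: "f n \<in> borel_measurable borel" for n using f by (rule sq_measurable)
  define d where "d m n = ip (\<lambda>x. f m x - f n x) (\<lambda>x. f m x - f n x)" for m n
  \<comment> \<open>The rate 4^-k leaves room for a weight 2^k in the series below. The weight makes
    summable squares yield summable norms, through 2t \<le> 2^-k + 2^k t^2.\<close>
  have "\<exists>N. \<forall>m\<ge>N. \<forall>n\<ge>N. d m n < (1/4)^k" for k :: nat
    using cauchy[of "(1/4)^k"] by (simp add: d_def)
  then obtain N where N: "\<And>k m n. m \<ge> N k \<Longrightarrow> n \<ge> N k \<Longrightarrow> d m n < (1/4)^k" by metis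
  \<comment> \<open>Partial sums lie above all earlier thresholds even if \<open>N\<close> is not
    monotone.\<close>
  define r where "r k = (\<Sum>i\<le>k. N i)" for k
  have r_ge: "r k \<ge> N k" "r (Suc k) \<ge> N k" for k
    unfolding r_def by (auto intro: member_le_sum trans_le_add1)
  have d_r: "d (r (Suc k)) (r k) < (1/4)^k" for k using N r_ge by blast
  have "(\<integral>\<^sup>+x. (\<Sum>k. ennreal (2^k * (norm (f (r (Suc k)) x - f (r k) x))\<^sup>2)) \<partial>lborel)
      = (\<Sum>k. \<integral>\<^sup>+x. ennreal (2^k * (norm (f (r (Suc k)) x - f (r k) x))\<^sup>2) \<partial>lborel)"
    by (intro nn_integral_suminf) measurable
  also have "\<dots> = (\<Sum>k. ennreal (2^k * d (r (Suc k)) (r k)))"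
    by (simp add: ennreal_mult' nn_integral_cmult nn_integral_norm_square f d_def)
  also have "\<dots> \<le> (\<Sum>k. ennreal ((1/2)^k))"
  proof (intro suminf_le ennreal_leI summableI)
    fix k :: nat
    have "2^k * d (r (Suc k)) (r k) \<le> 2^k * (1/4)^k"
      using d_r[of k] by (intro mult_left_mono) auto
    also have "\<dots> = (1/2::real)^k" by (simp flip: power_mult_distrib)
    finally show "2^k * d (r (Suc k)) (r k) \<le> (1/2)^k" .
  qed
  also have "\<dots> = ennreal (\<Sum>k. (1/2)^k)"
    by (intro suminf_ennreal2) (auto simp: summable_geometric)
  also have "\<dots> < \<infinity>" by simp
  finally have "AE x in lborel. (\<Sum>k. ennreal (2^k * (norm (f (r (Suc k)) x - f (r k) x))\<^sup>2)) \<noteq> \<infinity>"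
    by (intro nn_integral_noteq_infinite) (auto simp: less_top)
  then have conv: "AE x in lborel. convergent (\<lambda>k. f (r k) x)"
  proof eventually_elim
    fix x assume fin: "(\<Sum>k. ennreal (2^k * (norm (f (r (Suc k)) x - f (r k) x))\<^sup>2)) \<noteq> \<infinity>"
    have "summable (\<lambda>k. 2^k * (norm (f (r (Suc k)) x - f (r k) x))\<^sup>2)"
      by (rule summable_suminf_not_top) (use fin in auto)
    then have "summable (\<lambda>k. ((1/2)^k + 2^k * (norm (f (r (Suc k)) x - f (r k) x))\<^sup>2))"
      by (intro summable_add) (auto simp: summable_geometric)
    then have "summable (\<lambda>k. norm (f (r (Suc k)) x - f (r k) x))"
    proof (rule summable_comparison_test')
      fix k :: nat
      let ?t = "norm (f (r (Suc k)) x - f (r k) x)"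
      have "?t * 2^k * 2 \<le> 1 + (2^k * ?t)\<^sup>2"
        using sum_squares_bound[of 1 "2^k * ?t"] by (simp add: mult_ac)
      also have "\<dots> = 2^k * ((1/2)^k + 2^k * ?t\<^sup>2)"
        by (simp add: power2_eq_square algebra_simps power_divide)
      finally have "2^k * (2 * ?t) \<le> 2^k * ((1/2)^k + 2^k * ?t\<^sup>2)" by (simp add: mult_ac)
      then have "2 * ?t \<le> (1/2)^k + 2^k * ?t\<^sup>2" by (rule mult_left_le_imp_le) simp
      then show "norm ?t \<le> (1/2)^k + 2^k * ?t\<^sup>2"
        using norm_ge_zero[of "f (r (Suc k)) x - f (r k) x"] unfolding real_norm_def abs_norm_cancel
            by linarith
    qed
    then have "summable (\<lambda>k. f (r (Suc k)) x - f (r k) x)" by (rule summable_norm_cancel)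
    then have "convergent (\<lambda>n. \<Sum>k<n. (f (r (Suc k)) x - f (r k) x))"
      by (simp add: summable_iff_convergent)
    then have "convergent (\<lambda>n. f (r n) x - f (r 0) x)"
        by (simp add: sum_lessThan_telescope[of "\<lambda>k. f (r k) x"])
    then show "convergent (\<lambda>n. f (r n) x)" by (simp add: convergent_diff_const_right_iff)
  qed
  define g where "g x = lim (\<lambda>k. f (r k) x)" for x
  have [measurable]: "g \<in> borel_measurable borel" unfolding g_def by measurable
  have lim_g: "AE x in lborel. (\<lambda>k. f (r k) x) \<longlonglongrightarrow> g x"
    using conv by eventually_elim (simp add: g_def convergent_LIMSEQ_iff)
  have main: "(\<integral>\<^sup>+x. ennreal ((norm (f n x - g x))\<^sup>2) \<partial>lborel) \<le> ennreal ((1/4)^k)" if n: "n \<ge> N k" for n k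
  proof -
    have "(\<integral>\<^sup>+x. ennreal ((norm (f n x - g x))\<^sup>2) \<partial>lborel)
        = (\<integral>\<^sup>+x. liminf (\<lambda>i. ennreal ((norm (f n x - f (r i) x))\<^sup>2)) \<partial>lborel)"
    proof (rule nn_integral_cong_AE)
      show "AE x in lborel. ennreal ((norm (f n x - g x))\<^sup>2)
          = liminf (\<lambda>i. ennreal ((norm (f n x - f (r i) x))\<^sup>2))"
        using lim_g
      proof eventually_elim
        fix x assume "(\<lambda>k. f (r k) x) \<longlonglongrightarrow> g x"
        then have "(\<lambda>i. ennreal ((norm (f n x - f (r i) x))\<^sup>2)) \<longlonglongrightarrow> ennreal ((norm (f n x - g x))\<^sup>2)"
          by (intro tendsto_ennrealI tendsto_intros)
        then show "ennreal ((norm (f n x - g x))\<^sup>2) = liminf (\<lambda>i. ennreal ((norm (f n x - f (r i) x))\<^sup>2))"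
          by (intro lim_imp_Liminf[symmetric]) auto
      qed
    qed
    also have "\<dots> \<le> liminf (\<lambda>i. \<integral>\<^sup>+x. ennreal ((norm (f n x - f (r i) x))\<^sup>2) \<partial>lborel)"
      by (rule nn_integral_liminf) measurable
    also have "\<dots> = liminf (\<lambda>i. ennreal (d n (r i)))"
      by (simp add: nn_integral_norm_square f d_def)
    also have "\<dots> \<le> liminf (\<lambda>i. ennreal ((1/4)^k))"
    proof (rule Liminf_mono, rule eventually_sequentiallyI[of k])
      fix i assume "k \<le> i"
      have "r i \<ge> N k" unfolding r_def using \<open>k \<le> i\<close> by (auto intro: member_le_sum)
      then show "ennreal (d n (r i)) \<le> ennreal ((1/4)^k)"
        using N[OF n] by (intro ennreal_leI less_imp_le) auto
    qed
    also have "\<dots> = ennreal ((1/4)^k)" by (simp add: Liminf_const)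
    finally show ?thesis .
  qed
  have sq_g: "sq g"
  proof -
    have "sq (\<lambda>x. f (N 0) x - g x)"
      using main[of 0 "N 0"] by (intro sq_nn_integralI) (auto intro: le_less_trans)
    from sq_diff[OF f[of "N 0"] this] show ?thesis by simp
  qed
  have "(\<lambda>n. ip (\<lambda>x. f n x - g x) (\<lambda>x. f n x - g x)) \<longlonglongrightarrow> 0"
  proof (rule LIMSEQ_I)
    fix e :: real assume "0 < e"
    obtain k :: nat where k: "(1/4)^k < e" using real_arch_pow_inv[of e "1/4"] \<open>0 < e\<close> by auto
    have "ip (\<lambda>x. f n x - g x) (\<lambda>x. f n x - g x) \<le> (1/4)^k" if "n \<ge> N k" for n
      using main[OF that] f sq_g by (simp add: nn_integral_norm_square)
    then show "\<exists>no. \<forall>n\<ge>no. norm (ip (\<lambda>x. f n x - g x) (\<lambda>x. f n x - g x) - 0) < e"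
      using k by (intro exI[of _ "N k"]) force
  qed
  with sq_g show ?thesis by blast
qed

lemma ip_tendsto:
  assumes "\<And>n. sq (F n)" "sq f" "sq \<phi>" and lim: "(\<lambda>n. ip (\<lambda>x. F n x - f x) (\<lambda>x. F n x - f x)) \<longlonglongrightarrow> 0"
  shows "(\<lambda>n. ip (F n) \<phi>) \<longlonglongrightarrow> ip f \<phi>"
proof -
  have "(\<lambda>n. sqrt (ip (\<lambda>x. F n x - f x) (\<lambda>x. F n x - f x)) * sqrt (ip \<phi> \<phi>)) \<longlonglongrightarrow> sqrt 0 * sqrt (ip \<phi> \<phi>)"
    by (intro tendsto_intros lim)
  then have "(\<lambda>n. sqrt (ip (\<lambda>x. F n x - f x) (\<lambda>x. F n x - f x)) * sqrt (ip \<phi> \<phi>)) \<longlonglongrightarrow> 0" by simp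
  then have "(\<lambda>n. ip (F n) \<phi> - ip f \<phi>) \<longlonglongrightarrow> 0"
  proof (rule Lim_null_comparison[rotated], intro always_eventually allI)
    fix n show "norm (ip (F n) \<phi> - ip f \<phi>) \<le> sqrt (ip (\<lambda>x. F n x - f x) (\<lambda>x. F n x - f x)) * sqrt (ip \<phi> \<phi>)"
      using ip_Cauchy_Schwarz_sqrt[of "\<lambda>x. F n x - f x" \<phi>] assms by (simp add: ip_linear)
  qed
  then show ?thesis by (rule LIM_zero_cancel)
qed

text \<open>This serves both as the Riesz representation theorem (\<open>V\<close> everything) and as the projection
  theorem (\<open>L\<close> given by an inner product).\<close>

lemma L2_representation:
  fixes V :: "(real^'n::finite \<Rightarrow> 'b::euclidean_space) set"
  assumes V: "\<And>g. g \<in> V \<Longrightarrow> sq g" and V0: "V \<noteq> {}"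
    and Vadd: "\<And>g h. g \<in> V \<Longrightarrow> h \<in> V \<Longrightarrow> (\<lambda>x. g x + h x) \<in> V"
    and Vscale: "\<And>c g. g \<in> V \<Longrightarrow> (\<lambda>x. c *\<^sub>R g x) \<in> V"
    and Ladd: "\<And>g h. g \<in> V \<Longrightarrow> h \<in> V \<Longrightarrow> L (\<lambda>x. g x + h x) = L g + L h"
    and Lscale: "\<And>c g. g \<in> V \<Longrightarrow> L (\<lambda>x. c *\<^sub>R g x) = c * L g"
    and Lbound: "\<And>g. g \<in> V \<Longrightarrow> (L g)\<^sup>2 \<le> C * ip g g"
  shows "\<exists>f. sq f \<and> (\<forall>g\<in>V. ip f g = L g) \<and>
     (\<exists>F. (\<forall>n::nat. F n \<in> V) \<and> (\<lambda>n. ip (\<lambda>x. F n x - f x) (\<lambda>x. F n x - f x)) \<longlonglongrightarrow> 0)"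
proof -
  \<comment> \<open>If \<open>f\<close> represents \<open>L\<close>, then \<Phi>(g) = |g - f|^2 -
    |f|^2, so a minimising sequence in \<open>V\<close> should converge to \<open>f\<close>.\<close>
  define \<Phi> where "\<Phi> g = ip g g - 2 * L g" for g
  have lower: "- \<bar>C\<bar> \<le> \<Phi> g" if "g \<in> V" for g
  proof -
    have "(L g)\<^sup>2 \<le> \<bar>C\<bar> * ip g g"
      using Lbound[OF that] mult_right_mono[of C "\<bar>C\<bar>" "ip g g"] ip_nonneg[of g] by linarith
    also have "\<dots> \<le> ((\<bar>C\<bar> + ip g g) / 2)\<^sup>2"
      using zero_le_power2[of "\<bar>C\<bar> - ip g g"] by (simp add: power2_eq_square field_simps)
    finally have "\<bar>L g\<bar> \<le> \<bar>(\<bar>C\<bar> + ip g g) / 2\<bar>" by (simp only: abs_le_square_iff)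
    also have "\<bar>(\<bar>C\<bar> + ip g g) / 2\<bar> = (\<bar>C\<bar> + ip g g) / 2" using ip_nonneg[of g] by (intro abs_of_nonneg) auto
    finally show ?thesis unfolding \<Phi>_def using abs_le_D1[of "L g"] by (simp add: field_simps)
  qed
  define m where "m = Inf (\<Phi> ` V)"
  have bdd: "bdd_below (\<Phi> ` V)" using lower by (intro bdd_belowI2)
  have m_le: "m \<le> \<Phi> g" if "g \<in> V" for g unfolding m_def using that bdd by (intro cInf_lower) auto
  have "\<exists>g\<in>V. \<Phi> g < m + 1 / Suc n" for n
    using cInf_lessD[of "\<Phi> ` V" "m + 1 / Suc n"] V0 by (auto simp: m_def)
  then obtain F where F: "\<And>n. F n \<in> V" "\<And>n. \<Phi> (F n) < m + 1 / Suc n" by metis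
  have sqF: "sq (F n)" for n using F V by blast
  \<comment> \<open>The midpoint of two members stays in \<open>V\<close>, so the parallelogram law
    makes the minimising sequence Cauchy.\<close>
  have dist: "ip (\<lambda>x. F i x - F j x) (\<lambda>x. F i x - F j x) \<le> 2 / Suc i + 2 / Suc j" for i j
  proof -
    define h where "h = (\<lambda>x. (1/2) *\<^sub>R (F i x + F j x))"
    have sumV: "(\<lambda>x. F i x + F j x) \<in> V" by (intro Vadd F)
    have "h \<in> V" unfolding h_def by (rule Vscale[OF sumV])
    have Lh: "L h = (L (F i) + L (F j)) / 2"
      unfolding h_def by (subst Lscale[OF sumV]) (simp add: Ladd F)
    have hh: "ip h h = (ip (F i) (F i) + 2 * ip (F i) (F j) + ip (F j) (F j)) / 4"
      unfolding h_def by (simp add: ip_self_add sqF)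
    have "ip (\<lambda>x. F i x - F j x) (\<lambda>x. F i x - F j x) = 2 * \<Phi> (F i) + 2 * \<Phi> (F j) - 4 * \<Phi> h"
      unfolding \<Phi>_def Lh hh by (simp add: ip_self_diff sqF field_simps)
    with m_le[OF \<open>h \<in> V\<close>] F(2)[of i] F(2)[of j] show ?thesis by simp
  qed
  have "\<exists>N. \<forall>i\<ge>N. \<forall>j\<ge>N. ip (\<lambda>x. F i x - F j x) (\<lambda>x. F i x - F j x) < e" if "0 < e" for e
  proof -
    obtain N :: nat where N: "1 / Suc N < e / 4" using nat_approx_posE[of "e/4"] \<open>0 < e\<close> by auto
    have small: "1 / Suc i < e / 4" if "i \<ge> N" for i
      using N that by (smt (verit) frac_le of_nat_0_less_iff of_nat_le_iff zero_less_Suc Suc_le_mono)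
    show ?thesis
    proof (intro exI[of _ N] allI impI)
      fix i j assume "N \<le> i" "N \<le> j"
      then show "ip (\<lambda>x. F i x - F j x) (\<lambda>x. F i x - F j x) < e"
        using dist[of i j] small[of i] small[of j] by simp
    qed
  qed
  from L2_complete[OF sqF this] obtain f where f: "sq f"
    and lim: "(\<lambda>n. ip (\<lambda>x. F n x - f x) (\<lambda>x. F n x - f x)) \<longlonglongrightarrow> 0" by blast
  have "ip f g = L g" if g: "g \<in> V" for g
  proof -
    \<comment> \<open>Minimality along \<open>F n + t g\<close>, with the defect 1/(n+1) removed in
      the limit. A nonnegative quadratic in \<open>t\<close> without constant term has no linear
      term.\<close>
    have ineq: "0 \<le> 0 + 2 * (ip f g - L g) * t + ip g g * t\<^sup>2" for t
    proof -
      have "0 \<le> 1 / Suc n + 2 * (ip (F n) g - L g) * t + ip g g * t\<^sup>2" for n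
      proof -
        have "m \<le> \<Phi> (\<lambda>x. F n x + t *\<^sub>R g x)" by (intro m_le Vadd F Vscale g)
        also have "\<dots> = \<Phi> (F n) + 2 * (ip (F n) g - L g) * t + ip g g * t\<^sup>2"
          unfolding \<Phi>_def using F g
          by (simp add: Ladd Lscale Vscale ip_self_add sqF V power2_eq_square algebra_simps)
        finally show ?thesis using F(2)[of n] by simp
      qed
      moreover have "(\<lambda>n. 1 / Suc n + 2 * (ip (F n) g - L g) * t + ip g g * t\<^sup>2)
          \<longlonglongrightarrow> 0 + 2 * (ip f g - L g) * t + ip g g * t\<^sup>2"
        by (intro tendsto_intros ip_tendsto[OF sqF f V[OF g] lim]
             LIMSEQ_inverse_real_of_nat[unfolded inverse_eq_divide])
      ultimately show ?thesis by (intro LIMSEQ_le_const) auto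
    qed
    have "(ip f g - L g)\<^sup>2 \<le> 0 * ip g g"
      by (rule quadratic_nonneg_discriminant[OF ineq]) simp
    then show ?thesis by simp
  qed
  with f F lim show ?thesis by blast
qed

definition wconv :: "(nat \<Rightarrow> real^'n::finite \<Rightarrow> 'b::euclidean_space) \<Rightarrow> (real^'n \<Rightarrow> 'b) \<Rightarrow> bool" where
  "wconv f g \<longleftrightarrow> (\<forall>\<phi>. sq \<phi> \<longrightarrow> (\<lambda>n. ip (f n) \<phi>) \<longlonglongrightarrow> ip g \<phi>)"

lemma wconv_subseq: "wconv f g \<Longrightarrow> strict_mono r \<Longrightarrow> wconv (\<lambda>n. f (r n)) g"
  unfolding wconv_def using LIMSEQ_subseq_LIMSEQ[where f = r] by (fastforce simp: o_def)

text \<open>Boundedness of \<open>f\<close> makes the pairings uniformly continuous in the second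
  argument, so the functions against which they converge form a closed set.\<close>

lemma weakly_bounded_closed:
  assumes f: "\<And>n::nat. sq (f n)" "\<And>n. ip (f n) (f n) \<le> C"
    and F: "\<And>n::nat. sq (F n)" "\<And>n. convergent (\<lambda>k. ip (f k) (F n))" and p: "sq p"
    and lim: "(\<lambda>n. ip (\<lambda>x. F n x - p x) (\<lambda>x. F n x - p x)) \<longlonglongrightarrow> 0"
  shows "convergent (\<lambda>k. ip (f k) p)"
proof -
  have "Cauchy (\<lambda>k. ip (f k) p)"
  proof (rule CauchyI)
    fix e :: real assume "0 < e"
    have C0: "0 \<le> C" using f(2)[of 0] ip_nonneg[of "f 0"] by linarith
    define d where "d = (e / 4)\<^sup>2 / (C + 1)"
    have "d > 0" using C0 \<open>0 < e\<close> by (simp add: d_def)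
    then obtain n where n: "ip (\<lambda>x. F n x - p x) (\<lambda>x. F n x - p x) < d"
      using lim by (auto simp: LIMSEQ_def dist_real_def)
    have close: "\<bar>ip (f k) (F n) - ip (f k) p\<bar> \<le> e / 4" for k
    proof -
      have "(ip (f k) (\<lambda>x. F n x - p x))\<^sup>2 \<le> ip (f k) (f k) * ip (\<lambda>x. F n x - p x) (\<lambda>x. F n x - p x)"
        using f F p by (intro ip_Cauchy_Schwarz) auto
      also have "\<dots> \<le> (C + 1) * d"
        using f(2)[of k] n C0 by (intro mult_mono) auto
      also have "\<dots> = (e / 4)\<^sup>2" using C0 by (simp add: d_def)
      finally have "\<bar>ip (f k) (\<lambda>x. F n x - p x)\<bar> \<le> \<bar>e / 4\<bar>" by (simp only: abs_le_square_iff)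
      then show ?thesis using \<open>0 < e\<close> f F p by (simp add: ip_linear)
    qed
    from F(2)[of n] have "Cauchy (\<lambda>k. ip (f k) (F n))" by (simp add: Cauchy_convergent_iff)
    then obtain M where M: "\<And>i j. i \<ge> M \<Longrightarrow> j \<ge> M \<Longrightarrow> \<bar>ip (f i) (F n) - ip (f j) (F n)\<bar> < e / 4"
      using CauchyD[of "\<lambda>k. ip (f k) (F n)" "e/4"] \<open>0 < e\<close> by auto
    show "\<exists>M. \<forall>i\<ge>M. \<forall>j\<ge>M. norm (ip (f i) p - ip (f j) p) < e"
    proof (intro exI[of _ M] allI impI)
      fix i j assume "M \<le> i" "M \<le> j"
      from M[OF this] close[of i] close[of j] show "norm (ip (f i) p - ip (f j) p) < e"
        using \<open>0 < e\<close> unfolding real_norm_def by arith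
    qed
  qed
  then show ?thesis by (simp add: Cauchy_convergent_iff)
qed

text \<open>Diagonal extraction gives convergence only against the members \<open>f m\<close>. This
  suffices: an arbitrary function may be replaced by its projection onto the closure of
  \<open>W\<close>, the space of functions with convergent pairings, since the sequence itself lies
  in \<open>W\<close>. No countable dense family is involved.\<close>

lemma L2_weakly_compact:
  fixes f :: "nat \<Rightarrow> real^'n::finite \<Rightarrow> 'b::euclidean_space"
  assumes f: "\<And>n. sq (f n)" and bound: "\<And>n. ip (f n) (f n) \<le> C"
  shows "\<exists>r g. strict_mono r \<and> sq g \<and> wconv (\<lambda>n. f (r n)) g"
proof -
  have C0: "0 \<le> C" using bound[of 0] ip_nonneg[of "f 0"] by linarith
  have bdd: "(ip (f n) \<phi>)\<^sup>2 \<le> C * ip \<phi> \<phi>" if "sq \<phi>" for n \<phi>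
    using ip_Cauchy_Schwarz[OF f that, of n] mult_right_mono[OF bound[of n] ip_nonneg[of \<phi>]] by linarith
  interpret subseqs "\<lambda>m s. convergent (\<lambda>n. ip (f (s n)) (f m))"
  proof
    fix m and s :: "nat \<Rightarrow> nat" assume "strict_mono s"
    have "bounded (range (\<lambda>n. ip (f (s n)) (f m)))"
    proof (rule boundedI)
      fix y assume "y \<in> range (\<lambda>n. ip (f (s n)) (f m))"
      then obtain n where y: "y = ip (f (s n)) (f m)" by auto
      have "y\<^sup>2 \<le> (sqrt (C * ip (f m) (f m)))\<^sup>2" using bdd[OF f] C0 by (simp add: y)
      then show "norm y \<le> sqrt (C * ip (f m) (f m))"
        using C0 ip_nonneg[of "f m"] by (metis abs_le_square_iff abs_of_nonneg mult_nonneg_nonneg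
            real_norm_def real_sqrt_ge_zero)
    qed
    then obtain l r where "strict_mono r" "((\<lambda>n. ip (f (s n)) (f m)) \<circ> r) \<longlonglongrightarrow> l"
      using bounded_imp_convergent_subsequence by blast
    then show "\<exists>r'. strict_mono r' \<and> convergent (\<lambda>n. ip (f ((s \<circ> r') n)) (f m))"
      by (auto simp: o_def convergent_def)
  qed
  define g where "g n = f (diagseq n)" for n
  have sqg: "sq (g n)" and bg: "ip (g n) (g n) \<le> C" for n by (auto simp: g_def f bound)
  have conv_f: "convergent (\<lambda>n. ip (g n) (f m))" for m
  proof -
    have "convergent (\<lambda>n. ip (f ((diagseq \<circ> (+) (Suc m)) n)) (f m))"
    proof (rule diagseq_holds)
      fix r s :: "nat \<Rightarrow> nat" and n
      assume "strict_mono r" "convergent (\<lambda>na. ip (f (s na)) (f n))"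
      then show "convergent (\<lambda>na. ip (f ((s \<circ> r) na)) (f n))"
        using convergent_subseq_convergent[of "\<lambda>na. ip (f (s na)) (f n)" r] by (simp add: o_def)
    qed
    then have "convergent (\<lambda>n. ip (g (n + Suc m)) (f m))"
      by (simp add: g_def o_def add.commute)
    then show ?thesis using convergent_ignore_initial_segment[of "\<lambda>n. ip (g n) (f m)" "Suc m"] by simp
  qed
  define W where "W = {\<phi>. sq \<phi> \<and> convergent (\<lambda>n. ip (g n) \<phi>)}"
  have W: "sq \<phi> \<Longrightarrow> \<phi> \<in> W" for \<phi>
  proof -
    assume \<phi>: "sq \<phi>"
    have "\<exists>p. sq p \<and> (\<forall>w\<in>W. ip p w = ip \<phi> w) \<and>
     (\<exists>F. (\<forall>n::nat. F n \<in> W) \<and> (\<lambda>n. ip (\<lambda>x. F n x - p x) (\<lambda>x. F n x - p x)) \<longlonglongrightarrow> 0)"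
    proof (rule L2_representation)
      show "W \<noteq> {}" using conv_f f by (auto simp: W_def)
      show "(ip \<phi> w)\<^sup>2 \<le> ip \<phi> \<phi> * ip w w" if "w \<in> W" for w
        using that \<phi> by (intro ip_Cauchy_Schwarz) (auto simp: W_def)
    qed (use \<phi> sqg in \<open>auto simp: W_def ip_linear intro!: convergent_add convergent_mult convergent_const\<close>)
    then obtain p F where p: "sq p" "\<forall>w\<in>W. ip p w = ip \<phi> w" and F: "\<forall>n::nat. F n \<in> W"
      and lim: "(\<lambda>n. ip (\<lambda>x. F n x - p x) (\<lambda>x. F n x - p x)) \<longlonglongrightarrow> 0" by blast
    have "convergent (\<lambda>k. ip (g k) p)"
      by (rule weakly_bounded_closed[OF sqg bg _ _ p(1) lim]) (use F in \<open>auto simp: W_def\<close>)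
    \<comment> \<open>Each \<open>g k\<close> belongs to \<open>W\<close>, so it does not see the
      part of \<phi> orthogonal to \<open>W\<close>.\<close>
    moreover have "ip (g k) p = ip (g k) \<phi>" for k
    proof -
      have "g k \<in> W" using conv_f[of "diagseq k"] f by (simp add: W_def g_def)
      with p(2) have "ip p (g k) = ip \<phi> (g k)" by blast
      then show ?thesis by (simp add: ip_commute)
    qed
    ultimately show "\<phi> \<in> W" using \<phi> by (simp add: W_def)
  qed
  define L where "L \<phi> = lim (\<lambda>n. ip (g n) \<phi>)" for \<phi>
  have L: "(\<lambda>n. ip (g n) \<phi>) \<longlonglongrightarrow> L \<phi>" if "sq \<phi>" for \<phi>
    using W[OF that] by (simp add: W_def L_def convergent_LIMSEQ_iff)
  have "\<exists>h::real^'n \<Rightarrow> 'b. sq h \<and> (\<forall>\<phi>\<in>Collect sq. ip h \<phi> = L \<phi>) \<and>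
     (\<exists>F. (\<forall>n::nat. F n \<in> Collect sq) \<and> (\<lambda>n. ip (\<lambda>x. F n x - h x) (\<lambda>x. F n x - h x)) \<longlonglongrightarrow> 0)"
  proof (rule L2_representation)
    show "Collect sq \<noteq> ({} :: (real^'n \<Rightarrow> 'b) set)" using sqg by blast
    show "L (\<lambda>x. \<phi> x + \<psi> x) = L \<phi> + L \<psi>" if "\<phi> \<in> Collect sq" "\<psi> \<in> Collect sq" for \<phi> \<psi>
    proof (rule LIMSEQ_unique)
      show "(\<lambda>n. ip (g n) (\<lambda>x. \<phi> x + \<psi> x)) \<longlonglongrightarrow> L (\<lambda>x. \<phi> x + \<psi> x)" using that by (intro L) simp
      show "(\<lambda>n. ip (g n) (\<lambda>x. \<phi> x + \<psi> x)) \<longlonglongrightarrow> L \<phi> + L \<psi>"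
        using tendsto_add[OF L[of \<phi>] L[of \<psi>]] that sqg by (simp add: ip_add_right)
    qed
    show "L (\<lambda>x. c *\<^sub>R \<phi> x) = c * L \<phi>" if "\<phi> \<in> Collect sq" for c \<phi>
    proof (rule LIMSEQ_unique)
      show "(\<lambda>n. ip (g n) (\<lambda>x. c *\<^sub>R \<phi> x)) \<longlonglongrightarrow> L (\<lambda>x. c *\<^sub>R \<phi> x)" using that by (intro L) simp
      show "(\<lambda>n. ip (g n) (\<lambda>x. c *\<^sub>R \<phi> x)) \<longlonglongrightarrow> c * L \<phi>"
        using tendsto_mult[OF tendsto_const[of c] L[of \<phi>]] that by simp
    qed
    show "(L \<phi>)\<^sup>2 \<le> C * ip \<phi> \<phi>" if "\<phi> \<in> Collect sq" for \<phi>
    proof (rule LIMSEQ_le_const2)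
      show "(\<lambda>n. (ip (g n) \<phi>)\<^sup>2) \<longlonglongrightarrow> (L \<phi>)\<^sup>2" using that by (intro tendsto_power L) simp
      show "\<exists>N. \<forall>n\<ge>N. (ip (g n) \<phi>)\<^sup>2 \<le> C * ip \<phi> \<phi>" using bdd that by (auto simp: g_def)
    qed
  qed auto
  then obtain h where "sq h" "\<forall>\<phi>\<in>Collect sq. ip h \<phi> = L \<phi>" by blast
  with L have "wconv g h" by (simp add: wconv_def)
  with \<open>sq h\<close> subseq_diagseq show ?thesis unfolding g_def by blast
qed

section \<open>Test functions\<close>

lemma partial_deriv_eq:
  "(f has_derivative f') (at x) \<Longrightarrow> partial_deriv i f x = f' (axis i 1)"
  unfolding partial_deriv_def using frechet_derivative_at by metis

lemma C_k_continuous: "C_k k f \<Longrightarrow> continuous_on UNIV f"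
  by (cases k) (auto intro: differentiable_imp_continuous_on simp: differentiable_on_def
      differentiable_at_withinI)

lemma has_frechet_derivative: "f differentiable at x \<Longrightarrow> (f has_derivative frechet_derivative f (at x)) (at x)"
  using frechet_derivative_works by blast

lemma C_k_add: "C_k k f \<Longrightarrow> C_k k g \<Longrightarrow> C_k k (\<lambda>x. f x + g x)"
proof (induction k arbitrary: f g)
  case 0 then show ?case by (auto intro: continuous_intros)
next
  case (Suc k)
  have "partial_deriv i (\<lambda>x. f x + g x) = (\<lambda>x. partial_deriv i f x + partial_deriv i g x)" for i
  proof
    fix x
    from Suc.prems have "f differentiable at x" "g differentiable at x" by auto
    then show "partial_deriv i (\<lambda>x. f x + g x) x = partial_deriv i f x + partial_deriv i g x"
      by (subst partial_deriv_eq[OF has_derivative_add[OF has_frechet_derivative has_frechet_derivative]])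
         (auto simp: partial_deriv_def)
  qed
  with Suc show ?case by simp
qed

lemma C_k_cmult: "C_k k f \<Longrightarrow> C_k k (\<lambda>x. c * f x)"
proof (induction k arbitrary: f)
  case 0 then show ?case by (auto intro: continuous_intros)
next
  case (Suc k)
  have "partial_deriv i (\<lambda>x. c * f x) = (\<lambda>x. c * partial_deriv i f x)" for i
  proof
    fix x
    from Suc.prems have "f differentiable at x" by auto
    then show "partial_deriv i (\<lambda>x. c * f x) x = c * partial_deriv i f x"
      by (subst partial_deriv_eq[OF has_derivative_mult_right[OF has_frechet_derivative]])
         (auto simp: partial_deriv_def)
  qed
  with Suc show ?case by simp
qed

lemma has_derivative_affine_comp:
  assumes "f differentiable at (h + t *\<^sub>R x)"
  shows "((\<lambda>x. f (h + t *\<^sub>R x)) has_derivative (\<lambda>v. frechet_derivative f (at (h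
      + t *\<^sub>R x)) (t *\<^sub>R v))) (at x)"
proof -
  have "((\<lambda>x. h + t *\<^sub>R x) has_derivative (\<lambda>v. t *\<^sub>R v)) (at x)"
    by (auto intro!: derivative_eq_intros)
  from has_derivative_compose[OF this has_frechet_derivative[OF assms]] show ?thesis by simp
qed

lemma partial_deriv_affine:
  fixes f :: "real^'n::finite \<Rightarrow> real"
  assumes "\<And>x. f differentiable at x"
  shows "partial_deriv i (\<lambda>x. f (h + t *\<^sub>R x)) = (\<lambda>x. t * partial_deriv i f (h + t *\<^sub>R x))"
proof
  fix x
  have "linear (frechet_derivative f (at (h + t *\<^sub>R x)))"
    using has_frechet_derivative[OF assms] by (rule has_derivative_linear)
  from linear_cmul[OF this, of t "axis i 1"]
  show "partial_deriv i (\<lambda>x. f (h + t *\<^sub>R x)) x = t * partial_deriv i f (h + t *\<^sub>R x)"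
    by (subst partial_deriv_eq[OF has_derivative_affine_comp[OF assms]]) (simp add: partial_deriv_def)
qed

lemma C_k_affine: "C_k k f \<Longrightarrow> C_k k (\<lambda>x. f (h + t *\<^sub>R x))"
proof (induction k arbitrary: f)
  case 0
  then have "continuous_on UNIV f" by simp
  then have "continuous_on UNIV (f \<circ> (\<lambda>x. h + t *\<^sub>R x))"
    by (intro continuous_on_compose continuous_intros) (auto intro: continuous_on_subset)
  then show ?case by (simp add: o_def)
next
  case (Suc k)
  then show ?case
    by (auto simp: partial_deriv_affine C_k_cmult
        intro: differentiableI[OF has_derivative_affine_comp])
qed

lemma compact_closure_iff_bounded: "compact (closure A) \<longleftrightarrow> bounded (A :: 'a::euclidean_space set)"
  by (metis bounded_closure bounded_subset closed_closure closure_subset compact_eq_bounded_closed)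

lemma test_functions_iff:
  "\<phi> \<in> test_functions \<longleftrightarrow> (\<forall>k. C_k k \<phi>) \<and> bounded {x. \<phi> x \<noteq> 0}"
  by (simp add: test_functions_def support_on_def compact_closure_iff_bounded)

lemma test_supportE:
  assumes "\<phi> \<in> test_functions"
  obtains R where "0 < R" "\<And>x. R \<le> norm x \<Longrightarrow> \<phi> x = 0"
  using assms unfolding test_functions_iff bounded_pos_less by (metis linorder_not_less mem_Collect_eq)

lemma test_differentiable: "\<phi> \<in> test_functions \<Longrightarrow> \<phi> differentiable at x"
  using C_k.simps(2)[of 0 \<phi>] unfolding test_functions_iff by blast

lemma test_continuous: "\<phi> \<in> test_functions \<Longrightarrow> continuous_on UNIV \<phi>"
  using C_k_continuous[of 0 \<phi>] unfolding test_functions_iff by blast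

lemma test_measurable: "\<phi> \<in> test_functions \<Longrightarrow> \<phi> \<in> borel_measurable borel"
  by (rule borel_measurable_continuous_onI[OF test_continuous])

lemma test_add: "\<phi> \<in> test_functions \<Longrightarrow> \<psi> \<in> test_functions \<Longrightarrow> (\<lambda>x. \<phi> x + \<psi> x) \<in> test_functions"
proof -
  assume *: "\<phi> \<in> test_functions" "\<psi> \<in> test_functions"
  have "bounded {x. \<phi> x + \<psi> x \<noteq> 0}"
    by (rule bounded_subset[of "{x. \<phi> x \<noteq> 0} \<union> {x. \<psi> x \<noteq> 0}"]) (use * in \<open>auto simp: test_functions_iff\<close>)
  with * show ?thesis by (simp add: test_functions_iff C_k_add)
qed

lemma test_cmult: "\<phi> \<in> test_functions \<Longrightarrow> (\<lambda>x. c * \<phi> x) \<in> test_functions"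
proof -
  assume *: "\<phi> \<in> test_functions"
  have "bounded {x. c * \<phi> x \<noteq> 0}"
    by (rule bounded_subset[of "{x. \<phi> x \<noteq> 0}"]) (use * in \<open>auto simp: test_functions_iff\<close>)
  with * show ?thesis by (simp add: test_functions_iff C_k_cmult)
qed

lemma test_affine:
  assumes "\<phi> \<in> test_functions" "t \<noteq> 0"
  shows "(\<lambda>x. \<phi> (h + t *\<^sub>R x)) \<in> test_functions"
proof -
  from test_supportE[OF assms(1)] obtain R where R: "0 < R" "\<And>x. R \<le> norm x \<Longrightarrow> \<phi> x = 0" by blast
  have "bounded {x. \<phi> (h + t *\<^sub>R x) \<noteq> 0}"
  proof (rule boundedI)
    fix x assume "x \<in> {x. \<phi> (h + t *\<^sub>R x) \<noteq> 0}"
    then have "norm (h + t *\<^sub>R x) < R" using R(2)[of "h + t *\<^sub>R x"] by (cases "R \<le> norm (h + t *\<^sub>R x)") auto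
    then have "norm (t *\<^sub>R x) \<le> R + norm h"
      using norm_triangle_ineq4[of "h + t *\<^sub>R x" h] by simp
    then show "norm x \<le> (R + norm h) / \<bar>t\<bar>" using assms(2) by (simp add: field_simps)
  qed
  with assms show ?thesis by (simp add: test_functions_iff C_k_affine)
qed

lemma test_translate: "\<phi> \<in> test_functions \<Longrightarrow> (\<lambda>x. \<phi> (x + h)) \<in> test_functions"
  using test_affine[of \<phi> 1 h] by (simp add: add.commute)

lemma test_partial_deriv:
  assumes \<phi>: "\<phi> \<in> test_functions"
  shows "partial_deriv i \<phi> \<in> test_functions"
proof -
  have "C_k k (partial_deriv i \<phi>)" for k
    using \<phi> C_k.simps(2)[of k \<phi>] unfolding test_functions_iff by blast
  moreover have "bounded {x. partial_deriv i \<phi> x \<noteq> 0}"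
  proof (rule bounded_subset)
    show "bounded (closure {x. \<phi> x \<noteq> 0})" using \<phi> by (simp add: test_functions_iff bounded_closure)
    show "{x. partial_deriv i \<phi> x \<noteq> 0} \<subseteq> closure {x. \<phi> x \<noteq> 0}"
    proof (rule ccontr)
      assume "\<not> {x. partial_deriv i \<phi> x \<noteq> 0} \<subseteq> closure {x. \<phi> x \<noteq> 0}"
      then obtain x where x: "partial_deriv i \<phi> x \<noteq> 0" "x \<in> - closure {x. \<phi> x \<noteq> 0}" by auto
      have "(\<phi> has_derivative (\<lambda>_. 0)) (at x)"
      proof (rule has_derivative_transform_within_open[of "\<lambda>_. 0"])
        show "\<And>y. y \<in> - closure {x. \<phi> x \<noteq> 0} \<Longrightarrow> 0 = \<phi> y"
          using closure_subset[of "{x. \<phi> x \<noteq> 0}"] by auto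
      qed (use x in auto)
      from x(1) partial_deriv_eq[OF this] show False by simp
    qed
  qed
  ultimately show ?thesis by (simp add: test_functions_iff)
qed

lemma test_zero: "(\<lambda>x::real^'n::finite. 0) \<in> test_functions"
proof -
  have "C_k k (\<lambda>x::real^'n. 0)" for k
  proof (induction k)
    case (Suc k)
    have "partial_deriv i (\<lambda>x::real^'n. 0) = (\<lambda>x. 0)" for i
      by (rule ext) (simp add: partial_deriv_eq[OF has_derivative_const])
    then show ?case using Suc by simp
  qed simp
  then show ?thesis by (simp add: test_functions_iff)
qed

lemma test_sum: "finite I \<Longrightarrow> (\<And>i. i \<in> I \<Longrightarrow> f i \<in> test_functions) \<Longrightarrow> (\<lambda>x. \<Sum>i\<in>I. f i x) \<in> test_functions"
  by (induction I rule: finite_induct) (auto simp: test_zero intro: test_add)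

lemma test_bounded:
  assumes \<phi>: "\<phi> \<in> test_functions"
  shows "\<exists>B>0. \<forall>x. \<bar>\<phi> x\<bar> \<le> B"
proof -
  from test_supportE[OF assms(1)] obtain R where R: "0 < R" "\<And>x. R \<le> norm x \<Longrightarrow> \<phi> x = 0" by blast
  have "bounded (\<phi> ` cball 0 R)"
    by (intro compact_imp_bounded compact_continuous_image continuous_on_subset[OF test_continuous[OF \<phi>]])
        auto
  then obtain B where B: "B > 0" "\<And>x. x \<in> cball 0 R \<Longrightarrow> norm (\<phi> x) \<le> B" by (auto simp: bounded_pos)
  have "\<bar>\<phi> x\<bar> \<le> B" for x
    using B R(2)[of x] by (cases "norm x \<le> R") auto
  with B(1) show ?thesis by blast
qed

lemma sq_bounded_support:
  assumes [measurable]: "f \<in> borel_measurable borel"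
    and B: "\<And>x. norm (f x) \<le> B" and R: "\<And>x. R \<le> norm x \<Longrightarrow> f x = 0"
  shows "sq (f :: real^'n::finite \<Rightarrow> 'b::euclidean_space)"
proof -
  have "integrable lborel (\<lambda>x. (norm (f x))\<^sup>2)"
  proof (rule Bochner_Integration.integrable_bound)
    show "integrable lborel (\<lambda>x::real^'n. B\<^sup>2 * indicator (ball 0 R) x)"
      using emeasure_lborel_ball_finite[of "0::real^'n" R] by (simp add: less_top)
    have "(norm (f x))\<^sup>2 \<le> B\<^sup>2 * indicator (ball 0 R) x" for x
    proof (cases "norm x < R")
      case True
      have "(norm (f x))\<^sup>2 \<le> B\<^sup>2" by (intro power_mono B) auto
      then show ?thesis using True by simp
    next
      case False
      then show ?thesis using R[of x] by simp
    qed
    then show "AE x in lborel. norm ((norm (f x))\<^sup>2) \<le> norm (B\<^sup>2 * indicator (ball 0 R) x)"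
      by (auto intro!: AE_I2)
  qed measurable
  then show ?thesis by (simp add: square_integrable_def)
qed

lemma test_sq [simp]: "\<phi> \<in> test_functions \<Longrightarrow> sq \<phi>"
  by (metis sq_bounded_support test_measurable test_bounded test_supportE real_norm_def)

section \<open>Difference quotients of test functions\<close>

definition dir_deriv :: "real^'n::finite \<Rightarrow> (real^'n \<Rightarrow> real) \<Rightarrow> real^'n \<Rightarrow> real" where
  "dir_deriv e \<phi> x = (\<Sum>i\<in>UNIV. e $ i * partial_deriv i \<phi> x)"

lemma dir_deriv_test: "\<phi> \<in> test_functions \<Longrightarrow> dir_deriv e \<phi> \<in> test_functions"
  unfolding dir_deriv_def[abs_def] by (intro test_sum test_cmult test_partial_deriv) auto

lemma dir_deriv_frechet:
  assumes "\<phi> differentiable at x"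
  shows "dir_deriv e \<phi> x = frechet_derivative \<phi> (at x) e"
proof -
  have lin: "linear (frechet_derivative \<phi> (at x))"
    using has_frechet_derivative[OF assms] by (rule has_derivative_linear)
  have "frechet_derivative \<phi> (at x) e = frechet_derivative \<phi> (at x) (\<Sum>i\<in>UNIV. (e$i) *\<^sub>R axis i 1)"
    by (metis basis_expansion scalar_mult_eq_scaleR)
  also have "\<dots> = (\<Sum>i\<in>UNIV. (e$i) *\<^sub>R frechet_derivative \<phi> (at x) (axis i 1))"
    by (simp add: linear_sum[OF lin] linear_cmul[OF lin])
  finally show ?thesis by (simp add: dir_deriv_def partial_deriv_def)
qed

lemma test_line_deriv:
  assumes "\<phi> \<in> test_functions"
  shows "((\<lambda>t. \<phi> (x + t *\<^sub>R e)) has_real_derivative dir_deriv e \<phi> (x + t *\<^sub>R e)) (at t)"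
proof -
  have "((\<lambda>t. x + t *\<^sub>R e) has_derivative (\<lambda>v. v *\<^sub>R e)) (at t)"
    by (auto intro!: derivative_eq_intros)
  from has_derivative_compose[OF this has_frechet_derivative[OF test_differentiable[OF assms]]]
  have d: "((\<lambda>t. \<phi> (x + t *\<^sub>R e)) has_derivative
     (\<lambda>v. frechet_derivative \<phi> (at (x + t *\<^sub>R e)) (v *\<^sub>R e))) (at t)" by simp
  have lin: "linear (frechet_derivative \<phi> (at (x + t *\<^sub>R e)))"
    using has_frechet_derivative[OF test_differentiable[OF assms]] by (rule has_derivative_linear)
  have "(\<lambda>v. frechet_derivative \<phi> (at (x + t *\<^sub>R e)) (v *\<^sub>R e)) = (*) (dir_deriv e \<phi> (x + t *\<^sub>R e))"
    by (rule ext) (simp add: linear_cmul[OF lin] dir_deriv_frechet[OF test_differentiable[OF assms]])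
  then show ?thesis
    using d unfolding has_field_derivative_def by simp
qed

text \<open>The mean value theorem bounds the quotients, and for steps below 1 they share one
  bounded support, so dominated convergence gives strong convergence. This allows a quotient to be
  shifted from a nonsmooth function to a test function before passing to the limit.\<close>

lemma test_difference_quotient:
  fixes s :: "nat \<Rightarrow> real"
  assumes \<phi>: "\<phi> \<in> test_functions" and s: "\<And>n. s n \<noteq> 0" "s \<longlonglongrightarrow> 0"
  shows "(\<lambda>n. ip (\<lambda>x. (\<phi> (x + s n *\<^sub>R e) - \<phi> x) / s n - dir_deriv e \<phi> x)
                (\<lambda>x. (\<phi> (x + s n *\<^sub>R e) - \<phi> x) / s n - dir_deriv e \<phi> x)) \<longlonglongrightarrow> 0" (is "?I \<longlonglongrightarrow> 0")
proof -
  have d\<phi>: "dir_deriv e \<phi> \<in> test_functions" by (rule dir_deriv_test[OF \<phi>])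
  from s(2) have "eventually (\<lambda>n. \<bar>s n\<bar> < 1) sequentially"
    using order_tendstoD(2)[OF tendsto_rabs_zero] zero_less_one by blast
  then obtain N where N: "\<And>n. n \<ge> N \<Longrightarrow> \<bar>s n\<bar> < 1" by (auto simp: eventually_sequentially)
  obtain R where R: "0 < R" "\<And>x. R \<le> norm x \<Longrightarrow> \<phi> x = 0" using test_supportE[OF \<phi>] by blast
  obtain R' where R': "0 < R'" "\<And>x. R' \<le> norm x \<Longrightarrow> dir_deriv e \<phi> x = 0" using test_supportE[OF d\<phi>] by blast
  obtain B where B: "B > 0" "\<And>x. \<bar>dir_deriv e \<phi> x\<bar> \<le> B" using test_bounded[OF d\<phi>] by blast
  \<comment> \<open>The error of the quotient. From index \<open>N\<close> on the steps are below 1,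
    so that it vanishes outside the fixed radius \<open>S\<close>; the limit is therefore taken
    along the shifted sequence.\<close>
  define q where "q n x = (\<phi> (x + s n *\<^sub>R e) - \<phi> x) / s n - dir_deriv e \<phi> x" for n x
  define S where "S = R + R' + norm e"
  note [measurable] = test_measurable[OF \<phi>] test_measurable[OF d\<phi>]
  have [measurable]: "q n \<in> borel_measurable borel" for n unfolding q_def by measurable
  have q_bound: "\<bar>q n x\<bar> \<le> 2 * B" for n x
  proof -
    have "\<bar>\<phi> (x + s n *\<^sub>R e) - \<phi> x\<bar> \<le> B * \<bar>s n - 0\<bar>"
      using field_differentiable_bound[of UNIV "\<lambda>t. \<phi> (x + t *\<^sub>R e)" "\<lambda>t. dir_deriv e \<phi> (x
          + t *\<^sub>R e)" B "s n" 0]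
        test_line_deriv[OF \<phi>] B by simp
    then have "\<bar>(\<phi> (x + s n *\<^sub>R e) - \<phi> x) / s n\<bar> \<le> B"
      using s(1)[of n] by (simp add: divide_le_eq abs_divide)
    then show ?thesis unfolding q_def using B(2)[of x] by linarith
  qed
  have q_supp: "q (n + N) x = 0" if "S \<le> norm x" for n x
  proof -
    have "norm (s (n + N) *\<^sub>R e) \<le> norm e"
      using N[of "n + N"] mult_right_mono[of "\<bar>s (n + N)\<bar>" 1 "norm e"] by simp
    then have "R \<le> norm (x + s (n + N) *\<^sub>R e)"
      using norm_triangle_ineq4[of "x + s (n + N) *\<^sub>R e" "s (n + N) *\<^sub>R e"] that R'(1) by (simp add: S_def)
    moreover have "R \<le> norm x" "R' \<le> norm x" using that R(1) R'(1) norm_ge_zero[of e] unfolding S_def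
        by linarith+
    ultimately show ?thesis using R R' by (simp add: q_def)
  qed
  have q_lim: "(\<lambda>n. q n x) \<longlonglongrightarrow> 0" for x
  proof -
    have "((\<lambda>h. (\<phi> (x + h *\<^sub>R e) - \<phi> x) / h) \<longlongrightarrow> dir_deriv e \<phi> x) (at 0)"
      using test_line_deriv[OF \<phi>, of x e 0] by (simp add: DERIV_def)
    then have "(\<lambda>n. (\<phi> (x + s n *\<^sub>R e) - \<phi> x) / s n) \<longlonglongrightarrow> dir_deriv e \<phi> x"
      using s unfolding tendsto_at_iff_sequentially by (auto simp: o_def)
    then show ?thesis unfolding q_def by (rule LIM_zero)
  qed
  have "(\<lambda>n. LINT x|lborel. q (n + N) x * q (n + N) x) \<longlonglongrightarrow> (LINT x::real^'a|lborel. 0)"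
  proof (rule integral_dominated_convergence)
    show "integrable lborel (\<lambda>x::real^'a. (2 * B)\<^sup>2 * indicator (ball 0 S) x)"
      using emeasure_lborel_ball_finite[of "0::real^'a" S] by (simp add: less_top)
    show "AE x in lborel. (\<lambda>n. q (n + N) x * q (n + N) x) \<longlonglongrightarrow> 0"
      using tendsto_mult[OF LIMSEQ_ignore_initial_segment[OF q_lim] LIMSEQ_ignore_initial_segment[OF q_lim]]
      by (auto intro!: AE_I2)
    show "AE x in lborel. norm (q (n + N) x * q (n + N) x) \<le> (2 * B)\<^sup>2 * indicator (ball 0 S) x" for n
    proof (intro AE_I2)
      fix x
      show "norm (q (n + N) x * q (n + N) x) \<le> (2 * B)\<^sup>2 * indicator (ball 0 S) x"
        using q_supp[of x n] mult_mono[OF q_bound[of "n + N" x] q_bound[of "n + N" x]] B(1)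
        by (cases "S \<le> norm x") (auto simp: power2_eq_square abs_mult)
    qed
  qed measurable
  then have "(\<lambda>n. ?I (n + N)) \<longlonglongrightarrow> 0" by (simp add: ip_def q_def)
  then show ?thesis by (rule LIMSEQ_offset)
qed

section \<open>The fundamental lemma of the calculus of variations\<close>

text \<open>The functions p(1/t) exp(-1/t), extended by zero to t \<le> 0. Admitting all polynomials
  makes the family closed under differentiation.\<close>

definition flat :: "real poly \<Rightarrow> real \<Rightarrow> real" where
  "flat p t = (if t > 0 then poly p (1 / t) * exp (- (1 / t)) else 0)"

lemma poly_times_exp_minus_tendsto_0: "((\<lambda>y. poly p y * exp (- y)) \<longlongrightarrow> (0::real)) at_top"
proof -
  have "((\<lambda>y. \<Sum>i\<le>degree p. coeff p i * (y ^ i / exp y)) \<longlongrightarrow> (\<Sum>i\<le>degree p. coeff p i * 0)) at_top"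
    by (intro tendsto_intros tendsto_power_div_exp_0)
  moreover have "poly p y * exp (- y) = (\<Sum>i\<le>degree p. coeff p i * (y ^ i / exp y))" for y
    by (simp add: poly_altdef sum_distrib_right sum_divide_distrib exp_minus divide_inverse mult.assoc)
  ultimately show ?thesis by simp
qed

text \<open>With y = 1/t and dy/dt = -y^2, differentiation turns \<open>p\<close> into y^2 (p - p').
  At t = 0 the right difference quotient is y p(y) exp(-y), which decays as y grows.\<close>

lemma flat_has_derivative:
  "(flat p has_real_derivative flat ([:0, 0, 1:] * (p - pderiv p)) t) (at t)"
proof (cases t "0::real" rule: linorder_cases)
  case less
  have "((\<lambda>_. 0) has_real_derivative 0) (at t)" by simp
  then have "(flat p has_real_derivative 0) (at t)"
    by (rule has_field_derivative_transform_within_open[where S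
        = "{..<0}"]) (use less in \<open>auto simp: flat_def\<close>)
  then show ?thesis using less by (simp add: flat_def)
next
  case greater
  have "((\<lambda>t. poly p (1 / t) * exp (- (1 / t))) has_real_derivative
      flat ([:0, 0, 1:] * (p - pderiv p)) t) (at t)"
    using greater
    by (auto intro!: derivative_eq_intros simp: flat_def power2_eq_square field_simps)
  then show ?thesis
    by (rule has_field_derivative_transform_within_open[where S
        = "{0<..}"]) (use greater in \<open>auto simp: flat_def\<close>)
next
  case equal
  have *: "((\<lambda>h. flat p h / h) \<longlongrightarrow> 0) (at 0)"
  proof (rule filterlim_split_at)
    show "((\<lambda>h. flat p h / h) \<longlongrightarrow> 0) (at_left 0)"
      by (rule tendsto_eventually) (auto simp: eventually_at_filter flat_def)
    have "((\<lambda>y. poly ([:0, 1:] * p) y * exp (- y)) \<longlongrightarrow> 0) at_top"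
      by (rule poly_times_exp_minus_tendsto_0)
    from filterlim_compose[OF this filterlim_inverse_at_top_right]
    have "((\<lambda>h. poly ([:0, 1:] * p) (inverse h) * exp (- (inverse h))) \<longlongrightarrow> 0) (at_right 0)" .
    then show "((\<lambda>h. flat p h / h) \<longlongrightarrow> 0) (at_right 0)"
      by (rule Lim_transform_eventually) (auto simp: eventually_at_filter flat_def field_simps)
  qed
  then show ?thesis using equal by (simp add: DERIV_def flat_def)
qed

text \<open>An algebra of functions containing the bumps and closed under partial derivatives;
  \<open>C_k\<close> for all \<open>k\<close> then follows by a plain induction on
  \<open>k\<close>.\<close>

inductive_set flat_generated :: "(real^'n::finite \<Rightarrow> real) set" where
  fg_flat: "(\<lambda>x. flat p (c * x $ i + d)) \<in> flat_generated"
| fg_const: "(\<lambda>x. c) \<in> flat_generated"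
| fg_add: "f \<in> flat_generated \<Longrightarrow> g \<in> flat_generated \<Longrightarrow> (\<lambda>x. f x + g x) \<in> flat_generated"
| fg_mult: "f \<in> flat_generated \<Longrightarrow> g \<in> flat_generated \<Longrightarrow> (\<lambda>x. f x * g x) \<in> flat_generated"

lemma flat_generated_deriv:
  "f \<in> flat_generated \<Longrightarrow> (\<forall>x. f differentiable at x) \<and> (\<forall>j. partial_deriv j f \<in> flat_generated)"
proof (induction rule: flat_generated.induct)
  case (fg_flat p c i d)
  define p' where "p' = [:0, 0, 1:] * (p - pderiv p)"
  have d: "((\<lambda>x::real^'a. flat p (c * x $ i + d)) has_derivative (\<lambda>v. flat p' (c * x $ i + d)
      * (c * v $ i))) (at x)" for x
  proof -
    have "((\<lambda>x::real^'a. c * x $ i + d) has_derivative (\<lambda>v. c * v $ i)) (at x)"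
      by (auto intro!: derivative_eq_intros bounded_linear.has_derivative[OF bounded_linear_vec_nth])
    from has_derivative_compose[OF this flat_has_derivative[of p, unfolded has_field_derivative_def]]
    show ?thesis by (simp add: p'_def)
  qed
  have "partial_deriv j (\<lambda>x::real^'a. flat p (c * x $ i + d))
      = (\<lambda>x. flat p' (c * x $ i + d) * (c * axis j 1 $ i))" for j
    by (rule ext) (simp add: partial_deriv_eq[OF d])
  then show ?case using d
    by (auto simp: differentiable_def intro!: flat_generated.fg_mult flat_generated.fg_flat
        flat_generated.fg_const)
next
  case (fg_const c)
  have "partial_deriv j (\<lambda>x::real^'a. c) = (\<lambda>x. 0)" for j
    by (rule ext) (simp add: partial_deriv_eq[OF has_derivative_const])
  then show ?case by (auto intro: flat_generated.fg_const)
next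
  case (fg_add f g)
  have "partial_deriv j (\<lambda>x. f x + g x) = (\<lambda>x. partial_deriv j f x + partial_deriv j g x)" for j
    using fg_add by (intro ext, subst partial_deriv_eq[OF has_derivative_add[OF has_frechet_derivative
        has_frechet_derivative]])
         (auto simp: partial_deriv_def)
  then show ?case using fg_add by (auto intro: flat_generated.fg_add)
next
  case (fg_mult f g)
  have "partial_deriv j (\<lambda>x. f x * g x) = (\<lambda>x. f x * partial_deriv j g x + partial_deriv j f x * g x)" for j
    using fg_mult by (intro ext, subst partial_deriv_eq[OF has_derivative_mult[OF has_frechet_derivative
        has_frechet_derivative]])
         (auto simp: partial_deriv_def)
  then show ?case using fg_mult by (auto intro!: flat_generated.fg_add flat_generated.fg_mult)
qed

lemma flat_generated_C_k: "f \<in> flat_generated \<Longrightarrow> C_k k f"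
proof (induction k arbitrary: f)
  case 0
  then show ?case using flat_generated_deriv[OF 0]
    by (auto intro!: differentiable_imp_continuous_on simp: differentiable_on_def differentiable_at_withinI)
next
  case (Suc k)
  then show ?case using flat_generated_deriv[OF Suc.prems] by simp
qed

text \<open>The factor \<open>Suc k\<close> steepens the flanks: every factor with a positive
  argument tends to 1, so these test functions stay below the indicator of the open box and converge
  to it.\<close>

definition bump :: "nat \<Rightarrow> real^'n::finite \<Rightarrow> real^'n \<Rightarrow> real^'n \<Rightarrow> real" where
  "bump k a b x = (\<Prod>i\<in>UNIV. flat 1 (real (Suc k) * (x $ i - a $ i))
      * flat 1 (real (Suc k) * (b $ i - x $ i)))"

lemma flat_one_bounds: "0 \<le> flat 1 t" "flat 1 t \<le> 1" "flat 1 t = 0 \<longleftrightarrow> t \<le> 0"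
  by (auto simp: flat_def)

lemma bump_flat_generated: "bump k a b \<in> flat_generated"
proof -
  have "(\<lambda>x. \<Prod>i\<in>I. flat 1 (real (Suc k) * (x $ i - a $ i))
      * flat 1 (real (Suc k) * (b $ i - x $ i))) \<in> flat_generated"
    if "finite I" for I
    using that
  proof (induction I rule: finite_induct)
    case empty
    then show ?case using fg_const[of 1] by simp
  next
    case (insert i I)
    have "(\<lambda>x. flat 1 (real (Suc k) * (x $ i - a $ i))) \<in> flat_generated"
      using fg_flat[of 1 "real (Suc k)" i "- (real (Suc k) * a $ i)"]
          by (simp add: right_diff_distrib del: of_nat_Suc)
    moreover have "(\<lambda>x. flat 1 (real (Suc k) * (b $ i - x $ i))) \<in> flat_generated"
      using fg_flat[of 1 "- real (Suc k)" i "real (Suc k) * b $ i"]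
          by (simp add: right_diff_distrib del: of_nat_Suc)
    ultimately show ?case using insert by (auto intro: fg_mult)
  qed
  from this[of UNIV] show ?thesis by (simp add: bump_def[abs_def])
qed

lemma bump_nonzero: "bump k a b x \<noteq> 0 \<Longrightarrow> x \<in> box a b"
  by (auto simp: bump_def flat_one_bounds mem_box_cart zero_less_mult_iff mult_le_0_iff not_le)

lemma bump_bounds: "0 \<le> bump k a b x" "bump k a b x \<le> 1"
  unfolding bump_def by (auto intro!: prod_nonneg mult_nonneg_nonneg prod_le_1 mult_le_one simp:
      flat_one_bounds)

lemma bump_test: "bump k a b \<in> test_functions"
proof -
  have "bounded {x. bump k a b x \<noteq> 0}"
    by (rule bounded_subset[OF bounded_box[of a b]]) (auto dest: bump_nonzero)
  then show ?thesis by (simp add: test_functions_iff flat_generated_C_k bump_flat_generated)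
qed

lemma flat_one_tendsto:
  assumes "0 < t" shows "(\<lambda>k. flat 1 (real (Suc k) * t)) \<longlonglongrightarrow> 1"
proof -
  have "(\<lambda>k. exp (- (inverse (real (Suc k)) * (1 / t)))) \<longlonglongrightarrow> exp (- (0 * (1 / t)))"
    by (intro tendsto_intros LIMSEQ_inverse_real_of_nat)
  then show ?thesis using assms by (simp add: flat_def divide_inverse mult_ac)
qed

lemma bump_tendsto: "(\<lambda>k. bump k a b x) \<longlonglongrightarrow> indicator (box a b) x"
proof (cases "x \<in> box a b")
  case True
  then have "(\<lambda>k. bump k a b x) \<longlonglongrightarrow> (\<Prod>i\<in>(UNIV::'a set). 1 * 1)"
    unfolding bump_def by (intro tendsto_intros flat_one_tendsto) (auto simp: mem_box_cart)
  then show ?thesis using True by simp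
next
  case False
  then have "bump k a b x = 0" for k using bump_nonzero by blast
  then show ?thesis using False by simp
qed

lemma integrable_sq_times_bounded_support:
  fixes g :: "real^'n::finite \<Rightarrow> real"
  assumes [measurable]: "sq g"
  shows "integrable lborel (\<lambda>x. indicator (box a b) x * g x)"
proof -
  obtain R where R: "box a b \<subseteq> ball (0::real^'n) R"
    using bounded_subset_ballD[OF bounded_box[of a b], of 0] by blast
  have "sq (indicator (box a b) :: real^'n \<Rightarrow> real)"
    by (rule sq_bounded_support[where R = R and B = 1]) (use R in \<open>auto simp: indicator_def\<close>)
  from integrable_inner[OF this assms] show ?thesis by simp
qed

text \<open>Bumps approximate indicators, so all integrals over boxes vanish. The positive and
  negative parts of \<open>g\<close> are then densities of two measures that agree on the
  intersection-stable family of boxes and are finite there, hence the measures coincide.\<close>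

lemma fundamental_lemma:
  fixes g :: "real^'n::finite \<Rightarrow> real"
  assumes sq_g: "sq g" and orth: "\<And>\<phi>. \<phi> \<in> test_functions \<Longrightarrow> ip \<phi> g = 0"
  shows "AE x in lborel. g x = 0"
proof -
  have [measurable]: "g \<in> borel_measurable borel" using sq_g by measurable
  have box0: "(LINT x|lborel. indicator (box a b) x * g x) = 0" for a b
  proof (rule LIMSEQ_unique)
    show "(\<lambda>k. ip (bump k a b) g) \<longlonglongrightarrow> 0" by (simp add: orth[OF bump_test])
    show "(\<lambda>k. ip (bump k a b) g) \<longlonglongrightarrow> (LINT x|lborel. indicator (box a b) x * g x)"
      unfolding ip_def inner_real_def
    proof (rule integral_dominated_convergence)
      show "integrable lborel (\<lambda>x. \<bar>indicator (box a b) x * g x\<bar>)"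
        using integrable_sq_times_bounded_support[OF sq_g, of a b] by (intro integrable_abs)
      show "AE x in lborel. (\<lambda>k. bump k a b x * g x) \<longlonglongrightarrow> indicator (box a b) x * g x"
        by (intro AE_I2 tendsto_intros bump_tendsto)
      show "AE x in lborel. norm (bump k a b x * g x) \<le> \<bar>indicator (box a b) x * g x\<bar>" for k
      proof (intro AE_I2)
        fix x
        have "bump k a b x \<le> indicator (box a b) x"
          using bump_nonzero[of k a b x] bump_bounds(2)[of k a b x]
          by (cases "bump k a b x = 0") (auto simp: indicator_def)
        then show "norm (bump k a b x * g x) \<le> \<bar>indicator (box a b) x * g x\<bar>"
          using bump_bounds(1)[of k a b x] by (simp add: abs_mult mult_right_mono)
      qed
    qed (use test_measurable[OF bump_test] in measurable)
  qed
  let ?p = "\<lambda>x. ennreal (g x)" and ?m = "\<lambda>x. ennreal (- g x)"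
  have box_eq: "emeasure (density lborel ?p) (box a b) = emeasure (density lborel ?m) (box a b)"
    and box_fin: "emeasure (density lborel ?p) (box a b) \<noteq> \<infinity>" for a b
  proof -
    have int: "integrable lborel (\<lambda>x. indicator (box a b) x * g x)"
      by (rule integrable_sq_times_bounded_support[OF sq_g])
    define ip' where "ip' = (LINT x|lborel. max 0 (indicator (box a b) x * g x))"
    define im where "im = (LINT x|lborel. max 0 (- (indicator (box a b) x * g x)))"
    have int1: "integrable lborel (\<lambda>x. max 0 (indicator (box a b) x * g x))"
      and int2: "integrable lborel (\<lambda>x. max 0 (- (indicator (box a b) x * g x)))"
      using int by (auto intro!: integrable_max)
    have "ip' - im = (LINT x|lborel. indicator (box a b) x * g x)"
      unfolding ip'_def im_def
      by (subst Bochner_Integration.integral_diff[symmetric, OF int1 int2])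
         (auto intro!: Bochner_Integration.integral_cong simp: max_def)
    then have eq: "ip' = im" using box0 by simp
    have p: "emeasure (density lborel ?p) (box a b) = ennreal ip'"
      unfolding ip'_def
      by (subst nn_integral_eq_integral[OF int1, symmetric])
         (auto simp: emeasure_density max_def ennreal_neg intro!: nn_integral_cong split: split_indicator)
    have m: "emeasure (density lborel ?m) (box a b) = ennreal im"
      unfolding im_def
      by (subst nn_integral_eq_integral[OF int2, symmetric])
         (auto simp: emeasure_density max_def ennreal_neg intro!: nn_integral_cong split: split_indicator)
    show "emeasure (density lborel ?p) (box a b) = emeasure (density lborel ?m) (box a b)"
      "emeasure (density lborel ?p) (box a b) \<noteq> \<infinity>"
      using p m eq by auto
  qed
  have "density lborel ?p = density lborel ?m"
  proof (rule measure_eqI_generator_eq)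
    let ?E = "range (\<lambda>(a, b). box a b::(real^'n) set)"
    show "Int_stable ?E" by (auto simp: Int_stable_def box_Int_box)
    show "?E \<subseteq> Pow UNIV" "sets (density lborel ?p) = sigma_sets UNIV ?E" "sets (density lborel ?m)
        = sigma_sets UNIV ?E"
      by (simp_all add: borel_eq_box)
    let ?A = "\<lambda>n::nat. box (- (real n *\<^sub>R One)) (real n *\<^sub>R One) :: (real^'n) set"
    show "range ?A \<subseteq> ?E" "(\<Union>i. ?A i) = UNIV" unfolding UN_box_eq_UNIV by auto
    show "emeasure (density lborel ?p) (?A i) \<noteq> \<infinity>" for i by (rule box_fin)
    show "emeasure (density lborel ?p) X = emeasure (density lborel ?m) X" if "X \<in> ?E" for X
      using that box_eq by auto
  qed
  then have "AE x in lborel. ?p x = ?m x"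
    by (subst sigma_finite_measure.density_unique_iff[OF lborel.sigma_finite_measure_axioms, symmetric]) auto
  then show ?thesis
  proof eventually_elim
    fix x assume "ennreal (g x) = ennreal (- g x)"
    then show "g x = 0" by (cases "g x \<ge> 0") (auto simp: ennreal_neg ennreal_eq_0_iff dest: sym)
  qed
qed

text \<open>The projection of \<open>g\<close> onto the closure of the test functions differs from
  \<open>g\<close> by a function orthogonal to all of them, which is null by the fundamental
  lemma.\<close>

lemma test_functions_dense:
  fixes g :: "real^'n::finite \<Rightarrow> real"
  assumes g: "sq g"
  shows "\<exists>F. (\<forall>n::nat. F n \<in> test_functions) \<and> (\<lambda>n. ip (\<lambda>x. F n x - g x) (\<lambda>x. F n x - g x)) \<longlonglongrightarrow> 0"
proof -
  have "\<exists>f. sq f \<and> (\<forall>\<phi>\<in>test_functions. ip f \<phi> = ip g \<phi>) \<and>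
     (\<exists>F. (\<forall>n::nat. F n \<in> test_functions) \<and> (\<lambda>n. ip (\<lambda>x. F n x - f x) (\<lambda>x. F n x - f x)) \<longlonglongrightarrow> 0)"
  proof (rule L2_representation)
    show "test_functions \<noteq> ({} :: (real^'n \<Rightarrow> real) set)" using test_zero by blast
    show "(ip g \<phi>)\<^sup>2 \<le> ip g g * ip \<phi> \<phi>" if "\<phi> \<in> test_functions" for \<phi>
      using that g by (intro ip_Cauchy_Schwarz) auto
    show "ip g (\<lambda>x. c *\<^sub>R \<phi> x) = c * ip g \<phi>" for c \<phi> by (rule ip_scale_right)
  qed (use g in \<open>auto intro: test_add test_cmult simp: ip_add_right\<close>)
  then obtain f F where f: "sq f" "\<And>\<phi>. \<phi> \<in> test_functions \<Longrightarrow> ip f \<phi> = ip g \<phi>"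
    and F: "\<And>n::nat. F n \<in> test_functions"
    and lim: "(\<lambda>n. ip (\<lambda>x. F n x - f x) (\<lambda>x. F n x - f x)) \<longlonglongrightarrow> 0" by blast
  have "AE x in lborel. f x - g x = 0"
    by (rule fundamental_lemma) (use f g in \<open>auto simp: ip_diff_right ip_commute\<close>)
  then have "AE x in lborel. f x = g x" by simp
  then have "ip (\<lambda>x. F n x - g x) (\<lambda>x. F n x - g x) = ip (\<lambda>x. F n x - f x) (\<lambda>x. F n x - f x)" for n
    using f g F by (intro ip_cong_AE) auto
  with lim have "(\<lambda>n. ip (\<lambda>x. F n x - g x) (\<lambda>x. F n x - g x)) \<longlonglongrightarrow> 0" by simp
  with F show ?thesis by blast
qed

section \<open>Affine changes of variables\<close>

lemma lborel_integral_affine: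
  fixes f :: "'a::euclidean_space \<Rightarrow> 'b::{banach, second_countable_topology}"
  assumes [measurable]: "f \<in> borel_measurable borel" and t: "t \<noteq> 0"
  shows "(LINT x|lborel. f x) = \<bar>t\<bar> ^ DIM('a) *\<^sub>R (LINT x|lborel. f (h + t *\<^sub>R x))"
  by (subst lborel_affine[OF t, of h]) (simp add: integral_density integral_distr)

lemma lborel_nn_integral_affine:
  fixes f :: "'a::euclidean_space \<Rightarrow> ennreal"
  assumes [measurable]: "f \<in> borel_measurable borel" and t: "t \<noteq> 0"
  shows "(\<integral>\<^sup>+x. f x \<partial>lborel) = ennreal (\<bar>t\<bar> ^ DIM('a)) * (\<integral>\<^sup>+x. f (h + t *\<^sub>R x) \<partial>lborel)"
  by (subst lborel_affine[OF t, of h])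
     (simp add: nn_integral_density nn_integral_distr nn_integral_cmult ennreal_power)

lemma lborel_integrable_affine:
  fixes f :: "'a::euclidean_space \<Rightarrow> 'b::{banach, second_countable_topology}"
  assumes f: "integrable lborel f" and t: "t \<noteq> 0"
  shows "integrable lborel (\<lambda>x. f (h + t *\<^sub>R x))"
proof -
  have [measurable]: "f \<in> borel_measurable borel" using f by auto
  have "(\<integral>\<^sup>+x. ennreal (norm (f x)) \<partial>lborel)
      = ennreal (\<bar>t\<bar> ^ DIM('a)) * (\<integral>\<^sup>+x. ennreal (norm (f (h + t *\<^sub>R x))) \<partial>lborel)"
    using t by (intro lborel_nn_integral_affine) auto
  moreover have "(\<integral>\<^sup>+x. ennreal (norm (f x)) \<partial>lborel) < \<infinity>" using f by (simp add: integrable_iff_bounded)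
  ultimately show ?thesis using t
    by (auto simp: integrable_iff_bounded ennreal_mult_less_top)
qed

section \<open>Translations and weak gradients\<close>

lemma ip_mult_left [simp]: "ip (\<lambda>x. c * f x) (h :: _ \<Rightarrow> real) = c * ip f h"
  using ip_scale_left[of c f h] by simp

lemma sq_mult [simp]: "sq f \<Longrightarrow> sq (\<lambda>x. c * f x :: real)"
  using sq_scaleR[of f c] by simp

lemma ip_mult_right [simp]: "ip (h :: _ \<Rightarrow> real) (\<lambda>x. c * f x) = c * ip h f"
  using ip_scale_right[of h c f] by simp

lemma ip_affine:
  fixes f g :: "real^'n::finite \<Rightarrow> 'b::euclidean_space"
  assumes [measurable]: "f \<in> borel_measurable borel" "g \<in> borel_measurable borel" and t: "t \<noteq> 0"
  shows "ip f g = \<bar>t\<bar> ^ CARD('n) * ip (\<lambda>x. f (h + t *\<^sub>R x)) (\<lambda>x. g (h + t *\<^sub>R x))"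
  unfolding ip_def using t by (subst lborel_integral_affine[of _ t h]) auto

lemma sq_affine [simp]:
  assumes [measurable]: "sq f" and t: "t \<noteq> 0"
  shows "sq (\<lambda>x. f (h + t *\<^sub>R x))"
proof -
  have [measurable]: "f \<in> borel_measurable borel" using assms(1) by measurable
  show ?thesis
    using lborel_integrable_affine[OF sq_integrable_norm[OF assms(1)] t]
    by (simp add: square_integrable_def)
qed

lemma sq_translate [simp]: "sq f \<Longrightarrow> sq (\<lambda>x. f (x + h))"
  using sq_affine[of f 1 h] by (simp add: add.commute)

lemma ip_translate:
  fixes f g :: "real^'n::finite \<Rightarrow> 'b::euclidean_space"
  assumes "sq f" "sq g" shows "ip (\<lambda>x. f (x + h)) (\<lambda>x. g (x + h)) = ip f g"
proof -
  have [measurable]: "f \<in> borel_measurable borel" "g \<in> borel_measurable borel" using assms by measurable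
  show ?thesis using ip_affine[of f g 1 h] by (simp add: add.commute)
qed

lemma ip_translate_left:
  assumes "sq f" "sq g" shows "ip (\<lambda>x. f (x + h)) g = ip f (\<lambda>x. g (x - h))"
  using ip_translate[of f "\<lambda>x. g (x - h)" h] assms sq_translate[of g "-h"] by simp

lemma sq_translate_minus [simp]: "sq f \<Longrightarrow> sq (\<lambda>x. f (x - h))"
  using sq_translate[of f "-h"] by simp

lemma sq_inner [simp]:
  fixes f :: "real^'n::finite \<Rightarrow> 'b::euclidean_space"
  assumes "sq f" shows "sq (\<lambda>x. f x \<bullet> b)"
proof -
  have [measurable]: "f \<in> borel_measurable borel" using assms by measurable
  show ?thesis
    by (rule sq_dominated[OF assms, of _ "norm b"])
      (simp_all add: mult.commute[of "norm b"] Cauchy_Schwarz_ineq2)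
qed

lemma sq_scaled [simp]:
  fixes f :: "real^'n::finite \<Rightarrow> real"
  assumes "sq f" shows "sq (\<lambda>x. f x *\<^sub>R b)"
proof -
  have [measurable]: "f \<in> borel_measurable borel" using assms by measurable
  show ?thesis by (rule sq_dominated[OF assms, of _ "norm b"]) auto
qed

lemma sq_vec_nth [simp]:
  fixes G :: "real^'n::finite \<Rightarrow> 'b::euclidean_space^'m::finite"
  assumes "sq G" shows "sq (\<lambda>x. G x $ i)"
proof -
  have [measurable]: "G \<in> borel_measurable borel" using assms by measurable
  have "(\<lambda>x. G x $ i) \<in> borel_measurable borel"
    by (rule borel_measurable_continuous_on[of "\<lambda>v. v $ i"]) (auto intro: continuous_intros)
  then show ?thesis
    by (rule sq_dominated[OF assms, of _ 1]) (simp add: Finite_Cartesian_Product.norm_nth_le)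
qed

lemma sq_sum: "finite I \<Longrightarrow> (\<And>i. i \<in> I \<Longrightarrow> sq (f i)) \<Longrightarrow> sq (\<lambda>x. \<Sum>i\<in>I. f i x)"
  by (induction I rule: finite_induct) auto

lemma ip_sum_right: "finite I \<Longrightarrow> sq h \<Longrightarrow> (\<And>i. i \<in> I \<Longrightarrow> sq (f i)) \<Longrightarrow> ip h (\<lambda>x. \<Sum>i\<in>I. f i x) = (\<Sum>i\<in>I. ip h (f i))"
proof (induction I rule: finite_induct)
  case empty then show ?case by (simp add: ip_def)
next
  case (insert i I) then show ?case by (simp add: ip_add_right sq_sum)
qed

lemma ip_components:
  fixes f g :: "real^'n::finite \<Rightarrow> 'b::euclidean_space"
  assumes "sq f" "sq g"
  shows "ip f g = (\<Sum>b\<in>Basis. ip (\<lambda>x. f x \<bullet> b) (\<lambda>x. g x \<bullet> b))"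
proof -
  have "ip f g = (LINT x|lborel. (\<Sum>b\<in>Basis. (f x \<bullet> b) \<bullet> (g x \<bullet> b)))"
    unfolding ip_def by (subst euclidean_inner) simp
  also have "\<dots> = (\<Sum>b\<in>Basis. LINT x|lborel. (f x \<bullet> b) \<bullet> (g x \<bullet> b))"
    using assms by (intro Bochner_Integration.integral_sum integrable_inner sq_inner)
  finally show ?thesis by (simp add: ip_def)
qed

lemma borel_measurable_vec_lambda:
  fixes f :: "'n::finite \<Rightarrow> 'a \<Rightarrow> 'b::euclidean_space"
  assumes "\<And>i. f i \<in> borel_measurable M"
  shows "(\<lambda>x. \<chi> i. f i x) \<in> borel_measurable M"
  using assms by (auto simp: borel_measurable_euclidean_space[of "\<lambda>x. \<chi> i. f i x"] Basis_vec_def inner_axis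
      intro!: borel_measurable_inner)

lemma norm_vec_square: "(norm (v :: 'b::euclidean_space^'n::finite))\<^sup>2 = (\<Sum>i\<in>UNIV. (norm (v $ i))\<^sup>2)"
  by (simp add: norm_vec_def L2_set_def sum_nonneg)

lemma sq_vec_lambda:
  fixes f :: "'m::finite \<Rightarrow> real^'n::finite \<Rightarrow> 'b::euclidean_space"
  assumes "\<And>i. sq (f i)"
  shows "sq (\<lambda>x. \<chi> i. f i x)"
proof -
  have "(\<lambda>x. \<chi> i. f i x) \<in> borel_measurable borel"
    by (rule borel_measurable_vec_lambda) (use assms in measurable)
  moreover have "integrable lborel (\<lambda>x. (norm (\<chi> i. f i x))\<^sup>2)"
    unfolding norm_vec_square using assms by (intro Bochner_Integration.integrable_sum) auto
  ultimately show ?thesis by (simp add: square_integrable_def)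
qed

lemma ip_vec:
  fixes f g :: "real^'n::finite \<Rightarrow> 'b::euclidean_space^'m::finite"
  assumes "sq f" "sq g"
  shows "ip f g = (\<Sum>i\<in>UNIV. ip (\<lambda>x. f x $ i) (\<lambda>x. g x $ i))"
  unfolding ip_def inner_vec_def using assms
  by (intro Bochner_Integration.integral_sum integrable_inner sq_vec_nth)

text \<open>Relational form of the weak gradient with integrability built in. Calculus is done with
  this relation; the representative chosen by \<open>weak_gradient\<close> is compared with it
  afterwards, up to null sets.\<close>

definition has_gradient ::
  "(real^'n::finite \<Rightarrow> 'k::euclidean_space) \<Rightarrow> (real^'n \<Rightarrow> 'k^'n) \<Rightarrow> bool" where
  "has_gradient u G \<longleftrightarrow> sq u \<and> sq G \<and> has_weak_gradient u G"

definition along :: "real^'n::finite \<Rightarrow> 'k::euclidean_space^'n \<Rightarrow> 'k" where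
  "along e v = (\<Sum>i\<in>UNIV. e $ i *\<^sub>R v $ i)"

lemma along_axis [simp]: "along (axis i 1) v = v $ i"
proof -
  have "along (axis i 1) v = (\<Sum>j\<in>UNIV. if j = i then v $ j else 0)"
    unfolding along_def by (intro sum.cong) (auto simp: axis_def)
  then show ?thesis by simp
qed

lemma along_minus: "along (- e) v = - along e v"
  by (simp add: along_def sum_negf)

lemma norm_along_le: "norm (along e v) \<le> norm e * norm v"
proof -
  have "norm (along e v) \<le> (\<Sum>i\<in>UNIV. \<bar>e $ i\<bar> * \<bar>norm (v $ i)\<bar>)"
    unfolding along_def by (rule order_trans[OF norm_sum]) simp
  also have "\<dots> \<le> L2_set (\<lambda>i. e $ i) UNIV * L2_set (\<lambda>i. norm (v $ i)) UNIV"
    by (rule L2_set_mult_ineq)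
  finally show ?thesis by (simp add: norm_vec_def L2_set_def)
qed

lemma sq_along [simp]:
  fixes G :: "real^'n::finite \<Rightarrow> 'k::euclidean_space^'n"
  shows "sq G \<Longrightarrow> sq (\<lambda>x. along e (G x))"
  unfolding along_def by (intro sq_sum) auto

lemma ip_along_le:
  fixes G :: "real^'n::finite \<Rightarrow> 'k::euclidean_space^'n"
  assumes "sq G"
  shows "ip (\<lambda>x. along e (G x)) (\<lambda>x. along e (G x)) \<le> (norm e)\<^sup>2 * ip G G"
proof -
  have "(LINT x|lborel. (norm (along e (G x)))\<^sup>2) \<le> (LINT x|lborel. (norm e)\<^sup>2 * (norm (G x))\<^sup>2)"
    using assms power_mono[OF norm_along_le norm_ge_zero, where n = 2]
    by (intro integral_mono) (auto simp: power_mult_distrib)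
  then show ?thesis by (simp add: ip_self)
qed

lemma has_gradientD:
  assumes "has_gradient u G" shows "sq u" "sq G"
  using assms by (auto simp: has_gradient_def)

text \<open>Taking components along \<open>Basis\<close> replaces the vector-valued integrals by
  scalar products \<open>ip\<close>, to which linearity, weak limits and density of test functions
  apply.\<close>

lemma has_gradient_iff:
  fixes u :: "real^'n::finite \<Rightarrow> 'k::euclidean_space"
  shows "has_gradient u G \<longleftrightarrow> sq u \<and> sq G \<and>
    (\<forall>\<phi>\<in>test_functions. \<forall>i. \<forall>b\<in>Basis. ip (partial_deriv i \<phi>) (\<lambda>x. u x \<bullet> b) = - ip \<phi> (\<lambda>x. G x $ i \<bullet> b))"
proof -
  have int: "integrable lborel (\<lambda>x. \<phi> x *\<^sub>R v x)" if "sq \<phi>" "sq v" for \<phi> and v :: "real^'n \<Rightarrow> 'k"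
  proof -
    have [measurable]: "\<phi> \<in> borel_measurable borel" "v \<in> borel_measurable borel" using that by measurable
    show ?thesis
      by (rule Bochner_Integration.integrable_bound[OF integrable_norm_mult[OF that]]) auto
  qed
  have comp: "(LINT x|lborel. \<phi> x *\<^sub>R v x) \<bullet> b = ip \<phi> (\<lambda>x. v x \<bullet> b)" if "sq \<phi>" "sq v" for \<phi> b
      and v :: "real^'n \<Rightarrow> 'k"
    unfolding ip_def by (subst integral_inner_left[symmetric, OF int[OF that]]) simp
  have "(LINT x|lborel. partial_deriv i \<phi> x *\<^sub>R u x) = - (LINT x|lborel. \<phi> x *\<^sub>R (G x $ i)) \<longleftrightarrow>
    (\<forall>b\<in>Basis. ip (partial_deriv i \<phi>) (\<lambda>x. u x \<bullet> b) = - ip \<phi> (\<lambda>x. G x $ i \<bullet> b))"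
    if "sq u" "sq G" "\<phi> \<in> test_functions" for \<phi> i
    using that by (subst euclidean_eq_iff) (simp add: comp test_partial_deriv)
  then show ?thesis by (auto simp: has_gradient_def has_weak_gradient_def)
qed

lemma has_gradient_along:
  assumes "has_gradient u G" "\<phi> \<in> test_functions" "b \<in> Basis"
  shows "ip (dir_deriv e \<phi>) (\<lambda>x. u x \<bullet> b) = - ip \<phi> (\<lambda>x. along e (G x) \<bullet> b)"
proof -
  have sq: "sq u" "sq G" using assms(1) by (auto simp: has_gradient_def)
  have "ip (dir_deriv e \<phi>) (\<lambda>x. u x \<bullet> b) = (\<Sum>i\<in>UNIV. e $ i * ip (partial_deriv i \<phi>) (\<lambda>x. u x \<bullet> b))"
    unfolding dir_deriv_def
    by (subst ip_commute, subst ip_sum_right)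
       (use sq assms in \<open>auto simp: test_partial_deriv test_cmult ip_commute[of "\<lambda>x. u x \<bullet> b"]\<close>)
  also have "\<dots> = - (\<Sum>i\<in>UNIV. e $ i * ip \<phi> (\<lambda>x. G x $ i \<bullet> b))"
    using assms by (simp add: has_gradient_iff sum_negf)
  also have "(\<Sum>i\<in>UNIV. e $ i * ip \<phi> (\<lambda>x. G x $ i \<bullet> b)) = (\<Sum>i\<in>UNIV. ip \<phi> (\<lambda>x. e $ i *\<^sub>R (G x $ i \<bullet> b)))"
    by (simp only: ip_scale_right)
  also have "\<dots> = ip \<phi> (\<lambda>x. \<Sum>i\<in>UNIV. e $ i *\<^sub>R (G x $ i \<bullet> b))"
    using sq assms by (intro ip_sum_right[symmetric]) auto
  also have "\<dots> = ip \<phi> (\<lambda>x. along e (G x) \<bullet> b)"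
    by (simp add: along_def inner_sum_left)
  finally show ?thesis .
qed

section \<open>Weak gradients as limits of difference quotients\<close>

lemma ip_test_translate_deriv:
  assumes hg: "has_gradient u G" and \<phi>: "\<phi> \<in> test_functions" and b: "b \<in> Basis"
  shows "((\<lambda>s. ip \<phi> (\<lambda>x. u (x + s *\<^sub>R e) \<bullet> b)) has_real_derivative
     ip \<phi> (\<lambda>x. along e (G (x + s *\<^sub>R e)) \<bullet> b)) (at s)"
proof -
  have sq: "sq u" "sq G" using hg by (auto simp: has_gradient_def)
  \<comment> \<open>After a change of variables the increment acts on the test function, whose
    quotients converge strongly, while \<open>u\<close> stays fixed.\<close>
  define \<psi> where "\<psi> = (\<lambda>x. \<phi> (x - s *\<^sub>R e))"
  have \<psi>: "\<psi> \<in> test_functions" unfolding \<psi>_def using test_translate[OF \<phi>, of "- s *\<^sub>R e"] by simp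
  define w where "w = (\<lambda>x. u x \<bullet> b)"
  have w: "sq w" using sq by (simp add: w_def)
  have shift: "ip \<phi> (\<lambda>x. f (x + h)) = ip (\<lambda>x. \<phi> (x - h)) f" if "sq f" for f h
    using ip_translate_left[OF that test_sq[OF \<phi>], of h] by (simp add: ip_commute)
  have "(\<lambda>n. (ip \<phi> (\<lambda>x. w (x + (s + S n) *\<^sub>R e)) - ip \<phi> (\<lambda>x. w (x + s *\<^sub>R e))) / S n)
      \<longlonglongrightarrow> ip \<phi> (\<lambda>x. along e (G (x + s *\<^sub>R e)) \<bullet> b)"
    if S: "\<And>n. S n \<noteq> 0" "S \<longlonglongrightarrow> 0" for S :: "nat \<Rightarrow> real"
  proof -
    have "(\<lambda>n. ip (\<lambda>x. (\<psi> (x + S n *\<^sub>R (- e)) - \<psi> x) / S n) w) \<longlonglongrightarrow> ip (dir_deriv (- e) \<psi>) w"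
    proof (rule ip_tendsto[OF _ _ w test_difference_quotient[OF \<psi> S]])
      show "sq (\<lambda>x. (\<psi> (x + S n *\<^sub>R (- e)) - \<psi> x) / S n)" for n
        using sq_scaleR[OF sq_diff[OF test_sq[OF test_translate[OF \<psi>, of "S n *\<^sub>R (- e)"]] test_sq[OF \<psi>]], of
            "1 / S n"]
        by simp
      show "sq (dir_deriv (- e) \<psi>)" using dir_deriv_test[OF \<psi>] by simp
    qed
    also have "ip (dir_deriv (- e) \<psi>) w = ip \<psi> (\<lambda>x. along e (G x) \<bullet> b)"
      unfolding w_def using has_gradient_along[OF hg \<psi> b, of "- e"] ip_scale_right[of \<psi> "-1" "\<lambda>x. along e (G
          x) \<bullet> b"]
      by (simp add: along_minus)
    also have "\<dots> = ip \<phi> (\<lambda>x. along e (G (x + s *\<^sub>R e)) \<bullet> b)"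
      unfolding \<psi>_def using shift[of "\<lambda>x. along e (G x) \<bullet> b" "s *\<^sub>R e"] sq by simp
    also have "(\<lambda>n. ip (\<lambda>x. (\<psi> (x + S n *\<^sub>R (- e)) - \<psi> x) / S n) w)
      = (\<lambda>n. (ip \<phi> (\<lambda>x. w (x + (s + S n) *\<^sub>R e)) - ip \<phi> (\<lambda>x. w (x + s *\<^sub>R e))) / S n)"
    proof
      fix n
      have "ip \<phi> (\<lambda>x. w (x + (s + S n) *\<^sub>R e)) = ip (\<lambda>x. \<psi> (x + S n *\<^sub>R (- e))) w"
        unfolding shift[OF w] \<psi>_def by (simp add: algebra_simps)
      moreover have "ip \<phi> (\<lambda>x. w (x + s *\<^sub>R e)) = ip \<psi> w" unfolding shift[OF w] \<psi>_def ..
      moreover have "ip (\<lambda>x. (\<psi> (x + S n *\<^sub>R (- e)) - \<psi> x) / S n) w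
        = (1 / S n) * (ip (\<lambda>x. \<psi> (x + S n *\<^sub>R (- e))) w - ip \<psi> w)"
        using ip_scale_left[of "1 / S n" "\<lambda>x. \<psi> (x + S n *\<^sub>R (- e)) - \<psi> x" w]
          ip_diff_left[OF test_sq[OF test_translate[OF \<psi>, of "S n *\<^sub>R (- e)"]] test_sq[OF \<psi>] w] by simp
      ultimately show "ip (\<lambda>x. (\<psi> (x + S n *\<^sub>R (- e)) - \<psi> x) / S n) w
         = (ip \<phi> (\<lambda>x. w (x + (s + S n) *\<^sub>R e)) - ip \<phi> (\<lambda>x. w (x + s *\<^sub>R e))) / S n" by simp
    qed
    finally show ?thesis .
  qed
  then show ?thesis
    unfolding DERIV_def tendsto_at_iff_sequentially w_def by (auto simp: o_def)
qed

text \<open>Duality: the pairing of a test function with \<open>u(x + s e)\<close> is differentiable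
  in \<open>s\<close>, so the mean value theorem, Cauchy-Schwarz and translation invariance bound
  the pairing with the increment. Testing with approximations of the increment itself recovers its
  norm.\<close>

lemma ip_component_translate_le:
  assumes hg: "has_gradient u G" and b: "b \<in> Basis"
  shows "ip (\<lambda>x. (u (x + e) - u x) \<bullet> b) (\<lambda>x. (u (x + e) - u x) \<bullet> b)
    \<le> ip (\<lambda>x. along e (G x) \<bullet> b) (\<lambda>x. along e (G x) \<bullet> b)" (is "ip ?w ?w \<le> ip ?g ?g")
proof -
  have sq: "sq u" "sq G" using hg by (auto simp: has_gradient_def)
  have w: "sq ?w" and g: "sq ?g" using sq by auto
  have test: "(ip \<phi> ?w)\<^sup>2 \<le> ip \<phi> \<phi> * ip ?g ?g" if \<phi>: "\<phi> \<in> test_functions" for \<phi>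
  proof -
    define F where "F s = ip \<phi> (\<lambda>x. u (x + s *\<^sub>R e) \<bullet> b)" for s
    define F' where "F' s = ip \<phi> (\<lambda>x. along e (G (x + s *\<^sub>R e)) \<bullet> b)" for s
    have "(F has_real_derivative F' s) (at s)" for s
      unfolding F_def F'_def by (rule ip_test_translate_deriv[OF hg \<phi> b])
    then obtain z where "F 1 - F 0 = (1 - 0) * F' z" using MVT2[of 0 1 F F'] by auto
    moreover have "F 1 - F 0 = ip \<phi> ?w"
      unfolding F_def using sq \<phi> by (subst ip_diff_right[symmetric]) (auto simp: inner_diff_left)
    moreover have "(F' z)\<^sup>2 \<le> ip \<phi> \<phi> * ip ?g ?g"
      using ip_Cauchy_Schwarz[of \<phi> "\<lambda>x. along e (G (x
          + z *\<^sub>R e)) \<bullet> b"] ip_translate[OF g g, of "z *\<^sub>R e"] sq \<phi>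
        sq_translate[OF g, of "z *\<^sub>R e"]
      by (simp add: F'_def)
    ultimately show ?thesis by simp
  qed
  obtain F where F: "\<And>n::nat. F n \<in> test_functions"
    and lim: "(\<lambda>n. ip (\<lambda>x. F n x - ?w x) (\<lambda>x. F n x - ?w x)) \<longlonglongrightarrow> 0"
    using test_functions_dense[OF w] by blast
  have l1: "(\<lambda>n. ip (F n) ?w) \<longlonglongrightarrow> ip ?w ?w" using F w by (intro ip_tendsto[OF _ _ _ lim]) auto
  have "(\<lambda>n. ip (\<lambda>x. F n x - ?w x) (\<lambda>x. F n x - ?w x) + 2 * ip (F n) ?w - ip ?w ?w)
      \<longlonglongrightarrow> 0 + 2 * ip ?w ?w - ip ?w ?w"
    by (intro tendsto_intros lim l1)
  moreover have "ip (\<lambda>x. F n x - ?w x) (\<lambda>x. F n x - ?w x) + 2 * ip (F n) ?w - ip ?w ?w = ip (F n) (F n)" for n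
    using ip_self_diff[OF test_sq[OF F] w, of n] by simp
  ultimately have l2: "(\<lambda>n. ip (F n) (F n)) \<longlonglongrightarrow> ip ?w ?w" by simp
  have "(ip ?w ?w)\<^sup>2 \<le> ip ?w ?w * ip ?g ?g"
  proof (rule LIMSEQ_le)
    show "(\<lambda>n. (ip (F n) ?w)\<^sup>2) \<longlonglongrightarrow> (ip ?w ?w)\<^sup>2" by (intro tendsto_power l1)
    show "(\<lambda>n. ip (F n) (F n) * ip ?g ?g) \<longlonglongrightarrow> ip ?w ?w * ip ?g ?g" by (intro tendsto_mult l2 tendsto_const)
    show "\<exists>N. \<forall>n\<ge>N. (ip (F n) ?w)\<^sup>2 \<le> ip (F n) (F n) * ip ?g ?g" using test[OF F] by blast
  qed
  then show ?thesis
    using ip_nonneg[of ?w] ip_nonneg[of ?g]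
    by (cases "ip ?w ?w = 0") (auto simp: power2_eq_square mult_le_cancel_left)
qed

lemma ip_translate_diff_along:
  assumes hg: "has_gradient u G"
  shows "ip (\<lambda>x. u (x + e) - u x) (\<lambda>x. u (x + e) - u x) \<le> ip (\<lambda>x. along e (G x)) (\<lambda>x. along e (G x))"
proof -
  have sq: "sq u" "sq G" using hg by (auto simp: has_gradient_def)
  show ?thesis
    using sq by (subst (1 2) ip_components) (auto intro!: sum_mono ip_component_translate_le[OF hg])
qed

lemma ip_translate_diff_le:
  assumes hg: "has_gradient u G"
  shows "ip (\<lambda>x. u (x + e) - u x) (\<lambda>x. u (x + e) - u x) \<le> (norm e)\<^sup>2 * ip G G"
  using ip_translate_diff_along[OF hg, of e] ip_along_le[of G e] hg by (simp add: has_gradient_def)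

text \<open>Complements \<open>weakly_bounded_closed\<close>: with the limit known on approximations
  of \<open>p\<close>, the limit at \<open>p\<close> is identified as well.\<close>

lemma ip_tendsto_dense:
  assumes f: "\<And>n::nat. sq (f n)" "\<And>n. ip (f n) (f n) \<le> C" and g: "sq g"
    and F: "\<And>n::nat. sq (F n)" "\<And>n. (\<lambda>k. ip (f k) (F n)) \<longlonglongrightarrow> ip g (F n)" and p: "sq p"
    and lim: "(\<lambda>n. ip (\<lambda>x. F n x - p x) (\<lambda>x. F n x - p x)) \<longlonglongrightarrow> 0"
  shows "(\<lambda>k. ip (f k) p) \<longlonglongrightarrow> ip g p"
proof -
  define l where "l = lim (\<lambda>k. ip (f k) p)"
  have l: "(\<lambda>k. ip (f k) p) \<longlonglongrightarrow> l"
  proof -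
    have "convergent (\<lambda>k. ip (f k) p)"
      by (rule weakly_bounded_closed[OF f F(1) _ p lim]) (use F(2) in \<open>auto simp: convergent_def\<close>)
    then show ?thesis by (simp add: l_def convergent_LIMSEQ_iff)
  qed
  have C0: "0 \<le> C" using f(2)[of 0] ip_nonneg[of "f 0"] by linarith
  have "\<bar>l - ip g p\<bar> \<le> 0"
  proof (rule LIMSEQ_le_const)
    have "(\<lambda>n. sqrt C * sqrt (ip (\<lambda>x. F n x - p x) (\<lambda>x. F n x - p x)) + \<bar>ip (F n) g - ip p g\<bar>)
       \<longlonglongrightarrow> sqrt C * sqrt 0 + \<bar>ip p g - ip p g\<bar>"
      by (intro tendsto_intros lim ip_tendsto[OF F(1) p g lim])
    then show "(\<lambda>n. sqrt C * sqrt (ip (\<lambda>x. F n x - p x) (\<lambda>x. F n x - p x)) + \<bar>ip (F n) g - ip p g\<bar>) \<longlonglongrightarrow> 0"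
      by simp
    have "\<bar>l - ip g p\<bar> \<le> sqrt C * sqrt (ip (\<lambda>x. F n x - p x) (\<lambda>x. F n x - p x)) + \<bar>ip (F n) g - ip p g\<bar>" for n
    proof -
      have "\<bar>l - ip g (F n)\<bar> \<le> sqrt C * sqrt (ip (\<lambda>x. F n x - p x) (\<lambda>x. F n x - p x))"
      proof (rule LIMSEQ_le_const2)
        show "(\<lambda>k. \<bar>ip (f k) p - ip (f k) (F n)\<bar>) \<longlonglongrightarrow> \<bar>l - ip g (F n)\<bar>"
          by (intro tendsto_intros l F(2))
        have "\<bar>ip (f k) p - ip (f k) (F n)\<bar> \<le> sqrt C * sqrt (ip (\<lambda>x. F n x - p x) (\<lambda>x. F n x - p x))" for k
        proof -
          have "\<bar>ip (f k) p - ip (f k) (F n)\<bar> = \<bar>ip (f k) (\<lambda>x. F n x - p x)\<bar>"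
            using f F p by (simp add: ip_diff_right)
          also have "\<dots> \<le> sqrt (ip (f k) (f k)) * sqrt (ip (\<lambda>x. F n x - p x) (\<lambda>x. F n x - p x))"
            using f F p by (intro ip_Cauchy_Schwarz_sqrt) auto
          also have "\<dots> \<le> sqrt C * sqrt (ip (\<lambda>x. F n x - p x) (\<lambda>x. F n x - p x))"
            using f(2)[of k] C0 by (intro mult_right_mono) auto
          finally show ?thesis .
        qed
        then show "\<exists>N. \<forall>k\<ge>N. \<bar>ip (f k) p - ip (f k) (F n)\<bar>
            \<le> sqrt C * sqrt (ip (\<lambda>x. F n x - p x) (\<lambda>x. F n x - p x))"
          by blast
      qed
      then show ?thesis unfolding ip_commute[of g] by linarith
    qed
    then show "\<exists>N. \<forall>n\<ge>N. \<bar>l - ip g p\<bar> \<le> sqrt C * sqrt (ip (\<lambda>x. F n x - p x) (\<lambda>x. F n x - p x)) + \<bar>ip (F n) g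
        - ip p g\<bar>"
      by blast
  qed
  then show ?thesis using l by simp
qed

text \<open>The quotients are bounded by the directional derivative, so it suffices to test against
  the dense class, where \<open>ip_test_translate_deriv\<close> applies.\<close>

lemma has_gradient_quotient:
  fixes s :: "nat \<Rightarrow> real"
  assumes hg: "has_gradient u G" and s: "\<And>n. s n \<noteq> 0" "s \<longlonglongrightarrow> 0"
  shows "wconv (\<lambda>n x. (1 / s n) *\<^sub>R (u (x + s n *\<^sub>R e) - u x)) (\<lambda>x. along e (G x))"
  unfolding wconv_def
proof (intro allI impI)
  fix \<phi> :: "real^'a \<Rightarrow> 'b" assume \<phi>: "sq \<phi>"
  have sq: "sq u" "sq G" using hg by (auto simp: has_gradient_def)
  define q where "q n x = (1 / s n) *\<^sub>R (u (x + s n *\<^sub>R e) - u x)" for n x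
  have q: "sq (q n)" for n using sq by (simp add: q_def[abs_def])
  have comp: "(\<lambda>n. ip (\<lambda>x. q n x \<bullet> b) (\<lambda>x. \<phi> x \<bullet> b)) \<longlonglongrightarrow> ip (\<lambda>x. along e (G x) \<bullet> b) (\<lambda>x. \<phi> x \<bullet> b)"
    if b: "b \<in> Basis" for b
  proof -
    obtain F where F: "\<And>n::nat. F n \<in> test_functions"
      and lim: "(\<lambda>n. ip (\<lambda>x. F n x - \<phi> x \<bullet> b) (\<lambda>x. F n x - \<phi> x \<bullet> b)) \<longlonglongrightarrow> 0"
      using test_functions_dense[OF sq_inner[OF \<phi>]] by blast
    show ?thesis
    proof (rule ip_tendsto_dense[OF _ _ _ _ _ _ lim])
      show "ip (\<lambda>x. q n x \<bullet> b) (\<lambda>x. q n x \<bullet> b) \<le> ip (\<lambda>x. along e (G x) \<bullet> b) (\<lambda>x. along e (G x) \<bullet> b)" for n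
      proof -
        have "ip (\<lambda>x. q n x \<bullet> b) (\<lambda>x. q n x \<bullet> b)
          = (1 / s n)\<^sup>2 * ip (\<lambda>x. (u (x + s n *\<^sub>R e) - u x) \<bullet> b) (\<lambda>x. (u (x + s n *\<^sub>R e) - u x) \<bullet> b)"
          unfolding q_def inner_scaleR_left
          using ip_scale_left[of "1 / s n" "\<lambda>x. (u (x + s n *\<^sub>R e) - u x) \<bullet> b"]
             ip_scale_right[of _ "1 / s n" "\<lambda>x. (u (x + s n *\<^sub>R e) - u x) \<bullet> b"]
          by (simp add: power2_eq_square)
        also have "\<dots> \<le> (1 / s n)\<^sup>2 * ip (\<lambda>x. along (s n *\<^sub>R e) (G x) \<bullet> b) (\<lambda>x. along (s n *\<^sub>R e) (G x) \<bullet> b)"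
          by (intro mult_left_mono ip_component_translate_le[OF hg b]) auto
        also have "along (s n *\<^sub>R e) v = s n *\<^sub>R along e v" for v :: "'b^'a"
          by (simp add: along_def scaleR_sum_right)
        then have "(1 / s n)\<^sup>2 * ip (\<lambda>x. along (s n *\<^sub>R e) (G x) \<bullet> b) (\<lambda>x. along (s n *\<^sub>R e) (G x) \<bullet> b)
          = ip (\<lambda>x. along e (G x) \<bullet> b) (\<lambda>x. along e (G x) \<bullet> b)"
          using ip_scale_left[of "s n" "\<lambda>x. along e (G x) \<bullet> b"]
             ip_scale_right[of _ "s n" "\<lambda>x. along e (G x) \<bullet> b"] s(1)[of n]
          by (simp add: power2_eq_square)
        finally show ?thesis .
      qed
      show "(\<lambda>k. ip (\<lambda>x. q k x \<bullet> b) (F n)) \<longlonglongrightarrow> ip (\<lambda>x. along e (G x) \<bullet> b) (F n)" for n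
      proof -
        have "((\<lambda>h. (ip (F n) (\<lambda>x. u (x + h *\<^sub>R e) \<bullet> b) - ip (F n) (\<lambda>x. u x \<bullet> b)) / h)
           \<longlongrightarrow> ip (F n) (\<lambda>x. along e (G x) \<bullet> b)) (at 0)"
          using ip_test_translate_deriv[OF hg F b, of n e 0] by (simp add: DERIV_def)
        then have "(\<lambda>k. (ip (F n) (\<lambda>x. u (x + s k *\<^sub>R e) \<bullet> b) - ip (F n) (\<lambda>x. u x \<bullet> b)) / s k)
           \<longlonglongrightarrow> ip (F n) (\<lambda>x. along e (G x) \<bullet> b)"
          using s unfolding tendsto_at_iff_sequentially by (auto simp: o_def)
        moreover have "ip (\<lambda>x. q k x \<bullet> b) (F n)
            = (ip (F n) (\<lambda>x. u (x + s k *\<^sub>R e) \<bullet> b) - ip (F n) (\<lambda>x. u x \<bullet> b)) / s k" for k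
          unfolding q_def inner_scaleR_left inner_diff_left
          using ip_scale_left[of "1 / s k" "\<lambda>x. u (x + s k *\<^sub>R e) \<bullet> b - u x \<bullet> b" "F n"] sq F
          by (simp add: ip_diff_left ip_diff_right ip_commute[of _ "F n"])
        ultimately show ?thesis by (simp add: ip_commute)
      qed
    qed (use q sq \<phi> F in auto)
  qed
  have "(\<lambda>n. \<Sum>b\<in>Basis. ip (\<lambda>x. q n x \<bullet> b) (\<lambda>x. \<phi> x \<bullet> b))
      \<longlonglongrightarrow> (\<Sum>b\<in>Basis. ip (\<lambda>x. along e (G x) \<bullet> b) (\<lambda>x. \<phi> x \<bullet> b))"
    by (intro tendsto_sum comp)
  then show "(\<lambda>n. ip (q n) \<phi>) \<longlonglongrightarrow> ip (\<lambda>x. along e (G x)) \<phi>"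
    using q sq \<phi> by (simp add: ip_components[of _ \<phi>])
qed

text \<open>Converse of \<open>has_gradient_quotient\<close>. One sequence of steps per coordinate
  direction is asked for, which is what weak compactness of bounded quotients delivers.\<close>

lemma has_gradientI:
  fixes u :: "real^'n::finite \<Rightarrow> 'k::euclidean_space"
  assumes sq: "sq u" "sq G"
    and "\<And>i. \<exists>s. (\<forall>n::nat. s n \<noteq> 0) \<and> s \<longlonglongrightarrow> 0 \<and>
       wconv (\<lambda>n x. (1 / s n) *\<^sub>R (u (x + s n *\<^sub>R axis i 1) - u x)) (\<lambda>x. G x $ i)"
  shows "has_gradient u G"
  unfolding has_gradient_iff
proof (intro conjI sq ballI allI)
  fix \<phi> :: "real^'n \<Rightarrow> real" and i and b :: 'k assume \<phi>: "\<phi> \<in> test_functions" and b: "b \<in> Basis"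
  obtain s where s: "\<And>n::nat. s n \<noteq> 0" "s \<longlonglongrightarrow> 0"
    and w: "wconv (\<lambda>n x. (1 / s n) *\<^sub>R (u (x + s n *\<^sub>R axis i 1) - u x)) (\<lambda>x. G x $ i)"
    using assms(3)[of i] by blast
  define e :: "real^'n" where "e = axis i 1"
  have "(\<lambda>n. ip (\<lambda>x. (\<phi> (x + s n *\<^sub>R (- e)) - \<phi> x) / s n) (\<lambda>x. u x \<bullet> b))
      \<longlonglongrightarrow> ip (dir_deriv (- e) \<phi>) (\<lambda>x. u x \<bullet> b)"
  proof (rule ip_tendsto[OF _ _ _ test_difference_quotient[OF \<phi> s]])
    show "sq (\<lambda>x. (\<phi> (x + s n *\<^sub>R (- e)) - \<phi> x) / s n)" for n
      using sq_scaleR[OF sq_diff[OF test_sq[OF test_translate[OF \<phi>, of "s n *\<^sub>R (- e)"]] test_sq[OF \<phi>]], of "1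
          / s n"]
      by simp
  qed (use dir_deriv_test[OF \<phi>] sq in auto)
  moreover have "ip (\<lambda>x. (\<phi> (x + s n *\<^sub>R (- e)) - \<phi> x) / s n) (\<lambda>x. u x \<bullet> b)
    = ip (\<lambda>x. (1 / s n) *\<^sub>R (u (x + s n *\<^sub>R axis i 1) - u x)) (\<lambda>x. \<phi> x *\<^sub>R b)" for n
  proof -
    have "ip (\<lambda>x. (\<phi> (x + s n *\<^sub>R (- e)) - \<phi> x) / s n) (\<lambda>x. u x \<bullet> b)
        = (1 / s n) * (ip (\<lambda>x. \<phi> (x - s n *\<^sub>R e)) (\<lambda>x. u x \<bullet> b) - ip \<phi> (\<lambda>x. u x \<bullet> b))"
      using ip_scale_left[of "1 / s n" "\<lambda>x. \<phi> (x - s n *\<^sub>R e) - \<phi> x" "\<lambda>x. u x \<bullet> b"] sq \<phi>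
      by (simp add: ip_diff_left)
    also have "ip (\<lambda>x. \<phi> (x - s n *\<^sub>R e)) (\<lambda>x. u x \<bullet> b) = ip \<phi> (\<lambda>x. u (x + s n *\<^sub>R e) \<bullet> b)"
      using ip_translate_left[of \<phi> "\<lambda>x. u x \<bullet> b" "- (s n *\<^sub>R e)"] sq \<phi> by simp
    also have "(1 / s n) * (ip \<phi> (\<lambda>x. u (x + s n *\<^sub>R e) \<bullet> b) - ip \<phi> (\<lambda>x. u x \<bullet> b))
       = (1 / s n) * (ip (\<lambda>x. u (x + s n *\<^sub>R e)) (\<lambda>x. \<phi> x *\<^sub>R b) - ip u (\<lambda>x. \<phi> x *\<^sub>R b))"
      by (simp add: ip_def)
    also have "\<dots> = ip (\<lambda>x. (1 / s n) *\<^sub>R (u (x + s n *\<^sub>R e) - u x)) (\<lambda>x. \<phi> x *\<^sub>R b)"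
      using sq \<phi> by (simp add: ip_diff_left)
    finally show ?thesis by (simp add: e_def)
  qed
  moreover have "(\<lambda>n. ip (\<lambda>x. (1 / s n) *\<^sub>R (u (x + s n *\<^sub>R axis i 1) - u x)) (\<lambda>x. \<phi> x *\<^sub>R b))
     \<longlonglongrightarrow> ip (\<lambda>x. G x $ i) (\<lambda>x. \<phi> x *\<^sub>R b)"
    using w \<phi> by (simp add: wconv_def)
  ultimately have "ip (dir_deriv (- e) \<phi>) (\<lambda>x. u x \<bullet> b) = ip (\<lambda>x. G x $ i) (\<lambda>x. \<phi> x *\<^sub>R b)"
    by (auto intro: LIMSEQ_unique)
  moreover have "dir_deriv (- e) \<phi> x = - partial_deriv i \<phi> x" for x
    by (simp add: dir_deriv_def e_def sum_negf axis_def if_distrib[of "\<lambda>t. t * _"] cong: if_cong)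
  ultimately have "- ip (partial_deriv i \<phi>) (\<lambda>x. u x \<bullet> b) = ip (\<lambda>x. G x $ i) (\<lambda>x. \<phi> x *\<^sub>R b)"
    using ip_scale_left[of "-1" "partial_deriv i \<phi>" "\<lambda>x. u x \<bullet> b"] by (simp add: ip_def)
  also have "\<dots> = ip \<phi> (\<lambda>x. G x $ i \<bullet> b)" by (simp add: ip_def)
  finally show "ip (partial_deriv i \<phi>) (\<lambda>x. u x \<bullet> b) = - ip \<phi> (\<lambda>x. G x $ i \<bullet> b)" by simp
qed

lemma has_gradient_add:
  assumes "has_gradient u G" "has_gradient v H"
  shows "has_gradient (\<lambda>x. u x + v x) (\<lambda>x. G x + H x)"
  using assms unfolding has_gradient_iff
  by (auto simp: inner_add_left ip_add_right test_partial_deriv)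

lemma has_gradient_scaleR:
  assumes "has_gradient u G"
  shows "has_gradient (\<lambda>x. c *\<^sub>R u x) (\<lambda>x. c *\<^sub>R G x)"
  using assms unfolding has_gradient_iff by auto

lemma has_gradient_diff:
  assumes "has_gradient u G" "has_gradient v H"
  shows "has_gradient (\<lambda>x. u x - v x) (\<lambda>x. G x - H x)"
  using has_gradient_add[OF assms(1) has_gradient_scaleR[OF assms(2), of "-1"]] by simp

lemma has_gradient_affine:
  fixes u :: "real^'n::finite \<Rightarrow> 'k::euclidean_space"
  assumes hg: "has_gradient u G" and t: "t \<noteq> 0"
  shows "has_gradient (\<lambda>x. u (h + t *\<^sub>R x)) (\<lambda>x. t *\<^sub>R G (h + t *\<^sub>R x))"
proof -
  have sq: "sq u" "sq G" using hg by (auto simp: has_gradient_def)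
  have "ip (partial_deriv i \<phi>) (\<lambda>x. u (h + t *\<^sub>R x) \<bullet> b) = - ip \<phi> (\<lambda>x. (t *\<^sub>R G (h + t *\<^sub>R x)) $ i \<bullet> b)"
    if \<phi>: "\<phi> \<in> test_functions" and b: "b \<in> Basis" for \<phi> i b
  proof -
    define \<psi> where "\<psi> = (\<lambda>x. \<phi> (- (h /\<^sub>R t) + (1 / t) *\<^sub>R x))"
    have \<psi>: "\<psi> \<in> test_functions" unfolding \<psi>_def using t by (intro test_affine \<phi>) auto
    have \<phi>\<psi>: "\<phi> = (\<lambda>x. \<psi> (h + t *\<^sub>R x))" using t by (auto simp: \<psi>_def algebra_simps divide_inverse)
    have pd: "partial_deriv i \<phi> = (\<lambda>x. t * partial_deriv i \<psi> (h + t *\<^sub>R x))"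
      unfolding \<phi>\<psi> by (rule partial_deriv_affine) (rule test_differentiable[OF \<psi>])
    note [measurable] = sq_measurable[OF sq(1)] sq_measurable[OF sq(2)] test_measurable[OF \<psi>]
       test_measurable[OF test_partial_deriv[OF \<psi>]] sq_measurable[OF sq_vec_nth[OF sq(2)]]
    have "\<bar>t\<bar> ^ CARD('n) * ip (partial_deriv i \<phi>) (\<lambda>x. u (h + t *\<^sub>R x) \<bullet> b)
       = t * (\<bar>t\<bar> ^ CARD('n) * ip (\<lambda>x. partial_deriv i \<psi> (h + t *\<^sub>R x)) (\<lambda>x. u (h + t *\<^sub>R x) \<bullet> b))"
      unfolding pd by simp
    also have "\<bar>t\<bar> ^ CARD('n) * ip (\<lambda>x. partial_deriv i \<psi> (h + t *\<^sub>R x)) (\<lambda>x. u (h + t *\<^sub>R x) \<bullet> b)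
       = ip (partial_deriv i \<psi>) (\<lambda>x. u x \<bullet> b)"
      by (rule ip_affine[symmetric]) (use t in measurable)
    also have "ip (partial_deriv i \<psi>) (\<lambda>x. u x \<bullet> b) = - ip \<psi> (\<lambda>x. G x $ i \<bullet> b)"
      using hg \<psi> b by (simp add: has_gradient_iff)
    also have "ip \<psi> (\<lambda>x. G x $ i \<bullet> b) = \<bar>t\<bar> ^ CARD('n) * ip \<phi> (\<lambda>x. G (h + t *\<^sub>R x) $ i \<bullet> b)"
      unfolding \<phi>\<psi> by (rule ip_affine) (use t in measurable)
    also have "t * - (\<bar>t\<bar> ^ CARD('n) * ip \<phi> (\<lambda>x. G (h + t *\<^sub>R x) $ i \<bullet> b))
       = \<bar>t\<bar> ^ CARD('n) * - ip \<phi> (\<lambda>x. (t *\<^sub>R G (h + t *\<^sub>R x)) $ i \<bullet> b)"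
      using ip_scale_right[where 'b=real, of \<phi> t] by simp
    finally show ?thesis using t by (subst (asm) mult_left_cancel) auto
  qed
  then show ?thesis using sq t unfolding has_gradient_iff by auto
qed

lemma has_gradient_translate:
  "has_gradient u G \<Longrightarrow> has_gradient (\<lambda>x. u (x + h)) (\<lambda>x. G (x + h))"
  using has_gradient_affine[of u G 1 h] by (simp add: add.commute)

text \<open>Each defining identity pairs \<open>u\<close> and \<open>G\<close> with fixed
  square-integrable functions, so the graph of the gradient is weakly closed.\<close>

lemma has_gradient_wconv:
  fixes u :: "nat \<Rightarrow> real^'n::finite \<Rightarrow> 'k::euclidean_space"
  assumes hg: "\<And>n. has_gradient (u n) (G n)" and sq: "sq v" "sq H" and w: "wconv u v" "wconv G H"
  shows "has_gradient v H"
  unfolding has_gradient_iff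
proof (intro conjI sq ballI allI)
  fix \<phi> :: "real^'n \<Rightarrow> real" and i and b :: 'k assume \<phi>: "\<phi> \<in> test_functions" and b: "b \<in> Basis"
  have scal: "ip \<psi> (\<lambda>x. f x \<bullet> b) = ip f (\<lambda>x. \<psi> x *\<^sub>R b)" for \<psi> and f :: "real^'n \<Rightarrow> 'k"
    by (simp add: ip_def)
  have vec: "ip \<phi> (\<lambda>x. F x $ i \<bullet> b) = ip F (\<lambda>x. axis i (\<phi> x *\<^sub>R b))" for F :: "real^'n \<Rightarrow> 'k^'n"
    by (simp add: ip_def inner_axis)
  have "axis i (\<phi> x *\<^sub>R b) = (\<chi> j. if j = i then \<phi> x *\<^sub>R b else 0)" for x
    by (simp add: axis_def vec_eq_iff)
  moreover have "sq (\<lambda>x. (\<chi> j. if j = i then \<phi> x *\<^sub>R b else 0))"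
  proof (rule sq_vec_lambda)
    fix j show "sq (\<lambda>x. if j = i then \<phi> x *\<^sub>R b else 0)" using \<phi> by (cases "j = i") auto
  qed
  ultimately have sqa: "sq (\<lambda>x. axis i (\<phi> x *\<^sub>R b) :: 'k^'n)" by simp
  show "ip (partial_deriv i \<phi>) (\<lambda>x. v x \<bullet> b) = - ip \<phi> (\<lambda>x. H x $ i \<bullet> b)"
  proof (rule LIMSEQ_unique)
    show "(\<lambda>n. ip (partial_deriv i \<phi>) (\<lambda>x. u n x \<bullet> b)) \<longlonglongrightarrow> ip (partial_deriv i \<phi>) (\<lambda>x. v x \<bullet> b)"
      unfolding scal using w \<phi> by (simp add: wconv_def test_partial_deriv)
    have "(\<lambda>n. - ip \<phi> (\<lambda>x. G n x $ i \<bullet> b)) \<longlonglongrightarrow> - ip \<phi> (\<lambda>x. H x $ i \<bullet> b)"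
      unfolding vec using w sqa by (intro tendsto_minus) (simp add: wconv_def)
    then show "(\<lambda>n. ip (partial_deriv i \<phi>) (\<lambda>x. u n x \<bullet> b)) \<longlonglongrightarrow> - ip \<phi> (\<lambda>x. H x $ i \<bullet> b)"
      using hg \<phi> b by (simp add: has_gradient_iff)
  qed
qed

section \<open>The space H1: uniqueness of the gradient and criteria for membership\<close>

lemma has_gradient_unique:
  assumes "has_gradient u G" "has_gradient u H"
  shows "AE x in lborel. G x = H x"
proof -
  have sq: "sq G" "sq H" using assms by (auto simp: has_gradient_def)
  have "AE x in lborel. (G x $ i - H x $ i) \<bullet> b = 0" if "b \<in> Basis" for i b
  proof (rule fundamental_lemma)
    fix \<phi> :: "real^'a \<Rightarrow> real" assume \<phi>: "\<phi> \<in> test_functions"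
    then have "ip \<phi> (\<lambda>x. G x $ i \<bullet> b) = ip \<phi> (\<lambda>x. H x $ i \<bullet> b)"
      using assms that by (auto simp: has_gradient_iff)
    then show "ip \<phi> (\<lambda>x. (G x $ i - H x $ i) \<bullet> b) = 0"
      using sq \<phi> by (simp add: inner_diff_left ip_diff_right)
  qed (use sq in auto)
  then have "AE x in lborel. \<forall>b\<in>Basis. (G x $ i - H x $ i) \<bullet> b = 0" for i
    by (intro AE_finite_allI) auto
  then have "AE x in lborel. \<forall>i\<in>UNIV. \<forall>b\<in>Basis. (G x $ i - H x $ i) \<bullet> b = 0"
    by (intro AE_finite_allI[OF finite]) blast
  then show ?thesis
    by eventually_elim (auto simp: vec_eq_iff euclidean_eq_iff[of "_ $ _"] inner_diff_left)
qed

lemma H1_iff: "u \<in> H1 \<longleftrightarrow> (\<exists>G. has_gradient u G)"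
  by (auto simp: H1_def has_gradient_def)

lemma has_gradient_weak_gradient:
  assumes "u \<in> H1" shows "has_gradient u (weak_gradient u)"
proof -
  have "\<exists>G. square_integrable G \<and> has_weak_gradient u G" using assms by (auto simp: H1_def)
  from someI_ex[OF this] show ?thesis using assms
    by (auto simp: weak_gradient_def has_gradient_def H1_def)
qed

lemma weak_gradient_eq_AE:
  "has_gradient u G \<Longrightarrow> AE x in lborel. weak_gradient u x = G x"
  using has_gradient_unique has_gradient_weak_gradient H1_iff by blast

lemma ip_weak_gradient:
  assumes "has_gradient u G" "has_gradient v H"
  shows "ip (weak_gradient u) (weak_gradient v) = ip G H"
proof (rule ip_cong_AE)
  have "u \<in> H1" "v \<in> H1" using assms by (auto simp: H1_iff)
  then show "sq (weak_gradient u)" "sq (weak_gradient v)"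
    by (auto dest: has_gradient_weak_gradient has_gradientD)
qed (use assms in \<open>auto intro: weak_gradient_eq_AE dest: has_gradientD\<close>)

lemma bounded_quotients_weak_limit:
  fixes u :: "real^'n::finite \<Rightarrow> 'k::euclidean_space"
  assumes sq: "sq u"
    and bound: "\<And>n::nat. ip (\<lambda>x. u (x + (1 / Suc n) *\<^sub>R e) - u x) (\<lambda>x. u (x + (1 / Suc n) *\<^sub>R e) - u x)
        \<le> C * (1 / Suc n)\<^sup>2"
  shows "\<exists>s g. (\<forall>n::nat. 0 < s n) \<and> s \<longlonglongrightarrow> 0 \<and> sq g \<and> wconv (\<lambda>n x. (1 / s n) *\<^sub>R (u (x + s n *\<^sub>R e) - u x)) g"
proof -
  define q where "q n x = real (Suc n) *\<^sub>R (u (x + (1 / Suc n) *\<^sub>R e) - u x)" for n x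
  have "\<exists>r g. strict_mono r \<and> sq g \<and> wconv (\<lambda>n. q (r n)) g"
  proof (rule L2_weakly_compact)
    show "sq (q n)" for n using sq by (simp add: q_def[abs_def] del: of_nat_Suc)
    show "ip (q n) (q n) \<le> C" for n
    proof -
      have "ip (q n) (q n) = (real (Suc n))\<^sup>2 * ip (\<lambda>x. u (x + (1 / Suc n) *\<^sub>R e)
          - u x) (\<lambda>x. u (x + (1 / Suc n) *\<^sub>R e) - u x)"
        by (simp add: q_def[abs_def] power2_eq_square del: of_nat_Suc)
      also have "\<dots> \<le> (real (Suc n))\<^sup>2 * (C * (1 / Suc n)\<^sup>2)"
        by (intro mult_left_mono bound) auto
      also have "\<dots> = C" by (simp add: power_divide del: of_nat_Suc)
      finally show ?thesis .
    qed
  qed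
  then obtain r g where r: "strict_mono r" and g: "sq g" "wconv (\<lambda>n. q (r n)) g" by blast
  have "(\<lambda>n. 1 / real (Suc (r n))) \<longlonglongrightarrow> 0"
    using LIMSEQ_subseq_LIMSEQ[OF LIMSEQ_inverse_real_of_nat r] by (simp add: o_def inverse_eq_divide)
  with g show ?thesis
    by (intro exI[of _ "\<lambda>n. 1 / real (Suc (r n))"] exI[of _ g]) (auto simp: q_def[abs_def])
qed

text \<open>Bounded difference quotients have weak limits along each axis, and these limits are the
  components of a gradient.\<close>

lemma H1_if_translation_bound:
  fixes u :: "real^'n::finite \<Rightarrow> 'k::euclidean_space"
  assumes sq: "sq u"
    and bound: "\<And>i (n::nat). ip (\<lambda>x. u (x + (1 / Suc n) *\<^sub>R axis i 1)
        - u x) (\<lambda>x. u (x + (1 / Suc n) *\<^sub>R axis i 1) - u x) \<le> C * (1 / Suc n)\<^sup>2"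
  shows "u \<in> H1"
proof -
  define Lim where "Lim i s g \<longleftrightarrow> (\<forall>n::nat. 0 < s n) \<and> s \<longlonglongrightarrow> 0 \<and> sq g \<and>
    wconv (\<lambda>n x. (1 / s n) *\<^sub>R (u (x + s n *\<^sub>R axis i 1) - u x)) g" for i s g
  have "\<exists>s g. Lim i s g" for i
    unfolding Lim_def by (rule bounded_quotients_weak_limit[OF sq bound])
  then obtain s g where g: "\<And>i. Lim i (s i) (g i)" by metis
  have "has_gradient u (\<lambda>x. \<chi> i. g i x)"
  proof (rule has_gradientI[OF sq])
    show "sq (\<lambda>x. \<chi> i. g i x)" using g by (intro sq_vec_lambda) (simp add: Lim_def)
    fix i
    show "\<exists>s. (\<forall>n::nat. s n \<noteq> 0) \<and> s \<longlonglongrightarrow> 0 \<and> wconv (\<lambda>n x. (1 / s n) *\<^sub>R (u (x + s n *\<^sub>R axis i 1)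
        - u x)) (\<lambda>x. (\<chi> i. g i x) $ i)"
      using g[of i] unfolding Lim_def by (intro exI[of _ "s i"]) (simp add: less_imp_neq[symmetric])
  qed
  then show ?thesis by (auto simp: H1_iff)
qed

text \<open>Leibniz rule for a bounded Lipschitz multiplier without compact support, as the Pohozaev
  argument requires. With \<open>q\<close> and \<open>r\<close> the quotients of \<open>u\<close>
  and of the multiplier \<eta>, the quotient of the product is \<eta> q + s r q + r u, and the
  middle term disappears because \<open>q\<close> and \<open>r\<close> stay bounded while s tends to
  0.\<close>

lemma has_gradient_mult:
  fixes u :: "real^'n::finite \<Rightarrow> 'k::euclidean_space" and \<eta> :: "real^'n \<Rightarrow> real"
  assumes hg: "has_gradient u G"
    and [measurable]: "\<eta> \<in> borel_measurable borel" "\<And>i. \<eta>' i \<in> borel_measurable borel"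
    and bound: "\<And>x. \<bar>\<eta> x\<bar> \<le> B"
    and lip: "\<And>x i h. \<bar>\<eta> (x + h *\<^sub>R axis i 1) - \<eta> x\<bar> \<le> L * \<bar>h\<bar>"
    and deriv: "\<And>x i. ((\<lambda>h. \<eta> (x + h *\<^sub>R axis i 1)) has_real_derivative \<eta>' i x) (at 0)"
  shows "has_gradient (\<lambda>x. \<eta> x *\<^sub>R u x) (\<lambda>x. \<chi> i. \<eta> x *\<^sub>R G x $ i + \<eta>' i x *\<^sub>R u x)"
proof -
  have sq: "sq u" "sq G" using hg by (auto simp: has_gradient_def)
  note [measurable] = sq_measurable[OF sq(1)] sq_measurable[OF sq_vec_nth[OF sq(2)]]
  have tendsto_quot: "(\<lambda>n. (\<eta> (x + s n *\<^sub>R axis i 1) - \<eta> x) / s n) \<longlonglongrightarrow> \<eta>' i x"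
    if "\<And>n. s n \<noteq> 0" "s \<longlonglongrightarrow> 0" for s :: "nat \<Rightarrow> real" and x i
    using deriv[of x i] that unfolding DERIV_def tendsto_at_iff_sequentially by (auto simp: o_def)
  have \<eta>'_bound: "\<bar>\<eta>' i x\<bar> \<le> L" for i x
  proof (rule LIMSEQ_le_const2)
    show "(\<lambda>n. \<bar>(\<eta> (x + (1 / Suc n) *\<^sub>R axis i 1) - \<eta> x) / (1 / Suc n)\<bar>) \<longlonglongrightarrow> \<bar>\<eta>' i x\<bar>"
      by (intro tendsto_rabs tendsto_quot LIMSEQ_inverse_real_of_nat[unfolded inverse_eq_divide]) auto
    show "\<exists>N. \<forall>n\<ge>N. \<bar>(\<eta> (x + (1 / Suc n) *\<^sub>R axis i 1) - \<eta> x) / (1 / Suc n)\<bar> \<le> L"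
    proof (intro exI allI impI)
      fix n :: nat
      show "\<bar>(\<eta> (x + (1 / Suc n) *\<^sub>R axis i 1) - \<eta> x) / (1 / Suc n)\<bar> \<le> L"
        using lip[of x "1 / Suc n" i] mult_right_mono[of "\<bar>\<eta> (x + (1 / Suc n) *\<^sub>R axis i 1) - \<eta> x\<bar>" "L * \<bar>1
            / Suc n\<bar>" "real (Suc n)"]
        unfolding abs_divide by (simp add: divide_divide_eq_right del: of_nat_Suc)
    qed
  qed
  have sq1: "sq (\<lambda>x. \<eta> x *\<^sub>R v x)" if v: "sq v" for v :: "real^'n \<Rightarrow> 'k"
  proof -
    have [measurable]: "v \<in> borel_measurable borel" using v by measurable
    show ?thesis by (rule sq_dominated[OF v, of _ B]) (use bound in \<open>auto intro: mult_right_mono\<close>)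
  qed
  have sq2: "sq (\<lambda>x. \<eta>' i x *\<^sub>R u x)" for i
    by (rule sq_dominated[OF sq(1), of _ L]) (use \<eta>'_bound in \<open>auto intro: mult_right_mono\<close>)
  show ?thesis
  proof (rule has_gradientI)
    show "sq (\<lambda>x. \<eta> x *\<^sub>R u x)" by (rule sq1[OF sq(1)])
    show "sq (\<lambda>x. \<chi> i. \<eta> x *\<^sub>R G x $ i + \<eta>' i x *\<^sub>R u x)"
      using sq by (intro sq_vec_lambda sq_add sq1 sq2) auto
    fix i :: 'n
    define e :: "real^'n" where "e = axis i 1"
    define s where "s n = 1 / real (Suc n)" for n
    have s: "\<And>n. s n \<noteq> 0" "s \<longlonglongrightarrow> 0"
      using LIMSEQ_inverse_real_of_nat by (auto simp: s_def[abs_def] inverse_eq_divide)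
    define q where "q n x = (1 / s n) *\<^sub>R (u (x + s n *\<^sub>R e) - u x)" for n x
    have q: "sq (q n)" for n using sq by (simp add: q_def[abs_def])
    note [measurable] = sq_measurable[OF q]
    have "wconv q (\<lambda>x. G x $ i)"
      using has_gradient_quotient[OF hg s, of "axis i 1"] by (simp add: q_def[abs_def] e_def)
    have q_bound: "ip (q n) (q n) \<le> ip G G" for n
    proof -
      have "ip (q n) (q n) = (1 / s n)\<^sup>2 * ip (\<lambda>x. u (x + s n *\<^sub>R e) - u x) (\<lambda>x. u (x + s n *\<^sub>R e) - u x)"
        by (simp add: q_def[abs_def] power2_eq_square)
      also have "\<dots> \<le> (1 / s n)\<^sup>2 * ((norm (s n *\<^sub>R e))\<^sup>2 * ip G G)"
        by (intro mult_left_mono ip_translate_diff_le[OF hg]) auto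
      also have "\<dots> = ip G G" using s(1)[of n] by (simp add: e_def power2_eq_square)
      finally show ?thesis .
    qed
    have "wconv (\<lambda>n x. (1 / s n) *\<^sub>R (\<eta> (x + s n *\<^sub>R e) *\<^sub>R u (x + s n *\<^sub>R e) - \<eta> x *\<^sub>R u x))
       (\<lambda>x. \<eta> x *\<^sub>R G x $ i + \<eta>' i x *\<^sub>R u x)"
      unfolding wconv_def
    proof (intro allI impI)
      fix \<phi> :: "real^'n \<Rightarrow> 'k" assume \<phi>: "sq \<phi>"
      note [measurable] = sq_measurable[OF \<phi>]
      define r where "r n x = (\<eta> (x + s n *\<^sub>R e) - \<eta> x) / s n" for n x
      have r_bound: "\<bar>r n x\<bar> \<le> L" for n x
        using lip[of x "s n" i] s(1)[of n] by (simp add: r_def e_def abs_divide field_simps)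
      have [measurable]: "r n \<in> borel_measurable borel" for n unfolding r_def by measurable
      have sqr: "sq (\<lambda>x. r n x *\<^sub>R v x)" if v: "sq v" for v :: "real^'n \<Rightarrow> 'k" and n
      proof -
        have [measurable]: "v \<in> borel_measurable borel" using v by measurable
        show ?thesis by (rule sq_dominated[OF v, of _ L]) (use r_bound in \<open>auto intro: mult_right_mono\<close>)
      qed
      have t1: "(\<lambda>n. ip (q n) (\<lambda>x. \<eta> x *\<^sub>R \<phi> x)) \<longlonglongrightarrow> ip (\<lambda>x. G x $ i) (\<lambda>x. \<eta> x *\<^sub>R \<phi> x)"
        using \<open>wconv q _\<close> sq1[OF \<phi>] by (simp add: wconv_def)
      have t2: "(\<lambda>n. s n * ip (q n) (\<lambda>x. r n x *\<^sub>R \<phi> x)) \<longlonglongrightarrow> 0"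
      proof (rule Lim_null_comparison)
        show "\<forall>\<^sub>F n in sequentially. norm (s n * ip (q n) (\<lambda>x. r n x *\<^sub>R \<phi> x))
            \<le> \<bar>s n\<bar> * (ip G G / 2 + L\<^sup>2 * ip \<phi> \<phi> / 2)"
        proof (intro always_eventually allI)
          fix n
          have "\<bar>ip (q n) (\<lambda>x. r n x *\<^sub>R \<phi> x)\<bar> \<le> ip (q n) (q n) / 2
              + ip (\<lambda>x. r n x *\<^sub>R \<phi> x) (\<lambda>x. r n x *\<^sub>R \<phi> x) / 2"
            using ip_young[OF q[of n] sqr[OF \<phi>, of n], of 1] by simp
          also have "ip (\<lambda>x. r n x *\<^sub>R \<phi> x) (\<lambda>x. r n x *\<^sub>R \<phi> x) \<le> L\<^sup>2 * ip \<phi> \<phi>"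
          proof -
            have "(LINT x|lborel. (norm (r n x *\<^sub>R \<phi> x))\<^sup>2) \<le> (LINT x|lborel. L\<^sup>2 * (norm (\<phi> x))\<^sup>2)"
            proof (rule integral_mono)
              show "integrable lborel (\<lambda>x. (norm (r n x *\<^sub>R \<phi> x))\<^sup>2)"
                  by (rule sq_integrable_norm[OF sqr[OF \<phi>]])
              show "(norm (r n x *\<^sub>R \<phi> x))\<^sup>2 \<le> L\<^sup>2 * (norm (\<phi> x))\<^sup>2" for x
                using power_mono[OF r_bound[of n x] abs_ge_zero, where n = 2]
                by (simp add: power_mult_distrib mult_right_mono)
            qed (use \<phi> in auto)
            then show ?thesis by (simp add: ip_self)
          qed
          finally have "\<bar>ip (q n) (\<lambda>x. r n x *\<^sub>R \<phi> x)\<bar> \<le> ip G G / 2 + L\<^sup>2 * ip \<phi> \<phi> / 2"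
            using q_bound[of n] by simp
          then show "norm (s n * ip (q n) (\<lambda>x. r n x *\<^sub>R \<phi> x)) \<le> \<bar>s n\<bar> * (ip G G / 2 + L\<^sup>2 * ip \<phi> \<phi> / 2)"
            by (simp add: abs_mult mult_left_mono)
        qed
        have "(\<lambda>n. \<bar>s n\<bar> * (ip G G / 2 + L\<^sup>2 * ip \<phi> \<phi> / 2)) \<longlonglongrightarrow> \<bar>0\<bar> * (ip G G / 2 + L\<^sup>2 * ip \<phi> \<phi> / 2)"
          by (intro tendsto_intros s)
        then show "(\<lambda>n. \<bar>s n\<bar> * (ip G G / 2 + L\<^sup>2 * ip \<phi> \<phi> / 2)) \<longlonglongrightarrow> 0" by simp
      qed
      have t3: "(\<lambda>n. ip (\<lambda>x. r n x *\<^sub>R u x) \<phi>) \<longlonglongrightarrow> ip (\<lambda>x. \<eta>' i x *\<^sub>R u x) \<phi>"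
        unfolding ip_def inner_scaleR_left
      proof (rule integral_dominated_convergence)
        show "integrable lborel (\<lambda>x. L * (norm (u x) * norm (\<phi> x)))"
          using integrable_norm_mult[OF sq(1) \<phi>] by simp
        show "AE x in lborel. (\<lambda>n. r n x * (u x \<bullet> \<phi> x)) \<longlonglongrightarrow> \<eta>' i x * (u x \<bullet> \<phi> x)"
          unfolding r_def e_def by (intro AE_I2 tendsto_intros tendsto_quot s)
        show "AE x in lborel. norm (r n x * (u x \<bullet> \<phi> x)) \<le> L * (norm (u x) * norm (\<phi> x))" for n
        proof (intro AE_I2)
          fix x
          have "0 \<le> L" using r_bound[of n x] by linarith
          then show "norm (r n x * (u x \<bullet> \<phi> x)) \<le> L * (norm (u x) * norm (\<phi> x))"
            unfolding real_norm_def abs_mult using r_bound Cauchy_Schwarz_ineq2 by (intro mult_mono) auto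
        qed
      qed measurable
      have "(\<lambda>n. ip (q n) (\<lambda>x. \<eta> x *\<^sub>R \<phi> x) + s n * ip (q n) (\<lambda>x. r n x *\<^sub>R \<phi> x) + ip (\<lambda>x. r n x *\<^sub>R u x) \<phi>)
        \<longlonglongrightarrow> ip (\<lambda>x. G x $ i) (\<lambda>x. \<eta> x *\<^sub>R \<phi> x) + 0 + ip (\<lambda>x. \<eta>' i x *\<^sub>R u x) \<phi>"
        by (intro tendsto_add t1 t2 t3)
      moreover have "ip (q n) (\<lambda>x. \<eta> x *\<^sub>R \<phi> x) + s n * ip (q n) (\<lambda>x. r n x *\<^sub>R \<phi> x)
          + ip (\<lambda>x. r n x *\<^sub>R u x) \<phi>
        = ip (\<lambda>x. (1 / s n) *\<^sub>R (\<eta> (x + s n *\<^sub>R e) *\<^sub>R u (x + s n *\<^sub>R e) - \<eta> x *\<^sub>R u x)) \<phi>" for n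
      proof -
        have "(1 / s n) *\<^sub>R (\<eta> (x + s n *\<^sub>R e) *\<^sub>R u (x + s n *\<^sub>R e) - \<eta> x *\<^sub>R u x)
           = \<eta> x *\<^sub>R q n x + s n *\<^sub>R r n x *\<^sub>R q n x + r n x *\<^sub>R u x" for x
        proof -
          have sr: "s n *\<^sub>R r n x *\<^sub>R q n x = (\<eta> (x + s n *\<^sub>R e) - \<eta> x) *\<^sub>R q n x"
            using s(1)[of n] by (simp add: r_def)
          have ru: "r n x *\<^sub>R u x = (1 / s n) *\<^sub>R (\<eta> (x + s n *\<^sub>R e) - \<eta> x) *\<^sub>R u x"
            by (simp add: r_def)
          show ?thesis unfolding sr ru unfolding q_def by (simp add: algebra_simps)
        qed
        then have "ip (\<lambda>x. (1 / s n) *\<^sub>R (\<eta> (x + s n *\<^sub>R e) *\<^sub>R u (x + s n *\<^sub>R e) - \<eta> x *\<^sub>R u x)) \<phi>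
           = ip (\<lambda>x. \<eta> x *\<^sub>R q n x + s n *\<^sub>R r n x *\<^sub>R q n x + r n x *\<^sub>R u x) \<phi>" by simp
        also have "\<dots> = ip (\<lambda>x. \<eta> x *\<^sub>R q n x) \<phi> + s n * ip (\<lambda>x. r n x *\<^sub>R q n x) \<phi> + ip (\<lambda>x. r n x *\<^sub>R u x) \<phi>"
          using sq1[OF q] sqr[OF q] sqr[OF sq(1)] \<phi> by (simp add: ip_add_left del: scaleR_scaleR)
        finally show ?thesis by (simp add: ip_def)
      qed
      moreover have "ip (\<lambda>x. G x $ i) (\<lambda>x. \<eta> x *\<^sub>R \<phi> x) + 0 + ip (\<lambda>x. \<eta>' i x *\<^sub>R u x) \<phi>
         = ip (\<lambda>x. \<eta> x *\<^sub>R G x $ i + \<eta>' i x *\<^sub>R u x) \<phi>"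
        using sq1[OF sq_vec_nth[OF sq(2)]] sq2 \<phi> by (simp add: ip_add_left) (simp add: ip_def)
      ultimately show "(\<lambda>n. ip (\<lambda>x. (1 / s n) *\<^sub>R (\<eta> (x + s n *\<^sub>R e) *\<^sub>R u (x + s n *\<^sub>R e) - \<eta> x *\<^sub>R u x)) \<phi>)
         \<longlonglongrightarrow> ip (\<lambda>x. \<eta> x *\<^sub>R G x $ i + \<eta>' i x *\<^sub>R u x) \<phi>" by simp
    qed
    then show "\<exists>s. (\<forall>n::nat. s n \<noteq> 0) \<and> s \<longlonglongrightarrow> 0 \<and>
       wconv (\<lambda>n x. (1 / s n) *\<^sub>R (\<eta> (x + s n *\<^sub>R axis i 1) *\<^sub>R u (x + s n *\<^sub>R axis i 1) - \<eta> x *\<^sub>R u x))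
         (\<lambda>x. (\<chi> i. \<eta> x *\<^sub>R G x $ i + \<eta>' i x *\<^sub>R u x) $ i)"
      using s by (intro exI[of _ s]) (auto simp: e_def)
  qed
qed

section \<open>The Hardy-Littlewood-Sobolev bound\<close>

definition near :: "real \<Rightarrow> 'a::euclidean_space \<Rightarrow> 'a \<Rightarrow> ennreal" where
  "near r x y = (if dist x y < r then 1 else 0)"

lemma near_commute: "near r x y = near r y x"
  by (simp add: near_def dist_commute)

lemma measurable_near [measurable]:
  assumes [measurable]: "f \<in> borel_measurable M" "g \<in> borel_measurable M"
  shows "(\<lambda>x. near r (f x) (g x :: 'a::euclidean_space)) \<in> borel_measurable M"
  unfolding near_def by measurable

definition vol :: "'a::euclidean_space itself \<Rightarrow> real \<Rightarrow> real" where
  "vol _ r = r ^ DIM('a) * measure lborel (ball (0::'a) 1)"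

lemma unit_ball_pos: "0 < measure lborel (ball (0::'a::euclidean_space) 1)"
  using content_ball_pos[of 1 "0::'a"] by simp

lemma vol_pos: "0 < r \<Longrightarrow> 0 < vol TYPE('a::euclidean_space) r"
  by (simp add: vol_def unit_ball_pos)

lemma nn_integral_near: "0 \<le> r \<Longrightarrow> (\<integral>\<^sup>+y. near r x y \<partial>lborel)
    = ennreal (vol TYPE('a) r)" for x :: "'a::euclidean_space"
proof -
  assume r: "0 \<le> r"
  have "(\<integral>\<^sup>+y. near r x y \<partial>lborel) = (\<integral>\<^sup>+y. indicator (ball x r) y \<partial>lborel)"
    by (intro nn_integral_cong) (auto simp: near_def indicator_def)
  also have "\<dots> = emeasure lborel (ball x r)" by simp
  also have "\<dots> = ennreal (measure lborel (ball x r))"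
    using emeasure_lborel_ball_finite[of x r] by (intro emeasure_eq_ennreal_measure) auto
  also have "measure lborel (ball x r) = vol TYPE('a) r"
    using content_ball_conv_unit_ball[OF r, of x] by (simp add: vol_def)
  finally show ?thesis .
qed

lemma nn_integral_near': "0 \<le> r \<Longrightarrow> (\<integral>\<^sup>+y. near r y x \<partial>lborel)
    = ennreal (vol TYPE('a) r)" for x :: "'a::euclidean_space"
  by (simp add: near_commute[of r _ x] nn_integral_near)

section \<open>Masses in balls and their decay with the radius\<close>

definition local_mass :: "(real^'n::finite \<Rightarrow> 'b::euclidean_space) \<Rightarrow> real \<Rightarrow> real^'n \<Rightarrow> ennreal" where
  "local_mass u r z = (\<integral>\<^sup>+x. near r z x * ennreal ((norm (u x))\<^sup>2) \<partial>lborel)"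

lemma measurable_local_mass [measurable]:
  assumes [measurable]: "u \<in> borel_measurable borel"
  shows "local_mass u r \<in> borel_measurable borel"
  unfolding local_mass_def by measurable

lemma local_mass_le: "sq u \<Longrightarrow> local_mass u r z \<le> ennreal (ip u u)"
  unfolding local_mass_def nn_integral_norm_square[symmetric]
  by (intro nn_integral_mono) (auto simp: near_def)

lemma local_mass_mono: "local_mass u r x \<le> local_mass u s z" if "dist x z + r \<le> s"
proof -
  have "near r x y \<le> near s z y" for y
    using dist_triangle[of z y x] that by (auto simp: near_def dist_commute)
  then show ?thesis unfolding local_mass_def by (intro nn_integral_mono mult_right_mono) auto
qed

lemma local_mass_translate:
  assumes [measurable]: "u \<in> borel_measurable borel"
  shows "(\<integral>\<^sup>+h. near r 0 h * ennreal ((norm (u (x + h)))\<^sup>2) \<partial>lborel) = local_mass u r x"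
proof -
  have "local_mass u r x = ennreal (\<bar>1\<bar> ^ DIM(real^'a)) *
      (\<integral>\<^sup>+h. near r x (x + 1 *\<^sub>R h) * ennreal ((norm (u (x + 1 *\<^sub>R h)))\<^sup>2) \<partial>lborel)"
    unfolding local_mass_def by (rule lborel_nn_integral_affine) auto
  then show ?thesis by (simp add: near_def dist_norm)
qed

lemma nn_integral_local_mass:
  assumes u: "sq u" and r: "0 \<le> r"
  shows "(\<integral>\<^sup>+z. local_mass (u :: real^'n::finite \<Rightarrow> 'b::euclidean_space) r z \<partial>lborel)
      = ennreal (vol TYPE(real^'n) r) * ennreal (ip u u)"
proof -
  have [measurable]: "u \<in> borel_measurable borel" using u by measurable
  have "(\<integral>\<^sup>+z. local_mass u r z \<partial>lborel) = (\<integral>\<^sup>+x. \<integral>\<^sup>+z. near r z x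
      * ennreal ((norm (u x))\<^sup>2) \<partial>lborel \<partial>lborel)"
    unfolding local_mass_def by (rule lborel_pair.Fubini') measurable
  also have "\<dots> = (\<integral>\<^sup>+x. ennreal (vol TYPE(real^'n) r) * ennreal ((norm (u x))\<^sup>2) \<partial>lborel)"
    by (intro nn_integral_cong) (simp add: nn_integral_multc nn_integral_near' r)
  also have "\<dots> = ennreal (vol TYPE(real^'n) r) * ennreal (ip u u)"
    by (simp add: nn_integral_cmult nn_integral_norm_square u)
  finally show ?thesis .
qed

text \<open>Up to the volume of a ball this dominates the double integral over pairs at distance
  below \<open>r\<close>. Being the squared L2 norm of a local average, it is accessible to a
  pointwise averaging estimate.\<close>

definition mass_energy :: "(real^'n::finite \<Rightarrow> 'b::euclidean_space) \<Rightarrow> real \<Rightarrow> ennreal" where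
  "mass_energy u r = (\<integral>\<^sup>+z. (local_mass u r z)\<^sup>2 \<partial>lborel)"

lemma mass_energy_le:
  assumes u: "sq (u :: real^'n::finite \<Rightarrow> 'b::euclidean_space)" and r: "0 < r"
  shows "mass_energy u r \<le> ennreal (vol TYPE(real^'n) r * (ip u u)\<^sup>2)"
proof -
  have [measurable]: "u \<in> borel_measurable borel" using u by measurable
  have "mass_energy u r \<le> (\<integral>\<^sup>+z. ennreal (ip u u) * local_mass u r z \<partial>lborel)"
    unfolding mass_energy_def power2_eq_square
    by (intro nn_integral_mono mult_right_mono local_mass_le u) auto
  also have "\<dots> = ennreal (ip u u) * (ennreal (vol TYPE(real^'n) r) * ennreal (ip u u))"
    using r by (simp add: nn_integral_cmult nn_integral_local_mass u)
  also have "\<dots> = ennreal (vol TYPE(real^'n) r * (ip u u)\<^sup>2)"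
    using vol_pos[OF r, where 'a="real^'n"] by (simp add: ennreal_mult' power2_eq_square mult_ac)
  finally show ?thesis .
qed

lemma sum_power2_le: "(a + b)\<^sup>2 \<le> 2 * a\<^sup>2 + 2 * (b::ennreal)\<^sup>2"
proof (cases a; cases b)
  fix x y :: real assume *: "0 \<le> x" "a = ennreal x" "0 \<le> y" "b = ennreal y"
  have "(x + y)\<^sup>2 \<le> 2 * x\<^sup>2 + 2 * y\<^sup>2"
    using zero_le_power2[of "x - y"] by (simp add: power2_eq_square algebra_simps)
  then show ?thesis using * by (simp add: ennreal_plus[symmetric] ennreal_power ennreal_mult'[symmetric]
        ennreal_numeral[symmetric] del: ennreal_plus ennreal_numeral)
qed (auto simp: ennreal_mult_eq_top_iff)

text \<open>Averaging |u(x)|^2 \<le> 2 |u(x+h)|^2 + 2 |u(x+h) - u(x)|^2 over |h| < L r spreads the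
  mass near \<open>z\<close> over the ball of radius (L+1) r. The local mass gains the ratio of the
  volumes of balls of radius \<open>r\<close> and \<open>L r\<close>, at the price of a gradient
  error. This plays the role of a Sobolev inequality.\<close>

lemma mass_energy_recursion:
  fixes u :: "real^'n::finite \<Rightarrow> 'b::euclidean_space"
  assumes u: "sq u" and A: "\<And>h. ip (\<lambda>x. u (x + h) - u x) (\<lambda>x. u (x + h) - u x) \<le> (norm h)\<^sup>2 * A"
    and r: "0 < r" and L: "0 < L"
  shows "(ennreal (vol TYPE(real^'n) (L * r)))\<^sup>2 * mass_energy u r
    \<le> 8 * (ennreal (vol TYPE(real^'n) r))\<^sup>2 * mass_energy u ((L + 1) * r)
      + 8 * ennreal (vol TYPE(real^'n) r * ((vol TYPE(real^'n) (L * r)) * ((L * r)\<^sup>2 * A))\<^sup>2)"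
proof -
  have [measurable]: "u \<in> borel_measurable borel" using u by measurable
  have A0: "0 \<le> A"
  proof -
    have "0 \<le> (norm (axis undefined 1 :: real^'n))\<^sup>2 * A" by (rule order_trans[OF ip_nonneg A])
    then show ?thesis by simp
  qed
  define V where "V = ennreal (vol TYPE(real^'n) (L * r))"
  define v where "v = ennreal (vol TYPE(real^'n) r)"
  define f where "f x = ennreal ((norm (u x))\<^sup>2)" for x
  define g where "g h x = ennreal ((norm (u (x + h) - u x))\<^sup>2)" for h x
  \<comment> \<open>The gradient error at \<open>z\<close>. Its supremum and its integral are both
    controlled by the translation bound; their product bounds the integral of its square.\<close>
  define G where "G z = (\<integral>\<^sup>+h. near (L * r) 0 h * (\<integral>\<^sup>+x. near r z x * g h x \<partial>lborel) \<partial>lborel)" for z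
  have [measurable]: "f \<in> borel_measurable borel" unfolding f_def by measurable
  have gm [measurable]: "(\<lambda>p. g (fst p) (snd p)) \<in> borel_measurable (lborel \<Otimes>\<^sub>M lborel)"
    unfolding g_def by measurable
  have [measurable]: "g h \<in> borel_measurable borel" for h
    unfolding g_def by measurable
  have [measurable]: "G \<in> borel_measurable borel" unfolding G_def g_def by measurable
  have Lr: "0 < L * r" using L r by simp
  have g_int: "(\<integral>\<^sup>+x. g h x \<partial>lborel) \<le> ennreal ((norm h)\<^sup>2 * A)" for h
    unfolding g_def using nn_integral_norm_square[of "\<lambda>x. u (x + h) - u x"] u A by (simp add: ennreal_leI)
  have fg: "f x \<le> 2 * f (x + h) + 2 * g h x" for x h
  proof -
    have "norm (u x) \<le> norm (u (x + h)) + norm (u (x + h) - u x)"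
      using norm_triangle_ineq4[of "u (x + h)" "u (x + h) - u x"] by simp
    then have "(norm (u x))\<^sup>2 \<le> (norm (u (x + h)) + norm (u (x + h) - u x))\<^sup>2"
      by (intro power_mono) auto
    also have "\<dots> \<le> 2 * (norm (u (x + h)))\<^sup>2 + 2 * (norm (u (x + h) - u x))\<^sup>2"
      using zero_le_power2[of "norm (u (x + h)) - norm (u (x + h) - u x)"]
      by (simp add: power2_eq_square algebra_simps)
    finally show ?thesis unfolding f_def g_def
      by (simp add: ennreal_plus[symmetric] ennreal_mult'[symmetric] ennreal_numeral[symmetric] ennreal_leI
          del: ennreal_plus ennreal_numeral)
  qed
  have main: "V * local_mass u r z \<le> 2 * (v * local_mass u ((L + 1) * r) z) + 2 * G z" for z
  proof -
    have "V * local_mass u r z = (\<integral>\<^sup>+h. near (L * r) (0::real^'n) h * local_mass u r z \<partial>lborel)"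
      using Lr by (simp add: nn_integral_multc nn_integral_near V_def)
    also have "\<dots> \<le> (\<integral>\<^sup>+h. near (L * r) 0 h * (2 * (\<integral>\<^sup>+x. near r z x * f (x + h) \<partial>lborel)
       + 2 * (\<integral>\<^sup>+x. near r z x * g h x \<partial>lborel)) \<partial>lborel)"
    proof (intro nn_integral_mono mult_left_mono)
      fix h
      have "local_mass u r z \<le> (\<integral>\<^sup>+x. near r z x * (2 * f (x + h) + 2 * g h x) \<partial>lborel)"
        unfolding local_mass_def f_def[symmetric] by (intro nn_integral_mono mult_left_mono fg) auto
      also have "\<dots> = (\<integral>\<^sup>+x. 2 * (near r z x * f (x + h)) + 2 * (near r z x * g h x) \<partial>lborel)"
        by (simp add: distrib_left mult.left_commute)
      also have "\<dots> = 2 * (\<integral>\<^sup>+x. near r z x * f (x + h) \<partial>lborel) + 2 * (\<integral>\<^sup>+x. near r z x * g h x \<partial>lborel)"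
        by (subst nn_integral_add) (auto simp: nn_integral_cmult)
      finally show "local_mass u r z \<le> 2 * (\<integral>\<^sup>+x. near r z x * f (x + h) \<partial>lborel)
          + 2 * (\<integral>\<^sup>+x. near r z x * g h x \<partial>lborel)" .
    qed simp
    also have "\<dots> = (\<integral>\<^sup>+h. 2 * (near (L * r) 0 h * (\<integral>\<^sup>+x. near r z x * f (x + h) \<partial>lborel))
       + 2 * (near (L * r) 0 h * (\<integral>\<^sup>+x. near r z x * g h x \<partial>lborel)) \<partial>lborel)"
      by (simp add: distrib_left mult.left_commute)
    also have "\<dots> = 2 * (\<integral>\<^sup>+h. near (L * r) 0 h * (\<integral>\<^sup>+x. near r z x * f (x + h) \<partial>lborel) \<partial>lborel) + 2 * G z"
      unfolding G_def g_def by (subst nn_integral_add) (auto simp: nn_integral_cmult)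
    also have "(\<integral>\<^sup>+h. near (L * r) 0 h * (\<integral>\<^sup>+x. near r z x * f (x + h) \<partial>lborel) \<partial>lborel)
       = (\<integral>\<^sup>+h. \<integral>\<^sup>+x. near (L * r) 0 h * (near r z x * f (x + h)) \<partial>lborel \<partial>lborel)"
      by (simp add: nn_integral_cmult)
    also have "\<dots> = (\<integral>\<^sup>+x. \<integral>\<^sup>+h. near (L * r) 0 h * (near r z x * f (x + h)) \<partial>lborel \<partial>lborel)"
      by (rule lborel_pair.Fubini') measurable
    also have "\<dots> = (\<integral>\<^sup>+x. near r z x * local_mass u (L * r) x \<partial>lborel)"
    proof (intro nn_integral_cong)
      fix x
      have "(\<integral>\<^sup>+h. near (L * r) 0 h * (near r z x * f (x + h)) \<partial>lborel)
         = (\<integral>\<^sup>+h. near r z x * (near (L * r) 0 h * f (x + h)) \<partial>lborel)"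
        by (simp add: mult.left_commute)
      also have "\<dots> = near r z x * (\<integral>\<^sup>+h. near (L * r) 0 h * f (x + h) \<partial>lborel)"
        by (simp add: nn_integral_cmult)
      also have "(\<integral>\<^sup>+h. near (L * r) 0 h * f (x + h) \<partial>lborel) = local_mass u (L * r) x"
        unfolding f_def by (rule local_mass_translate) measurable
      finally show "(\<integral>\<^sup>+h. near (L * r) 0 h * (near r z x * f (x + h)) \<partial>lborel)
          = near r z x * local_mass u (L * r) x" .
    qed
    also have "\<dots> \<le> (\<integral>\<^sup>+x. near r z x * local_mass u ((L + 1) * r) z \<partial>lborel)"
    proof (intro nn_integral_mono)
      fix x
      show "near r z x * local_mass u (L * r) x \<le> near r z x * local_mass u ((L + 1) * r) z"
      proof (cases "dist z x < r")
        case True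
        then have "local_mass u (L * r) x \<le> local_mass u ((L + 1) * r) z"
          by (intro local_mass_mono) (simp add: dist_commute algebra_simps)
        then show ?thesis by (intro mult_left_mono) auto
      qed (simp add: near_def)
    qed
    also have "\<dots> = v * local_mass u ((L + 1) * r) z"
      using r by (simp add: nn_integral_multc nn_integral_near v_def)
    finally show ?thesis by (simp add: add_right_mono mult_left_mono)
  qed
  define gA where "gA = ennreal ((L * r)\<^sup>2 * A)"
  have near_g: "near (L * r) 0 h * (\<integral>\<^sup>+x. g h x \<partial>lborel) \<le> near (L * r) 0 h * gA" for h
  proof (cases "norm h < L * r")
    case True
    have "(norm h)\<^sup>2 * A \<le> (L * r)\<^sup>2 * A" using True A0 by (intro mult_right_mono power_mono) auto
    then show ?thesis using g_int[of h] unfolding gA_def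
      by (intro mult_left_mono) (auto intro: order_trans ennreal_leI)
  qed (simp add: near_def)
  have G_sup: "G z \<le> V * gA" for z
  proof -
    have "G z \<le> (\<integral>\<^sup>+h. near (L * r) 0 h * (\<integral>\<^sup>+x. g h x \<partial>lborel) \<partial>lborel)"
      unfolding G_def by (intro nn_integral_mono mult_left_mono) (auto simp: near_def)
    also have "\<dots> \<le> (\<integral>\<^sup>+h. near (L * r) (0::real^'n) h * gA \<partial>lborel)"
      by (rule nn_integral_mono) (rule near_g)
    also have "\<dots> = V * gA" using Lr by (simp add: nn_integral_multc nn_integral_near V_def)
    finally show ?thesis .
  qed
  have G_int: "(\<integral>\<^sup>+z. G z \<partial>lborel) \<le> v * (V * gA)"
  proof -
    have inner: "(\<integral>\<^sup>+z. \<integral>\<^sup>+x. near r z x * g h x \<partial>lborel \<partial>lborel) = v * (\<integral>\<^sup>+x. g h x \<partial>lborel)" for h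
    proof -
      have "(\<integral>\<^sup>+z. \<integral>\<^sup>+x. near r z x * g h x \<partial>lborel \<partial>lborel)
          = (\<integral>\<^sup>+x. \<integral>\<^sup>+z. near r z x * g h x \<partial>lborel \<partial>lborel)"
        by (rule lborel_pair.Fubini') measurable
      also have "\<dots> = (\<integral>\<^sup>+x. v * g h x \<partial>lborel)"
        using r by (intro nn_integral_cong) (simp add: nn_integral_multc nn_integral_near' v_def)
      finally show ?thesis by (simp add: nn_integral_cmult)
    qed
    have "(\<integral>\<^sup>+z. G z \<partial>lborel) = (\<integral>\<^sup>+h. \<integral>\<^sup>+z. near (L * r) 0 h
        * (\<integral>\<^sup>+x. near r z x * g h x \<partial>lborel) \<partial>lborel \<partial>lborel)"
      unfolding G_def g_def by (rule lborel_pair.Fubini') measurable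
    also have "\<dots> = (\<integral>\<^sup>+h. near (L * r) 0 h * (v * (\<integral>\<^sup>+x. g h x \<partial>lborel)) \<partial>lborel)"
      by (intro nn_integral_cong) (simp add: nn_integral_cmult inner)
    also have "\<dots> = (\<integral>\<^sup>+h. v * (near (L * r) 0 h * (\<integral>\<^sup>+x. g h x \<partial>lborel)) \<partial>lborel)"
      by (simp add: mult.left_commute)
    also have "\<dots> \<le> (\<integral>\<^sup>+h. v * (near (L * r) (0::real^'n) h * gA) \<partial>lborel)"
      by (intro nn_integral_mono mult_left_mono near_g) auto
    also have "\<dots> = v * (V * gA)"
      using Lr by (simp add: nn_integral_cmult nn_integral_multc nn_integral_near V_def)
    finally show ?thesis .
  qed
  have G2: "(\<integral>\<^sup>+z. (G z)\<^sup>2 \<partial>lborel) \<le> v * (V * gA)\<^sup>2"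
  proof -
    have "(\<integral>\<^sup>+z. (G z)\<^sup>2 \<partial>lborel) \<le> (\<integral>\<^sup>+z. (V * gA) * G z \<partial>lborel)"
      unfolding power2_eq_square by (intro nn_integral_mono mult_right_mono G_sup) auto
    also have "\<dots> = (V * gA) * (\<integral>\<^sup>+z. G z \<partial>lborel)" by (simp add: nn_integral_cmult)
    also have "\<dots> \<le> (V * gA) * (v * (V * gA))" by (intro mult_left_mono G_int) auto
    finally show ?thesis by (simp add: power2_eq_square mult_ac)
  qed
  have "V\<^sup>2 * mass_energy u r = (\<integral>\<^sup>+z. (V * local_mass u r z)\<^sup>2 \<partial>lborel)"
    by (simp add: mass_energy_def nn_integral_cmult power_mult_distrib)
  also have "\<dots> \<le> (\<integral>\<^sup>+z. 8 * v\<^sup>2 * (local_mass u ((L + 1) * r) z)\<^sup>2 + 8 * (G z)\<^sup>2 \<partial>lborel)"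
  proof (intro nn_integral_mono)
    fix z
    have "(V * local_mass u r z)\<^sup>2 \<le> (2 * (v * local_mass u ((L + 1) * r) z) + 2 * G z)\<^sup>2"
      by (intro power_mono main) auto
    also have "\<dots> \<le> 2 * (2 * (v * local_mass u ((L + 1) * r) z))\<^sup>2 + 2 * (2 * G z)\<^sup>2"
      by (rule sum_power2_le)
    also have "\<dots> = 8 * v\<^sup>2 * (local_mass u ((L + 1) * r) z)\<^sup>2 + 8 * (G z)\<^sup>2"
    proof -
      have "(2::ennreal) * (2 * a)\<^sup>2 = 8 * a\<^sup>2" for a
      proof -
        have "(2::ennreal) * (2 * a)\<^sup>2 = (2 * 2 * 2) * a\<^sup>2" by (simp add: power2_eq_square mult_ac)
        then show ?thesis by simp
      qed
      then show ?thesis by (simp add: power_mult_distrib mult.assoc)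
    qed
    finally show "(V * local_mass u r z)\<^sup>2 \<le> 8 * v\<^sup>2 * (local_mass u ((L + 1) * r) z)\<^sup>2 + 8 * (G z)\<^sup>2" .
  qed
  also have "\<dots> = 8 * v\<^sup>2 * mass_energy u ((L + 1) * r) + 8 * (\<integral>\<^sup>+z. (G z)\<^sup>2 \<partial>lborel)"
    by (subst nn_integral_add) (auto simp: nn_integral_cmult mass_energy_def)
  also have "\<dots> \<le> 8 * v\<^sup>2 * mass_energy u ((L + 1) * r) + 8 * (v * (V * gA)\<^sup>2)"
    by (intro add_left_mono mult_left_mono G2) auto
  also have "v * (V * gA)\<^sup>2 = ennreal (vol TYPE(real^'n) r
      * ((vol TYPE(real^'n) (L * r)) * ((L * r)\<^sup>2 * A))\<^sup>2)"
    unfolding v_def V_def gA_def using vol_pos[OF r, where 'a="real^'n"] vol_pos[OF Lr, where 'a="real^'n"] A0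
    by (simp add: ennreal_power ennreal_mult'[symmetric])
  finally show ?thesis unfolding V_def v_def .
qed

text \<open>Division by the squared large volume exposes two rates: a contraction of order L^(-2N)
  per step, and an error of order r^(N+4), made of one volume r^N and the square of the translation
  bound at distance L r.\<close>

lemma mass_energy_recursion_real:
  fixes u :: "real^'n::finite \<Rightarrow> 'b::euclidean_space"
  assumes u: "sq u" and A: "\<And>h. ip (\<lambda>x. u (x + h) - u x) (\<lambda>x. u (x + h) - u x) \<le> (norm h)\<^sup>2 * A"
    and r: "0 < r" and L: "0 < L"
  shows "enn2real (mass_energy u r) \<le> 8 / L ^ (2 * CARD('n)) * enn2real (mass_energy u ((L + 1) * r))
     + 8 * measure lborel (ball (0::real^'n) 1) * L ^ 4 * A\<^sup>2 * r ^ (CARD('n) + 4)"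
proof -
  have fin: "mass_energy u s = ennreal (enn2real (mass_energy u s))" if "0 < s" for s
    using mass_energy_le[OF u that] by (metis ennreal_enn2real ennreal_less_top le_less_trans)
  define \<omega> where "\<omega> = measure lborel (ball (0::real^'n) 1)"
  have \<omega>: "0 < \<omega>" unfolding \<omega>_def by (rule unit_ball_pos)
  define e1 where "e1 = enn2real (mass_energy u r)"
  define e2 where "e2 = enn2real (mass_energy u ((L + 1) * r))"
  have [simp]: "0 \<le> e1" "0 \<le> e2" by (auto simp: e1_def e2_def)
  define V where "V = vol TYPE(real^'n) (L * r)"
  define v where "v = vol TYPE(real^'n) r"
  have V: "V = L ^ CARD('n) * v" by (simp add: V_def v_def vol_def power_mult_distrib)
  have v: "0 < v" "v = r ^ CARD('n) * \<omega>" using vol_pos[OF r, where 'a="real^'n"]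
      by (auto simp: v_def vol_def \<omega>_def)
  have Vpos: "0 < V" using V v L by simp
  have "ennreal (V\<^sup>2 * e1) \<le> ennreal (8 * v\<^sup>2 * e2 + 8 * (v * (V * ((L * r)\<^sup>2 * A))\<^sup>2))"
    using mass_energy_recursion[OF u A r L] fin[OF r] fin[of "(L + 1) * r"] r L Vpos v(1)
    unfolding e1_def[symmetric] e2_def[symmetric] V_def[symmetric] v_def[symmetric]
    by (simp add: ennreal_power ennreal_mult'[symmetric] ennreal_plus[symmetric] ennreal_numeral[symmetric]
         del: ennreal_plus ennreal_numeral)
  then have "V\<^sup>2 * e1 \<le> 8 * v\<^sup>2 * e2 + 8 * (v * (V * ((L * r)\<^sup>2 * A))\<^sup>2)"
    using v(1) by (subst (asm) ennreal_le_iff) auto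
  also have "\<dots> = V\<^sup>2 * (8 / L ^ (2 * CARD('n)) * e2 + 8 * \<omega> * L ^ 4 * A\<^sup>2 * r ^ (CARD('n) + 4))"
  proof -
    have "V\<^sup>2 * (8 / L ^ (2 * CARD('n)) * e2) = 8 * v\<^sup>2 * e2"
      using L by (simp add: V power_mult_distrib power_mult[symmetric] mult.commute[of 2])
    moreover have "v * (V * ((L * r)\<^sup>2 * A))\<^sup>2 = V\<^sup>2 * (\<omega> * L ^ 4 * A\<^sup>2 * r ^ (CARD('n) + 4))"
      unfolding v(2) by (simp add: power_mult_distrib power_add power2_eq_square power4_eq_xxxx)
    ultimately show ?thesis by (simp add: distrib_left)
  qed
  finally have "e1 \<le> 8 / L ^ (2 * CARD('n)) * e2 + 8 * \<omega> * L ^ 4 * A\<^sup>2 * r ^ (CARD('n) + 4)"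
    using Vpos by (simp add: mult_le_cancel_left)
  then show ?thesis by (simp add: e1_def e2_def \<omega>_def)
qed

text \<open>Summing the recursion bounds a partial sum by half of itself plus data; finiteness of
  partial sums makes the absorption legitimate.\<close>

lemma sum_bound_of_recursion:
  fixes p :: "nat \<Rightarrow> real"
  assumes p: "\<And>k. 0 \<le> p k" and rec: "\<And>k. p (Suc k) \<le> p k / 2 + b * q ^ Suc k" and q: "0 \<le> q" "q < 1"
      and b: "0 \<le> b"
  shows "(\<Sum>k<n. p k) \<le> 2 * (p 0 + b / (1 - q))"
proof -
  have geo: "(\<Sum>k<n. q ^ k) \<le> 1 / (1 - q)" for n
  proof -
    have "(\<Sum>k<n. q ^ k) = (1 - q ^ n) / (1 - q)" using q by (simp add: sum_gp_strict)
    also have "\<dots> \<le> 1 / (1 - q)" using q by (intro divide_right_mono) auto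
    finally show ?thesis .
  qed
  have "(\<Sum>k<Suc n. p k) \<le> p 0 + (\<Sum>k<n. p k) / 2 + b / (1 - q)" for n
  proof -
    have "(\<Sum>k<Suc n. p k) = p 0 + (\<Sum>k<n. p (Suc k))" by (rule sum.lessThan_Suc_shift)
    also have "\<dots> \<le> p 0 + (\<Sum>k<n. p k / 2 + b * q ^ Suc k)" by (intro add_left_mono sum_mono rec)
    also have "\<dots> = p 0 + (\<Sum>k<n. p k) / 2 + b * (q * (\<Sum>k<n. q ^ k))"
      by (simp add: sum.distrib sum_divide_distrib sum_distrib_left)
    also have "q * (\<Sum>k<n. q ^ k) \<le> 1 * (1 / (1 - q))"
      using q geo[of n] by (intro mult_mono) (auto intro: sum_nonneg)
    finally show ?thesis using b by (simp add: mult_left_mono)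
  qed
  from this[of n] p[of n] show ?thesis by simp
qed

definition riesz_energy ::
  "real \<Rightarrow> (real^'n::finite \<Rightarrow> 'b::euclidean_space) \<Rightarrow> (real^'n \<Rightarrow> 'c::euclidean_space) \<Rightarrow> ennreal" where
  "riesz_energy \<gamma> u w = (\<integral>\<^sup>+x. \<integral>\<^sup>+y. ennreal ((norm (u x))\<^sup>2 * (norm (w y))\<^sup>2
      / norm (x - y) powr \<gamma>) \<partial>lborel \<partial>lborel)"

text \<open>Two points at distance below \<open>r\<close> both lie within \<open>r\<close> of every
  point of the ball of radius r/2 about their midpoint.\<close>

lemma near_pairs_le_mass_energy:
  fixes u :: "real^'n::finite \<Rightarrow> 'b::euclidean_space"
  assumes u: "sq u" and r: "0 < r"
  shows "ennreal (vol TYPE(real^'n) (r / 2)) * (\<integral>\<^sup>+x. \<integral>\<^sup>+y. near r x y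
      * (ennreal ((norm (u x))\<^sup>2) * ennreal ((norm (u y))\<^sup>2)) \<partial>lborel \<partial>lborel)
     \<le> mass_energy u r"
proof -
  have [measurable]: "u \<in> borel_measurable borel" using u by measurable
  define f where "f x = ennreal ((norm (u x))\<^sup>2)" for x
  have [measurable]: "f \<in> borel_measurable borel" unfolding f_def by measurable
  have geom: "ennreal (vol TYPE(real^'n) (r / 2)) * near r x y
      \<le> (\<integral>\<^sup>+z. near r z x * near r z y \<partial>lborel)" for x y :: "real^'n"
  proof (cases "dist x y < r")
    case True
    have "near (r / 2) (midpoint x y) z \<le> near r z x * near r z y" for z
      using dist_triangle[of z x "midpoint x y"] dist_triangle[of z y "midpoint x y"] dist_midpoint[of x y]
          True
      by (auto simp: near_def dist_commute)
    then have "(\<integral>\<^sup>+z. near (r / 2) (midpoint x y) z \<partial>lborel) \<le> (\<integral>\<^sup>+z. near r z x * near r z y \<partial>lborel)"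
      by (intro nn_integral_mono)
    moreover have "near r x y = 1" using True by (simp add: near_def)
    ultimately show ?thesis using r by (simp add: nn_integral_near)
  qed (simp add: near_def)
  have "ennreal (vol TYPE(real^'n) (r / 2)) * (\<integral>\<^sup>+x. \<integral>\<^sup>+y. near r x y * (f x * f y) \<partial>lborel \<partial>lborel)
     = (\<integral>\<^sup>+x. \<integral>\<^sup>+y. (ennreal (vol TYPE(real^'n) (r / 2)) * near r x y) * (f x * f y) \<partial>lborel \<partial>lborel)"
    by (simp add: nn_integral_cmult mult.assoc)
  also have "\<dots> \<le> (\<integral>\<^sup>+x. \<integral>\<^sup>+y. (\<integral>\<^sup>+z. near r z x * near r z y \<partial>lborel) * (f x * f y) \<partial>lborel \<partial>lborel)"
    by (intro nn_integral_mono mult_right_mono geom) auto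
  also have "\<dots> = (\<integral>\<^sup>+x. \<integral>\<^sup>+y. \<integral>\<^sup>+z. (near r z x * f x) * (near r z y * f y) \<partial>lborel \<partial>lborel \<partial>lborel)"
  proof (intro nn_integral_cong)
    fix x y
    have "(\<integral>\<^sup>+z. near r z x * near r z y \<partial>lborel) * (f x * f y)
        = (\<integral>\<^sup>+z. (near r z x * near r z y) * (f x * f y) \<partial>lborel)"
      by (rule nn_integral_multc[symmetric]) measurable
    then show "(\<integral>\<^sup>+z. near r z x * near r z y \<partial>lborel) * (f x * f y)
       = (\<integral>\<^sup>+z. (near r z x * f x) * (near r z y * f y) \<partial>lborel)" by (simp add: mult_ac)
  qed
  also have "\<dots> = (\<integral>\<^sup>+x. \<integral>\<^sup>+z. \<integral>\<^sup>+y. (near r z x * f x) * (near r z y * f y) \<partial>lborel \<partial>lborel \<partial>lborel)"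
    by (intro nn_integral_cong lborel_pair.Fubini') measurable
  also have "\<dots> = (\<integral>\<^sup>+x. \<integral>\<^sup>+z. (near r z x * f x) * local_mass u r z \<partial>lborel \<partial>lborel)"
    by (simp add: nn_integral_cmult local_mass_def f_def)
  also have "\<dots> = (\<integral>\<^sup>+z. \<integral>\<^sup>+x. (near r z x * f x) * local_mass u r z \<partial>lborel \<partial>lborel)"
    by (rule lborel_pair.Fubini') measurable
  also have "\<dots> = mass_energy u r"
    by (simp add: nn_integral_multc mass_energy_def power2_eq_square local_mass_def f_def)
  finally show ?thesis by (simp add: f_def)
qed

text \<open>If l^-(j+1) \<le> |x - y| < l^-j, the summand with index j already dominates. Distances
  from 1 on are covered by the leading 1, and on the diagonal the kernel has the default value
  0.\<close>

lemma riesz_kernel_le_dyadic: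
  fixes x y :: "'a::euclidean_space"
  assumes l: "1 < l" and \<gamma>: "0 < \<gamma>"
  shows "ennreal (1 / norm (x - y) powr \<gamma>) \<le> 1
      + (\<Sum>k. ennreal (l powr (\<gamma> * real (Suc k))) * near ((1 / l) ^ k) x y)"
proof (cases "x = y")
  case False
  define d where "d = norm (x - y)"
  have d: "0 < d" using False by (simp add: d_def)
  show ?thesis
  proof (cases "1 \<le> d")
    case True
    then have "1 / d powr \<gamma> \<le> 1" using \<gamma> ge_one_powr_ge_zero[of d \<gamma>] by simp
    then have "ennreal (1 / d powr \<gamma>) \<le> 1" by (simp add: ennreal_le_1)
    then show ?thesis unfolding d_def[symmetric] by (rule order_trans) simp
  next
    case False
    obtain m :: nat where m: "(1 / l) ^ m \<le> d"
      using real_arch_pow_inv[of d "1 / l"] d l by (auto intro: less_imp_le)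
    \<comment> \<open>The least exponent is positive because \<open>d < 1\<close>; its predecessor
      \<open>j\<close> brackets \<open>d\<close> between consecutive powers of 1/l.\<close>
    define k where "k = (LEAST m. (1 / l) ^ m \<le> d)"
    have k: "(1 / l) ^ k \<le> d" unfolding k_def by (rule LeastI[of _ m]) (rule m)
    have "k \<noteq> 0" using k False by (cases k) auto
    then obtain j where j: "k = Suc j" by (cases k) auto
    have "\<not> (1 / l) ^ j \<le> d" using not_less_Least[of j "\<lambda>m. (1 / l) ^ m \<le> d"] j by (simp add: k_def)
    then have near: "near ((1 / l) ^ j) x y = 1" by (simp add: near_def d_def dist_norm)
    have "1 / d powr \<gamma> \<le> 1 / ((1 / l) ^ Suc j) powr \<gamma>"
      using k j l d \<gamma> by (intro divide_left_mono powr_mono2 mult_pos_pos) auto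
    also have "(1 / l) ^ Suc j = l powr (- real (Suc j))"
      using l by (simp add: powr_minus powr_realpow power_one_over inverse_eq_divide del: of_nat_Suc
          power_Suc)
    also have "1 / (l powr (- real (Suc j))) powr \<gamma> = l powr (\<gamma> * real (Suc j))"
      by (simp add: powr_powr powr_minus_divide[symmetric] mult.commute del: of_nat_Suc)
    finally have "ennreal (1 / d powr \<gamma>) \<le> ennreal (l powr (\<gamma> * real (Suc j))) * near ((1 / l) ^ j) x y"
      unfolding near by (simp add: ennreal_leI)
    also have "\<dots> \<le> (\<Sum>k. ennreal (l powr (\<gamma> * real (Suc k))) * near ((1 / l) ^ k) x y)"
      using sum_le_suminf[OF summableI, of "{j}" "\<lambda>k. ennreal (l powr (\<gamma> * real (Suc k)))
          * near ((1 / l) ^ k) x y"]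
      by simp
    finally show ?thesis unfolding d_def[symmetric] by (rule order_trans) simp
  qed
qed simp

text \<open>The kernel is decomposed over the radii l^-k, and the weighted mass energies at these
  radii satisfy a contracting recursion with summable errors. Only a translation bound is assumed of
  \<open>u\<close>, so the estimate can be applied to pair-valued functions without constructing
  their gradient.\<close>

theorem Hardy_Littlewood_Sobolev:
  assumes \<gamma>: "0 < \<gamma>" "\<gamma> < real CARD('n::finite)" "\<gamma> < 4"
  shows "\<exists>K>0. \<forall>(u :: real^'n \<Rightarrow> 'b::euclidean_space) A. sq u \<longrightarrow>
     (\<forall>h. ip (\<lambda>x. u (x + h) - u x) (\<lambda>x. u (x + h) - u x) \<le> (norm h)\<^sup>2 * A) \<longrightarrow>
     riesz_energy \<gamma> u u \<le> ennreal (K * (A + ip u u)\<^sup>2)"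
proof -
  define N where "N = real CARD('n)"
  define \<omega> where "\<omega> = measure lborel (ball (0::real^'n) 1)"
  have \<omega>: "0 < \<omega>" unfolding \<omega>_def by (rule unit_ball_pos)
  \<comment> \<open>Chosen so that the contraction 8 / L^(2N), multiplied by the weight
    l^(N+\<gamma>) \<le> (2L)^(N+\<gamma>) gained from one scale to the next, is at most 1/2. The
    exponent 1/(N - \<gamma>) shows the need for \<gamma> < N.\<close>
  define L where "L = (16 * 2 powr (N + \<gamma>)) powr (1 / (N - \<gamma>))"
  have NG: "0 < N - \<gamma>" using \<gamma> by (simp add: N_def)
  have "1 \<le> 2 powr (N + \<gamma>)" using \<gamma> by (intro ge_one_powr_ge_zero) (auto simp: N_def)
  then have base: "1 \<le> 16 * 2 powr (N + \<gamma>)" by simp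
  have L: "1 \<le> L" unfolding L_def using NG base by (intro ge_one_powr_ge_zero) auto
  have Lpow: "L powr (N - \<gamma>) = 16 * 2 powr (N + \<gamma>)"
    unfolding L_def using NG base by (simp add: powr_powr)
  define l where "l = L + 1"
  have l: "1 < l" "l \<le> 2 * L" using L by (auto simp: l_def)
  define \<theta> where "\<theta> = 8 / L ^ (2 * CARD('n))"
  have \<theta>: "\<theta> * l powr (N + \<gamma>) \<le> 1 / 2"
  proof -
    have "l powr (N + \<gamma>) \<le> (2 * L) powr (N + \<gamma>)" using l \<gamma> by (intro powr_mono2) (auto simp: N_def)
    also have "\<dots> = 2 powr (N + \<gamma>) * L powr (N + \<gamma>)" using L by (simp add: powr_mult)
    finally have "\<theta> * l powr (N + \<gamma>) \<le> \<theta> * (2 powr (N + \<gamma>) * L powr (N + \<gamma>))"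
      using L by (intro mult_left_mono) (auto simp: \<theta>_def)
    also have "L ^ (2 * CARD('n)) = L powr (N - \<gamma>) * L powr (N + \<gamma>)"
      using L by (simp add: powr_add[symmetric] N_def powr_realpow[symmetric])
    then have "\<theta> * (2 powr (N + \<gamma>) * L powr (N + \<gamma>)) = 1 / 2"
      using L by (simp add: \<theta>_def Lpow)
    finally show ?thesis .
  qed
  \<comment> \<open>Ratio of consecutive error terms: the weight grows by l^(N+\<gamma>) per scale
    and the error of the recursion shrinks by l^(N+4).\<close>
  define q where "q = l powr (\<gamma> - 4)"
  have q: "0 \<le> q" "q < 1" using l \<gamma> by (auto simp: q_def powr_less_one)
  define c where "c = l powr \<gamma> * 2 ^ CARD('n) / \<omega>"
  have c: "0 < c" using \<omega> l by (simp add: c_def)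
  define K where "K = 1 + c * (2 * \<omega>) + c * (2 * (8 * \<omega> * L ^ 4 / (1 - q)))"
  have Kpos: "0 < K" unfolding K_def using c \<omega> q L by (intro add_pos_nonneg add_pos_pos) auto
  have "riesz_energy \<gamma> u u \<le> ennreal (K * (A + ip u u)\<^sup>2)"
    if u: "sq u" and A: "\<And>h. ip (\<lambda>x. u (x + h) - u x) (\<lambda>x. u (x + h) - u x) \<le> (norm h)\<^sup>2 * A"
    for u :: "real^'n \<Rightarrow> 'b" and A
  proof -
    have [measurable]: "u \<in> borel_measurable borel" using u by measurable
    define M where "M = ip u u"
    have M0: "0 \<le> M" by (simp add: M_def)
    have A0: "0 \<le> A"
    proof -
      have "0 \<le> (norm (axis undefined 1 :: real^'n))\<^sup>2 * A" by (rule order_trans[OF ip_nonneg A])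
      then show ?thesis by simp
    qed
    define f where "f x = ennreal ((norm (u x))\<^sup>2)" for x
    have [measurable]: "f \<in> borel_measurable borel" unfolding f_def by measurable
    define r where "r k = (1 / l) ^ k" for k :: nat
    have r: "0 < r k" for k using l by (simp add: r_def)
    define en where "en k = enn2real (mass_energy u (r k))" for k
    have en: "mass_energy u (r k) = ennreal (en k)" "0 \<le> en k" for k
      using mass_energy_le[OF u r] unfolding en_def
      by (metis ennreal_enn2real ennreal_less_top le_less_trans, simp)
    \<comment> \<open>The kernel contributes l^(\<gamma> k), and passing from mass energies to close
      pairs divides by the volume of a ball of radius l^-k / 2, which contributes l^(N k).\<close>
    define p where "p k = l powr ((N + \<gamma>) * real k) * en k" for k
    have p0: "0 \<le> p k" for k using en by (simp add: p_def)
    have p_rec: "p (Suc k) \<le> p k / 2 + (8 * \<omega> * L ^ 4 * A\<^sup>2) * q ^ Suc k" for k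
    proof -
      have "(L + 1) * r (Suc k) = r k" using l by (simp add: r_def l_def[symmetric])
      then have rec: "en (Suc k) \<le> \<theta> * en k + 8 * \<omega> * L ^ 4 * A\<^sup>2 * r (Suc k) ^ (CARD('n) + 4)"
        using mass_energy_recursion_real[OF u A r[of "Suc k"], of L] L by (simp add: en_def \<theta>_def \<omega>_def)
      have split: "l powr ((N + \<gamma>) * real (Suc k)) = l powr (N + \<gamma>) * l powr ((N + \<gamma>) * real k)"
        by (simp add: powr_add[symmetric] algebra_simps)
      have rp: "l powr ((N + \<gamma>) * real (Suc k)) * r (Suc k) ^ (CARD('n) + 4) = q ^ Suc k"
      proof -
        have "r (Suc k) = l powr (- real (Suc k))"
          using l by (simp add: r_def powr_minus powr_realpow power_one_over inverse_eq_divide del: of_nat_Suc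
              power_Suc)
        then have "r (Suc k) ^ (CARD('n) + 4) = l powr (- real (Suc k) * (N + 4))"
          using l by (simp add: powr_realpow[symmetric] powr_powr N_def del: of_nat_Suc)
        moreover have "q ^ Suc k = l powr ((\<gamma> - 4) * real (Suc k))"
          using l by (simp add: q_def powr_realpow[symmetric] powr_powr del: of_nat_Suc power_Suc)
        ultimately show ?thesis by (simp add: powr_add[symmetric] algebra_simps del: power_Suc)
      qed
      have "p (Suc k) \<le> l powr ((N + \<gamma>) * real (Suc k))
          * (\<theta> * en k + 8 * \<omega> * L ^ 4 * A\<^sup>2 * r (Suc k) ^ (CARD('n) + 4))"
        unfolding p_def by (intro mult_left_mono rec) auto
      also have "\<dots> = (\<theta> * l powr (N + \<gamma>)) * p k + (8 * \<omega> * L ^ 4 * A\<^sup>2)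
          * (l powr ((N + \<gamma>) * real (Suc k)) * r (Suc k) ^ (CARD('n) + 4))"
        unfolding split p_def by (simp only: distrib_left mult_ac)
      also have "\<dots> \<le> p k / 2 + (8 * \<omega> * L ^ 4 * A\<^sup>2) * q ^ Suc k"
        unfolding rp using mult_right_mono[OF \<theta> p0[of k]] by simp
      finally show ?thesis .
    qed
    have p_0: "p 0 \<le> \<omega> * M\<^sup>2"
      using mass_energy_le[OF u r[of 0]] en[of 0] l \<omega> M0 unfolding p_def
      by (simp add: r_def vol_def \<omega>_def[symmetric] M_def[symmetric])
    define B where "B = 2 * (\<omega> * M\<^sup>2 + 8 * \<omega> * L ^ 4 * A\<^sup>2 / (1 - q))"
    have sum_p: "(\<Sum>k<n. p k) \<le> B" for n
    proof -
      have "(\<Sum>k<n. p k) \<le> 2 * (p 0 + 8 * \<omega> * L ^ 4 * A\<^sup>2 / (1 - q))"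
        by (rule sum_bound_of_recursion[OF p0 p_rec q]) (use \<omega> L in auto)
      then show ?thesis using p_0 by (simp add: B_def)
    qed
    define \<Phi> where "\<Phi> k = (\<integral>\<^sup>+x. \<integral>\<^sup>+y. near (r k) x y * (f x * f y) \<partial>lborel \<partial>lborel)" for k
    have \<Phi>: "ennreal (l powr (\<gamma> * real (Suc k))) * \<Phi> k \<le> ennreal (c * p k)" for k
    proof -
      define V where "V = vol TYPE(real^'n) (r k / 2)"
      have Vpos: "0 < V" using vol_pos[of "r k / 2"] r by (simp add: V_def)
      have "ennreal V * \<Phi> k \<le> ennreal (en k)"
        using near_pairs_le_mass_energy[OF u r[of k]] en[of k] by (simp add: V_def \<Phi>_def f_def)
      then have "ennreal (1 / V) * (ennreal V * \<Phi> k) \<le> ennreal (1 / V) * ennreal (en k)"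
        by (intro mult_left_mono) auto
      then have "\<Phi> k \<le> ennreal (en k / V)"
        using Vpos en(2)[of k] by (simp add: mult.assoc[symmetric] ennreal_mult'[symmetric])
      then have "ennreal (l powr (\<gamma> * real (Suc k))) * \<Phi> k \<le> ennreal (l powr (\<gamma> * real (Suc k)))
          * ennreal (en k / V)"
        by (intro mult_left_mono) auto
      also have "\<dots> = ennreal (l powr (\<gamma> * real (Suc k)) * (en k / V))" by (rule ennreal_mult'[symmetric]) simp
      also have "l powr (\<gamma> * real (Suc k)) * (en k / V) = c * p k"
      proof -
        have rk: "r k ^ CARD('n) = l powr (- N * real k)"
        proof -
          have "r k = l powr (- real k)"
            using l by (simp add: r_def powr_minus powr_realpow power_one_over inverse_eq_divide)
          then show ?thesis using l by (simp add: powr_realpow[symmetric] powr_powr N_def mult.commute)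
        qed
        have "V = l powr (- N * real k) / 2 ^ CARD('n) * \<omega>"
          by (simp add: V_def vol_def \<omega>_def power_divide rk)
        then have "l powr (\<gamma> * real (Suc k)) * (en k / V) = l powr (\<gamma> * real (Suc k)) * en k * 2 ^ CARD('n)
            / (\<omega> * l powr (- N * real k))"
          by (simp add: mult_ac)
        also have "\<dots> = (l powr (\<gamma> * real (Suc k)) / l powr (- N * real k)) * en k * 2 ^ CARD('n) / \<omega>"
          by simp
        also have "l powr (\<gamma> * real (Suc k)) / l powr (- N * real k) = l powr \<gamma> * l powr ((N + \<gamma>) * real k)"
          by (simp add: powr_diff[symmetric] powr_add[symmetric] algebra_simps)
        finally show ?thesis by (simp add: c_def p_def mult_ac)
      qed
      finally show ?thesis .
    qed
    have sum_ennreal: "(\<Sum>k. ennreal (c * p k)) \<le> ennreal (c * B)"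
    proof (rule suminf_le_const[OF summableI])
      fix n
      have "(\<Sum>k<n. ennreal (c * p k)) = ennreal (\<Sum>k<n. c * p k)" using c p0 by (intro sum_ennreal) auto
      also have "\<dots> \<le> ennreal (c * B)"
        using c sum_p[of n] by (intro ennreal_leI) (simp add: sum_distrib_left[symmetric] mult_left_mono)
      finally show "(\<Sum>k<n. ennreal (c * p k)) \<le> ennreal (c * B)" .
    qed
    have int_f: "(\<integral>\<^sup>+x. f x \<partial>lborel) = ennreal M"
      unfolding f_def M_def by (rule nn_integral_norm_square[OF u])
    have "riesz_energy \<gamma> u u = (\<integral>\<^sup>+x. \<integral>\<^sup>+y. ennreal (1 / norm (x - y) powr \<gamma>) * (f x * f y) \<partial>lborel \<partial>lborel)"
      unfolding riesz_energy_def f_def by (intro nn_integral_cong) (simp add: ennreal_mult'[symmetric]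
          mult_ac)
    also have "\<dots> \<le> (\<integral>\<^sup>+x. \<integral>\<^sup>+y. (1 + (\<Sum>k. ennreal (l powr (\<gamma> * real (Suc k))) * near ((1 / l) ^ k) x y))
        * (f x * f y) \<partial>lborel \<partial>lborel)"
      by (intro nn_integral_mono mult_right_mono riesz_kernel_le_dyadic l \<gamma>) auto
    also have "\<dots> = (\<integral>\<^sup>+x. \<integral>\<^sup>+y. f x * f y + (\<Sum>k. ennreal (l powr (\<gamma> * real (Suc k)))
        * (near (r k) x y * (f x * f y))) \<partial>lborel \<partial>lborel)"
      by (simp add: distrib_right ennreal_suminf_multc[symmetric] mult.assoc r_def)
    also have "\<dots> = (\<integral>\<^sup>+x. (\<integral>\<^sup>+y. f x * f y \<partial>lborel)
        + (\<Sum>k. \<integral>\<^sup>+y. ennreal (l powr (\<gamma> * real (Suc k))) * (near (r k) x y * (f x * f y)) \<partial>lborel) \<partial>lborel)"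
      by (intro nn_integral_cong, subst nn_integral_add, measurable, subst nn_integral_suminf) measurable
    also have "\<dots> = (\<integral>\<^sup>+x. (\<integral>\<^sup>+y. f x * f y \<partial>lborel) \<partial>lborel)
        + (\<Sum>k. \<integral>\<^sup>+x. \<integral>\<^sup>+y. ennreal (l powr (\<gamma> * real (Suc k)))
        * (near (r k) x y * (f x * f y)) \<partial>lborel \<partial>lborel)"
      by (subst nn_integral_add, measurable, subst nn_integral_suminf) measurable
    also have "(\<integral>\<^sup>+x. (\<integral>\<^sup>+y. f x * f y \<partial>lborel) \<partial>lborel) = ennreal M * ennreal M"
      by (simp add: nn_integral_cmult nn_integral_multc int_f)
    also have "(\<Sum>k. \<integral>\<^sup>+x. \<integral>\<^sup>+y. ennreal (l powr (\<gamma> * real (Suc k)))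
        * (near (r k) x y * (f x * f y)) \<partial>lborel \<partial>lborel)
       = (\<Sum>k. ennreal (l powr (\<gamma> * real (Suc k))) * \<Phi> k)"
      unfolding \<Phi>_def by (simp add: nn_integral_cmult)
    also have "\<dots> \<le> (\<Sum>k. ennreal (c * p k))"
      by (intro suminf_le \<Phi> summableI)
    also have "\<dots> \<le> ennreal (c * B)" by (rule sum_ennreal)
    finally have "riesz_energy \<gamma> u u \<le> ennreal M * ennreal M + ennreal (c * B)" by (simp add: add_left_mono)
    also have "\<dots> = ennreal (M\<^sup>2 + c * B)"
    proof -
      have "0 \<le> B" unfolding B_def using \<omega> M0 q L by (intro mult_nonneg_nonneg add_nonneg_nonneg) auto
      then show ?thesis using M0 c by (simp add: ennreal_mult'[symmetric] ennreal_plus[symmetric]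
          power2_eq_square del: ennreal_plus)
    qed
    also have "\<dots> \<le> ennreal (K * (A + M)\<^sup>2)"
    proof (intro ennreal_leI)
      have am: "M\<^sup>2 \<le> (A + M)\<^sup>2" "A\<^sup>2 \<le> (A + M)\<^sup>2" using A0 M0 by (auto intro!: power_mono)
      have k1: "0 \<le> 1 + c * (2 * \<omega>)" "0 \<le> c * (2 * (8 * \<omega> * L ^ 4 / (1 - q)))" using c \<omega> q L by auto
      have "M\<^sup>2 + c * B = (1 + c * (2 * \<omega>)) * M\<^sup>2 + c * (2 * (8 * \<omega> * L ^ 4 / (1 - q))) * A\<^sup>2"
        unfolding B_def by (simp add: algebra_simps)
      also have "\<dots> \<le> (1 + c * (2 * \<omega>)) * (A + M)\<^sup>2 + c * (2 * (8 * \<omega> * L ^ 4 / (1 - q))) * (A + M)\<^sup>2"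
        by (intro add_mono mult_left_mono am k1)
      also have "\<dots> = K * (A + M)\<^sup>2" by (simp add: K_def distrib_right)
      finally show "M\<^sup>2 + c * B \<le> K * (A + M)\<^sup>2" .
    qed
    finally show ?thesis by (simp add: M_def)
  qed
  with Kpos show ?thesis by blast
qed

section \<open>The quadrilinear Riesz form on \<open>H\<^sup>1\<close>\<close>

lemma H1_sq [simp]: "u \<in> H1 \<Longrightarrow> sq u"
  by (auto simp: H1_iff has_gradient_def)

lemma weak_gradient_sq [simp]: "u \<in> H1 \<Longrightarrow> sq (weak_gradient u)"
  using has_gradient_weak_gradient has_gradientD by blast

lemma H1_measurable: "u \<in> H1 \<Longrightarrow> u \<in> borel_measurable borel"
  using H1_sq sq_measurable by blast

lemma H1_add [simp]: "u \<in> H1 \<Longrightarrow> v \<in> H1 \<Longrightarrow> (\<lambda>x. u x + v x) \<in> H1"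
  using has_gradient_add H1_iff by blast

lemma H1_diff [simp]: "u \<in> H1 \<Longrightarrow> v \<in> H1 \<Longrightarrow> (\<lambda>x. u x - v x) \<in> H1"
  using has_gradient_diff H1_iff by blast

lemma H1_scaleR [simp]: "u \<in> H1 \<Longrightarrow> (\<lambda>x. c *\<^sub>R u x) \<in> H1"
  using has_gradient_scaleR H1_iff by blast

lemma H1_translate [simp]: "u \<in> H1 \<Longrightarrow> (\<lambda>x. u (x + h)) \<in> H1"
  using has_gradient_translate H1_iff by blast

definition kinetic :: "(real^'n::finite \<Rightarrow> 'k::euclidean_space) \<Rightarrow> real" where
  "kinetic u = ip (weak_gradient u) (weak_gradient u)"

definition h1sq :: "(real^'n::finite \<Rightarrow> 'k::euclidean_space) \<Rightarrow> real" where
  "h1sq u = kinetic u + ip u u"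

lemma kinetic_nonneg [simp]: "0 \<le> kinetic u"
  by (simp add: kinetic_def)

lemma h1sq_nonneg [simp]: "0 \<le> h1sq u"
  by (simp add: h1sq_def)

lemma kinetic_eq: "has_gradient u G \<Longrightarrow> kinetic u = ip G G"
  unfolding kinetic_def by (rule ip_weak_gradient)

lemma ip_translate_diff_kinetic:
  "u \<in> H1 \<Longrightarrow> ip (\<lambda>x. u (x + h) - u x) (\<lambda>x. u (x + h) - u x) \<le> (norm h)\<^sup>2 * kinetic u"
  unfolding kinetic_def by (rule ip_translate_diff_le[OF has_gradient_weak_gradient])

lemma kinetic_translate: "u \<in> H1 \<Longrightarrow> kinetic (\<lambda>x. u (x + h)) = kinetic u"
  by (simp add: kinetic_eq[OF has_gradient_translate[OF has_gradient_weak_gradient]] ip_translate)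
     (simp add: kinetic_def)

lemma h1sq_translate: "u \<in> H1 \<Longrightarrow> h1sq (\<lambda>x. u (x + h)) = h1sq u"
  by (simp add: h1sq_def kinetic_translate ip_translate)

definition admissible :: "'n::finite itself \<Rightarrow> real \<Rightarrow> bool" where
  "admissible _ \<gamma> \<longleftrightarrow> 0 < \<gamma> \<and> \<gamma> < real CARD('n) \<and> \<gamma> < 4"

abbreviation lborel2 :: "('a::euclidean_space \<times> 'a) measure" where
  "lborel2 \<equiv> lborel \<Otimes>\<^sub>M lborel"

definition riesz_kernel :: "real \<Rightarrow> ('a::euclidean_space \<times> 'a) \<Rightarrow> real" where
  "riesz_kernel \<gamma> z = 1 / norm (fst z - snd z) powr \<gamma>"

lemma riesz_kernel_nonneg [simp]: "0 \<le> riesz_kernel \<gamma> z"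
  by (simp add: riesz_kernel_def)

lemma riesz_kernel_measurable [measurable]: "riesz_kernel \<gamma> \<in> borel_measurable lborel2"
  unfolding riesz_kernel_def by measurable

definition riesz_integrand ::
  "real \<Rightarrow> ('a::euclidean_space \<Rightarrow> 'k::euclidean_space) \<Rightarrow> ('a \<Rightarrow> 'k) \<Rightarrow> ('a \<Rightarrow> 'k) \<Rightarrow> ('a \<Rightarrow> 'k) \<Rightarrow> 'a \<times> 'a \<Rightarrow> real"
      where
  "riesz_integrand \<gamma> a b c d z = (a (fst z) \<bullet> b (fst z)) * (c (snd z) \<bullet> d (snd z)) * riesz_kernel \<gamma> z"

text \<open>Full polarisation of \<open>D\<close>: the derivatives of \<open>D\<close> along lines,
  the nonlinear terms of the weak equation and the mixed terms of the Brezis-Lieb splitting are all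
  values of this form.\<close>

definition riesz_form ::
  "real \<Rightarrow> (real^'n::finite \<Rightarrow> 'k::euclidean_space) \<Rightarrow> (real^'n \<Rightarrow> 'k) \<Rightarrow> (real^'n \<Rightarrow> 'k) \<Rightarrow> (real^'n \<Rightarrow> 'k) \<Rightarrow> real"
      where
  "riesz_form \<gamma> a b c d = (LINT z|lborel2. riesz_integrand \<gamma> a b c d z)"

lemma riesz_integrand_measurable [measurable]:
  assumes [measurable]: "a \<in> borel_measurable borel" "b \<in> borel_measurable borel"
    "c \<in> borel_measurable borel" "d \<in> borel_measurable borel"
  shows "riesz_integrand \<gamma> a b c d \<in> borel_measurable lborel2"
  unfolding riesz_integrand_def by measurable

lemma riesz_integrand_nonneg [simp]: "0 \<le> riesz_integrand \<gamma> u u w w z"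
  by (simp add: riesz_integrand_def)

lemma riesz_form_nonneg [simp]: "0 \<le> riesz_form \<gamma> u u w w"
  unfolding riesz_form_def by (intro integral_nonneg_AE) auto

text \<open>The mixed bound is read off from the diagonal one for the pair-valued function (a u, b
  w), whose energy contains a^2 b^2 times the mixed energy of \<open>u\<close> and
  \<open>w\<close>.\<close>

lemma riesz_energy_le:
  fixes u w :: "real^'n::finite \<Rightarrow> 'k::euclidean_space"
  assumes "admissible TYPE('n) \<gamma>"
  shows "\<exists>K>0. \<forall>u\<in>H1. \<forall>w\<in>H1. riesz_energy \<gamma> (u :: real^'n \<Rightarrow> 'k) (w :: real^'n \<Rightarrow> 'k)
      \<le> ennreal (K * h1sq u * h1sq w)"
proof -
  obtain K where K: "0 < K" and
    HLS: "\<And>(p :: real^'n \<Rightarrow> 'k \<times> 'k) A. sq p \<Longrightarrow>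
     (\<And>h. ip (\<lambda>x. p (x + h) - p x) (\<lambda>x. p (x + h) - p x) \<le> (norm h)\<^sup>2 * A) \<Longrightarrow>
     riesz_energy \<gamma> p p \<le> ennreal (K * (A + ip p p)\<^sup>2)"
    using Hardy_Littlewood_Sobolev[of \<gamma>, where 'n='n and 'b="'k \<times> 'k"] assms unfolding admissible_def by blast
  have "riesz_energy \<gamma> u w \<le> ennreal (4 * K * h1sq u * h1sq w)" if u: "u \<in> H1"
      and w: "w \<in> H1" for u w :: "real^'n \<Rightarrow> 'k"
  proof -
    note [measurable] = H1_measurable[OF u] H1_measurable[OF w]
    have *: "riesz_energy \<gamma> u w \<le> ennreal (4 * K * (h1sq u + \<tau>) * (h1sq w + \<tau>))" if \<tau>: "0 < \<tau>" for \<tau>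
    proof -
      \<comment> \<open>The weights balance the two H1 norms, so that the square of the sum becomes
        a multiple of the product. The positive \<tau> allows division when a norm vanishes and is
        removed in the limit.\<close>
      define a where "a = sqrt (h1sq w + \<tau>)"
      define b where "b = sqrt (h1sq u + \<tau>)"
      have ab: "0 < a" "0 < b" using \<tau> by (auto simp: a_def b_def add_nonneg_pos)
      have ab2: "a\<^sup>2 = h1sq w + \<tau>" "b\<^sup>2 = h1sq u + \<tau>" using \<tau> by (auto simp: a_def b_def add_nonneg_nonneg)
      define p where "p x = (a *\<^sub>R u x, b *\<^sub>R w x)" for x
      have [measurable]: "p \<in> borel_measurable borel" unfolding p_def by measurable
      have np: "(norm (a *\<^sub>R x, b *\<^sub>R y))\<^sup>2 = a\<^sup>2 * (norm x)\<^sup>2 + b\<^sup>2 * (norm y)\<^sup>2" for x y :: 'k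
        by (simp add: norm_Pair power_mult_distrib)
      have sqp: "sq p" unfolding square_integrable_def p_def np using u w by auto
      have ipp: "ip (\<lambda>x. (a *\<^sub>R f x, b *\<^sub>R g x)) (\<lambda>x. (a *\<^sub>R f x, b *\<^sub>R g x)) = a\<^sup>2 * ip f f + b\<^sup>2 * ip g g"
        if "sq f" "sq g" for f g :: "real^'n \<Rightarrow> 'k"
        unfolding ip_self np using that by simp
      have "riesz_energy \<gamma> p p \<le> ennreal (K * ((a\<^sup>2 * kinetic u + b\<^sup>2 * kinetic w) + ip p p)\<^sup>2)"
      proof (rule HLS[OF sqp])
        fix h
        have "ip (\<lambda>x. p (x + h) - p x) (\<lambda>x. p (x + h) - p x) =
          a\<^sup>2 * ip (\<lambda>x. u (x + h) - u x) (\<lambda>x. u (x + h) - u x)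
              + b\<^sup>2 * ip (\<lambda>x. w (x + h) - w x) (\<lambda>x. w (x + h) - w x)"
          using ipp[of "\<lambda>x. u (x + h) - u x" "\<lambda>x. w (x + h) - w x"] u w
          by (simp add: p_def scaleR_diff_right)
        also have "\<dots> \<le> a\<^sup>2 * ((norm h)\<^sup>2 * kinetic u) + b\<^sup>2 * ((norm h)\<^sup>2 * kinetic w)"
          by (intro add_mono mult_left_mono ip_translate_diff_kinetic u w) auto
        finally show "ip (\<lambda>x. p (x + h) - p x) (\<lambda>x. p (x + h) - p x)
            \<le> (norm h)\<^sup>2 * (a\<^sup>2 * kinetic u + b\<^sup>2 * kinetic w)"
          by (simp add: algebra_simps)
      qed
      also have "(a\<^sup>2 * kinetic u + b\<^sup>2 * kinetic w) + ip p p = a\<^sup>2 * h1sq u + b\<^sup>2 * h1sq w"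
        unfolding p_def using ipp[of u w] u w by (simp add: h1sq_def algebra_simps)
      finally have 1: "riesz_energy \<gamma> p p \<le> ennreal (K * (a\<^sup>2 * h1sq u + b\<^sup>2 * h1sq w)\<^sup>2)" .
      have "ennreal (a\<^sup>2 * b\<^sup>2) * riesz_energy \<gamma> u w
        = (\<integral>\<^sup>+x. \<integral>\<^sup>+y. ennreal (a\<^sup>2 * b\<^sup>2 * ((norm (u x))\<^sup>2 * (norm (w y))\<^sup>2
            / norm (x - y) powr \<gamma>)) \<partial>lborel \<partial>lborel)"
        unfolding riesz_energy_def by (simp add: nn_integral_cmult[symmetric] ennreal_mult'[symmetric])
      also have "\<dots> \<le> riesz_energy \<gamma> p p"
        unfolding riesz_energy_def
      proof (intro nn_integral_mono ennreal_leI)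
        fix x y
        have "a\<^sup>2 * b\<^sup>2 * ((norm (u x))\<^sup>2 * (norm (w y))\<^sup>2) = (a\<^sup>2 * (norm (u x))\<^sup>2) * (b\<^sup>2 * (norm (w y))\<^sup>2)"
            by simp
        also have "\<dots> \<le> (norm (p x))\<^sup>2 * (norm (p y))\<^sup>2"
          unfolding p_def np by (intro mult_mono) auto
        finally show "a\<^sup>2 * b\<^sup>2 * ((norm (u x))\<^sup>2 * (norm (w y))\<^sup>2 / norm (x - y) powr \<gamma>)
            \<le> (norm (p x))\<^sup>2 * (norm (p y))\<^sup>2 / norm (x - y) powr \<gamma>"
          by (simp add: divide_right_mono)
      qed
      also note 1
      also have "K * (a\<^sup>2 * h1sq u + b\<^sup>2 * h1sq w)\<^sup>2 \<le> a\<^sup>2 * b\<^sup>2 * (4 * K * (h1sq u + \<tau>) * (h1sq w + \<tau>))"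
      proof -
        have "a\<^sup>2 * h1sq u + b\<^sup>2 * h1sq w \<le> 2 * (a\<^sup>2 * b\<^sup>2)"
        proof -
          have "a\<^sup>2 * h1sq u \<le> a\<^sup>2 * b\<^sup>2" unfolding ab2(2) using \<tau> by (intro mult_left_mono) auto
          moreover have "b\<^sup>2 * h1sq w \<le> b\<^sup>2 * a\<^sup>2" unfolding ab2(1) using \<tau> by (intro mult_left_mono) auto
          ultimately show ?thesis by (simp add: mult.commute)
        qed
        then have "(a\<^sup>2 * h1sq u + b\<^sup>2 * h1sq w)\<^sup>2 \<le> (2 * (a\<^sup>2 * b\<^sup>2))\<^sup>2" by (intro power_mono) auto
        then have "K * (a\<^sup>2 * h1sq u + b\<^sup>2 * h1sq w)\<^sup>2 \<le> K * (2 * (a\<^sup>2 * b\<^sup>2))\<^sup>2" using K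
            by (intro mult_left_mono) auto
        also have "\<dots> = a\<^sup>2 * b\<^sup>2 * (4 * K * (h1sq u + \<tau>) * (h1sq w + \<tau>))"
          unfolding ab2[symmetric] by (simp add: power2_eq_square)
        finally show ?thesis .
      qed
      finally have 2: "ennreal (a\<^sup>2 * b\<^sup>2) * riesz_energy \<gamma> u w
          \<le> ennreal (a\<^sup>2 * b\<^sup>2 * (4 * K * (h1sq u + \<tau>) * (h1sq w + \<tau>)))"
        by (simp add: ennreal_leI)
      have "ennreal (1 / (a\<^sup>2 * b\<^sup>2)) * (ennreal (a\<^sup>2 * b\<^sup>2) * riesz_energy \<gamma> u w)
        \<le> ennreal (1 / (a\<^sup>2 * b\<^sup>2)) * ennreal (a\<^sup>2 * b\<^sup>2 * (4 * K * (h1sq u + \<tau>) * (h1sq w + \<tau>)))"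
        by (intro mult_left_mono 2) auto
      moreover have "ennreal (1 / (a\<^sup>2 * b\<^sup>2)) * (ennreal (a\<^sup>2 * b\<^sup>2) * r) = r" for r
        using ab by (simp add: mult.assoc[symmetric] ennreal_mult'[symmetric])
      moreover have "ennreal (1 / (a\<^sup>2 * b\<^sup>2)) * ennreal (a\<^sup>2 * b\<^sup>2 * t) = ennreal t" for t
        using ab by (subst ennreal_mult'[symmetric]) auto
      ultimately show ?thesis by simp
    qed
    have "(\<lambda>n. ennreal (4 * K * (h1sq u + 1 / Suc n) * (h1sq w + 1 / Suc n)))
        \<longlonglongrightarrow> ennreal (4 * K * (h1sq u + 0) * (h1sq w + 0))"
      by (intro tendsto_ennrealI tendsto_intros LIMSEQ_inverse_real_of_nat[unfolded inverse_eq_divide])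
    then have "riesz_energy \<gamma> u w \<le> ennreal (4 * K * (h1sq u + 0) * (h1sq w + 0))"
      by (rule LIMSEQ_le_const) (use * in auto)
    then show ?thesis by simp
  qed
  then show ?thesis using K by (intro exI[of _ "4 * K"]) auto
qed

lemma riesz_energy_eq:
  assumes [measurable]: "u \<in> borel_measurable borel" "w \<in> borel_measurable borel"
  shows "riesz_energy \<gamma> u w = (\<integral>\<^sup>+z. ennreal (riesz_integrand \<gamma> u u w w z) \<partial>lborel2)"
proof -
  have "(\<integral>\<^sup>+x. \<integral>\<^sup>+y. ennreal (riesz_integrand \<gamma> u u w w (x, y)) \<partial>lborel \<partial>lborel)
      = (\<integral>\<^sup>+z. ennreal (riesz_integrand \<gamma> u u w w z) \<partial>lborel2)"
    by (rule lborel.nn_integral_fst) measurable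
  then show ?thesis
    by (simp add: riesz_energy_def riesz_integrand_def riesz_kernel_def power2_norm_eq_inner)
qed

context
  fixes \<gamma> :: real and kty :: "'k::euclidean_space itself" and nty :: "'n::finite itself"
  assumes adm: "admissible TYPE('n) \<gamma>"
begin

lemma riesz_form_diag:
  "\<exists>K>0. \<forall>u\<in>H1. \<forall>w\<in>H1. integrable lborel2 (riesz_integrand \<gamma> (u :: real^'n \<Rightarrow> 'k) u w w)
     \<and> riesz_form \<gamma> u u w w \<le> K * h1sq u * h1sq w"
proof -
  obtain K where K: "0 < K" and bound: "\<And>(u :: real^'n \<Rightarrow> 'k) (w :: real^'n \<Rightarrow> 'k). u \<in> H1 \<Longrightarrow> w \<in> H1
      \<Longrightarrow> riesz_energy \<gamma> u w \<le> ennreal (K * h1sq u * h1sq w)"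
    using riesz_energy_le[where 'n='n and 'k='k, OF adm] by blast
  have main: "integrable lborel2 (riesz_integrand \<gamma> u u w w) \<and> riesz_form \<gamma> u u w w \<le> K * h1sq u * h1sq w"
    if u: "u \<in> H1" and w: "w \<in> H1" for u w :: "real^'n \<Rightarrow> 'k"
  proof -
    note [measurable] = H1_measurable[OF u] H1_measurable[OF w]
    have le: "(\<integral>\<^sup>+z. ennreal (riesz_integrand \<gamma> u u w w z) \<partial>lborel2) \<le> ennreal (K * h1sq u * h1sq w)"
      using bound[OF u w] by (simp add: riesz_energy_eq)
    have int: "integrable lborel2 (riesz_integrand \<gamma> u u w w)"
      by (rule integrableI_bounded) (use le in \<open>auto intro: le_less_trans\<close>)
    have "ennreal (riesz_form \<gamma> u u w w) \<le> ennreal (K * h1sq u * h1sq w)"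
      using le unfolding riesz_form_def by (subst nn_integral_eq_integral[OF int, symmetric]) auto
    moreover have "0 \<le> K * h1sq u * h1sq w" using K by simp
    ultimately show ?thesis using int by (subst (asm) ennreal_le_iff) auto
  qed
  show ?thesis by (intro exI[of _ K] conjI ballI K main[THEN conjunct1] main[THEN conjunct2])
qed

lemma riesz_diag_integrable:
  assumes "u \<in> H1" "w \<in> H1" shows "integrable lborel2 (riesz_integrand \<gamma> (u :: real^'n \<Rightarrow> 'k) u w w)"
proof -
  obtain K where "\<forall>u\<in>H1. \<forall>w\<in>H1. integrable lborel2 (riesz_integrand \<gamma> (u :: real^'n \<Rightarrow> 'k) u w w)
     \<and> riesz_form \<gamma> u u w w \<le> K * h1sq u * h1sq w" using riesz_form_diag by (elim exE conjE) (rule that)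
  from this[rule_format, OF assms] show ?thesis by (rule conjunct1)
qed

text \<open>Groups \<open>a\<close> with \<open>c\<close> and \<open>b\<close> with
  \<open>d\<close>, so that Young's inequality bounds every form by two diagonal ones.\<close>

lemma norm_product_le:
  "norm a * norm b * (norm c * norm d) \<le> (a \<bullet> a) * (c \<bullet> c) / 2 + (b \<bullet> b) * (d \<bullet> d) / 2"
  for a b c d :: 'k
  using sum_squares_bound[of "norm a * norm c" "norm b * norm d"]
  by (simp add: power_mult_distrib power2_norm_eq_inner mult_ac)

lemma riesz_abs_integrable:
  fixes a b c d :: "real^'n \<Rightarrow> 'k"
  assumes "a \<in> H1" "b \<in> H1" "c \<in> H1" "d \<in> H1"
  shows "integrable lborel2 (\<lambda>z. norm (a (fst z)) * norm (b (fst z)) * (norm (c (snd z)) * norm (d (snd z)))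
      * riesz_kernel \<gamma> z)"
proof (rule Bochner_Integration.integrable_bound)
  note [measurable] = assms[THEN H1_measurable]
  show "integrable lborel2 (\<lambda>z. riesz_integrand \<gamma> a a c c z / 2 + riesz_integrand \<gamma> b b d d z / 2)"
    using assms by (intro Bochner_Integration.integrable_add integrable_divide riesz_diag_integrable)
  show "(\<lambda>z. norm (a (fst z)) * norm (b (fst z)) * (norm (c (snd z)) * norm (d (snd z)))
      * riesz_kernel \<gamma> z) \<in> borel_measurable lborel2"
    by measurable
  have "norm (a (fst z)) * norm (b (fst z)) * (norm (c (snd z)) * norm (d (snd z))) * riesz_kernel \<gamma> z
    \<le> riesz_integrand \<gamma> a a c c z / 2 + riesz_integrand \<gamma> b b d d z / 2" for z
    using mult_right_mono[OF norm_product_le[of "a (fst z)" "b (fst z)" "c (snd z)" "d (snd z)"]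
        riesz_kernel_nonneg[of \<gamma> z]]
    by (simp add: riesz_integrand_def distrib_right)
  then show "AE z in lborel2. norm (norm (a (fst z)) * norm (b (fst z))
      * (norm (c (snd z)) * norm (d (snd z))) * riesz_kernel \<gamma> z)
    \<le> norm (riesz_integrand \<gamma> a a c c z / 2 + riesz_integrand \<gamma> b b d d z / 2)"
    by (auto intro!: AE_I2 simp: abs_mult)
qed

lemma riesz_integrand_abs_le:
  fixes a b c d :: "real^'n \<Rightarrow> 'k"
  shows "\<bar>riesz_integrand \<gamma> a b c d z\<bar> \<le> norm (a (fst z)) * norm (b (fst z))
      * (norm (c (snd z)) * norm (d (snd z))) * riesz_kernel \<gamma> z"
  unfolding riesz_integrand_def abs_mult
  by (intro mult_mono Cauchy_Schwarz_ineq2) (auto intro: mult_nonneg_nonneg)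

lemma riesz_integrable:
  fixes a b c d :: "real^'n \<Rightarrow> 'k"
  assumes "a \<in> H1" "b \<in> H1" "c \<in> H1" "d \<in> H1"
  shows "integrable lborel2 (riesz_integrand \<gamma> a b c d)"
proof (rule Bochner_Integration.integrable_bound[OF riesz_abs_integrable[OF assms]])
  note [measurable] = assms[THEN H1_measurable]
  show "riesz_integrand \<gamma> a b c d \<in> borel_measurable lborel2" by measurable
qed (use riesz_integrand_abs_le[of a b c d] in \<open>auto intro!: AE_I2 simp: abs_mult\<close>)

lemma riesz_form_abs_le:
  fixes a b c d :: "real^'n \<Rightarrow> 'k"
  assumes "a \<in> H1" "b \<in> H1" "c \<in> H1" "d \<in> H1"
  shows "\<bar>riesz_form \<gamma> a b c d\<bar> \<le> riesz_form \<gamma> a a c c / 2 + riesz_form \<gamma> b b d d / 2"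
proof -
  have "\<bar>riesz_form \<gamma> a b c d\<bar> \<le> (LINT z|lborel2. \<bar>riesz_integrand \<gamma> a b c d z\<bar>)"
    unfolding riesz_form_def using integral_abs_bound by blast
  also have "\<dots> \<le> (LINT z|lborel2. riesz_integrand \<gamma> a a c c z / 2 + riesz_integrand \<gamma> b b d d z / 2)"
  proof (rule integral_mono)
    show "integrable lborel2 (\<lambda>z. \<bar>riesz_integrand \<gamma> a b c d z\<bar>)"
      by (intro integrable_abs riesz_integrable assms)
    show "integrable lborel2 (\<lambda>z. riesz_integrand \<gamma> a a c c z / 2 + riesz_integrand \<gamma> b b d d z / 2)"
      using assms by (intro Bochner_Integration.integrable_add integrable_divide riesz_diag_integrable)
    fix z
    have "\<bar>riesz_integrand \<gamma> a b c d z\<bar> \<le> norm (a (fst z)) * norm (b (fst z))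
        * (norm (c (snd z)) * norm (d (snd z))) * riesz_kernel \<gamma> z"
      by (rule riesz_integrand_abs_le)
    also have "\<dots> \<le> riesz_integrand \<gamma> a a c c z / 2 + riesz_integrand \<gamma> b b d d z / 2"
      using mult_right_mono[OF norm_product_le[of "a (fst z)" "b (fst z)" "c (snd z)" "d (snd z)"]
          riesz_kernel_nonneg[of \<gamma> z]]
      by (simp add: riesz_integrand_def distrib_right)
    finally show "\<bar>riesz_integrand \<gamma> a b c d z\<bar> \<le> riesz_integrand \<gamma> a a c c z / 2
        + riesz_integrand \<gamma> b b d d z / 2" .
  qed
  also have "\<dots> = riesz_form \<gamma> a a c c / 2 + riesz_form \<gamma> b b d d / 2"
    unfolding riesz_form_def using assms riesz_diag_integrable by simp
  finally show ?thesis .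
qed

lemma riesz_form_commute1: "riesz_form \<gamma> a b c d = riesz_form \<gamma> b a c d"
  by (simp add: riesz_form_def riesz_integrand_def inner_commute)

lemma riesz_form_commute2: "riesz_form \<gamma> a b c d = riesz_form \<gamma> a b d c"
  by (simp add: riesz_form_def riesz_integrand_def inner_commute)

lemma riesz_form_swap:
  fixes a b c d :: "real^'n \<Rightarrow> 'k"
  assumes "a \<in> H1" "b \<in> H1" "c \<in> H1" "d \<in> H1"
  shows "riesz_form \<gamma> a b c d = riesz_form \<gamma> c d a b"
proof -
  note [measurable] = assms[THEN H1_measurable]
  have "(LINT z|lborel2. riesz_integrand \<gamma> a b c d (snd z, fst z)) = riesz_form \<gamma> a b c d"
    unfolding riesz_form_def
    using lborel_pair.integral_product_swap[of "riesz_integrand \<gamma> a b c d"] by (simp add: case_prod_beta')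
  moreover have "riesz_integrand \<gamma> a b c d (snd z, fst z) = riesz_integrand \<gamma> c d a b z" for z
    by (simp add: riesz_integrand_def riesz_kernel_def norm_minus_commute mult_ac)
  ultimately show ?thesis by (simp add: riesz_form_def)
qed

lemma riesz_form_add:
  fixes a a' b c d :: "real^'n \<Rightarrow> 'k"
  assumes "a \<in> H1" "a' \<in> H1" "b \<in> H1" "c \<in> H1" "d \<in> H1"
  shows "riesz_form \<gamma> (\<lambda>x. a x + a' x) b c d = riesz_form \<gamma> a b c d + riesz_form \<gamma> a' b c d"
    and "riesz_form \<gamma> b (\<lambda>x. a x + a' x) c d = riesz_form \<gamma> b a c d + riesz_form \<gamma> b a' c d"
    and "riesz_form \<gamma> c d (\<lambda>x. a x + a' x) b = riesz_form \<gamma> c d a b + riesz_form \<gamma> c d a' b"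
    and "riesz_form \<gamma> c d b (\<lambda>x. a x + a' x) = riesz_form \<gamma> c d b a + riesz_form \<gamma> c d b a'"
  unfolding riesz_form_def
  by (subst Bochner_Integration.integral_add[symmetric];
      auto intro!: riesz_integrable assms Bochner_Integration.integral_cong
        simp: riesz_integrand_def inner_add distrib_right distrib_left)+

lemma riesz_form_scaleR:
  "riesz_form \<gamma> (\<lambda>x. t *\<^sub>R a x) b c d = t * riesz_form \<gamma> a b c d"
  "riesz_form \<gamma> b (\<lambda>x. t *\<^sub>R a x) c d = t * riesz_form \<gamma> b a c d"
  "riesz_form \<gamma> c d (\<lambda>x. t *\<^sub>R a x) b = t * riesz_form \<gamma> c d a b"
  "riesz_form \<gamma> c d b (\<lambda>x. t *\<^sub>R a x) = t * riesz_form \<gamma> c d b a"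
  by (simp_all add: riesz_form_def riesz_integrand_def mult.assoc mult.left_commute[of _ t])

lemma D_eq_riesz_form:
  fixes u :: "real^'n \<Rightarrow> 'k"
  assumes "u \<in> H1" shows "D \<gamma> u = riesz_form \<gamma> u u u u"
proof -
  have "(LINT x|lborel. LINT y|lborel. riesz_integrand \<gamma> u u u u (x, y)) = riesz_form \<gamma> u u u u"
    unfolding riesz_form_def by (rule lborel_pair.integral_fst'[OF riesz_integrable]) (rule assms)+
  then show ?thesis
    by (simp add: D_def riesz_integrand_def riesz_kernel_def power2_norm_eq_inner)
qed

lemma riesz_conv_eq_riesz_form:
  fixes u v :: "real^'n \<Rightarrow> 'k"
  assumes "u \<in> H1" "v \<in> H1"
  shows "(LINT x|lborel. (riesz_conv \<gamma> u x *\<^sub>R u x) \<bullet> v x) = riesz_form \<gamma> u v u u"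
proof -
  have "(LINT x|lborel. LINT y|lborel. riesz_integrand \<gamma> u v u u (x, y)) = riesz_form \<gamma> u v u u"
    unfolding riesz_form_def by (rule lborel_pair.integral_fst'[OF riesz_integrable]) (rule assms)+
  moreover have "(LINT y|lborel. riesz_integrand \<gamma> u v u u (x, y)) = (riesz_conv \<gamma> u x *\<^sub>R u x) \<bullet> v x" for x
  proof -
    have "(LINT y|lborel. riesz_integrand \<gamma> u v u u (x, y))
       = (LINT y|lborel. (u x \<bullet> v x) * ((norm (u y))\<^sup>2 / norm (x - y) powr \<gamma>))"
      by (simp add: riesz_integrand_def riesz_kernel_def power2_norm_eq_inner)
    also have "\<dots> = (u x \<bullet> v x) * (LINT y|lborel. (norm (u y))\<^sup>2 / norm (x - y) powr \<gamma>)"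
      by (rule integral_mult_right_zero)
    finally show ?thesis by (simp add: riesz_conv_def)
  qed
  ultimately show ?thesis by simp
qed

text \<open>On pairs of points the Lebesgue measure scales by t^(2N) and the kernel by
  t^(-\<gamma>).\<close>

lemma riesz_form_affine:
  fixes a b c d :: "real^'n \<Rightarrow> 'k"
  assumes "a \<in> H1" "b \<in> H1" "c \<in> H1" "d \<in> H1" and t: "0 < t"
  shows "riesz_form \<gamma> a b c d = t ^ (2 * CARD('n)) / t powr \<gamma> *
     riesz_form \<gamma> (\<lambda>x. a (h + t *\<^sub>R x)) (\<lambda>x. b (h + t *\<^sub>R x)) (\<lambda>x. c (h + t *\<^sub>R x)) (\<lambda>x. d (h + t *\<^sub>R x))"
proof -
  note [measurable] = assms(1-4)[THEN H1_measurable]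
  have "riesz_form \<gamma> a b c d = (LINT z|lborel. riesz_integrand \<gamma> a b c d z)"
    unfolding riesz_form_def by (simp only: lborel_prod)
  also have "\<dots> = \<bar>t\<bar> ^ DIM((real^'n) \<times> (real^'n)) *\<^sub>R (LINT z|lborel. riesz_integrand \<gamma> a b c d ((h, h)
      + t *\<^sub>R z))"
  proof (rule lborel_integral_affine)
    show "riesz_integrand \<gamma> a b c d \<in> borel_measurable borel"
      using riesz_integrand_measurable[of a b c d \<gamma>] by (simp add: lborel_prod)
  qed (use t in simp)
  also have "\<dots> = t ^ (2 * CARD('n)) * (LINT z|lborel2. riesz_integrand \<gamma> a b c d ((h, h) + t *\<^sub>R z))"
    using t by (simp add: lborel_prod mult_2 power_add)
  also have "(\<lambda>z. riesz_integrand \<gamma> a b c d ((h, h) + t *\<^sub>R z)) = (\<lambda>z. (1 / t powr \<gamma>) *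
     riesz_integrand \<gamma> (\<lambda>x. a (h + t *\<^sub>R x)) (\<lambda>x. b (h + t *\<^sub>R x)) (\<lambda>x. c (h + t *\<^sub>R x)) (\<lambda>x. d (h
         + t *\<^sub>R x)) z)"
  proof
    fix z :: "(real^'n) \<times> (real^'n)"
    have "riesz_kernel \<gamma> ((h, h) + t *\<^sub>R z) = (1 / t powr \<gamma>) * riesz_kernel \<gamma> z"
      using t by (simp add: riesz_kernel_def powr_mult flip: scaleR_diff_right)
    then show "riesz_integrand \<gamma> a b c d ((h, h) + t *\<^sub>R z) = (1 / t powr \<gamma>) *
     riesz_integrand \<gamma> (\<lambda>x. a (h + t *\<^sub>R x)) (\<lambda>x. b (h + t *\<^sub>R x)) (\<lambda>x. c (h + t *\<^sub>R x)) (\<lambda>x. d (h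
         + t *\<^sub>R x)) z"
      by (simp add: riesz_integrand_def)
  qed
  finally show ?thesis by (simp add: riesz_form_def)
qed

lemma riesz_form_translate:
  fixes a b c d :: "real^'n \<Rightarrow> 'k"
  assumes "a \<in> H1" "b \<in> H1" "c \<in> H1" "d \<in> H1"
  shows "riesz_form \<gamma> (\<lambda>x. a (x + h)) (\<lambda>x. b (x + h)) (\<lambda>x. c (x + h)) (\<lambda>x. d (x + h)) = riesz_form \<gamma> a b c d"
  using riesz_form_affine[OF assms, of 1 h] by (simp add: add.commute)

end

lemma lborel2_product_integral:
  fixes f g :: "'a::euclidean_space \<Rightarrow> real"
  assumes f: "integrable lborel f" and g: "integrable lborel g"
  shows "integrable lborel2 (\<lambda>z. f (fst z) * g (snd z))"
    and "(LINT z|lborel2. f (fst z) * g (snd z)) = (LINT x|lborel. f x) * (LINT y|lborel. g y)"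
proof -
  note [measurable] = borel_measurable_integrable[OF f] borel_measurable_integrable[OF g]
  show int: "integrable lborel2 (\<lambda>z. f (fst z) * g (snd z))"
  proof (rule lborel_pair.Fubini_integrable)
    show "integrable lborel (\<lambda>x. LINT y|lborel. norm (f (fst (x, y)) * g (snd (x, y))))"
      using f by (simp add: abs_mult)
    show "AE x in lborel. integrable lborel (\<lambda>y. f (fst (x, y)) * g (snd (x, y)))"
      using g by simp
  qed measurable
  have "(LINT x|lborel. LINT y|lborel. f (fst (x, y)) * g (snd (x, y)))
      = (LINT z|lborel2. f (fst z) * g (snd z))"
    by (rule lborel_pair.integral_fst'[OF int])
  then show "(LINT z|lborel2. f (fst z) * g (snd z)) = (LINT x|lborel. f x) * (LINT y|lborel. g y)" by simp
qed

section \<open>Splitting the Riesz form by distance\<close>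

definition real_local_mass :: "(real^'n::finite \<Rightarrow> 'k::euclidean_space) \<Rightarrow> real \<Rightarrow> real^'n \<Rightarrow> real" where
  "real_local_mass w R x = (LINT y|lborel. indicator (ball x R) y * (w y \<bullet> w y))"

lemma real_local_mass_integrable:
  assumes w: "sq w" shows "integrable lborel (\<lambda>y. indicator (ball x R) y * (w y \<bullet> w y))"
proof (rule Bochner_Integration.integrable_bound[OF sq_integrable[OF w]])
  have [measurable]: "w \<in> borel_measurable borel" using w by measurable
  show "(\<lambda>y. indicator (ball x R) y * (w y \<bullet> w y)) \<in> borel_measurable lborel"
    by (intro borel_measurable_times borel_measurable_indicator) auto
qed (auto intro!: AE_I2 simp: indicator_def)

lemma real_local_mass_nonneg [simp]: "0 \<le> real_local_mass w R x"
  unfolding real_local_mass_def by (intro integral_nonneg_AE) auto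

lemma real_local_mass_le: "sq w \<Longrightarrow> real_local_mass w R x \<le> ip w w"
  unfolding real_local_mass_def ip_def
  by (intro integral_mono real_local_mass_integrable) (auto simp: indicator_def)

lemma ball_indicator_measurable2 [measurable]:
  "(\<lambda>z. indicator (ball (fst z) R) (snd z) :: real) \<in> borel_measurable (lborel2 :: ('a::euclidean_space \<times> 'a)
      measure)"
proof -
  have "(\<lambda>z::'a \<times> 'a. indicator (ball (fst z) R) (snd z) :: real)
      = (\<lambda>z. if dist (fst z) (snd z) < R then 1 else 0)"
    by (auto simp: indicator_def)
  then show ?thesis by simp
qed

lemma real_local_mass_measurable [measurable]:
  assumes [measurable]: "w \<in> borel_measurable borel"
  shows "real_local_mass w R \<in> borel_measurable borel"
proof -
  have "(\<lambda>x. LINT y|lborel. (\<lambda>x y. indicator (ball x R) y * (w y \<bullet> w y)) x y) \<in> borel_measurable lborel"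
  proof (rule lborel.borel_measurable_lebesgue_integral)
    show "(\<lambda>(x, y). indicator (ball x R) y * (w y \<bullet> w y)) \<in> borel_measurable lborel2"
      unfolding case_prod_beta' by measurable
  qed
  then show ?thesis by (simp add: real_local_mass_def[abs_def])
qed

text \<open>Three ranges of distance: below \<epsilon> the more singular kernel takes over with a
  small factor; between \<epsilon> and \<open>R\<close> the kernel is at most
  \<epsilon>^(-\<gamma>); beyond \<open>R\<close> it is at most R^(-\<gamma>).\<close>

lemma riesz_kernel_split:
  assumes "0 < \<epsilon>" "\<gamma> < \<gamma>'" "0 < \<gamma>" "0 < R"
  shows "riesz_kernel \<gamma> z \<le> \<epsilon> powr (\<gamma>' - \<gamma>) * riesz_kernel \<gamma>' z
     + \<epsilon> powr (- \<gamma>) * indicator (ball (fst z) R) (snd z) + R powr (- \<gamma>)"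
proof -
  define d where "d = norm (fst z - snd z)"
  have sum: "1 / d powr \<gamma> \<le> \<epsilon> powr (\<gamma>' - \<gamma>) * (1 / d powr \<gamma>')
     + \<epsilon> powr (- \<gamma>) * (if d < R then 1 else 0) + R powr (- \<gamma>)" if d: "0 < d"
  proof (cases "d < \<epsilon>")
    case True
    have "1 / d powr \<gamma> = d powr (\<gamma>' - \<gamma>) * (1 / d powr \<gamma>')"
      using d by (simp add: powr_diff)
    also have "\<dots> \<le> \<epsilon> powr (\<gamma>' - \<gamma>) * (1 / d powr \<gamma>')"
      using True d assms by (intro mult_right_mono powr_mono2) auto
    finally show ?thesis by (rule order_trans) simp
  next
    case False
    have inv: "1 / d powr \<gamma> = d powr (- \<gamma>)" by (simp add: powr_minus_divide)
    show ?thesis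
    proof (cases "d < R")
      case True
      have "1 / d powr \<gamma> \<le> \<epsilon> powr (- \<gamma>)"
        unfolding inv using False assms by (intro powr_mono2') auto
      then show ?thesis using True d by (simp add: add_increasing add_increasing2)
    next
      case False
      have "1 / d powr \<gamma> \<le> R powr (- \<gamma>)"
        unfolding inv using False assms by (intro powr_mono2') auto
      then show ?thesis by (rule order_trans) simp
    qed
  qed
  show ?thesis
  proof (cases "d = 0")
    case True
    then show ?thesis by (simp add: riesz_kernel_def d_def)
  next
    case False
    then have "0 < d" by (simp add: d_def)
    moreover have "indicator (ball (fst z) R) (snd z) = (if d < R then 1 else (0::real))"
      by (simp add: indicator_def d_def dist_norm)
    ultimately show ?thesis unfolding riesz_kernel_def d_def[symmetric] using sum by simp
  qed
qed

text \<open>Common source of the small form bound, non-vanishing, the vanishing of mixed terms and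
  the comparison of D2 with D1: each of them fixes \<epsilon> and \<open>R\<close> and controls the
  middle term by a bound on local masses.\<close>

lemma riesz_form_split:
  fixes u w :: "real^'n::finite \<Rightarrow> 'k::euclidean_space"
  assumes adm: "admissible TYPE('n) \<gamma>" "admissible TYPE('n) \<gamma>'" and \<gamma>: "\<gamma> < \<gamma>'" and u: "u \<in> H1"
      and w: "w \<in> H1"
    and \<epsilon>: "0 < \<epsilon>" and R: "0 < R"
  shows "riesz_form \<gamma> u u w w \<le> \<epsilon> powr (\<gamma>' - \<gamma>) * riesz_form \<gamma>' u u w w
     + \<epsilon> powr (- \<gamma>) * (LINT x|lborel. (u x \<bullet> u x) * real_local_mass w R x) + R powr (- \<gamma>) * ip u u * ip w w"
proof -
  note [measurable] = H1_measurable[OF u] H1_measurable[OF w]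
  define p where "p z = (u (fst z) \<bullet> u (fst z)) * (w (snd z) \<bullet> w (snd z))" for z
  have [measurable]: "p \<in> borel_measurable lborel2" unfolding p_def by measurable
  have p0: "0 \<le> p z" for z by (simp add: p_def)
  have intp: "integrable lborel2 p" and valp: "(LINT z|lborel2. p z) = ip u u * ip w w"
    unfolding p_def ip_def using lborel2_product_integral[OF sq_integrable[OF H1_sq[OF u]] sq_integrable[OF
        H1_sq[OF w]]] by auto
  have inti: "integrable lborel2 (\<lambda>z. indicator (ball (fst z) R) (snd z) * p z)"
  proof (rule Bochner_Integration.integrable_bound[OF intp])
    show "(\<lambda>z. indicator (ball (fst z) R) (snd z) * p z) \<in> borel_measurable lborel2" by measurable
  qed (auto intro!: AE_I2 simp: indicator_def)
  have vali: "(LINT z|lborel2. indicator (ball (fst z) R) (snd z) * p z)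
      = (LINT x|lborel. (u x \<bullet> u x) * real_local_mass w R x)"
  proof -
    have "(LINT z|lborel2. indicator (ball (fst z) R) (snd z) * p z)
       = (LINT x|lborel. LINT y|lborel. indicator (ball (fst (x, y)) R) (snd (x, y)) * p (x, y))"
      by (rule lborel_pair.integral_fst'[OF inti, symmetric])
    also have "\<dots> = (LINT x|lborel. (u x \<bullet> u x) * real_local_mass w R x)"
      unfolding real_local_mass_def by (simp add: p_def mult.left_commute[of "indicator _ _"])
    finally show ?thesis .
  qed
  have "riesz_form \<gamma> u u w w \<le> (LINT z|lborel2. \<epsilon> powr (\<gamma>' - \<gamma>) * riesz_integrand \<gamma>' u u w w z
      + \<epsilon> powr (- \<gamma>) * (indicator (ball (fst z) R) (snd z) * p z) + R powr (- \<gamma>) * p z)"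
    unfolding riesz_form_def
  proof (rule integral_mono)
    show "integrable lborel2 (riesz_integrand \<gamma> u u w w)" by (rule riesz_diag_integrable[OF adm(1) u w])
    show "integrable lborel2 (\<lambda>z. \<epsilon> powr (\<gamma>' - \<gamma>) * riesz_integrand \<gamma>' u u w w z
      + \<epsilon> powr (- \<gamma>) * (indicator (ball (fst z) R) (snd z) * p z) + R powr (- \<gamma>) * p z)"
      by (intro Bochner_Integration.integrable_add integrable_mult_right riesz_diag_integrable[OF adm(2) u w]
          inti intp)
    fix z
    have "p z * riesz_kernel \<gamma> z \<le> p z * (\<epsilon> powr (\<gamma>' - \<gamma>) * riesz_kernel \<gamma>' z
     + \<epsilon> powr (- \<gamma>) * indicator (ball (fst z) R) (snd z) + R powr (- \<gamma>))"
      using adm \<gamma> \<epsilon> R by (intro mult_left_mono riesz_kernel_split p0) (auto simp: admissible_def)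
    then show "riesz_integrand \<gamma> u u w w z \<le> \<epsilon> powr (\<gamma>' - \<gamma>) * riesz_integrand \<gamma>' u u w w z
      + \<epsilon> powr (- \<gamma>) * (indicator (ball (fst z) R) (snd z) * p z) + R powr (- \<gamma>) * p z"
      by (simp add: riesz_integrand_def p_def algebra_simps)
  qed
  also have "\<dots> = \<epsilon> powr (\<gamma>' - \<gamma>) * riesz_form \<gamma>' u u w w
     + \<epsilon> powr (- \<gamma>) * (LINT x|lborel. (u x \<bullet> u x) * real_local_mass w R x) + R powr (- \<gamma>) * (ip u u * ip w w)"
    unfolding riesz_form_def vali[symmetric] valp[symmetric]
    by (subst Bochner_Integration.integral_add, intro Bochner_Integration.integrable_add integrable_mult_right
        riesz_diag_integrable[OF adm(2) u w] inti,
        intro integrable_mult_right intp, subst Bochner_Integration.integral_add)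
      (auto intro!: integrable_mult_right riesz_diag_integrable[OF adm(2) u w] inti)
  finally show ?thesis by (simp add: mult.assoc)
qed

text \<open>Admissibility is an open condition; the room above \<gamma> pays for the region near the
  diagonal.\<close>

lemma admissible_larger:
  assumes "admissible TYPE('n::finite) \<gamma>"
  shows "\<exists>\<gamma>'>\<gamma>. admissible TYPE('n) \<gamma>'"
proof -
  have "\<gamma> < min (real CARD('n)) 4" using assms by (simp add: admissible_def)
  then obtain \<gamma>' where "\<gamma> < \<gamma>'" "\<gamma>' < min (real CARD('n)) 4" using dense by blast
  then show ?thesis using assms by (auto simp: admissible_def intro!: exI[of _ \<gamma>'])
qed

lemma local_mass_integral_le:
  assumes "u \<in> H1" "sq w" and \<delta>: "\<And>x. real_local_mass w R x \<le> \<delta>"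
  shows "integrable lborel (\<lambda>x. (u x \<bullet> u x) * real_local_mass w R x)"
    and "(LINT x|lborel. (u x \<bullet> u x) * real_local_mass w R x) \<le> \<delta> * ip u u"
proof -
  have [measurable]: "u \<in> borel_measurable borel" "w \<in> borel_measurable borel" using assms
      by (auto simp: H1_measurable sq_measurable)
  have "0 \<le> \<delta>" using \<delta> real_local_mass_nonneg order_trans by blast
  show int: "integrable lborel (\<lambda>x. (u x \<bullet> u x) * real_local_mass w R x)"
  proof (rule Bochner_Integration.integrable_bound)
    show "integrable lborel (\<lambda>x. \<delta> * (u x \<bullet> u x))" using assms by simp
    show "AE x in lborel. norm ((u x \<bullet> u x) * real_local_mass w R x) \<le> norm (\<delta> * (u x \<bullet> u x))"
      using mult_right_mono[OF \<delta> inner_ge_zero] \<open>0 \<le> \<delta>\<close>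
      by (auto intro!: AE_I2 simp: abs_mult mult.commute[of "real_local_mass _ _ _", symmetric])
  qed measurable
  have "(LINT x|lborel. (u x \<bullet> u x) * real_local_mass w R x) \<le> (LINT x|lborel. \<delta> * (u x \<bullet> u x))"
    using assms mult_right_mono[OF \<delta> inner_ge_zero]
    by (intro integral_mono int) (auto simp: mult.commute[of "real_local_mass _ _ _", symmetric])
  then show "(LINT x|lborel. (u x \<bullet> u x) * real_local_mass w R x) \<le> \<delta> * ip u u" by (simp add: ip_def)
qed

text \<open>The potential generated by a bounded set in H1 has relative form bound zero with respect
  to the kinetic energy.\<close>

lemma riesz_form_bound_small:
  assumes adm: "admissible TYPE('n::finite) \<gamma>" and \<epsilon>: "0 < \<epsilon>"
  shows "\<exists>C\<ge>0. \<forall>u\<in>H1. \<forall>w\<in>H1. h1sq (u :: real^'n \<Rightarrow> 'k::euclidean_space) \<le> H \<longrightarrow>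
     riesz_form \<gamma> u u w w \<le> \<epsilon> * kinetic w + C * ip (w :: real^'n \<Rightarrow> 'k) w"
proof -
  obtain \<gamma>' where \<gamma>': "\<gamma> < \<gamma>'" "admissible TYPE('n) \<gamma>'" using admissible_larger[OF adm] by blast
  obtain K where K: "0 < K" "\<And>u w :: real^'n \<Rightarrow> 'k. u \<in> H1 \<Longrightarrow> w \<in> H1
      \<Longrightarrow> riesz_form \<gamma>' u u w w \<le> K * h1sq u * h1sq w"
    using riesz_form_diag[OF \<gamma>'(2)] by blast
  define H' where "H' = \<bar>H\<bar> + 1"
  \<comment> \<open>Makes the near-diagonal term, bounded through the exponent \<gamma>', at most
    \<epsilon> times the squared H1 norm of \<open>w\<close>.\<close>
  define e where "e = (\<epsilon> / (K * H')) powr (1 / (\<gamma>' - \<gamma>))"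
  have KH: "0 < K * H'" using K by (simp add: H'_def)
  have e: "0 < e" "e powr (\<gamma>' - \<gamma>) = \<epsilon> / (K * H')" using KH \<epsilon> \<gamma>' by (auto simp: e_def powr_powr)
  define C where "C = \<epsilon> + (e powr (- \<gamma>) + 1) * H'"
  have "riesz_form \<gamma> u u w w \<le> \<epsilon> * kinetic w + C * ip w w"
    if u: "u \<in> H1" and w: "w \<in> H1" and H: "h1sq u \<le> H" for u w :: "real^'n \<Rightarrow> 'k"
  proof -
    have uH: "h1sq u \<le> H'" "ip u u \<le> H'"
      using H kinetic_nonneg[of u] unfolding H'_def h1sq_def by linarith+
    have "riesz_form \<gamma> u u w w \<le> e powr (\<gamma>' - \<gamma>) * riesz_form \<gamma>' u u w w
     + e powr (- \<gamma>) * (LINT x|lborel. (u x \<bullet> u x) * real_local_mass w 1 x) + 1 powr (- \<gamma>) * ip u u * ip w w"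
      by (rule riesz_form_split[OF adm \<gamma>'(2,1) u w e(1)]) simp
    also have "\<dots> \<le> e powr (\<gamma>' - \<gamma>) * (K * H' * h1sq w) + e powr (- \<gamma>) * (H' * ip w w) + H' * ip w w"
    proof (intro add_mono mult_left_mono)
      have "riesz_form \<gamma>' u u w w \<le> K * h1sq u * h1sq w" by (rule K(2)[OF u w])
      also have "\<dots> \<le> K * H' * h1sq w" using K(1) uH by (intro mult_right_mono mult_left_mono) auto
      finally show "riesz_form \<gamma>' u u w w \<le> K * H' * h1sq w" .
      have "(LINT x|lborel. (u x \<bullet> u x) * real_local_mass w 1 x) \<le> ip w w * ip u u"
        using w by (intro local_mass_integral_le u real_local_mass_le) auto
      also have "\<dots> \<le> H' * ip w w" using uH by (simp add: mult.commute mult_right_mono)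
      finally show "(LINT x|lborel. (u x \<bullet> u x) * real_local_mass w 1 x) \<le> H' * ip w w" .
      show "1 powr (- \<gamma>) * ip u u * ip w w \<le> H' * ip w w" using uH by (simp add: mult_right_mono)
    qed auto
    also have "\<dots> = \<epsilon> * kinetic w + C * ip w w"
    proof -
      have "e powr (\<gamma>' - \<gamma>) * (K * H' * h1sq w) = \<epsilon> * h1sq w" unfolding e(2) using KH K(1)
          by (auto simp: zero_less_mult_iff)
      then show ?thesis by (simp add: C_def h1sq_def algebra_simps)
    qed
    finally show ?thesis .
  qed
  moreover have "0 \<le> C" unfolding C_def H'_def using \<epsilon> by (intro add_nonneg_nonneg mult_nonneg_nonneg) auto
  ultimately show ?thesis by blast
qed

text \<open>If all local masses were small, each of the three ranges of distance would contribute at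
  most \<beta>/4, which is too little to reach \<beta>.\<close>

lemma riesz_form_nonvanishing:
  assumes adm: "admissible TYPE('n::finite) \<gamma>" and \<beta>: "0 < \<beta>"
  shows "\<exists>R>0. \<exists>\<delta>>0. \<forall>u\<in>H1. h1sq (u :: real^'n \<Rightarrow> 'k::euclidean_space) \<le> H \<longrightarrow> \<beta> \<le> riesz_form \<gamma> u u u u \<longrightarrow>
     (\<exists>x. \<delta> < real_local_mass u R x)"
proof -
  obtain \<gamma>' where \<gamma>': "\<gamma> < \<gamma>'" "admissible TYPE('n) \<gamma>'" using admissible_larger[OF adm] by blast
  have g0: "0 < \<gamma>" using adm by (simp add: admissible_def)
  obtain K where K: "0 < K" "\<And>u w :: real^'n \<Rightarrow> 'k. u \<in> H1 \<Longrightarrow> w \<in> H1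
      \<Longrightarrow> riesz_form \<gamma>' u u w w \<le> K * h1sq u * h1sq w"
    using riesz_form_diag[OF \<gamma>'(2)] by blast
  define H' where "H' = \<bar>H\<bar> + 1"
  have H': "0 < H'" by (simp add: H'_def)
  define e where "e = (\<beta> / (4 * K * H'\<^sup>2)) powr (1 / (\<gamma>' - \<gamma>))"
  have e: "0 < e" "e powr (\<gamma>' - \<gamma>) = \<beta> / (4 * K * H'\<^sup>2)" using K H' \<beta> \<gamma>' by (auto simp: e_def powr_powr)
  define R where "R = (\<beta> / (4 * H'\<^sup>2)) powr (- 1 / \<gamma>)"
  have R: "0 < R" "R powr (- \<gamma>) = \<beta> / (4 * H'\<^sup>2)" using H' \<beta> g0 by (auto simp: R_def powr_powr)
  define \<delta> where "\<delta> = \<beta> / (4 * e powr (- \<gamma>) * H')"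
  have \<delta>: "0 < \<delta>" using \<beta> e H' by (simp add: \<delta>_def)
  have "\<exists>x. \<delta> < real_local_mass u R x"
    if u: "u \<in> H1" and H: "h1sq u \<le> H" and \<beta>u: "\<beta> \<le> riesz_form \<gamma> u u u u" for u :: "real^'n \<Rightarrow> 'k"
  proof (rule ccontr)
    assume "\<not> (\<exists>x. \<delta> < real_local_mass u R x)"
    then have loc: "real_local_mass u R x \<le> \<delta>" for x by (simp add: not_less)
    have uH: "h1sq u \<le> H'" "ip u u \<le> H'"
      using H kinetic_nonneg[of u] unfolding H'_def h1sq_def by linarith+
    have "riesz_form \<gamma> u u u u \<le> e powr (\<gamma>' - \<gamma>) * riesz_form \<gamma>' u u u u
     + e powr (- \<gamma>) * (LINT x|lborel. (u x \<bullet> u x) * real_local_mass u R x) + R powr (- \<gamma>) * ip u u * ip u u"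
      by (rule riesz_form_split[OF adm \<gamma>'(2,1) u u e(1) R(1)])
    also have "\<dots> \<le> e powr (\<gamma>' - \<gamma>) * (K * H' * H') + e powr (- \<gamma>) * (\<delta> * H') + R powr (- \<gamma>) * (H' * H')"
    proof (intro add_mono mult_left_mono)
      have "riesz_form \<gamma>' u u u u \<le> K * h1sq u * h1sq u" by (rule K(2)[OF u u])
      also have "\<dots> \<le> K * H' * H'" using K(1) uH H' by (intro mult_mono mult_left_mono) auto
      finally show "riesz_form \<gamma>' u u u u \<le> K * H' * H'" .
      have "(LINT x|lborel. (u x \<bullet> u x) * real_local_mass u R x) \<le> \<delta> * ip u u"
        using u loc by (intro local_mass_integral_le) auto
      also have "\<dots> \<le> \<delta> * H'" using uH \<delta> by (intro mult_left_mono) auto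
      finally show "(LINT x|lborel. (u x \<bullet> u x) * real_local_mass u R x) \<le> \<delta> * H'" .
      show "R powr (- \<gamma>) * ip u u * ip u u \<le> R powr (- \<gamma>) * (H' * H')"
        unfolding mult.assoc using uH H' by (intro mult_left_mono mult_mono) auto
    qed auto
    also have "\<dots> = \<beta> / 4 + \<beta> / 4 + \<beta> / 4"
      unfolding e(2) R(2) \<delta>_def using K H' e by (simp add: power2_eq_square)
    finally show False using \<beta>u \<beta> by simp
  qed
  then show ?thesis using R \<delta> by blast
qed

text \<open>The near and far ranges are uniformly small for bounded \<open>w n\<close>; in the
  middle range the local masses tend to zero pointwise, and the fixed |u|^2 serves as dominating
  function.\<close>

lemma riesz_form_vanishing:
  fixes u :: "real^'n::finite \<Rightarrow> 'k::euclidean_space"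
  assumes adm: "admissible TYPE('n) \<gamma>" and u: "u \<in> H1" and w: "\<And>n. w n \<in> H1" "\<And>n. h1sq (w n) \<le> H"
    and loc: "\<And>x R. (\<lambda>n. real_local_mass (w n) R x) \<longlonglongrightarrow> 0"
  shows "(\<lambda>n. riesz_form \<gamma> u u (w n) (w n)) \<longlonglongrightarrow> 0"
proof (rule LIMSEQ_I)
  fix r :: real assume r: "0 < r"
  note [measurable] = H1_measurable[OF u] H1_measurable[OF w(1)]
  obtain \<gamma>' where \<gamma>': "\<gamma> < \<gamma>'" "admissible TYPE('n) \<gamma>'" using admissible_larger[OF adm] by blast
  have g0: "0 < \<gamma>" using adm by (simp add: admissible_def)
  obtain K where K: "0 < K" "\<And>u w :: real^'n \<Rightarrow> 'k. u \<in> H1 \<Longrightarrow> w \<in> H1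
      \<Longrightarrow> riesz_form \<gamma>' u u w w \<le> K * h1sq u * h1sq w"
    using riesz_form_diag[OF \<gamma>'(2)] by blast
  define H' where "H' = \<bar>H\<bar> + h1sq u + 1"
  have H': "0 < H'" using h1sq_nonneg[of u] unfolding H'_def by linarith
  have uH: "h1sq u \<le> H'" "ip u u \<le> H'" using kinetic_nonneg[of u] by (auto simp: H'_def h1sq_def)
  have wH: "h1sq (w n) \<le> H'" "ip (w n) (w n) \<le> H'" for n
    using w(2)[of n] kinetic_nonneg[of "w n"] h1sq_nonneg[of u] unfolding H'_def h1sq_def by linarith+
  define e where "e = (r / (4 * K * H'\<^sup>2)) powr (1 / (\<gamma>' - \<gamma>))"
  have e: "0 < e" "e powr (\<gamma>' - \<gamma>) = r / (4 * K * H'\<^sup>2)" using K H' r \<gamma>' by (auto simp: e_def powr_powr)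
  define R where "R = (r / (4 * H'\<^sup>2)) powr (- 1 / \<gamma>)"
  have R: "0 < R" "R powr (- \<gamma>) = r / (4 * H'\<^sup>2)" using H' r g0 by (auto simp: R_def powr_powr)
  have "(\<lambda>n. LINT x|lborel. (u x \<bullet> u x) * real_local_mass (w n) R x) \<longlonglongrightarrow> (LINT x::real^'n|lborel. 0)"
  proof (rule integral_dominated_convergence)
    show "integrable lborel (\<lambda>x. H' * (u x \<bullet> u x))" using u by simp
    show "AE x in lborel. (\<lambda>n. (u x \<bullet> u x) * real_local_mass (w n) R x) \<longlonglongrightarrow> 0"
      by (intro AE_I2 tendsto_mult_right_zero loc)
    show "AE x in lborel. norm ((u x \<bullet> u x) * real_local_mass (w n) R x) \<le> H' * (u x \<bullet> u x)" for n
    proof (intro AE_I2)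
      fix x
      have "real_local_mass (w n) R x \<le> H'" using real_local_mass_le[of "w n" R x] w wH[of n] by simp
      then have "(u x \<bullet> u x) * real_local_mass (w n) R x \<le> (u x \<bullet> u x) * H'" by (intro mult_left_mono) auto
      then show "norm ((u x \<bullet> u x) * real_local_mass (w n) R x) \<le> H' * (u x \<bullet> u x)"
        by (simp add: abs_mult mult.commute)
    qed
  qed measurable
  then have lim: "(\<lambda>n. LINT x|lborel. (u x \<bullet> u x) * real_local_mass (w n) R x) \<longlonglongrightarrow> 0" by simp
  have "0 < r / (4 * e powr (- \<gamma>))" using r e by simp
  with lim obtain n0 where n0: "\<And>n. n \<ge> n0 \<Longrightarrow> \<bar>LINT x|lborel. (u x \<bullet> u x) * real_local_mass (w n) R x\<bar>
      < r / (4 * e powr (- \<gamma>))"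
    unfolding LIMSEQ_def dist_real_def by auto
  have "norm (riesz_form \<gamma> u u (w n) (w n) - 0) < r" if n: "n \<ge> n0" for n
  proof -
    have "riesz_form \<gamma> u u (w n) (w n) \<le> e powr (\<gamma>' - \<gamma>) * riesz_form \<gamma>' u u (w n) (w n)
     + e powr (- \<gamma>) * (LINT x|lborel. (u x \<bullet> u x) * real_local_mass (w n) R x) + R powr (- \<gamma>) * ip u u
         * ip (w n) (w n)"
      by (rule riesz_form_split[OF adm \<gamma>'(2,1) u w(1) e(1) R(1)])
    also have "\<dots> \<le> e powr (\<gamma>' - \<gamma>) * (K * H' * H') + e powr (- \<gamma>) * (r / (4 * e powr (- \<gamma>))) + R powr (- \<gamma>)
        * (H' * H')"
    proof (intro add_mono mult_left_mono)
      have "riesz_form \<gamma>' u u (w n) (w n) \<le> K * h1sq u * h1sq (w n)" by (rule K(2)[OF u w(1)])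
      also have "\<dots> \<le> K * H' * H'" using K(1) uH wH H' by (intro mult_mono mult_left_mono) auto
      finally show "riesz_form \<gamma>' u u (w n) (w n) \<le> K * H' * H'" .
      show "(LINT x|lborel. (u x \<bullet> u x) * real_local_mass (w n) R x) \<le> r / (4 * e powr (- \<gamma>))"
        using n0[OF n] by (simp add: abs_less_iff)
      show "R powr (- \<gamma>) * ip u u * ip (w n) (w n) \<le> R powr (- \<gamma>) * (H' * H')"
        unfolding mult.assoc using uH wH H' by (intro mult_left_mono mult_mono) auto
    qed auto
    also have "\<dots> = r / 4 + r / 4 + r / 4"
      unfolding e(2) R(2) using K H' e by (simp add: power2_eq_square)
    finally show ?thesis using r riesz_form_nonneg[of \<gamma> u "w n"] by simp
  qed
  then show "\<exists>no. \<forall>n\<ge>no. norm (riesz_form \<gamma> u u (w n) (w n) - 0) < r" by blast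
qed

text \<open>Young's inequality with weight \<open>s\<close> sends each mixed term to a small
  multiple of the two pure products plus a large multiple of the products with \<open>v\<close> at
  one point and \<open>w\<close> at the other. The latter are the terms that vanish in the limit. In
  the constant, 3 = 1 + 2 comes from the cross squares and the term with both inner products, 2/s
  from two applications of Young.\<close>

lemma Brezis_Lieb_pointwise:
  fixes v w v' w' :: "'k::euclidean_space" and s :: real
  assumes s: "0 < s"
  shows "\<bar>((v + w) \<bullet> (v + w)) * ((v' + w') \<bullet> (v' + w')) - (v \<bullet> v) * (v' \<bullet> v') - (w \<bullet> w) * (w' \<bullet> w')\<bar>
    \<le> 2 * s * ((v \<bullet> v) * (v' \<bullet> v') + (w \<bullet> w) * (w' \<bullet> w'))
      + (3 + 2 / s) * ((v \<bullet> v) * (w' \<bullet> w') + (w \<bullet> w) * (v' \<bullet> v'))"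
proof -
  define a where "a = norm v" define b where "b = norm v'"
  define p where "p = norm w" define q where "q = norm w'"
  define \<alpha> where "\<alpha> = v \<bullet> w" define \<beta> where "\<beta> = v' \<bullet> w'"
  have nn: "0 \<le> a" "0 \<le> b" "0 \<le> p" "0 \<le> q" by (auto simp: a_def b_def p_def q_def)
  have \<alpha>: "\<bar>\<alpha>\<bar> \<le> a * p" and \<beta>: "\<bar>\<beta>\<bar> \<le> b * q"
    by (auto simp: \<alpha>_def \<beta>_def a_def b_def p_def q_def Cauchy_Schwarz_ineq2)
  have sq: "v \<bullet> v = a\<^sup>2" "v' \<bullet> v' = b\<^sup>2" "w \<bullet> w = p\<^sup>2" "w' \<bullet> w' = q\<^sup>2"
    by (simp_all add: a_def b_def p_def q_def power2_norm_eq_inner)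
  have young: "2 * (x * y) \<le> s * x\<^sup>2 + 1 / s * y\<^sup>2" for x y :: real
  proof -
    have "0 \<le> (s * x - y)\<^sup>2 / s" using s by simp
    also have "\<dots> = s * x\<^sup>2 + 1 / s * y\<^sup>2 - 2 * (x * y)" using s by (simp add: power2_eq_square field_simps)
    finally show ?thesis by simp
  qed
  have exp: "((v + w) \<bullet> (v + w)) * ((v' + w') \<bullet> (v' + w')) - (v \<bullet> v) * (v' \<bullet> v') - (w \<bullet> w) * (w' \<bullet> w')
     = a\<^sup>2 * q\<^sup>2 + p\<^sup>2 * b\<^sup>2 + 2 * (\<alpha> * b\<^sup>2) + 2 * (\<alpha> * q\<^sup>2) + 2 * (\<beta> * a\<^sup>2) + 2 * (\<beta> * p\<^sup>2) + 4 * (\<alpha> * \<beta>)"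
    by (simp add: inner_add sq inner_commute[of w v] inner_commute[of w' v'] \<alpha>_def[symmetric] \<beta>_def[symmetric]
        algebra_simps)
  have aux: "\<bar>2 * (\<alpha>' * c\<^sup>2)\<bar> \<le> 2 * (m * c\<^sup>2)" if "\<bar>\<alpha>'\<bar> \<le> m" for \<alpha>' m c :: real
    using mult_right_mono[OF that, of "c\<^sup>2"] by (simp add: abs_mult)
  have t1: "\<bar>2 * (\<alpha> * b\<^sup>2)\<bar> \<le> s * (a * b)\<^sup>2 + 1 / s * (p * b)\<^sup>2"
    by (rule order_trans[OF aux[OF \<alpha>] order_trans[OF eq_refl young[of "a * b" "p
        * b"]]]) (simp add: power2_eq_square mult_ac)
  have t2: "\<bar>2 * (\<alpha> * q\<^sup>2)\<bar> \<le> s * (p * q)\<^sup>2 + 1 / s * (a * q)\<^sup>2"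
    by (rule order_trans[OF aux[OF \<alpha>] order_trans[OF eq_refl young[of "p * q" "a
        * q"]]]) (simp add: power2_eq_square mult_ac)
  have t3: "\<bar>2 * (\<beta> * a\<^sup>2)\<bar> \<le> s * (a * b)\<^sup>2 + 1 / s * (a * q)\<^sup>2"
    by (rule order_trans[OF aux[OF \<beta>] order_trans[OF eq_refl young[of "a * b" "a
        * q"]]]) (simp add: power2_eq_square mult_ac)
  have t4: "\<bar>2 * (\<beta> * p\<^sup>2)\<bar> \<le> s * (p * q)\<^sup>2 + 1 / s * (p * b)\<^sup>2"
    by (rule order_trans[OF aux[OF \<beta>] order_trans[OF eq_refl young[of "p * q" "p
        * b"]]]) (simp add: power2_eq_square mult_ac)
  have t5: "\<bar>4 * (\<alpha> * \<beta>)\<bar> \<le> 2 * ((a * q)\<^sup>2 + (p * b)\<^sup>2)"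
  proof -
    have "\<bar>\<alpha> * \<beta>\<bar> \<le> (a * p) * (b * q)" unfolding abs_mult by (intro mult_mono \<alpha> \<beta>) (auto simp: nn)
    then show ?thesis using sum_squares_bound[of "a * q" "p * b"] by (simp add: mult_ac)
  qed
  have "\<bar>a\<^sup>2 * q\<^sup>2 + p\<^sup>2 * b\<^sup>2 + 2 * (\<alpha> * b\<^sup>2) + 2 * (\<alpha> * q\<^sup>2) + 2 * (\<beta> * a\<^sup>2) + 2 * (\<beta> * p\<^sup>2) + 4 * (\<alpha> * \<beta>)\<bar>
    \<le> (a * q)\<^sup>2 + (p * b)\<^sup>2 + (s * (a * b)\<^sup>2 + 1 / s * (p * b)\<^sup>2) + (s * (p * q)\<^sup>2 + 1 / s * (a * q)\<^sup>2)
      + (s * (a * b)\<^sup>2 + 1 / s * (a * q)\<^sup>2) + (s * (p * q)\<^sup>2 + 1 / s * (p * b)\<^sup>2)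
          + 2 * ((a * q)\<^sup>2 + (p * b)\<^sup>2)"
  proof -
    have tri: "\<bar>z + z' + x1 + x2 + x3 + x4 + x5\<bar> \<le> z + z' + y1 + y2 + y3 + y4 + y5"
      if "0 \<le> z" "0 \<le> z'" "\<bar>x1\<bar> \<le> y1" "\<bar>x2\<bar> \<le> y2" "\<bar>x3\<bar> \<le> y3" "\<bar>x4\<bar> \<le> y4" "\<bar>x5\<bar> \<le> y5"
      for z z' x1 x2 x3 x4 x5 y1 y2 y3 y4 y5 :: real
      using that by linarith
    have "a\<^sup>2 * q\<^sup>2 = (a * q)\<^sup>2" "p\<^sup>2 * b\<^sup>2 = (p * b)\<^sup>2" by (simp_all add: power_mult_distrib)
    then show ?thesis using tri[OF zero_le_power2 zero_le_power2 t1 t2 t3 t4 t5, of "a * q" "p * b"] by simp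
  qed
  also have "\<dots> = 2 * s * (a\<^sup>2 * b\<^sup>2 + p\<^sup>2 * q\<^sup>2) + (3 + 2 / s) * (a\<^sup>2 * q\<^sup>2 + p\<^sup>2 * b\<^sup>2)"
    by (simp add: power_mult_distrib algebra_simps)
  finally show ?thesis by (subst exp, unfold sq)
qed

lemma Brezis_Lieb_riesz_form:
  fixes v :: "real^'n::finite \<Rightarrow> 'k::euclidean_space"
  assumes adm: "admissible TYPE('n) \<gamma>" and v: "v \<in> H1" and w: "\<And>n. w n \<in> H1" "\<And>n. h1sq (w n) \<le> H"
    and lim: "(\<lambda>n. riesz_form \<gamma> v v (w n) (w n)) \<longlonglongrightarrow> 0"
  shows "(\<lambda>n. riesz_form \<gamma> (\<lambda>x. v x + w n x) (\<lambda>x. v x + w n x) (\<lambda>x. v x + w n x) (\<lambda>x. v x + w n x)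
      - riesz_form \<gamma> v v v v - riesz_form \<gamma> (w n) (w n) (w n) (w n)) \<longlonglongrightarrow> 0" (is "(\<lambda>n. ?d n) \<longlonglongrightarrow> 0")
proof (rule LIMSEQ_I)
  fix r :: real assume r: "0 < r"
  obtain K where K: "0 < K" "\<And>u w :: real^'n \<Rightarrow> 'k. u \<in> H1 \<Longrightarrow> w \<in> H1
      \<Longrightarrow> riesz_form \<gamma> u u w w \<le> K * h1sq u * h1sq w"
    using riesz_form_diag[OF adm] by blast
  define B where "B = riesz_form \<gamma> v v v v + K * \<bar>H\<bar> * \<bar>H\<bar> + 1"
  have B: "0 < B" unfolding B_def using K by (intro add_nonneg_pos add_nonneg_nonneg) auto
  have DB: "riesz_form \<gamma> v v v v + riesz_form \<gamma> (w n) (w n) (w n) (w n) \<le> B" for n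
  proof -
    have "riesz_form \<gamma> (w n) (w n) (w n) (w n) \<le> K * h1sq (w n) * h1sq (w n)" by (rule K(2)[OF w(1) w(1)])
    also have "\<dots> \<le> K * \<bar>H\<bar> * \<bar>H\<bar>" using K(1) w(2)[of n] by (intro mult_mono mult_left_mono) auto
    finally show ?thesis by (simp add: B_def)
  qed
  \<comment> \<open>Half of the tolerance pays for the pure terms, bounded by \<open>B\<close>; the
    other half pays for the mixed form, whose large constant is harmless because the form tends to
    zero.\<close>
  define s where "s = r / (4 * B)"
  have s: "0 < s" using r B by (simp add: s_def)
  define C where "C = (3 + 2 / s) * 2"
  have C: "0 < C" unfolding C_def using s by (intro mult_pos_pos add_pos_pos) auto
  have "0 < r / (2 * C)" using r C by simp
  with lim obtain n0 where n0: "\<And>n. n \<ge> n0 \<Longrightarrow> \<bar>riesz_form \<gamma> v v (w n) (w n)\<bar> < r / (2 * C)"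
    unfolding LIMSEQ_def dist_real_def by auto
  have "norm (?d n - 0) < r" if n: "n \<ge> n0" for n
  proof -
    note int = riesz_diag_integrable[OF adm v v] riesz_diag_integrable[OF adm w(1) w(1), of n n]
      riesz_diag_integrable[OF adm v w(1), of n] riesz_diag_integrable[OF adm w(1) v, of n]
      riesz_diag_integrable[OF adm H1_add[OF v w(1)] H1_add[OF v w(1)], of n n]
    have "\<bar>?d n\<bar> = \<bar>LINT z|lborel2. riesz_integrand \<gamma> (\<lambda>x. v x + w n x) (\<lambda>x. v x + w n x) (\<lambda>x. v x
        + w n x) (\<lambda>x. v x + w n x) z
      - riesz_integrand \<gamma> v v v v z - riesz_integrand \<gamma> (w n) (w n) (w n) (w n) z\<bar>"
      unfolding riesz_form_def using int by simp
    also have "\<dots> \<le> (LINT z|lborel2. \<bar>riesz_integrand \<gamma> (\<lambda>x. v x + w n x) (\<lambda>x. v x + w n x) (\<lambda>x. v x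
        + w n x) (\<lambda>x. v x + w n x) z
      - riesz_integrand \<gamma> v v v v z - riesz_integrand \<gamma> (w n) (w n) (w n) (w n) z\<bar>)"
      by (rule integral_abs_bound)
    also have "\<dots> \<le> (LINT z|lborel2. 2 * s * (riesz_integrand \<gamma> v v v v z
        + riesz_integrand \<gamma> (w n) (w n) (w n) (w n) z)
      + (3 + 2 / s) * (riesz_integrand \<gamma> v v (w n) (w n) z + riesz_integrand \<gamma> (w n) (w n) v v z))"
    proof (rule integral_mono)
      fix z
      show "\<bar>riesz_integrand \<gamma> (\<lambda>x. v x + w n x) (\<lambda>x. v x + w n x) (\<lambda>x. v x + w n x) (\<lambda>x. v x + w n x) z
      - riesz_integrand \<gamma> v v v v z - riesz_integrand \<gamma> (w n) (w n) (w n) (w n) z\<bar>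
       \<le> 2 * s * (riesz_integrand \<gamma> v v v v z + riesz_integrand \<gamma> (w n) (w n) (w n) (w n) z)
      + (3 + 2 / s) * (riesz_integrand \<gamma> v v (w n) (w n) z + riesz_integrand \<gamma> (w n) (w n) v v z)"
        using mult_right_mono[OF Brezis_Lieb_pointwise[OF s, of "v (fst z)" "w n (fst z)" "v (snd z)" "w n
            (snd z)"] riesz_kernel_nonneg[of \<gamma> z]]
        unfolding riesz_integrand_def left_diff_distrib[symmetric] distrib_right[symmetric]
            mult.assoc[symmetric] abs_mult
        by (simp add: distrib_right mult.assoc)
    qed (use int in auto)
    also have "\<dots> = 2 * s * (riesz_form \<gamma> v v v v + riesz_form \<gamma> (w n) (w n) (w n) (w n))
       + (3 + 2 / s) * (riesz_form \<gamma> v v (w n) (w n) + riesz_form \<gamma> (w n) (w n) v v)"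
      unfolding riesz_form_def using int by simp
    also have "\<dots> = 2 * s * (riesz_form \<gamma> v v v v + riesz_form \<gamma> (w n) (w n) (w n) (w n))
        + C * riesz_form \<gamma> v v (w n) (w n)"
      using riesz_form_swap[OF adm w(1) w(1) v v, of n n] by (simp add: C_def)
    also have "\<dots> \<le> 2 * s * B + C * riesz_form \<gamma> v v (w n) (w n)"
      using DB[of n] s by (intro add_right_mono mult_left_mono) auto
    also have "\<dots> < r / 2 + r / 2"
    proof (rule add_le_less_mono)
      show "2 * s * B \<le> r / 2" using B by (simp add: s_def)
      have "C * riesz_form \<gamma> v v (w n) (w n) < C * (r / (2 * C))"
        using n0[OF n] C by (intro mult_strict_left_mono) auto
      then show "C * riesz_form \<gamma> v v (w n) (w n) < r / 2" using C by simp
    qed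
    finally show ?thesis by simp
  qed
  then show "\<exists>no. \<forall>n\<ge>no. norm (?d n - 0) < r" by blast
qed

section \<open>Local compactness\<close>

lemma sq_indicator_ball [simp]: "sq (indicator (ball x r) :: real^'n::finite \<Rightarrow> real)"
proof (rule sq_bounded_support)
  show "(indicator (ball x r) :: real^'n \<Rightarrow> real) \<in> borel_measurable borel"
      by (intro borel_measurable_indicator) simp
  show "norm (indicator (ball x r) y :: real) \<le> 1" for y by (simp add: indicator_def)
  show "indicator (ball x r) y = (0::real)" if "norm x + \<bar>r\<bar> \<le> norm y" for y
  proof -
    have "r \<le> dist x y" using that norm_triangle_ineq2[of y x] by (simp add: dist_norm norm_minus_commute)
    then show ?thesis by simp
  qed
qed

lemma measure_ball_pos: "0 < r \<Longrightarrow> 0 < measure lborel (ball (x::'a::euclidean_space) r)"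
  using content_ball_pos[of r x] by simp

lemma ip_indicator_ball: "ip (indicator (ball x r)) (indicator (ball x r) :: real^'n::finite \<Rightarrow> real)
    = measure lborel (ball x r)"
proof -
  have "ip (indicator (ball x r)) (indicator (ball x r) :: real^'n \<Rightarrow> real)
      = (LINT y|lborel. indicator (ball x r) y)"
    unfolding ip_def by (intro Bochner_Integration.integral_cong) (auto simp: indicator_def)
  then show ?thesis by simp
qed

text \<open>Rellich's theorem by averaging. Integrals over balls of a fixed radius tend to zero
  pointwise by weak convergence and are uniformly bounded, hence tend to zero in L2 locally; the
  translation bound controls the distance between \<open>w n\<close> and its averages.\<close>

lemma weak_null_locally_null_real:
  fixes w :: "nat \<Rightarrow> real^'n::finite \<Rightarrow> real"
  assumes w: "\<And>n. sq (w n)" and weak: "wconv w (\<lambda>x. 0)" and M: "\<And>n. ip (w n) (w n) \<le> M"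
    and A: "\<And>n h. ip (\<lambda>x. w n (x + h) - w n x) (\<lambda>x. w n (x + h) - w n x) \<le> (norm h)\<^sup>2 * A"
  shows "(\<lambda>n. real_local_mass (w n) R z) \<longlonglongrightarrow> 0"
proof (rule LIMSEQ_I)
  fix e :: real assume e: "0 < e"
  have [measurable]: "w n \<in> borel_measurable borel" for n using w by measurable
  have M0: "0 \<le> M" using M[of 0] ip_nonneg[of "w 0"] by linarith
  have A0: "0 \<le> A"
  proof -
    have "0 \<le> (norm (axis undefined 1 :: real^'n))\<^sup>2 * A" by (rule order_trans[OF ip_nonneg A[of 0]])
    then show ?thesis by simp
  qed
  \<comment> \<open>Averaging radius for which the averaging error r (M + A) / 2 stays below e/2;
    adding 1 avoids division by zero.\<close>
  define r where "r = e / (M + A + 1)"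
  have r: "0 < r" using e M0 A0 by (simp add: r_def)
  have rMA: "r * (M + A) / 2 < e / 2"
    using e M0 A0 by (simp add: r_def field_simps)
  define V where "V = measure lborel (ball (0::real^'n) r)"
  have V: "0 < V" "measure lborel (ball x r) = V" for x :: "real^'n"
    using measure_ball_pos[OF r, of "0::real^'n"] content_ball_conv_unit_ball[of r "0::real^'n"]
      content_ball_conv_unit_ball[of r x] r by (auto simp: V_def)
  define g where "g n x = indicator (ball z R) x * w n x" for n x
  define W where "W n x = (LINT y|lborel. indicator (ball x r) y * w n y)" for n x
  define k where "k n x = indicator (ball z R) x * W n x" for n x
  have W_ip: "W n x = ip (indicator (ball x r)) (w n)" for n x by (simp add: W_def ip_def)
  have [measurable]: "g n \<in> borel_measurable borel" for n
    unfolding g_def by (intro borel_measurable_times borel_measurable_indicator) auto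
  have [measurable]: "W n \<in> borel_measurable borel" for n
  proof -
    have "(\<lambda>x. LINT y|lborel. (\<lambda>x y. indicator (ball x r) y * w n y) x y) \<in> borel_measurable lborel"
    proof (rule lborel.borel_measurable_lebesgue_integral)
      show "(\<lambda>(x, y). indicator (ball x r) y * w n y) \<in> borel_measurable lborel2"
        unfolding case_prod_beta' by measurable
    qed
    then show ?thesis by (simp add: W_def[abs_def])
  qed
  have [measurable]: "k n \<in> borel_measurable borel" for n
    unfolding k_def by (intro borel_measurable_times borel_measurable_indicator) auto
  have sqg: "sq (g n)" for n
    by (rule sq_dominated[OF w[of n], of _ 1]) (auto simp: g_def indicator_def)
  have gM: "ip (g n) (g n) \<le> M" for n
  proof -
    have "ip (g n) (g n) \<le> ip (w n) (w n)"
      unfolding ip_def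
      by (rule integral_mono[OF sq_integrable[OF sqg] sq_integrable[OF w]]) (auto simp: g_def indicator_def)
    then show ?thesis using M[of n] by simp
  qed
  have lm: "real_local_mass (w n) R z = ip (g n) (w n)" for n
    by (simp add: real_local_mass_def ip_def g_def mult.assoc)
  have W_bound: "(W n x)\<^sup>2 \<le> V * M" for n x
  proof -
    have "(W n x)\<^sup>2 \<le> V * ip (w n) (w n)"
      unfolding W_ip using ip_Cauchy_Schwarz[OF sq_indicator_ball[of x r] w[of n]]
          by (simp add: ip_indicator_ball V)
    also have "\<dots> \<le> V * M" using M[of n] V(1) by (intro mult_left_mono) auto
    finally show ?thesis .
  qed
  have sqk: "sq (k n)" for n
  proof (rule sq_dominated[OF sq_indicator_ball[of z R], of _ "sqrt (V * M)"])
    fix x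
    have "\<bar>W n x\<bar> \<le> sqrt (V * M)" using W_bound[of n x] by (metis real_sqrt_abs real_sqrt_le_iff)
    then show "norm (k n x) \<le> sqrt (V * M) * norm (indicator (ball z R) x :: real)"
      by (simp add: k_def abs_mult indicator_def)
  qed measurable
  have k_lim: "(\<lambda>n. ip (k n) (k n)) \<longlonglongrightarrow> 0"
  proof -
    have "(\<lambda>n. LINT x|lborel. k n x \<bullet> k n x) \<longlonglongrightarrow> (LINT x::real^'n|lborel. 0)"
    proof (rule integral_dominated_convergence)
      show "integrable lborel (\<lambda>x. (V * M) * indicator (ball z R) x)"
        using emeasure_lborel_ball_finite[of z R] by (simp add: less_top)
      show "AE x in lborel. (\<lambda>n. k n x \<bullet> k n x) \<longlonglongrightarrow> 0"
      proof (intro AE_I2)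
        fix x
        have "(\<lambda>n. ip (w n) (indicator (ball x r))) \<longlonglongrightarrow> ip (\<lambda>x. 0) (indicator (ball x r) :: real^'n \<Rightarrow> real)"
          using weak sq_indicator_ball unfolding wconv_def by blast
        then have "(\<lambda>n. W n x) \<longlonglongrightarrow> 0" by (simp add: W_ip ip_commute[of "indicator (ball x r)"] ip_def[of "\<lambda>x.
            0"])
        then have "(\<lambda>n. k n x) \<longlonglongrightarrow> indicator (ball z R) x * 0" unfolding k_def by (intro tendsto_intros)
        from tendsto_mult[OF this this] show "(\<lambda>n. k n x \<bullet> k n x) \<longlonglongrightarrow> 0" by simp
      qed
      show "AE x in lborel. norm (k n x \<bullet> k n x) \<le> (V * M) * indicator (ball z R) x" for n
        using W_bound[of n] by (auto intro!: AE_I2 simp: k_def indicator_def power2_eq_square)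
    qed measurable
    then show ?thesis by (simp add: ip_def)
  qed
  \<comment> \<open>The local mass is \<open>ip (g n) (w n)\<close>. Replacing \<open>w n\<close> by
    its translates, at a cost bounded by Young's inequality, and integrating over |h| < r produces
    by Fubini the pairing with the unnormalised average \<open>W n\<close>; the factor
    \<open>V\<close> stands for the missing normalisation.\<close>
  have main: "V * real_local_mass (w n) R z \<le> ip (g n) (k n) + V * (r * (M + A) / 2)" for n
  proof -
    define Z where "Z p = indicator (ball 0 r) (fst p)
        * (g n (snd p) * w n (snd p + fst p))" for p :: "(real^'n) \<times> (real^'n)"
    have Zm [measurable]: "Z \<in> borel_measurable lborel2"
    proof -
      have [measurable]: "(indicator (ball 0 r) :: real^'n \<Rightarrow> real) \<in> borel_measurable borel"
        by (intro borel_measurable_indicator) simp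
      show ?thesis unfolding Z_def by measurable
    qed
    have intZ: "integrable lborel2 Z"
    proof (rule lborel_pair.Fubini_integrable[OF Zm])
      have int1: "integrable lborel (\<lambda>x. g n x * w n (x + h))" for h
        using integrable_inner[OF sqg[of n] sq_translate[OF w[of n], of h]] by simp
      show "AE h in lborel. integrable lborel (\<lambda>x. Z (h, x))"
        unfolding Z_def using int1 by (auto intro!: AE_I2)
      show "integrable lborel (\<lambda>h. LINT x|lborel. norm (Z (h, x)))"
      proof (rule Bochner_Integration.integrable_bound)
        show "integrable lborel (\<lambda>h::real^'n. M * indicator (ball 0 r) h)"
          using emeasure_lborel_ball_finite[of "0::real^'n" r] by (simp add: less_top)
        show "AE h in lborel. norm (LINT x|lborel. norm (Z (h, x))) \<le> norm (M * indicator (ball 0 r) h)"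
        proof (intro AE_I2)
          fix h :: "real^'n"
          have "(LINT x|lborel. \<bar>g n x * w n (x + h)\<bar>)
              \<le> (LINT x|lborel. g n x \<bullet> g n x / 2 + w n (x + h) \<bullet> w n (x + h) / 2)"
          proof (rule integral_mono)
            show "integrable lborel (\<lambda>x. \<bar>g n x * w n (x + h)\<bar>)" using int1 by (intro integrable_abs)
            show "integrable lborel (\<lambda>x. g n x \<bullet> g n x / 2 + w n (x + h) \<bullet> w n (x + h) / 2)"
              by (intro Bochner_Integration.integrable_add integrable_divide sq_integrable[OF sqg]
                  sq_integrable[OF sq_translate[OF w]])
            show "\<bar>g n x * w n (x + h)\<bar> \<le> g n x \<bullet> g n x / 2 + w n (x + h) \<bullet> w n (x + h) / 2" for x
              using abs_inner_le_squares[of "g n x" "w n (x + h)"] by simp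
          qed
          also have "\<dots> = ip (g n) (g n) / 2 + ip (\<lambda>x. w n (x + h)) (\<lambda>x. w n (x + h)) / 2"
            unfolding ip_def using sqg w sq_integrable[OF sq_translate[OF w[of n], of h]] sq_integrable[OF
                sqg[of n]]
            by (subst Bochner_Integration.integral_add) auto
          also have "\<dots> \<le> M" using gM[of n] M[of n] w by (simp add: ip_translate)
          finally have "(LINT x|lborel. \<bar>g n x * w n (x + h)\<bar>) \<le> M" .
          then show "norm (LINT x|lborel. norm (Z (h, x))) \<le> norm (M * indicator (ball 0 r) h)"
            using M0 by (auto simp: Z_def indicator_def)
        qed
      qed measurable
    qed
    have lhs: "(LINT x|lborel. Z (h, x)) = indicator (ball 0 r) h * ip (g n) (\<lambda>x. w n (x + h))" for h
      by (simp add: Z_def ip_def)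
    have "(LINT h|lborel. LINT x|lborel. Z (h, x)) = (LINT x|lborel. LINT h|lborel. Z (h, x))"
      using lborel_pair.Fubini_integral[of "\<lambda>h x. Z (h, x)"] intZ by simp
    also have "\<dots> = (LINT x|lborel. g n x * W n x)"
    proof (rule Bochner_Integration.integral_cong[OF refl])
      fix x
      have "(LINT h|lborel. Z (h, x)) = g n x * (LINT h|lborel. indicator (ball 0 r) h * w n (x + h))"
        unfolding Z_def by (simp add: mult.left_commute[of "indicator _ _"])
      also have "(LINT h|lborel. indicator (ball 0 r) h * w n (x + h)) = W n x"
      proof -
        have "W n x = \<bar>1\<bar> ^ DIM(real^'n) *\<^sub>R (LINT h|lborel. indicator (ball x r) (x + 1 *\<^sub>R h)
            * w n (x + 1 *\<^sub>R h))"
          unfolding W_def by (rule lborel_integral_affine) (auto intro!: borel_measurable_times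
              borel_measurable_indicator)
        then show ?thesis by (simp add: indicator_def dist_norm)
      qed
      finally show "(LINT h|lborel. Z (h, x)) = g n x * W n x" .
    qed
    also have "\<dots> = ip (g n) (k n)"
      unfolding ip_def by (intro Bochner_Integration.integral_cong) (auto simp: g_def k_def indicator_def)
    finally have Fub: "(LINT h|lborel. indicator (ball 0 r) h * ip (g n) (\<lambda>x. w n (x + h))) = ip (g n) (k n)"
      by (simp add: lhs)
    have int_h: "integrable lborel (\<lambda>h. indicator (ball 0 r) h * ip (g n) (\<lambda>x. w n (x + h)))"
      using lborel_pair.integrable_fst'[OF intZ] by (simp add: lhs)
    have ind: "integrable lborel (\<lambda>h::real^'n. indicator (ball 0 r) h
        * c)" "(LINT h|lborel. indicator (ball (0::real^'n) r) h * c) = V * c" for c :: real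
      using emeasure_lborel_ball_finite[of "0::real^'n" r] by (simp_all add: less_top V_def)
    have "V * real_local_mass (w n) R z = (LINT h|lborel. indicator (ball (0::real^'n) r) h
        * real_local_mass (w n) R z)"
      by (simp add: V_def)
    also have "\<dots> \<le> (LINT h|lborel. indicator (ball 0 r) h * ip (g n) (\<lambda>x. w n (x + h))
        + indicator (ball 0 r) h * (r * (M + A) / 2))"
    proof (rule integral_mono)
      show "integrable lborel (\<lambda>h::real^'n. indicator (ball 0 r) h * real_local_mass (w n) R z)" by (rule ind)
      show "integrable lborel (\<lambda>h. indicator (ball 0 r) h * ip (g n) (\<lambda>x. w n (x + h))
          + indicator (ball 0 r) h * (r * (M + A) / 2))"
        by (intro Bochner_Integration.integrable_add int_h ind)
      fix h :: "real^'n"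
      show "indicator (ball 0 r) h * real_local_mass (w n) R z \<le> indicator (ball 0 r) h
          * ip (g n) (\<lambda>x. w n (x + h)) + indicator (ball 0 r) h * (r * (M + A) / 2)"
      proof (cases "norm h < r")
        case True
        have "\<bar>ip (g n) (\<lambda>x. w n (x + h) - w n x)\<bar> \<le> r / 2 * ip (g n) (g n) + 1 / (2 * r)
            * ip (\<lambda>x. w n (x + h) - w n x) (\<lambda>x. w n (x + h) - w n x)"
          using sqg w r by (intro ip_young) auto
        also have "\<dots> \<le> r / 2 * M + 1 / (2 * r) * (r\<^sup>2 * A)"
        proof (intro add_mono mult_left_mono gM)
          have "(norm h)\<^sup>2 * A \<le> r\<^sup>2 * A" using True A0 by (intro mult_right_mono power_mono) auto
          then show "ip (\<lambda>x. w n (x + h) - w n x) (\<lambda>x. w n (x + h) - w n x) \<le> r\<^sup>2 * A" using A[of n h]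
              by linarith
        qed (use r in auto)
        also have "\<dots> = r * (M + A) / 2" using r by (simp add: power2_eq_square field_simps)
        finally have "ip (g n) (w n) \<le> ip (g n) (\<lambda>x. w n (x + h)) + r * (M + A) / 2"
          using ip_diff_right[OF sq_translate[OF w[of n], of h] w[of n] sqg[of n]] by linarith
        then show ?thesis using True by (simp add: lm)
      qed simp
    qed
    also have "\<dots> = ip (g n) (k n) + V * (r * (M + A) / 2)"
      by (simp only: Bochner_Integration.integral_add[OF int_h ind(1)] Fub ind(2))
    finally show ?thesis .
  qed
  \<comment> \<open>Weight for Young's inequality: the part proportional to \<open>M\<close> costs
    at most V e / 4, and the rest is paid by the convergence of \<open>k n\<close> to zero.\<close>
  define s where "s = V * e / (2 * (M + 1))"
  have s: "0 < s" using V(1) e M0 by (simp add: s_def)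
  have "0 < s * (V * e / 2)" using s V(1) e by simp
  then obtain n0 where n0: "\<And>n. n \<ge> n0 \<Longrightarrow> \<bar>ip (k n) (k n)\<bar> < s * (V * e / 2)"
    using LIMSEQ_D[OF k_lim] unfolding diff_zero real_norm_def by blast
  have "norm (real_local_mass (w n) R z - 0) < e" if n: "n \<ge> n0" for n
  proof -
    have "ip (g n) (k n) \<le> s / 2 * ip (g n) (g n) + 1 / (2 * s) * ip (k n) (k n)"
      using ip_young[OF sqg sqk s, of n n] by linarith
    also have "\<dots> \<le> s / 2 * M + 1 / (2 * s) * (s * (V * e / 2))"
      using n0[OF n] s by (intro add_mono mult_left_mono gM) auto
    also have "\<dots> \<le> V * e / 4 + V * e / 4"
    proof (rule add_mono)
      have "s * M \<le> s * (M + 1)" using s by (intro mult_left_mono) auto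
      also have "\<dots> = V * e / 2" using M0 by (simp add: s_def field_simps)
      finally show "s / 2 * M \<le> V * e / 4" by (simp add: mult.commute)
    qed (use s in simp)
    finally have "V * real_local_mass (w n) R z \<le> V * (e / 2) + V * (r * (M + A) / 2)" using main[of n]
        by simp
    also have "\<dots> < V * (e / 2) + V * (e / 2)" using rMA V(1)
        by (intro add_strict_left_mono mult_strict_left_mono) auto
    also have "\<dots> = V * e" by simp
    finally have "real_local_mass (w n) R z < e" using V(1) by simp
    then show ?thesis by simp
  qed
  then show "\<exists>no. \<forall>n\<ge>no. norm (real_local_mass (w n) R z - 0) < e" by blast
qed

lemma weak_null_locally_null:
  fixes w :: "nat \<Rightarrow> real^'n::finite \<Rightarrow> 'k::euclidean_space"
  assumes w: "\<And>n. sq (w n)" and weak: "wconv w (\<lambda>x. 0)" and M: "\<And>n. ip (w n) (w n) \<le> M"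
    and A: "\<And>n h. ip (\<lambda>x. w n (x + h) - w n x) (\<lambda>x. w n (x + h) - w n x) \<le> (norm h)\<^sup>2 * A"
  shows "(\<lambda>n. real_local_mass (w n) R z) \<longlonglongrightarrow> 0"
proof -
  have comp_le: "ip (\<lambda>x. f x \<bullet> b) (\<lambda>x. f x \<bullet> b) \<le> ip f f" if "sq f" "b \<in> Basis" for b and f :: "real^'n \<Rightarrow> 'k"
    unfolding ip_components[OF that(1) that(1)]
    by (rule member_le_sum[OF that(2), of "\<lambda>b. ip (\<lambda>x. f x \<bullet> b) (\<lambda>x. f x \<bullet> b)"]) auto
  have lim: "(\<lambda>n. real_local_mass (\<lambda>x. w n x \<bullet> b) R z) \<longlonglongrightarrow> 0" if b: "b \<in> Basis" for b
  proof (rule weak_null_locally_null_real)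
    show "wconv (\<lambda>n x. w n x \<bullet> b) (\<lambda>x. 0)"
      unfolding wconv_def
    proof (intro allI impI)
      fix \<phi> :: "real^'n \<Rightarrow> real" assume "sq \<phi>"
      then have "(\<lambda>n. ip (w n) (\<lambda>x. \<phi> x *\<^sub>R b)) \<longlonglongrightarrow> ip (\<lambda>x. 0) (\<lambda>x. \<phi> x *\<^sub>R b)"
        using weak by (simp add: wconv_def)
      then show "(\<lambda>n. ip (\<lambda>x. w n x \<bullet> b) \<phi>) \<longlonglongrightarrow> ip (\<lambda>x. 0) \<phi>"
        by (simp add: ip_def mult.commute)
    qed
    show "ip (\<lambda>x. w n x \<bullet> b) (\<lambda>x. w n x \<bullet> b) \<le> M" for n
      using comp_le[OF w b, of n] M[of n] by linarith
    show "ip (\<lambda>x. w n (x + h) \<bullet> b - w n x \<bullet> b) (\<lambda>x. w n (x + h) \<bullet> b - w n x \<bullet> b) \<le> (norm h)\<^sup>2 * A" for n h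
      using comp_le[OF sq_diff[OF sq_translate[OF w] w] b, of n h n] A[of n h] by (simp add: inner_diff_left)
  qed (use w in auto)
  have "real_local_mass (w n) R z = (\<Sum>b\<in>Basis. real_local_mass (\<lambda>x. w n x \<bullet> b) R z)" for n
  proof -
    have "real_local_mass (w n) R z = (LINT y|lborel. (\<Sum>b\<in>Basis. indicator (ball z R) y
        * ((w n y \<bullet> b) \<bullet> (w n y \<bullet> b))))"
      unfolding real_local_mass_def by (subst euclidean_inner) (simp add: sum_distrib_left)
    also have "\<dots> = (\<Sum>b\<in>Basis. real_local_mass (\<lambda>x. w n x \<bullet> b) R z)"
      unfolding real_local_mass_def using w
      by (intro Bochner_Integration.integral_sum real_local_mass_integrable sq_inner) auto
    finally show ?thesis .
  qed
  moreover have "(\<lambda>n. \<Sum>b\<in>Basis. real_local_mass (\<lambda>x. w n x \<bullet> b) R z) \<longlonglongrightarrow> (\<Sum>b\<in>(Basis::'k set). 0)"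
    by (intro tendsto_sum lim)
  ultimately show ?thesis by simp
qed

section \<open>Splitting of norms along weakly convergent sequences\<close>

lemma wconv_diff_null:
  fixes g :: "real^'n::finite \<Rightarrow> 'k::euclidean_space"
  assumes "wconv f g" "\<And>n. sq (f n)" "sq g"
  shows "wconv (\<lambda>n x. f n x - g x) (\<lambda>x. 0)"
  unfolding wconv_def
proof (intro allI impI)
  fix \<phi> :: "real^'n \<Rightarrow> 'k" assume \<phi>: "sq \<phi>"
  have "(\<lambda>n. ip (f n) \<phi> - ip g \<phi>) \<longlonglongrightarrow> 0"
    using assms(1) \<phi> unfolding wconv_def by (intro LIM_zero) blast
  then show "(\<lambda>n. ip (\<lambda>x. f n x - g x) \<phi>) \<longlonglongrightarrow> ip (\<lambda>x. 0) \<phi>"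
    using assms \<phi> by (simp add: ip_diff_left ip_def[of "\<lambda>x. 0"])
qed

lemma wconv_norm_split:
  assumes w: "wconv f g" and sq: "\<And>n. sq (f n)" "sq g"
  shows "(\<lambda>n. ip (f n) (f n) - ip g g - ip (\<lambda>x. f n x - g x) (\<lambda>x. f n x - g x)) \<longlonglongrightarrow> 0"
proof -
  have "(\<lambda>n. 2 * ip (f n) g - 2 * ip g g) \<longlonglongrightarrow> 2 * ip g g - 2 * ip g g"
    using w sq(2) unfolding wconv_def by (intro tendsto_intros) blast
  then show ?thesis using sq by (simp add: ip_self_diff)
qed

text \<open>The conclusion records the asymptotic additivity of mass and kinetic energy and the
  local decay of the remainder, which is the form in which weak convergence is used by the splitting
  of all functionals.\<close>

theorem H1_weakly_compact:
  fixes u :: "nat \<Rightarrow> real^'n::finite \<Rightarrow> 'k::euclidean_space"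
  assumes u: "\<And>n. u n \<in> H1" and H: "\<And>n. h1sq (u n) \<le> H"
  shows "\<exists>r v. strict_mono r \<and> v \<in> H1 \<and>
     (\<lambda>n. ip (u (r n)) (u (r n)) - ip v v - ip (\<lambda>x. u (r n) x - v x) (\<lambda>x. u (r n) x - v x)) \<longlonglongrightarrow> 0 \<and>
     (\<lambda>n. kinetic (u (r n)) - kinetic v - kinetic (\<lambda>x. u (r n) x - v x)) \<longlonglongrightarrow> 0 \<and>
     (\<forall>R z. (\<lambda>n. real_local_mass (\<lambda>x. u (r n) x - v x) R z) \<longlonglongrightarrow> 0)"
proof -
  have bound: "ip (u n) (u n) \<le> H" "kinetic (u n) \<le> H" for n
    using H[of n] kinetic_nonneg[of "u n"] ip_nonneg[of "u n"] unfolding h1sq_def by linarith+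
  obtain r1 v where r1: "strict_mono r1" and v: "sq v" "wconv (\<lambda>n. u (r1 n)) v"
    using L2_weakly_compact[of u H] u bound(1) by auto
  obtain r2 G where r2: "strict_mono r2" and G: "sq G" "wconv (\<lambda>n. weak_gradient (u (r1 (r2 n)))) G"
    using L2_weakly_compact[of "\<lambda>n. weak_gradient (u (r1 n))" H] u bound(2) by (auto simp: kinetic_def)
  define r where "r = r1 \<circ> r2"
  have r: "strict_mono r" unfolding r_def by (rule strict_mono_o[OF r1 r2])
  define f where "f n = u (r n)" for n
  have f: "f n \<in> H1" for n using u by (simp add: f_def)
  have wf: "wconv f v" using wconv_subseq[OF v(2) r2] by (simp add: f_def[abs_def] r_def)
  have wG: "wconv (\<lambda>n. weak_gradient (f n)) G" using G(2) by (simp add: f_def[abs_def] r_def)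
  have hg: "has_gradient v G"
    by (rule has_gradient_wconv[OF has_gradient_weak_gradient[OF f] v(1) G(1) wf wG])
  have vH1: "v \<in> H1" using hg by (auto simp: H1_iff)
  have diffH1: "(\<lambda>x. f n x - v x) \<in> H1" for n using f vH1 by simp
  have kin_diff: "kinetic (\<lambda>x. f n x - v x) = ip (\<lambda>x. weak_gradient (f n) x - G x) (\<lambda>x. weak_gradient (f n) x
      - G x)" for n
    by (rule kinetic_eq[OF has_gradient_diff[OF has_gradient_weak_gradient[OF f] hg]])
  have kin_v: "kinetic v = ip G G" by (rule kinetic_eq[OF hg])
  have split1: "(\<lambda>n. ip (f n) (f n) - ip v v - ip (\<lambda>x. f n x - v x) (\<lambda>x. f n x - v x)) \<longlonglongrightarrow> 0"
    by (rule wconv_norm_split[OF wf]) (use f v in auto)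
  have split2: "(\<lambda>n. kinetic (f n) - kinetic v - kinetic (\<lambda>x. f n x - v x)) \<longlonglongrightarrow> 0"
    unfolding kin_diff kin_v using wconv_norm_split[OF wG] f G by (simp add: kinetic_def)
  have loc: "(\<lambda>n. real_local_mass (\<lambda>x. f n x - v x) R z) \<longlonglongrightarrow> 0" for R z
  proof (rule weak_null_locally_null)
    show "sq (\<lambda>x. f n x - v x)" for n using f v by simp
    show "wconv (\<lambda>n x. f n x - v x) (\<lambda>x. 0)" by (rule wconv_diff_null[OF wf]) (use f v in auto)
    show "ip (\<lambda>x. f n x - v x) (\<lambda>x. f n x - v x) \<le> 2 * H + 2 * ip v v" for n
      using ip_self_diff_le[of "f n" v "\<lambda>x. 0"] f v bound(1)[of "r n"] ip_scale_left[of "-1" v]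
          ip_scale_right[of _ "-1" v]
      by (simp add: f_def)
    show "ip (\<lambda>x. f n (x + h) - v (x + h) - (f n x - v x)) (\<lambda>x. f n (x + h) - v (x + h) - (f n x - v x))
       \<le> (norm h)\<^sup>2 * (2 * H + 2 * kinetic v)" for n h
    proof -
      have "kinetic (\<lambda>x. f n x - v x) \<le> 2 * kinetic (f n) + 2 * kinetic v"
        unfolding kin_diff kin_v
        using ip_self_diff_le[of "weak_gradient (f n)" G "\<lambda>x. 0"] f G ip_scale_left[of "-1" G]
            ip_scale_right[of _ "-1" G]
        by (simp add: kinetic_def)
      also have "\<dots> \<le> 2 * H + 2 * kinetic v" using bound(2)[of "r n"] by (simp add: f_def)
      finally have "(norm h)\<^sup>2 * kinetic (\<lambda>x. f n x - v x) \<le> (norm h)\<^sup>2 * (2 * H + 2 * kinetic v)"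
        by (intro mult_left_mono) auto
      then show ?thesis using ip_translate_diff_kinetic[OF diffH1, of n h] by linarith
    qed
  qed
  show ?thesis using r vH1 split1 split2 loc unfolding f_def by blast
qed

section \<open>The relaxed minimisation problem\<close>

text \<open>The exponent N/2 preserves the mass. Under this group the kinetic energy scales by t^2
  and the self-energy by t^\<gamma>.\<close>

definition dilate :: "real \<Rightarrow> (real^'n::finite \<Rightarrow> 'k::euclidean_space) \<Rightarrow> real^'n \<Rightarrow> 'k" where
  "dilate t u x = t powr (real CARD('n) / 2) *\<^sub>R u (t *\<^sub>R x)"

definition self_energy :: "real \<Rightarrow> (real^'n::finite \<Rightarrow> 'k::euclidean_space) \<Rightarrow> real" where
  "self_energy \<gamma> u = riesz_form \<gamma> u u u u"

lemma self_energy_nonneg [simp]: "0 \<le> self_energy \<gamma> u"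
  by (simp add: self_energy_def)

lemma has_gradient_dilate:
  fixes u :: "real^'n::finite \<Rightarrow> 'k::euclidean_space"
  assumes "has_gradient u G" "0 < t"
  shows "has_gradient (dilate t u) (\<lambda>x. t powr (real CARD('n) / 2) *\<^sub>R t *\<^sub>R G (t *\<^sub>R x))"
  using has_gradient_scaleR[OF has_gradient_affine[OF assms(1), of t 0], of "t powr (real CARD('n)
      / 2)"] assms(2)
  by (simp add: dilate_def[abs_def])

lemma dilate_H1 [simp]: "u \<in> H1 \<Longrightarrow> 0 < t \<Longrightarrow> dilate t u \<in> H1"
  using has_gradient_dilate H1_iff by blast

lemma powr_half_card: "0 < t \<Longrightarrow> t powr (real n / 2) * t powr (real n / 2) = t ^ n"
  by (simp add: powr_add[symmetric] powr_realpow)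

lemma ip_rescale:
  fixes f :: "real^'n::finite \<Rightarrow> 'b::euclidean_space"
  assumes "sq f" "0 < t"
  shows "t powr (real CARD('n) / 2) * (t powr (real CARD('n) / 2) * ip (\<lambda>x. f (t *\<^sub>R x)) (\<lambda>x. f (t *\<^sub>R x)))
      = ip f f"
  using ip_affine[of f f t 0] assms sq_measurable[OF assms(1)] powr_half_card[OF assms(2), of "CARD('n)"]
  by (simp add: mult.assoc[symmetric])

lemma ip_dilate:
  assumes "u \<in> H1" "0 < t" shows "ip (dilate t u) (dilate t u) = ip u u"
  unfolding dilate_def[abs_def] using ip_rescale[of u t] assms by simp

lemma kinetic_dilate:
  fixes u :: "real^'n::finite \<Rightarrow> 'k::euclidean_space"
  assumes "u \<in> H1" "0 < t" shows "kinetic (dilate t u) = t\<^sup>2 * kinetic u"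
proof -
  have "kinetic (dilate t u) = t\<^sup>2 * (t powr (real CARD('n) / 2) * (t powr (real CARD('n) / 2) *
     ip (\<lambda>x. weak_gradient u (t *\<^sub>R x)) (\<lambda>x. weak_gradient u (t *\<^sub>R x))))"
    by (subst kinetic_eq[OF has_gradient_dilate[OF has_gradient_weak_gradient[OF assms(1)] assms(2)]])
       (simp add: power2_eq_square del: scaleR_scaleR)
  also have "\<dots> = t\<^sup>2 * kinetic u"
    using ip_rescale[of "weak_gradient u" t] assms by (simp add: kinetic_def)
  finally show ?thesis .
qed

lemma self_energy_dilate:
  fixes u :: "real^'n::finite \<Rightarrow> 'k::euclidean_space"
  assumes adm: "admissible TYPE('n) \<gamma>" and u: "u \<in> H1" and t: "0 < t"
  shows "self_energy \<gamma> (dilate t u) = t powr \<gamma> * self_energy \<gamma> u"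
proof -
  define c where "c = t powr (real CARD('n) / 2)"
  define E where "E = riesz_form \<gamma> (\<lambda>x. u (t *\<^sub>R x)) (\<lambda>x. u (t *\<^sub>R x)) (\<lambda>x. u (t *\<^sub>R x)) (\<lambda>x. u (t *\<^sub>R x))"
  have cc: "c * (c * (c * c)) = t ^ (2 * CARD('n))"
    using powr_half_card[OF t, of "CARD('n)"] by (simp add: c_def mult_2 power_add mult.assoc[symmetric])
  have "self_energy \<gamma> (dilate t u) = c * (c * (c * (c * E)))"
    unfolding self_energy_def dilate_def[abs_def] c_def[symmetric] E_def
    by (simp only: riesz_form_scaleR[OF adm])
  also have "\<dots> = t ^ (2 * CARD('n)) * E" by (simp only: cc[symmetric] mult.assoc)
  finally have 1: "self_energy \<gamma> (dilate t u) = t ^ (2 * CARD('n)) * E" .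
  have "self_energy \<gamma> u = t ^ (2 * CARD('n)) / t powr \<gamma> * E"
    unfolding self_energy_def E_def using riesz_form_affine[OF adm u u u u t, of 0] by simp
  then have "t powr \<gamma> * self_energy \<gamma> u = t ^ (2 * CARD('n)) * E" using t by simp
  with 1 show ?thesis by simp
qed

lemma AE_off_diagonal: "AE z in (lborel2 :: ('a::euclidean_space \<times> 'a) measure). fst z \<noteq> snd z"
proof (rule lborel_pair.AE_pair_measure)
  show "{z \<in> space (lborel2 :: ('a \<times> 'a) measure). fst z \<noteq> snd z} \<in> sets lborel2" by measurable
  show "AE x in lborel. AE y in lborel. fst (x, y) \<noteq> snd (x, y :: 'a)"
  proof (rule AE_I2)
    fix x :: 'a
    show "AE y in lborel. fst (x, y) \<noteq> snd (x, y)"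
      using AE_lborel_singleton[of x] by eventually_elim auto
  qed
qed

lemma self_energy_pos:
  fixes u :: "real^'n::finite \<Rightarrow> 'k::euclidean_space"
  assumes adm: "admissible TYPE('n) \<gamma>" and u: "u \<in> H1" and M: "0 < ip u u"
  shows "0 < self_energy \<gamma> u"
proof (rule ccontr)
  assume "\<not> 0 < self_energy \<gamma> u"
  then have "self_energy \<gamma> u = 0" using self_energy_nonneg[of \<gamma> u] by linarith
  then have "AE z in lborel2. riesz_integrand \<gamma> u u u u z = 0"
    unfolding self_energy_def riesz_form_def
    by (subst (asm) integral_nonneg_eq_0_iff_AE) (auto intro: riesz_diag_integrable[OF adm u u])
  with AE_off_diagonal have "AE z in lborel2. (u (fst z) \<bullet> u (fst z)) * (u (snd z) \<bullet> u (snd z)) = 0"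
    by eventually_elim (auto simp: riesz_integrand_def riesz_kernel_def)
  then have "(LINT z|lborel2. (u (fst z) \<bullet> u (fst z)) * (u (snd z) \<bullet> u (snd z))) = 0"
    by (rule integral_eq_zero_AE)
  then have "ip u u * ip u u = 0"
    using lborel2_product_integral(2)[OF sq_integrable sq_integrable, of u u] u by (simp add: ip_def)
  with M show False by simp
qed

text \<open>At zero mass the small form bound leaves only an arbitrarily small multiple of the
  kinetic energy.\<close>

lemma self_energy_null:
  fixes u :: "real^'n::finite \<Rightarrow> 'k::euclidean_space"
  assumes adm: "admissible TYPE('n) \<gamma>" and u: "u \<in> H1" and M: "ip u u = 0"
  shows "self_energy \<gamma> u = 0"
proof -
  have "self_energy \<gamma> u \<le> 0 + e" if e: "0 < e" for e
  proof -
    define \<epsilon> where "\<epsilon> = e / (kinetic u + 1)"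
    have "0 < kinetic u + 1" using kinetic_nonneg[of u] by linarith
    then have \<epsilon>: "0 < \<epsilon>" "\<epsilon> * kinetic u \<le> e"
      using e mult_left_mono[of "kinetic u" "kinetic u + 1" \<epsilon>] by (auto simp: \<epsilon>_def)
    from riesz_form_bound_small[OF adm \<epsilon>(1), of "h1sq u"] u M show ?thesis
      using \<epsilon>(2) unfolding self_energy_def by fastforce
  qed
  then have "self_energy \<gamma> u \<le> 0" by (rule field_le_epsilon)
  then show ?thesis using self_energy_nonneg[of \<gamma> u] by linarith
qed

text \<open>The H1 bound is not invariant under dilations; applying it to all dilates leaves a free
  parameter \<open>t\<close> to be optimised.\<close>

lemma self_energy_bound:
  assumes adm: "admissible TYPE('n::finite) \<gamma>"
  shows "\<exists>K>0. \<forall>u\<in>H1. \<forall>t>0. t powr \<gamma> * self_energy \<gamma> (u :: real^'n \<Rightarrow> 'k::euclidean_space)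
      \<le> K * (t\<^sup>2 * kinetic u + ip u u)\<^sup>2"
proof -
  obtain K where K: "0 < K" "\<And>(u :: real^'n \<Rightarrow> 'k) (w :: real^'n \<Rightarrow> 'k). u \<in> H1 \<Longrightarrow> w \<in> H1
      \<Longrightarrow> riesz_form \<gamma> u u w w \<le> K * h1sq u * h1sq w"
    using riesz_form_diag[OF adm] by blast
  have "t powr \<gamma> * self_energy \<gamma> u \<le> K * (t\<^sup>2 * kinetic u + ip u u)\<^sup>2" if u: "u \<in> H1"
      and t: "0 < t" for u :: "real^'n \<Rightarrow> 'k" and t
  proof -
    have "t powr \<gamma> * self_energy \<gamma> u = self_energy \<gamma> (dilate t u)"
        by (rule self_energy_dilate[OF adm u t, symmetric])
    also have "\<dots> \<le> K * h1sq (dilate t u) * h1sq (dilate t u)" unfolding self_energy_def using u t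
        by (intro K(2)) auto
    also have "h1sq (dilate t u) = t\<^sup>2 * kinetic u + ip u u" using u t
        by (simp add: h1sq_def kinetic_dilate ip_dilate)
    finally show ?thesis by (simp add: power2_eq_square mult.assoc)
  qed
  with K(1) show ?thesis by blast
qed

text \<open>With zero kinetic energy the right-hand side of \<open>self_energy_bound\<close> would
  not depend on \<open>t\<close>, whereas the left-hand side grows like t^\<gamma>.\<close>

lemma kinetic_pos:
  fixes u :: "real^'n::finite \<Rightarrow> 'k::euclidean_space"
  assumes adm: "admissible TYPE('n) \<gamma>" and u: "u \<in> H1" and M: "0 < ip u u"
  shows "0 < kinetic u"
proof (rule ccontr)
  assume "\<not> 0 < kinetic u"
  then have kin: "kinetic u = 0" using kinetic_nonneg[of u] by linarith
  obtain K where K: "0 < K" "\<forall>u\<in>H1. \<forall>t>0. t powr \<gamma> * self_energy \<gamma> (u :: real^'n \<Rightarrow> 'k)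
      \<le> K * (t\<^sup>2 * kinetic u + ip u u)\<^sup>2"
    using self_energy_bound[OF adm] by blast
  have s: "0 < self_energy \<gamma> u" by (rule self_energy_pos[OF adm u M])
  define X where "X = 2 * K * (ip u u)\<^sup>2 / self_energy \<gamma> u"
  define t where "t = X powr (1 / \<gamma>)"
  have X: "0 < X" using K M s by (simp add: X_def)
  then have t: "0 < t" "t powr \<gamma> = X"
    using adm by (auto simp: t_def powr_powr admissible_def)
  have "X * self_energy \<gamma> u \<le> K * (t\<^sup>2 * kinetic u + ip u u)\<^sup>2" using K(2) u t by blast
  then have "2 * (K * (ip u u)\<^sup>2) \<le> K * (ip u u)\<^sup>2" using s by (simp add: kin X_def)
  moreover have "0 < K * (ip u u)\<^sup>2" using K M by simp
  ultimately show False by simp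
qed

text \<open>A tent function: Lipschitz with bounded support, so the translation bound places it in
  H1.\<close>

lemma exists_nonzero_H1: "\<exists>u \<in> (H1 :: (real^'n::finite \<Rightarrow> 'k::euclidean_space) set). 0 < ip u u"
proof -
  obtain b :: 'k where b: "b \<in> Basis" using nonempty_Basis by blast
  define u :: "real^'n \<Rightarrow> 'k" where "u x = max 0 (1 - norm x) *\<^sub>R b" for x
  have [measurable]: "u \<in> borel_measurable borel" unfolding u_def by measurable
  have nu: "norm (u x) = max 0 (1 - norm x)" for x using b by (simp add: u_def)
  have sq: "sq u" by (rule sq_bounded_support[of _ 1 1]) (auto simp: u_def b)
  have lip: "norm (u (x + h) - u x) \<le> norm h" for x h
  proof -
    have "norm (u (x + h) - u x) = \<bar>max 0 (1 - norm (x + h)) - max 0 (1 - norm x)\<bar>"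
      using b by (simp add: u_def scaleR_diff_left[symmetric])
    also have "\<dots> \<le> \<bar>norm (x + h) - norm x\<bar>" by (auto simp: max_def abs_if)
    also have "\<dots> \<le> norm h" using norm_triangle_ineq3[of "x + h" x] by simp
    finally show ?thesis .
  qed
  have "u \<in> H1"
  proof (rule H1_if_translation_bound[OF sq])
    fix i :: 'n and n :: nat
    define h :: "real^'n" where "h = (1 / Suc n) *\<^sub>R axis i 1"
    have h: "norm h = 1 / Suc n" by (simp add: h_def)
    have h1: "norm h \<le> 1" unfolding h by simp
    have pw: "(norm (u (x + h) - u x))\<^sup>2 \<le> (norm h)\<^sup>2 * indicator (ball 0 2) x" for x
    proof (cases "norm x < 2")
      case True
      then show ?thesis using power_mono[OF lip[of x h], of 2] by simp
    next
      case False
      then have "1 \<le> norm (x + h)" using h1 norm_triangle_ineq4[of "x + h" h] by simp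
      then show ?thesis using False by (simp add: u_def)
    qed
    have "(LINT x|lborel. (norm (u (x + h) - u x))\<^sup>2)
        \<le> (LINT x|lborel. (norm h)\<^sup>2 * indicator (ball (0::real^'n) 2) x)"
    proof (rule integral_mono)
      show "integrable lborel (\<lambda>x. (norm (u (x + h) - u x))\<^sup>2)" using sq
          by (intro sq_integrable_norm sq_diff sq_translate)
      show "integrable lborel (\<lambda>x::real^'n. (norm h)\<^sup>2 * indicator (ball 0 2) x)"
        using emeasure_lborel_ball_finite[of "0::real^'n" 2] by (simp add: less_top)
    qed (rule pw)
    then show "ip (\<lambda>x. u (x + (1 / Suc n) *\<^sub>R axis i 1) - u x) (\<lambda>x. u (x + (1 / Suc n) *\<^sub>R axis i 1) - u x)
      \<le> measure lborel (ball (0::real^'n) 2) * (1 / Suc n)\<^sup>2"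
      unfolding h_def[symmetric] by (simp add: ip_self mult.commute h)
  qed
  moreover have "0 < ip u u"
  proof -
    have "0 < (1/4) * measure lborel (ball (0::real^'n) (1/2))" using measure_ball_pos[of "1/2" "0::real^'n"]
        by simp
    also have "\<dots> = (LINT x|lborel. (1/4) * indicator (ball (0::real^'n) (1/2)) x)" by simp
    also have "\<dots> \<le> (LINT x|lborel. (norm (u x))\<^sup>2)"
    proof (rule integral_mono)
      show "integrable lborel (\<lambda>x::real^'n. (1/4) * indicator (ball 0 (1/2)) x :: real)"
        using emeasure_lborel_ball_finite[of "0::real^'n" "1/2"] by (simp add: less_top)
      show "(1/4) * indicator (ball 0 (1/2)) x \<le> (norm (u x))\<^sup>2" for x
        using power_mono[of "1/2" "max 0 (1 - norm x)" 2] by (simp add: nu indicator_def power2_eq_square)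
    qed (use sq in simp)
    finally show ?thesis by (simp add: ip_self)
  qed
  ultimately show ?thesis by blast
qed

text \<open>The derivative at t = 1 of the energy of \<open>dilate t u\<close>.\<close>

definition virial :: "real \<Rightarrow> real \<Rightarrow> (real^'n::finite \<Rightarrow> 'k::euclidean_space) \<Rightarrow> real" where
  "virial \<gamma>1 \<gamma>2 u = kinetic u + \<gamma>2/4 * self_energy \<gamma>2 u - \<gamma>1/4 * self_energy \<gamma>1 u"

text \<open>The energy is \<^term>\<open>reduced_energy \<gamma>1 \<gamma>2 u + virial \<gamma>1 \<gamma>2 u / \<gamma>1\<close>; unlike the energy, the reduced
  energy is coercive.\<close>

definition reduced_energy :: "real \<Rightarrow> real \<Rightarrow> (real^'n::finite \<Rightarrow> 'k::euclidean_space) \<Rightarrow> real" where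
  "reduced_energy \<gamma>1 \<gamma>2 u = (1/2 - 1/\<gamma>1) * kinetic u + (1 - \<gamma>2/\<gamma>1)/4 * self_energy \<gamma>2 u"

definition feasible :: "real \<Rightarrow> real \<Rightarrow> real \<Rightarrow> (real^'n::finite \<Rightarrow> 'k::euclidean_space) set" where
  "feasible \<gamma>1 \<gamma>2 c = {u \<in> H1. 0 < ip u u \<and> ip u u \<le> c \<and> virial \<gamma>1 \<gamma>2 u \<le> 0}"

locale hartree_exponents =
  fixes \<gamma>1 \<gamma>2 :: real and dimension :: "'n::finite itself"
  assumes adm1: "admissible TYPE('n) \<gamma>1" and adm2: "admissible TYPE('n) \<gamma>2"
    and \<gamma>21: "\<gamma>2 < \<gamma>1" and \<gamma>1_gt: "2 < \<gamma>1"
begin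

lemma exponents_pos: "0 < \<gamma>1" "0 < \<gamma>2" "\<gamma>1 < 4" "0 < 1/2 - 1/\<gamma>1" "0 < (1 - \<gamma>2/\<gamma>1)/4"
  using adm1 adm2 \<gamma>21 \<gamma>1_gt by (auto simp: admissible_def field_simps)

lemma virial_dilate:
  "u \<in> H1 \<Longrightarrow> 0 < t \<Longrightarrow> virial \<gamma>1 \<gamma>2 (dilate t (u :: real^'n \<Rightarrow> 'k::euclidean_space))
   = t\<^sup>2 * kinetic u + \<gamma>2/4 * (t powr \<gamma>2 * self_energy \<gamma>2 u) - \<gamma>1/4 * (t powr \<gamma>1 * self_energy \<gamma>1 u)"
  by (simp add: virial_def kinetic_dilate self_energy_dilate[OF adm1] self_energy_dilate[OF adm2])

lemma reduced_energy_dilate: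
  "u \<in> H1 \<Longrightarrow> 0 < t \<Longrightarrow> reduced_energy \<gamma>1 \<gamma>2 (dilate t (u :: real^'n \<Rightarrow> 'k::euclidean_space))
   = (1/2 - 1/\<gamma>1) * (t\<^sup>2 * kinetic u) + (1 - \<gamma>2/\<gamma>1)/4 * (t powr \<gamma>2 * self_energy \<gamma>2 u)"
  by (simp add: reduced_energy_def kinetic_dilate self_energy_dilate[OF adm2])

lemma reduced_energy_pos:
  assumes "u \<in> H1" "0 < ip u u" shows "0 < reduced_energy \<gamma>1 \<gamma>2 (u :: real^'n \<Rightarrow> 'k::euclidean_space)"
  unfolding reduced_energy_def using kinetic_pos[OF adm1 assms] exponents_pos(4,5)
  by (intro add_pos_nonneg mult_pos_pos mult_nonneg_nonneg) auto

lemma reduced_energy_nonneg: "0 \<le> reduced_energy \<gamma>1 \<gamma>2 u"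
  unfolding reduced_energy_def using exponents_pos(4,5)
  by (intro add_nonneg_nonneg mult_nonneg_nonneg) auto

text \<open>A dilation-optimised, Gagliardo-Nirenberg type inequality: it combines
  \<open>kinetic u \<le> \<gamma>1/4 * self_energy \<gamma>1 u\<close>, a consequence of the virial
  constraint, with the bound of the self-energy at the best dilation.\<close>

lemma kinetic_lower_bound:
  "\<exists>\<kappa>>0. \<forall>u\<in>H1. 0 < ip u u \<longrightarrow> virial \<gamma>1 \<gamma>2 (u :: real^'n \<Rightarrow> 'k::euclidean_space) \<le> 0 \<longrightarrow>
     1 \<le> \<kappa> * ip u u * (kinetic u / ip u u) powr (\<gamma>1 / 2 - 1)"
proof -
  obtain K where K: "0 < K" "\<forall>u\<in>H1. \<forall>t>0. t powr \<gamma>1 * self_energy \<gamma>1 (u :: real^'n \<Rightarrow> 'k)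
      \<le> K * (t\<^sup>2 * kinetic u + ip u u)\<^sup>2"
    using self_energy_bound[OF adm1] by blast
  have "1 \<le> \<gamma>1 * K * ip u u * (kinetic u / ip u u) powr (\<gamma>1 / 2 - 1)"
    if u: "u \<in> H1" and M: "0 < ip u u" and Q: "virial \<gamma>1 \<gamma>2 u \<le> 0" for u :: "real^'n \<Rightarrow> 'k"
  proof -
    define a where "a = kinetic u / ip u u"
    have a: "0 < a" "kinetic u = a * ip u u" using kinetic_pos[OF adm1 u M] M by (auto simp: a_def)
    \<comment> \<open>The dilation at which kinetic energy and mass become equal.\<close>
    define t where "t = a powr (- (1/2))"
    have t: "0 < t" using a(1) by (simp add: t_def)
    have t1: "t powr \<gamma>1 = a powr (- (\<gamma>1/2))" unfolding t_def powr_powr by simp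
    have t2: "t\<^sup>2 = 1 / a" unfolding t_def power2_eq_square powr_add[symmetric] using a(1)
        by (simp add: powr_minus_divide)
    have "0 \<le> \<gamma>2/4 * self_energy \<gamma>2 u" using exponents_pos by (intro mult_nonneg_nonneg) auto
    then have "kinetic u \<le> \<gamma>1/4 * self_energy \<gamma>1 u" using Q by (simp add: virial_def)
    then have "t powr \<gamma>1 * kinetic u \<le> t powr \<gamma>1 * (\<gamma>1/4 * self_energy \<gamma>1 u)" by (intro mult_left_mono) auto
    also have "\<dots> = \<gamma>1/4 * (t powr \<gamma>1 * self_energy \<gamma>1 u)" by simp
    also have "\<dots> \<le> \<gamma>1/4 * (K * (t\<^sup>2 * kinetic u + ip u u)\<^sup>2)"
      using K(2) u t exponents_pos by (intro mult_left_mono) auto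
    also have "t\<^sup>2 * kinetic u + ip u u = 2 * ip u u" using a by (simp add: t2)
    finally have "a powr (- (\<gamma>1/2)) * (a * ip u u) \<le> \<gamma>1 * K * (ip u u)\<^sup>2"
        by (simp add: t1 a(2)[symmetric] power2_eq_square mult_ac)
    then have "ip u u * (a powr (- (\<gamma>1/2)) * a) \<le> ip u u * (\<gamma>1 * K * ip u u)"
        by (simp add: power2_eq_square mult_ac)
    then have "a powr (- (\<gamma>1/2)) * a \<le> \<gamma>1 * K * ip u u" using M by (rule mult_left_le_imp_le)
    then have "a powr (\<gamma>1/2 - 1) * (a powr (- (\<gamma>1/2)) * a) \<le> a powr (\<gamma>1/2 - 1) * (\<gamma>1 * K * ip u u)"
        by (intro mult_left_mono) auto
    also have "a powr (\<gamma>1/2 - 1) * (a powr (- (\<gamma>1/2)) * a) = 1"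
    proof -
      have "a powr (\<gamma>1/2 - 1) * (a powr (- (\<gamma>1/2)) * a powr 1) = a powr ((\<gamma>1/2 - 1) + (- (\<gamma>1/2) + 1))"
        by (simp only: powr_add)
      then show ?thesis using a(1) by simp
    qed
    finally show ?thesis by (simp add: a_def mult_ac)
  qed
  then show ?thesis using K(1) exponents_pos by (intro exI[of _ "\<gamma>1 * K"]) auto
qed

text \<open>Under strong concentration the power t^\<gamma>1 outgrows both t^2 and t^\<gamma>2, so
  the virial becomes nonpositive while the mass is kept.\<close>

lemma feasible_nonempty:
  assumes c: "0 < c" shows "(feasible \<gamma>1 \<gamma>2 c :: (real^'n \<Rightarrow> 'k::euclidean_space) set) \<noteq> {}"
proof -
  obtain u0 :: "real^'n \<Rightarrow> 'k" where u0: "u0 \<in> H1" "0 < ip u0 u0" using exists_nonzero_H1 by blast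
  define u where "u x = sqrt (c / ip u0 u0) *\<^sub>R u0 x" for x
  have u: "u \<in> H1" using u0 by (simp add: u_def[abs_def])
  have "sqrt (c / ip u0 u0) * sqrt (c / ip u0 u0) = c / ip u0 u0"
    using c u0 by (intro real_sqrt_mult_self[THEN trans]) simp
  then have M: "ip u u = c" using u0 by (simp add: u_def[abs_def] mult.assoc[symmetric])
  define m where "m = max 2 \<gamma>2"
  have m: "m < \<gamma>1" "2 \<le> m" "\<gamma>2 \<le> m" using \<gamma>21 \<gamma>1_gt by (auto simp: m_def)
  define X where "X = kinetic u + \<gamma>2/4 * self_energy \<gamma>2 u"
  define Y where "Y = \<gamma>1/4 * self_energy \<gamma>1 u"
  have Y: "0 < Y" using self_energy_pos[OF adm1 u] M c exponents_pos by (simp add: Y_def)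
  define t where "t = max 1 ((\<bar>X\<bar> / Y) powr (1 / (\<gamma>1 - m)))"
  have t: "1 \<le> t" by (simp add: t_def)
  have "\<bar>X\<bar> / Y = ((\<bar>X\<bar> / Y) powr (1 / (\<gamma>1 - m))) powr (\<gamma>1 - m)" if "X \<noteq> 0"
    using that Y m by (simp add: powr_powr)
  also have "\<dots> \<le> t powr (\<gamma>1 - m)" using m by (intro powr_mono2) (auto simp: t_def)
  finally have "\<bar>X\<bar> / Y \<le> t powr (\<gamma>1 - m)" by (cases "X = 0") (use t in auto)
  then have XY: "X \<le> t powr (\<gamma>1 - m) * Y" using Y by (simp add: divide_le_eq)
  have "virial \<gamma>1 \<gamma>2 (dilate t u) = t powr 2 * kinetic u + \<gamma>2/4 * (t powr \<gamma>2 * self_energy \<gamma>2 u) - \<gamma>1/4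
      * (t powr \<gamma>1 * self_energy \<gamma>1 u)"
    using t by (simp add: virial_dilate[OF u])
  also have "\<dots> \<le> t powr m * kinetic u + \<gamma>2/4 * (t powr m * self_energy \<gamma>2 u) - \<gamma>1/4
      * (t powr \<gamma>1 * self_energy \<gamma>1 u)"
    using t m exponents_pos by (intro diff_right_mono add_mono mult_left_mono mult_right_mono powr_mono) auto
  also have "\<dots> = t powr m * X - t powr \<gamma>1 * Y" by (simp add: X_def Y_def algebra_simps)
  also have "\<dots> \<le> t powr m * (t powr (\<gamma>1 - m) * Y) - t powr \<gamma>1 * Y"
    by (intro diff_right_mono mult_left_mono XY) auto
  also have "\<dots> = 0" by (simp add: mult.assoc[symmetric] powr_add[symmetric])
  finally have "dilate t u \<in> feasible \<gamma>1 \<gamma>2 c"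
    using u M c t by (simp add: feasible_def ip_dilate)
  then show ?thesis by blast
qed

text \<open>With p = \<gamma>1/2 - 1 and M the mass, the scale-invariant bound involves M^(1-p)
  times the p-th power of the kinetic energy. Since \<gamma>1 < 4 gives p < 1, M may be replaced by
  its upper bound \<open>c\<close>, which keeps the kinetic energy, and with it D1, away from zero
  on the whole relaxed set.\<close>

lemma self_energy_lower_bound:
  assumes c: "0 < c"
  shows "\<exists>\<beta>>0. \<forall>u\<in>(feasible \<gamma>1 \<gamma>2 c :: (real^'n \<Rightarrow> 'k::euclidean_space) set). \<beta> \<le> self_energy \<gamma>1 u"
proof -
  obtain \<kappa> where \<kappa>: "0 < \<kappa>" "\<forall>u\<in>H1. 0 < ip u u \<longrightarrow> virial \<gamma>1 \<gamma>2 (u :: real^'n \<Rightarrow> 'k) \<le> 0 \<longrightarrow>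
     1 \<le> \<kappa> * ip u u * (kinetic u / ip u u) powr (\<gamma>1 / 2 - 1)"
    using kinetic_lower_bound by blast
  define p where "p = \<gamma>1 / 2 - 1"
  have p: "0 < p" "p < 1" using \<gamma>1_gt exponents_pos by (auto simp: p_def)
  define a0 where "a0 = (1 / (\<kappa> * c powr (1 - p))) powr (1 / p)"
  have a0: "0 < a0" "a0 powr p = 1 / (\<kappa> * c powr (1 - p))" using \<kappa>(1) c p by (auto simp: a0_def powr_powr)
  have "4 / \<gamma>1 * a0 \<le> self_energy \<gamma>1 u" if "u \<in> feasible \<gamma>1 \<gamma>2 c" for u :: "real^'n \<Rightarrow> 'k"
  proof -
    have u: "u \<in> H1" "0 < ip u u" "ip u u \<le> c" "virial \<gamma>1 \<gamma>2 u \<le> 0" using that by (auto simp: feasible_def)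
    have A: "0 < kinetic u" by (rule kinetic_pos[OF adm1 u(1,2)])
    have "1 \<le> \<kappa> * (ip u u * (kinetic u / ip u u) powr p)" using \<kappa>(2) u by (simp add: p_def mult.assoc)
    also have "ip u u * (kinetic u / ip u u) powr p = ip u u powr (1 - p) * kinetic u powr p"
      using u(2) A by (simp add: powr_divide powr_diff)
    also have "\<kappa> * (ip u u powr (1 - p) * kinetic u powr p) \<le> \<kappa> * (c powr (1 - p) * kinetic u powr p)"
      using \<kappa>(1) u p by (intro mult_left_mono mult_right_mono powr_mono2) auto
    finally have "a0 powr p \<le> kinetic u powr p"
      unfolding a0(2) using \<kappa>(1) c by (simp add: divide_le_eq mult_ac)
    then have "a0 \<le> kinetic u" using p A a0(1) by (meson not_le powr_less_mono2 less_imp_le)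
    moreover have "kinetic u \<le> \<gamma>1/4 * self_energy \<gamma>1 u"
    proof -
      have "0 \<le> \<gamma>2/4 * self_energy \<gamma>2 u" using exponents_pos by (intro mult_nonneg_nonneg) auto
      then show ?thesis using u(4) by (simp add: virial_def)
    qed
    ultimately show ?thesis using exponents_pos by (simp add: field_simps)
  qed
  then show ?thesis using a0 exponents_pos by (intro exI[of _ "4 / \<gamma>1 * a0"]) auto
qed

lemma functionals_translate:
  assumes u: "u \<in> H1"
  shows "virial \<gamma>1 \<gamma>2 (\<lambda>x. u (x + h) :: 'k::euclidean_space) = virial \<gamma>1 \<gamma>2 (u :: real^'n \<Rightarrow> 'k)"
    and "reduced_energy \<gamma>1 \<gamma>2 (\<lambda>x. u (x + h)) = reduced_energy \<gamma>1 \<gamma>2 u"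
  using u by (simp_all add: virial_def reduced_energy_def self_energy_def kinetic_translate
      riesz_form_translate[OF adm1] riesz_form_translate[OF adm2])

lemma feasible_translate:
  "u \<in> feasible \<gamma>1 \<gamma>2 c \<Longrightarrow> (\<lambda>x. u (x + h)) \<in> feasible \<gamma>1 \<gamma>2 c" for u :: "real^'n \<Rightarrow> 'k::euclidean_space"
  by (simp add: feasible_def functionals_translate ip_translate)

lemma real_local_mass_translate:
  fixes u :: "real^'m::finite \<Rightarrow> 'k::euclidean_space"
  assumes [measurable]: "u \<in> borel_measurable borel"
  shows "real_local_mass (\<lambda>x. u (x + h)) R 0 = real_local_mass u R h"
proof -
  have "real_local_mass u R h = \<bar>1\<bar> ^ DIM(real^'m) *\<^sub>R (LINT y|lborel. indicator (ball h R) (h + 1 *\<^sub>R y)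
      * (u (h + 1 *\<^sub>R y) \<bullet> u (h + 1 *\<^sub>R y)))"
    unfolding real_local_mass_def
    by (rule lborel_integral_affine) (auto intro!: borel_measurable_times borel_measurable_indicator)
  then show ?thesis by (simp add: real_local_mass_def indicator_def dist_norm add.commute)
qed

text \<open>Translation to points of concentration gives a nonzero weak limit \<open>v\<close>, and
  mass, virial and reduced energy split between \<open>v\<close> and the remainder. Either
  \<open>v\<close> satisfies the virial constraint and is a minimiser, or the remainder is
  eventually feasible, which contradicts that its reduced energy tends to the infimum minus a
  positive amount.\<close>

theorem minimizer_exists:
  assumes c: "0 < c"
  shows "\<exists>u \<in> (feasible \<gamma>1 \<gamma>2 c :: (real^'n \<Rightarrow> 'k::euclidean_space) set).
     \<forall>w \<in> (feasible \<gamma>1 \<gamma>2 c :: (real^'n \<Rightarrow> 'k) set). reduced_energy \<gamma>1 \<gamma>2 u \<le> reduced_energy \<gamma>1 \<gamma>2 w"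
proof -
  define F :: "(real^'n \<Rightarrow> 'k) set" where "F = feasible \<gamma>1 \<gamma>2 c"
  define I where "I = (reduced_energy \<gamma>1 \<gamma>2 :: (real^'n \<Rightarrow> 'k) \<Rightarrow> real)"
  define m where "m = Inf (I ` F)"
  have F0: "F \<noteq> {}" unfolding F_def by (rule feasible_nonempty[OF c])
  have I0: "0 \<le> I w" for w unfolding I_def by (rule reduced_energy_nonneg)
  have m_le: "m \<le> I w" if "w \<in> F" for w
    unfolding m_def using that I0 by (intro cInf_lower bdd_belowI2[of _ 0]) auto
  have "\<exists>w\<in>F. I w < m + 1 / Suc n" for n
    using cInf_lessD[of "I ` F" "m + 1 / Suc n"] F0 by (auto simp: m_def)
  then obtain un where un: "\<And>n. un n \<in> F" "\<And>n. I (un n) < m + 1 / Suc n" by metis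
  have unH: "un n \<in> H1" for n using un(1)[of n] by (simp add: F_def feasible_def)
  define \<alpha> where "\<alpha> = 1/2 - 1/\<gamma>1"
  have \<alpha>: "0 < \<alpha>" using exponents_pos by (simp add: \<alpha>_def)
  \<comment> \<open>Coercivity: the reduced energy bounds the kinetic part, and feasibility bounds
    the mass.\<close>
  define H where "H = (m + 1) / \<alpha> + c"
  have unb: "h1sq (un n) \<le> H" for n
  proof -
    have "0 \<le> (1 - \<gamma>2/\<gamma>1)/4 * self_energy \<gamma>2 (un n)" using exponents_pos(5) by (intro mult_nonneg_nonneg) auto
    then have "\<alpha> * kinetic (un n) \<le> I (un n)" unfolding I_def reduced_energy_def \<alpha>_def by linarith
    also have "\<dots> \<le> m + 1" using un(2)[of n] by (rule order_trans[OF less_imp_le]) simp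
    finally have "kinetic (un n) \<le> (m + 1) / \<alpha>" using \<alpha> by (simp add: le_divide_eq mult.commute)
    moreover have "ip (un n) (un n) \<le> c" using un(1)[of n] by (simp add: F_def feasible_def)
    ultimately show ?thesis by (simp add: h1sq_def H_def)
  qed
  obtain \<beta> where \<beta>: "0 < \<beta>" "\<And>u. u \<in> F \<Longrightarrow> \<beta> \<le> self_energy \<gamma>1 u"
    using self_energy_lower_bound[OF c, where 'k='k] unfolding F_def by blast
  obtain R \<delta> where R: "0 < R" "0 < \<delta>" and nonvan: "\<And>u :: real^'n \<Rightarrow> 'k. u \<in> H1 \<Longrightarrow> h1sq u \<le> H
      \<Longrightarrow> \<beta> \<le> riesz_form \<gamma>1 u u u u \<Longrightarrow>
     \<exists>x. \<delta> < real_local_mass u R x"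
    using riesz_form_nonvanishing[OF adm1 \<beta>(1), where 'k='k, of H] by blast
  have "\<exists>x. \<delta> < real_local_mass (un n) R x" for n
    using \<beta>(2)[OF un(1)[of n]] by (intro nonvan unH unb) (simp add: self_energy_def)
  then obtain x where x: "\<And>n. \<delta> < real_local_mass (un n) R (x n)" by metis
  define vn where "vn n y = un n (y + x n)" for n y
  have vnF: "vn n \<in> F" for n using feasible_translate un(1)[of n] by (simp add: vn_def[abs_def] F_def)
  have vnH: "vn n \<in> H1" for n using vnF[of n] by (simp add: F_def feasible_def)
  have vnI: "I (vn n) < m + 1 / Suc n" for n
    using un(2)[of n] functionals_translate(2)[OF unH[of n], of "x n"] by (simp add: I_def vn_def[abs_def])
  have vnb: "h1sq (vn n) \<le> H" for n using unb[of n] by (simp add: vn_def[abs_def] h1sq_translate unH)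
  have vnloc: "\<delta> < real_local_mass (vn n) R 0" for n
    using x[of n] unfolding vn_def[abs_def] by (simp add: real_local_mass_translate H1_measurable unH)
  obtain r v where r: "strict_mono r" and v: "v \<in> H1"
    and lim_ip: "(\<lambda>n. ip (vn (r n)) (vn (r n)) - ip v v - ip (\<lambda>x. vn (r n) x - v x) (\<lambda>x. vn (r n) x - v x))
        \<longlonglongrightarrow> 0"
    and lim_kin: "(\<lambda>n. kinetic (vn (r n)) - kinetic v - kinetic (\<lambda>x. vn (r n) x - v x)) \<longlonglongrightarrow> 0"
    and loc: "\<And>R z. (\<lambda>n. real_local_mass (\<lambda>x. vn (r n) x - v x) R z) \<longlonglongrightarrow> 0"
    using H1_weakly_compact[of vn H, OF vnH vnb] by blast
  define f where "f n = vn (r n)" for n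
  define w where "w n x = f n x - v x" for n x
  have f: "f n \<in> F" "f n \<in> H1" "h1sq (f n) \<le> H" for n using vnF vnH vnb by (auto simp: f_def)
  have w: "w n \<in> H1" for n using f v by (simp add: w_def[abs_def])
  have wb: "h1sq (w n) \<le> 2 * H + 2 * h1sq v" for n
  proof -
    have "ip (w n) (w n) \<le> 2 * ip (f n) (f n) + 2 * ip v v"
      using ip_self_diff_le[of "f n" v "\<lambda>x. 0"] f v ip_scale_left[of "-1" v] ip_scale_right[of _ "-1" v]
      by (simp add: w_def[abs_def])
    moreover have "kinetic (w n) \<le> 2 * kinetic (f n) + 2 * kinetic v"
    proof -
      have "kinetic (w n) = ip (\<lambda>x. weak_gradient (f n) x - weak_gradient v x) (\<lambda>x. weak_gradient (f n) x
          - weak_gradient v x)"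
        unfolding w_def[abs_def]
        by (rule kinetic_eq[OF has_gradient_diff[OF has_gradient_weak_gradient has_gradient_weak_gradient]])
            (rule f v)+
      then show ?thesis
        using ip_self_diff_le[of "weak_gradient (f n)" "weak_gradient v" "\<lambda>x. 0"] f v
          ip_scale_left[of "-1" "weak_gradient v"] ip_scale_right[of _ "-1" "weak_gradient v"]
        by (simp add: kinetic_def)
    qed
    ultimately show ?thesis using f(3)[of n] by (simp add: h1sq_def)
  qed
  have loc_w: "(\<lambda>n. real_local_mass (w n) R z) \<longlonglongrightarrow> 0" for R z using loc by (simp add: w_def[abs_def] f_def)
  have split_ip: "(\<lambda>n. ip (f n) (f n) - ip v v - ip (w n) (w n)) \<longlonglongrightarrow> 0" using lim_ip
      by (simp add: f_def w_def[abs_def])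
  have split_kin: "(\<lambda>n. kinetic (f n) - kinetic v - kinetic (w n)) \<longlonglongrightarrow> 0" using lim_kin
      by (simp add: f_def w_def[abs_def])
  have split_se: "(\<lambda>n. self_energy \<gamma> (f n) - self_energy \<gamma> v - self_energy \<gamma> (w n)) \<longlonglongrightarrow> 0"
    if adm: "admissible TYPE('n) \<gamma>" for \<gamma>
    using Brezis_Lieb_riesz_form[OF adm v w wb riesz_form_vanishing[OF adm v w wb loc_w]]
    by (simp add: self_energy_def w_def)
  have split_I: "(\<lambda>n. I (f n) - I v - I (w n)) \<longlonglongrightarrow> 0"
  proof -
    have "(\<lambda>n. (1/2 - 1/\<gamma>1) * (kinetic (f n) - kinetic v - kinetic (w n))
        + (1 - \<gamma>2/\<gamma>1)/4 * (self_energy \<gamma>2 (f n) - self_energy \<gamma>2 v - self_energy \<gamma>2 (w n)))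
       \<longlonglongrightarrow> (1/2 - 1/\<gamma>1) * 0 + (1 - \<gamma>2/\<gamma>1)/4 * 0"
      by (intro tendsto_intros split_kin split_se adm2)
    moreover have "a * (x - y - z) + b * (x' - y' - z') = (a * x + b * x') - (a * y + b * y')
        - (a * z + b * z')"
      for a b x y z x' y' z' :: real by (simp add: algebra_simps)
    ultimately show ?thesis by (simp only: I_def reduced_energy_def mult_zero_right add_0_right)
  qed
  have split_Q: "(\<lambda>n. virial \<gamma>1 \<gamma>2 (f n) - virial \<gamma>1 \<gamma>2 v - virial \<gamma>1 \<gamma>2 (w n)) \<longlonglongrightarrow> 0"
  proof -
    have "(\<lambda>n. (kinetic (f n) - kinetic v - kinetic (w n))
        + \<gamma>2/4 * (self_energy \<gamma>2 (f n) - self_energy \<gamma>2 v - self_energy \<gamma>2 (w n))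
        - \<gamma>1/4 * (self_energy \<gamma>1 (f n) - self_energy \<gamma>1 v - self_energy \<gamma>1 (w n)))
       \<longlonglongrightarrow> 0 + \<gamma>2/4 * 0 - \<gamma>1/4 * 0"
      by (intro tendsto_intros split_kin split_se adm2 adm1)
    then show ?thesis by (simp add: virial_def algebra_simps)
  qed
  have I_f: "(\<lambda>n. I (f n)) \<longlonglongrightarrow> m"
  proof (rule tendsto_sandwich)
    show "\<forall>\<^sub>F n in sequentially. m \<le> I (f n)" using m_le f(1) by simp
    show "\<forall>\<^sub>F n in sequentially. I (f n) \<le> m + 1 / Suc (r n)" unfolding f_def
        by (intro always_eventually allI less_imp_le vnI)
    have "(\<lambda>n. 1 / real (Suc (r n))) \<longlonglongrightarrow> 0"
      using LIMSEQ_subseq_LIMSEQ[OF LIMSEQ_inverse_real_of_nat r] by (simp add: o_def inverse_eq_divide)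
    then show "(\<lambda>n. m + 1 / Suc (r n)) \<longlonglongrightarrow> m" using tendsto_add[OF tendsto_const[of m]] by force
  qed simp
  have vpos: "0 < ip v v"
  proof -
    \<comment> \<open>The mass concentrated near the origin is shared by \<open>v\<close> and the
      remainder, and the remainder loses its local mass in the limit.\<close>
    have "\<delta> \<le> 0 + 2 * ip v v"
    proof (rule LIMSEQ_le_const)
      show "(\<lambda>n. 2 * real_local_mass (w n) R 0 + 2 * ip v v) \<longlonglongrightarrow> 0 + 2 * ip v v"
        using tendsto_add[OF tendsto_mult[OF tendsto_const[of 2] loc_w[of R 0]] tendsto_const[of "2
            * ip v v"]] by simp
      have "\<delta> \<le> 2 * real_local_mass (w n) R 0 + 2 * ip v v" for n
      proof -
        have "real_local_mass (f n) R 0 \<le> (LINT y|lborel. 2 * (indicator (ball 0 R) y * (w n y \<bullet> w n y))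
            + 2 * (indicator (ball 0 R) y * (v y \<bullet> v y)))"
          unfolding real_local_mass_def
        proof (rule integral_mono)
          show "integrable lborel (\<lambda>y. indicator (ball 0 R) y * (f n y \<bullet> f n y))" using f
              by (intro real_local_mass_integrable) auto
          show "integrable lborel (\<lambda>y. 2 * (indicator (ball 0 R) y * (w n y \<bullet> w n y))
              + 2 * (indicator (ball 0 R) y * (v y \<bullet> v y)))"
            using w v by (intro Bochner_Integration.integrable_add integrable_mult_right
                real_local_mass_integrable) auto
          fix y
          have "f n y \<bullet> f n y \<le> 2 * (w n y \<bullet> w n y) + 2 * (v y \<bullet> v y)"
            using inner_ge_zero[of "w n y - v y"] by (simp add: w_def inner_diff inner_commute)
          then show "indicator (ball 0 R) y * (f n y \<bullet> f n y) \<le> 2 * (indicator (ball 0 R) y * (w n y \<bullet> w n y))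
              + 2 * (indicator (ball 0 R) y * (v y \<bullet> v y))"
            by (simp add: indicator_def)
        qed
        also have "\<dots> = 2 * real_local_mass (w n) R 0 + 2 * real_local_mass v R 0"
          unfolding real_local_mass_def
          by (subst Bochner_Integration.integral_add) (use w v in \<open>auto intro!: integrable_mult_right
              real_local_mass_integrable\<close>)
        also have "\<dots> \<le> 2 * real_local_mass (w n) R 0 + 2 * ip v v" using real_local_mass_le[of v R 0] v
            by simp
        finally show ?thesis using vnloc[of "r n"] by (simp add: f_def)
      qed
      then show "\<exists>N. \<forall>n\<ge>N. \<delta> \<le> 2 * real_local_mass (w n) R 0 + 2 * ip v v" by blast
    qed
    then show ?thesis using R(2) by simp
  qed
  have I_w: "(\<lambda>n. I (w n)) \<longlonglongrightarrow> m - I v"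
  proof -
    have "(\<lambda>n. I (f n) - I v - (I (f n) - I v - I (w n))) \<longlonglongrightarrow> m - I v - 0"
      by (intro tendsto_intros I_f split_I)
    then show ?thesis by simp
  qed
  have fM: "ip (f n) (f n) \<le> c" and fQ: "virial \<gamma>1 \<gamma>2 (f n) \<le> 0" for n using f(1)[of n]
      by (auto simp: F_def feasible_def)
  show ?thesis
  proof (cases "virial \<gamma>1 \<gamma>2 v \<le> 0")
    case True
    have "ip v v \<le> c - 0"
    proof (rule LIMSEQ_le_const)
      show "(\<lambda>n. c - (ip (f n) (f n) - ip v v - ip (w n) (w n))) \<longlonglongrightarrow> c - 0"
        by (intro tendsto_intros split_ip)
      have "ip v v \<le> c - (ip (f n) (f n) - ip v v - ip (w n) (w n))" for n
        using fM[of n] ip_nonneg[of "w n"] by linarith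
      then show "\<exists>N. \<forall>n\<ge>N. ip v v \<le> c - (ip (f n) (f n) - ip v v - ip (w n) (w n))" by blast
    qed
    with v vpos True have vF: "v \<in> F" by (simp add: F_def feasible_def)
    have Iv: "0 \<le> m - I v" by (rule LIMSEQ_le_const[OF I_w]) (use I0 in auto)
    have "I v \<le> I w" if "w \<in> F" for w using m_le[OF that] Iv by linarith
    then have "\<forall>w\<in>(feasible \<gamma>1 \<gamma>2 c :: (real^'n \<Rightarrow> 'k) set). reduced_energy \<gamma>1 \<gamma>2 v \<le> reduced_energy \<gamma>1 \<gamma>2 w"
      unfolding F_def I_def by blast
    then show ?thesis using vF unfolding F_def by (rule bexI)
  next
    case False
    then have Qv: "0 < virial \<gamma>1 \<gamma>2 v" by simp
    \<comment> \<open>A positive virial of \<open>v\<close> forces a negative one on the remainder,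
      since the sum is at most zero up to a vanishing error. A negative virial also excludes zero
      mass.\<close>
    have "\<forall>\<^sub>F n in sequentially. virial \<gamma>1 \<gamma>2 (f n) - virial \<gamma>1 \<gamma>2 v - virial \<gamma>1 \<gamma>2 (w n) > - virial \<gamma>1 \<gamma>2 v"
      by (rule order_tendstoD(1)[OF split_Q]) (use Qv in simp)
    moreover have "\<forall>\<^sub>F n in sequentially. ip (f n) (f n) - ip v v - ip (w n) (w n) > - ip v v"
      by (rule order_tendstoD(1)[OF split_ip]) (use vpos in simp)
    ultimately have "\<forall>\<^sub>F n in sequentially. m \<le> I (w n)"
    proof eventually_elim
      case (elim n)
      have Qw: "virial \<gamma>1 \<gamma>2 (w n) < 0" using elim(1) fQ[of n] by linarith
      have "0 < ip (w n) (w n)"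
      proof (rule ccontr)
        assume "\<not> 0 < ip (w n) (w n)"
        then have "ip (w n) (w n) = 0" using ip_nonneg[of "w n"] by linarith
        then have "self_energy \<gamma>1 (w n) = 0" "self_energy \<gamma>2 (w n) = 0"
          using self_energy_null[OF adm1 w] self_energy_null[OF adm2 w] by auto
        then show False using Qw kinetic_nonneg[of "w n"] by (simp add: virial_def)
      qed
      moreover have "ip (w n) (w n) \<le> c" using elim(2) fM[of n] by linarith
      ultimately have "w n \<in> F" using w[of n] Qw by (simp add: F_def feasible_def)
      then show "m \<le> I (w n)" by (rule m_le)
    qed
    then have "m \<le> m - I v" by (intro tendsto_lowerbound[OF I_w]) auto
    moreover have "0 < I v" unfolding I_def by (rule reduced_energy_pos[OF v vpos])
    ultimately show ?thesis by simp
  qed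
qed

end

section \<open>Minimisers solve the equation\<close>

definition first_variation ::
  "real \<Rightarrow> real \<Rightarrow> (real^'n::finite \<Rightarrow> 'k::euclidean_space) \<Rightarrow> (real^'n \<Rightarrow> 'k) \<Rightarrow> real" where
  "first_variation \<gamma>1 \<gamma>2 u \<psi> = ip (weak_gradient u) (weak_gradient \<psi>) + riesz_form \<gamma>2 u \<psi> u u
      - riesz_form \<gamma>1 u \<psi> u u"

lemma kinetic_line:
  assumes "u \<in> H1" "\<psi> \<in> H1"
  shows "kinetic (\<lambda>x. u x + s *\<^sub>R \<psi> x) = kinetic u + 2 * ip (weak_gradient u) (weak_gradient \<psi>) * s
      + kinetic \<psi> * s\<^sup>2"
proof -
  have "kinetic (\<lambda>x. u x + s *\<^sub>R \<psi> x) = ip (\<lambda>x. weak_gradient u x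
      + s *\<^sub>R weak_gradient \<psi> x) (\<lambda>x. weak_gradient u x + s *\<^sub>R weak_gradient \<psi> x)"
    by (intro kinetic_eq has_gradient_add has_gradient_scaleR has_gradient_weak_gradient assms)
  then show ?thesis using assms by (simp add: ip_self_add kinetic_def power2_eq_square)
qed

lemma mass_line:
  assumes "u \<in> H1" "\<psi> \<in> H1"
  shows "ip (\<lambda>x. u x + s *\<^sub>R \<psi> x) (\<lambda>x. u x + s *\<^sub>R \<psi> x) = ip u u + 2 * ip u \<psi> * s + ip \<psi> \<psi> * s\<^sup>2"
  using assms by (simp add: ip_self_add power2_eq_square)

text \<open>Multilinearity makes this a quartic in \<open>s\<close>; the symmetries of the form let
  the four contributions to the linear coefficient coincide.\<close>

lemma self_energy_line:
  fixes u \<psi> :: "real^'n::finite \<Rightarrow> 'k::euclidean_space"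
  assumes adm: "admissible TYPE('n) \<gamma>" and u: "u \<in> H1" and \<psi>: "\<psi> \<in> H1"
  shows "\<exists>a b c. \<forall>s. self_energy \<gamma> (\<lambda>x. u x + s *\<^sub>R \<psi> x) = self_energy \<gamma> u + 4 * riesz_form \<gamma> u \<psi> u u * s
      + a * s^2 + b * s^3 + c * s^4"
proof -
  let ?T = "riesz_form \<gamma>"
  note add = riesz_form_add[OF adm] and scale = riesz_form_scaleR[OF adm]
  have pair1: "?T (\<lambda>x. u x + s *\<^sub>R \<psi> x) (\<lambda>x. u x + s *\<^sub>R \<psi> x) f g = ?T u u f g + 2 * s * ?T u \<psi> f g
      + s^2 * ?T \<psi> \<psi> f g"
    if "f \<in> H1" "g \<in> H1" for f g s
    using that u \<psi> riesz_form_commute1[OF adm, of \<psi> u f g]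
        by (simp add: add scale power2_eq_square algebra_simps)
  have pair2: "?T f g (\<lambda>x. u x + s *\<^sub>R \<psi> x) (\<lambda>x. u x + s *\<^sub>R \<psi> x) = ?T f g u u + 2 * s * ?T f g u \<psi>
      + s^2 * ?T f g \<psi> \<psi>"
    if "f \<in> H1" "g \<in> H1" for f g s
    using that u \<psi> riesz_form_commute2[OF adm, of f g \<psi> u]
        by (simp add: add scale power2_eq_square algebra_simps)
  have "self_energy \<gamma> (\<lambda>x. u x + s *\<^sub>R \<psi> x) = self_energy \<gamma> u + 4 * ?T u \<psi> u u * s
     + (2 * ?T u u \<psi> \<psi> + 4 * ?T u \<psi> u \<psi>) * s^2 + (4 * ?T u \<psi> \<psi> \<psi>) * s^3 + ?T \<psi> \<psi> \<psi> \<psi> * s^4" for s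
  proof -
    have "self_energy \<gamma> (\<lambda>x. u x + s *\<^sub>R \<psi> x)
       = (?T u u u u + 2 * s * ?T u u u \<psi> + s^2 * ?T u u \<psi> \<psi>)
        + 2 * s * (?T u \<psi> u u + 2 * s * ?T u \<psi> u \<psi> + s^2 * ?T u \<psi> \<psi> \<psi>)
        + s^2 * (?T \<psi> \<psi> u u + 2 * s * ?T \<psi> \<psi> u \<psi> + s^2 * ?T \<psi> \<psi> \<psi> \<psi>)"
      unfolding self_energy_def using u \<psi> by (subst pair1) (simp_all add: pair2)
    also have "?T u u u \<psi> = ?T u \<psi> u u" by (rule riesz_form_swap[OF adm]) (rule u \<psi>)+
    also have "?T \<psi> \<psi> u u = ?T u u \<psi> \<psi>" by (rule riesz_form_swap[OF adm]) (rule u \<psi>)+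
    also have "?T \<psi> \<psi> u \<psi> = ?T u \<psi> \<psi> \<psi>" by (rule riesz_form_swap[OF adm]) (rule u \<psi>)+
    finally show ?thesis
      by (simp add: self_energy_def power2_eq_square power3_eq_cube power4_eq_xxxx algebra_simps)
  qed
  then show ?thesis by blast
qed

lemma self_energy_line_deriv:
  fixes u \<psi> :: "real^'n::finite \<Rightarrow> 'k::euclidean_space"
  assumes adm: "admissible TYPE('n) \<gamma>" and u: "u \<in> H1" and \<psi>: "\<psi> \<in> H1"
  shows "((\<lambda>s. self_energy \<gamma> (\<lambda>x. u x + s *\<^sub>R \<psi> x)) has_real_derivative 4 * riesz_form \<gamma> u \<psi> u u) (at 0)"
proof -
  obtain a b c where eq: "\<And>s. self_energy \<gamma> (\<lambda>x. u x + s *\<^sub>R \<psi> x) = self_energy \<gamma> u + 4 * riesz_form \<gamma> u \<psi> u u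
      * s + a * s^2 + b * s^3 + c * s^4"
    using self_energy_line[OF assms] by blast
  show ?thesis unfolding eq by (auto intro!: derivative_eq_intros)
qed

context hartree_exponents
begin

text \<open>With a strictly negative virial there is room for a dilation slightly below 1, and this
  lowers the reduced energy strictly, since it consists of positive powers of the dilation
  parameter.\<close>

lemma minimizer_virial:
  fixes u :: "real^'n \<Rightarrow> 'k::euclidean_space"
  assumes u: "u \<in> feasible \<gamma>1 \<gamma>2 c"
    and min: "\<And>w. w \<in> feasible \<gamma>1 \<gamma>2 c \<Longrightarrow> reduced_energy \<gamma>1 \<gamma>2 u \<le> reduced_energy \<gamma>1 \<gamma>2 (w :: real^'n \<Rightarrow> 'k)"
  shows "virial \<gamma>1 \<gamma>2 u = 0"
proof (rule ccontr)
  assume "virial \<gamma>1 \<gamma>2 u \<noteq> 0"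
  have uH: "u \<in> H1" "0 < ip u u" "ip u u \<le> c" and Q: "virial \<gamma>1 \<gamma>2 u < 0"
    using u \<open>virial \<gamma>1 \<gamma>2 u \<noteq> 0\<close> by (auto simp: feasible_def)
  define q where "q t = t\<^sup>2 * kinetic u + \<gamma>2/4 * (t powr \<gamma>2 * self_energy \<gamma>2 u) - \<gamma>1/4
      * (t powr \<gamma>1 * self_energy \<gamma>1 u)" for t
  have q1: "q 1 < 0" using Q by (simp add: q_def virial_def)
  have "(q \<longlongrightarrow> q 1) (at_left 1)" unfolding q_def by (intro tendsto_intros) auto
  then have "\<forall>\<^sub>F t in at_left 1. q t < 0" using q1 by (rule order_tendstoD(2))
  moreover have "\<forall>\<^sub>F t in at_left 1. t \<in> {0<..<1::real}" by (rule eventually_at_left_real) simp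
  ultimately have "\<exists>t. q t < 0 \<and> t \<in> {0<..<1::real}"
    by (intro eventually_happens'[OF _ eventually_conj]) auto
  then obtain t where t: "q t < 0" "0 < t" "t < 1" by auto
  have "virial \<gamma>1 \<gamma>2 (dilate t u) = q t" using uH t by (simp add: virial_dilate q_def)
  then have "dilate t u \<in> feasible \<gamma>1 \<gamma>2 c"
    using uH t by (simp add: feasible_def ip_dilate)
  from min[OF this] have "reduced_energy \<gamma>1 \<gamma>2 u \<le> (1/2 - 1/\<gamma>1) * (t\<^sup>2 * kinetic u) + (1 - \<gamma>2/\<gamma>1)/4
      * (t powr \<gamma>2 * self_energy \<gamma>2 u)"
    using uH t by (simp add: reduced_energy_dilate)
  moreover have "(1/2 - 1/\<gamma>1) * (t\<^sup>2 * kinetic u) < (1/2 - 1/\<gamma>1) * kinetic u"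
    using exponents_pos(4) kinetic_pos[OF adm1 uH(1,2)] t power_strict_mono[of t 1 2]
    by (intro mult_strict_left_mono) (auto simp: mult_less_cancel_right1)
  moreover have "(1 - \<gamma>2/\<gamma>1)/4 * (t powr \<gamma>2 * self_energy \<gamma>2 u) \<le> (1 - \<gamma>2/\<gamma>1)/4 * self_energy \<gamma>2 u"
    using exponents_pos t powr_le_one_le[of t] powr_mono2[of \<gamma>2 t 1]
        by (intro mult_left_mono) (auto intro: mult_left_le_one_le)
  ultimately show False by (simp add: reduced_energy_def)
qed

text \<open>The perturbed function is dilated by \<open>1 + \<kappa> s\<close>, with \<open>\<kappa>\<close> chosen such that the virial becomes
  negative along the curve; the energy does not see \<open>\<kappa>\<close> to first order, because its derivative in
  the dilation parameter is the virial, which vanishes.\<close>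

lemma minimizer_first_variation:
  fixes u \<psi> :: "real^'n \<Rightarrow> 'k::euclidean_space"
  assumes u: "u \<in> feasible \<gamma>1 \<gamma>2 c"
    and min: "\<And>w. w \<in> feasible \<gamma>1 \<gamma>2 c \<Longrightarrow> reduced_energy \<gamma>1 \<gamma>2 u \<le> reduced_energy \<gamma>1 \<gamma>2 (w :: real^'n \<Rightarrow> 'k)"
    and \<psi>: "\<psi> \<in> H1" and mass: "ip u u < c \<or> ip u \<psi> < 0"
  shows "0 \<le> first_variation \<gamma>1 \<gamma>2 u \<psi>"
proof (rule ccontr)
  assume "\<not> 0 \<le> first_variation \<gamma>1 \<gamma>2 u \<psi>"
  define dE where "dE = first_variation \<gamma>1 \<gamma>2 u \<psi>"
  have dE: "dE < 0" using \<open>\<not> 0 \<le> first_variation \<gamma>1 \<gamma>2 u \<psi>\<close> by (simp add: dE_def)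
  have uH: "u \<in> H1" "0 < ip u u" "ip u u \<le> c" using u by (auto simp: feasible_def)
  have Q: "virial \<gamma>1 \<gamma>2 u = 0" by (rule minimizer_virial[OF u min])
  define v where "v s x = u x + s *\<^sub>R \<psi> x" for s x
  have v: "v s \<in> H1" for s using uH \<psi> by (simp add: v_def[abs_def])
  have v0: "v 0 = u" by (simp add: v_def[abs_def])
  define A B C where "A s = kinetic (v s)" and "B s = self_energy \<gamma>1 (v s)"
      and "C s = self_energy \<gamma>2 (v s)" for s
  define A' B' C' where "A' = 2 * ip (weak_gradient u) (weak_gradient \<psi>)"
    and "B' = 4 * riesz_form \<gamma>1 u \<psi> u u" and "C' = 4 * riesz_form \<gamma>2 u \<psi> u u"
  have dA: "(A has_real_derivative A') (at 0)"
    unfolding A_def[abs_def] A'_def v_def[abs_def] kinetic_line[OF uH(1) \<psi>]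
        by (auto intro!: derivative_eq_intros)
  have dB: "(B has_real_derivative B') (at 0)"
    unfolding B_def[abs_def] B'_def v_def[abs_def] by (rule self_energy_line_deriv[OF adm1 uH(1) \<psi>])
  have dC: "(C has_real_derivative C') (at 0)"
    unfolding C_def[abs_def] C'_def v_def[abs_def] by (rule self_energy_line_deriv[OF adm2 uH(1) \<psi>])
  have dE_eq: "dE = A'/2 + C'/4 - B'/4" by (simp add: dE_def first_variation_def A'_def B'_def C'_def)
  have Q0: "\<gamma>1/4 * B 0 = A 0 + \<gamma>2/4 * C 0" using Q by (simp add: virial_def A_def B_def C_def v0)
  have A0: "0 < A 0" unfolding A_def v0 by (rule kinetic_pos[OF adm1 uH(1,2)])
  have C0: "0 \<le> C 0" by (simp add: C_def)
  \<comment> \<open>The derivative of the virial along dilations at t = 1. Eliminating D1 by the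
    vanishing virial shows it to be negative, so the constraint can be corrected by
    dilating.\<close>
  define Qt where "Qt = 2 * A 0 + \<gamma>2/4 * (\<gamma>2 * C 0) - \<gamma>1/4 * (\<gamma>1 * B 0)"
  have "Qt = (2 - \<gamma>1) * A 0 + \<gamma>2/4 * ((\<gamma>2 - \<gamma>1) * C 0)"
  proof -
    have "\<gamma>1/4 * (\<gamma>1 * B 0) = \<gamma>1 * (A 0 + \<gamma>2/4 * C 0)" unfolding Q0[symmetric] by simp
    then show ?thesis by (simp add: Qt_def algebra_simps)
  qed
  moreover have "(2 - \<gamma>1) * A 0 < 0" using \<gamma>1_gt A0 by (simp add: mult_neg_pos)
  moreover have "\<gamma>2/4 * ((\<gamma>2 - \<gamma>1) * C 0) \<le> 0"
    using exponents_pos \<gamma>21 C0 by (intro mult_nonneg_nonpos mult_nonpos_nonneg) auto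
  ultimately have Qt: "Qt < 0" by simp
  \<comment> \<open>The reduced energy is the energy minus virial/\<gamma>1, so if the virial has
    slope -\<delta> its slope is dE + \<delta>/\<gamma>1. This choice keeps half of the negative
    slope.\<close>
  define \<delta> where "\<delta> = - \<gamma>1 * dE / 2"
  have \<delta>: "0 < \<delta>" using dE exponents_pos by (simp add: \<delta>_def mult_pos_neg)
  define dQ where "dQ = A' + \<gamma>2/4 * C' - \<gamma>1/4 * B'"
  \<comment> \<open>Solves \<kappa> Qt + dQ = -\<delta>, where dQ is the slope of the virial without
    dilation.\<close>
  define \<kappa> where "\<kappa> = (- \<delta> - dQ) / Qt"
  define q where "q s = (1 + \<kappa> * s)\<^sup>2 * A s + \<gamma>2/4 * ((1 + \<kappa> * s) powr \<gamma>2 * C s) - \<gamma>1/4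
      * ((1 + \<kappa> * s) powr \<gamma>1 * B s)" for s
  define i where "i s = (1/2 - 1/\<gamma>1) * ((1 + \<kappa> * s)\<^sup>2 * A s) + (1 - \<gamma>2/\<gamma>1)/4
      * ((1 + \<kappa> * s) powr \<gamma>2 * C s)" for s
  have dpow: "((\<lambda>s. (1 + \<kappa> * s) powr \<gamma>) has_real_derivative \<gamma> * \<kappa>) (at 0)" for \<gamma>
    by (auto intro!: derivative_eq_intros)
  have dsq: "((\<lambda>s. (1 + \<kappa> * s)\<^sup>2) has_real_derivative 2 * \<kappa>) (at 0)"
    by (auto intro!: derivative_eq_intros)
  have dq: "(q has_real_derivative (2 * \<kappa> * A 0 + A') + \<gamma>2/4 * (\<gamma>2 * \<kappa> * C 0 + C') - \<gamma>1/4
      * (\<gamma>1 * \<kappa> * B 0 + B')) (at 0)"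
    unfolding q_def[abs_def]
    by (rule derivative_eq_intros DERIV_cmult dsq dpow dA dB dC | simp)+
  have di: "(i has_real_derivative (1/2 - 1/\<gamma>1) * (2 * \<kappa> * A 0 + A') + (1 - \<gamma>2/\<gamma>1)/4
      * (\<gamma>2 * \<kappa> * C 0 + C')) (at 0)"
    unfolding i_def[abs_def]
    by (rule derivative_eq_intros DERIV_cmult dsq dpow dA dB dC | simp)+
  have q': "(2 * \<kappa> * A 0 + A') + \<gamma>2/4 * (\<gamma>2 * \<kappa> * C 0 + C') - \<gamma>1/4 * (\<gamma>1 * \<kappa> * B 0 + B') = - \<delta>"
  proof -
    have "(2 * \<kappa> * A 0 + A') + \<gamma>2/4 * (\<gamma>2 * \<kappa> * C 0 + C') - \<gamma>1/4 * (\<gamma>1 * \<kappa> * B 0 + B') = \<kappa> * Qt + dQ"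
      by (simp add: Qt_def dQ_def algebra_simps)
    then show ?thesis using Qt by (simp add: \<kappa>_def)
  qed
  have i': "(1/2 - 1/\<gamma>1) * (2 * \<kappa> * A 0 + A') + (1 - \<gamma>2/\<gamma>1)/4 * (\<gamma>2 * \<kappa> * C 0 + C') = dE / 2"
  proof -
    have "(1/2 - 1/\<gamma>1) * (2 * \<kappa> * A 0 + A') + (1 - \<gamma>2/\<gamma>1)/4 * (\<gamma>2 * \<kappa> * C 0 + C')
       = dE + \<kappa> * (A 0 + \<gamma>2/4 * C 0 - \<gamma>1/4 * B 0)
         - ((2 * \<kappa> * A 0 + A') + \<gamma>2/4 * (\<gamma>2 * \<kappa> * C 0 + C') - \<gamma>1/4 * (\<gamma>1 * \<kappa> * B 0 + B')) / \<gamma>1"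
      using exponents_pos(1) unfolding dE_eq by (simp add: field_simps)
    also have "\<dots> = dE + \<delta> / \<gamma>1" unfolding q' using Q0 by simp
    also have "\<dots> = dE / 2" using exponents_pos(1) by (simp add: \<delta>_def)
    finally show ?thesis .
  qed
  have q0: "q 0 = 0" using Q0 by (simp add: q_def)
  have i0: "i 0 = reduced_energy \<gamma>1 \<gamma>2 u" by (simp add: i_def reduced_energy_def A_def C_def v0)
  have e1: "\<forall>\<^sub>F s in at_right 0. q s < 0"
    using DERIV_neg_dec_right[OF dq[unfolded q']] \<delta> q0 by (auto simp: eventually_at_right[of 0 1])
  have e2: "\<forall>\<^sub>F s in at_right 0. i s < i 0"
    using DERIV_neg_dec_right[OF di[unfolded i']] dE by (auto simp: eventually_at_right[of 0 1])
  define m where "m s = ip u u + 2 * ip u \<psi> * s + ip \<psi> \<psi> * s\<^sup>2" for s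
  have m_tendsto: "(m \<longlongrightarrow> ip u u) (at_right 0)"
  proof -
    have "(m \<longlongrightarrow> ip u u + 2 * ip u \<psi> * 0 + ip \<psi> \<psi> * 0\<^sup>2) (at_right 0)" unfolding m_def by (intro tendsto_intros)
    then show ?thesis by simp
  qed
  have e3: "\<forall>\<^sub>F s in at_right 0. 0 < m s" by (rule order_tendstoD(1)[OF m_tendsto uH(2)])
  have e4: "\<forall>\<^sub>F s in at_right 0. m s \<le> c"
    using mass
  proof
    assume "ip u u < c"
    from order_tendstoD(2)[OF m_tendsto this] show ?thesis by eventually_elim simp
  next
    assume neg: "ip u \<psi> < 0"
    have "(m has_real_derivative 2 * ip u \<psi>) (at 0)" unfolding m_def[abs_def]
        by (auto intro!: derivative_eq_intros)
    from DERIV_neg_dec_right[OF this] neg obtain d where "d > 0" "\<forall>h>0. h < d \<longrightarrow> m (0 + h) < m 0" by auto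
    then have "\<forall>\<^sub>F s in at_right 0. m s < m 0" by (auto simp: eventually_at_right[of 0 1])
    moreover have "m 0 \<le> c" using uH by (simp add: m_def)
    ultimately show ?thesis by (auto elim: eventually_mono)
  qed
  have "((\<lambda>s. 1 + \<kappa> * s) \<longlongrightarrow> 1 + \<kappa> * 0) (at_right 0)" by (intro tendsto_intros)
  then have e5: "\<forall>\<^sub>F s in at_right 0. 0 < 1 + \<kappa> * s" by (rule order_tendstoD(1)) simp
  have "\<exists>s. (((q s < 0 \<and> i s < i 0) \<and> 0 < m s) \<and> m s \<le> c) \<and> 0 < 1 + \<kappa> * s"
    by (rule eventually_happens'[OF _ eventually_conj[OF eventually_conj[OF eventually_conj[OF
        eventually_conj[OF e1 e2] e3] e4] e5]]) simp
  then obtain s where s: "q s < 0" "i s < i 0" "0 < m s" "m s \<le> c" "0 < 1 + \<kappa> * s" by blast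
  have "ip (v s) (v s) = m s" unfolding v_def[abs_def] m_def by (rule mass_line[OF uH(1) \<psi>])
  then have "dilate (1 + \<kappa> * s) (v s) \<in> feasible \<gamma>1 \<gamma>2 c"
    using s v by (simp add: feasible_def ip_dilate virial_dilate q_def A_def B_def C_def)
  from min[OF this] have "reduced_energy \<gamma>1 \<gamma>2 u \<le> i s"
    using s v by (simp add: reduced_energy_dilate i_def A_def C_def)
  with s(2) i0 show False by simp
qed

text \<open>Given zero virial and D1 \<le> kinetic + D2, both the kinetic energy and D1 are at most
  multiples of D2. Splitting the kernel of D2 against that of D1 then absorbs half of D2 and leaves
  the squared mass.\<close>

lemma small_mass_contradiction:
  "\<exists>c1>0. \<forall>u\<in>(H1 :: (real^'n \<Rightarrow> 'k::euclidean_space) set). 0 < ip u u \<longrightarrow> ip u u < c1 \<longrightarrow> virial \<gamma>1 \<gamma>2 u = 0 \<longrightarrow>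
     kinetic u + self_energy \<gamma>2 u < self_energy \<gamma>1 u"
proof -
  obtain k where k: "0 < k" "\<forall>u\<in>H1. 0 < ip u u \<longrightarrow> virial \<gamma>1 \<gamma>2 (u :: real^'n \<Rightarrow> 'k) \<le> 0 \<longrightarrow>
     1 \<le> k * ip u u * (kinetic u / ip u u) powr (\<gamma>1 / 2 - 1)"
    using kinetic_lower_bound by blast
  define p where "p = \<gamma>1 / 2 - 1"
  have p: "0 < p" using \<gamma>1_gt by (simp add: p_def)
  \<comment> \<open>The constant in D1 \<le> \<kappa> D2. It comes from (4 - \<gamma>1) kinetic
    \<le> (\<gamma>1 - \<gamma>2) D2 inserted into the virial identity; here \<gamma>1 < 4 is
    essential.\<close>
  define \<kappa> where "\<kappa> = (4 * ((\<gamma>1 - \<gamma>2) / (4 - \<gamma>1)) + \<gamma>2) / \<gamma>1"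
  have \<kappa>: "0 < \<kappa>" unfolding \<kappa>_def using exponents_pos \<gamma>21 by (intro divide_pos_pos add_nonneg_pos) auto
  \<comment> \<open>Splitting distance at which the D1 part of the bound for D2 is at most
    D2/2.\<close>
  define e where "e = (1 / (2 * \<kappa>)) powr (1 / (\<gamma>1 - \<gamma>2))"
  have e: "0 < e" "e powr (\<gamma>1 - \<gamma>2) = 1 / (2 * \<kappa>)" using \<kappa> \<gamma>21 by (auto simp: e_def powr_powr)
  define K where "K = (\<gamma>1 - \<gamma>2) / (4 - \<gamma>1) * (4 * e powr (- \<gamma>2))"
  have K: "0 < K" unfolding K_def using exponents_pos \<gamma>21 e by (intro mult_pos_pos divide_pos_pos) auto
  \<comment> \<open>With kinetic \<le> K M^2 for the mass M, the right-hand side of the lower bound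
    is at most k K^p M^(1+p); at this threshold it would equal 1/2 instead of being at least
    1.\<close>
  define c1 where "c1 = (1 / (2 * k * K powr p)) powr (1 / (1 + p))"
  have c1: "0 < c1" "c1 powr (1 + p) = 1 / (2 * k * K powr p)" using k K p by (auto simp: c1_def powr_powr)
  have "kinetic u + self_energy \<gamma>2 u < self_energy \<gamma>1 u"
    if u: "u \<in> H1" and M: "0 < ip u u" "ip u u < c1" and Q: "virial \<gamma>1 \<gamma>2 u = 0" for u :: "real^'n \<Rightarrow> 'k"
  proof (rule ccontr)
    assume neg: "\<not> kinetic u + self_energy \<gamma>2 u < self_energy \<gamma>1 u"
    define A B C M where "A = kinetic u" and "B = self_energy \<gamma>1 u" and "C = self_energy \<gamma>2 u"
        and "M = ip u u"
    have A: "0 < A" unfolding A_def by (rule kinetic_pos[OF adm1 u M(1)])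
    have M0: "0 < M" "M < c1" using M by (auto simp: M_def)
    have Q': "\<gamma>1 * B = 4 * A + \<gamma>2 * C" using Q by (simp add: virial_def A_def B_def C_def)
    have "\<gamma>1 * B \<le> \<gamma>1 * (A + C)" using neg exponents_pos
        by (intro mult_left_mono) (auto simp: A_def B_def C_def)
    then have "(4 - \<gamma>1) * A \<le> (\<gamma>1 - \<gamma>2) * C" using Q' by (simp add: algebra_simps)
    then have AC: "A \<le> (\<gamma>1 - \<gamma>2) / (4 - \<gamma>1) * C" using exponents_pos by (simp add: le_divide_eq mult.commute)
    have BC: "B \<le> \<kappa> * C"
    proof -
      have "B = (4 * A + \<gamma>2 * C) / \<gamma>1" using Q' exponents_pos by (simp add: eq_divide_eq mult.commute)
      also have "\<dots> \<le> (4 * ((\<gamma>1 - \<gamma>2) / (4 - \<gamma>1) * C) + \<gamma>2 * C) / \<gamma>1"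
        using AC exponents_pos by (intro divide_right_mono add_right_mono mult_left_mono) auto
      also have "\<dots> = \<kappa> * C" by (simp add: \<kappa>_def algebra_simps add_divide_distrib)
      finally show ?thesis .
    qed
    have "C \<le> e powr (\<gamma>1 - \<gamma>2) * B + e powr (- \<gamma>2) * (LINT x|lborel. (u x \<bullet> u x) * real_local_mass u e x)
        + e powr (- \<gamma>2) * M * M"
      unfolding B_def C_def M_def self_energy_def by (rule riesz_form_split[OF adm2 adm1 \<gamma>21 u u e(1) e(1)])
    also have "\<dots> \<le> e powr (\<gamma>1 - \<gamma>2) * (\<kappa> * C) + e powr (- \<gamma>2) * (M * M) + e powr (- \<gamma>2) * M * M"
    proof (intro add_right_mono add_mono mult_left_mono BC)
      show "(LINT x|lborel. (u x \<bullet> u x) * real_local_mass u e x) \<le> M * M"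
        unfolding M_def using u by (intro local_mass_integral_le real_local_mass_le) auto
    qed auto
    also have "e powr (\<gamma>1 - \<gamma>2) * (\<kappa> * C) = C / 2" unfolding e(2) using \<kappa> by simp
    finally have "C \<le> 4 * e powr (- \<gamma>2) * M\<^sup>2" by (simp add: power2_eq_square mult_ac)
    then have "(\<gamma>1 - \<gamma>2) / (4 - \<gamma>1) * C \<le> (\<gamma>1 - \<gamma>2) / (4 - \<gamma>1) * (4 * e powr (- \<gamma>2) * M\<^sup>2)"
      using exponents_pos \<gamma>21 by (intro mult_left_mono) auto
    with AC have "A \<le> K * M\<^sup>2" by (simp add: K_def)
    then have "A / M \<le> K * M" using M0 by (simp add: divide_le_eq power2_eq_square mult.assoc)
    then have "(A / M) powr p \<le> (K * M) powr p" using A M0 p by (intro powr_mono2) auto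
    have "1 \<le> k * M * (A / M) powr p" using k(2) u M Q by (simp add: p_def A_def M_def)
    also have "\<dots> \<le> k * M * (K * M) powr p" using k(1) M0 \<open>(A / M) powr p \<le> _\<close> by (intro mult_left_mono) auto
    also have "\<dots> = k * K powr p * M powr (1 + p)" using M0 K by (simp add: powr_mult powr_add)
    also have "\<dots> \<le> k * K powr p * c1 powr (1 + p)" using M0 p k(1) by (intro mult_left_mono powr_mono2) auto
    also have "\<dots> = 1 / 2" unfolding c1(2) using k(1) K by simp
    finally show False by simp
  qed
  with c1(1) show ?thesis by blast
qed

lemma first_variation_linear:
  fixes u \<psi> \<phi> :: "real^'n \<Rightarrow> 'k::euclidean_space"
  assumes "u \<in> H1" "\<psi> \<in> H1" "\<phi> \<in> H1"
  shows "first_variation \<gamma>1 \<gamma>2 u (\<lambda>x. \<psi> x + s *\<^sub>R \<phi> x) = first_variation \<gamma>1 \<gamma>2 u \<psi>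
      + s * first_variation \<gamma>1 \<gamma>2 u \<phi>"
proof -
  have "ip (weak_gradient u) (weak_gradient (\<lambda>x. \<psi> x + s *\<^sub>R \<phi> x))
     = ip (weak_gradient u) (\<lambda>x. weak_gradient \<psi> x + s *\<^sub>R weak_gradient \<phi> x)"
    by (intro ip_weak_gradient has_gradient_add has_gradient_scaleR has_gradient_weak_gradient assms)
  then show ?thesis
    using assms by (simp add: first_variation_def ip_add_right riesz_form_add[OF adm1] riesz_form_add[OF adm2]
        riesz_form_scaleR[OF adm1] riesz_form_scaleR[OF adm2] algebra_simps)
qed

text \<open>For directions orthogonal to \<open>u\<close> a small multiple of -u is added to lower
  the mass to first order, then the multiple is sent to zero. Applied to both signs this gives
  equality on the orthogonal complement, and the multiplier is the quotient found by testing with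
  \<open>u\<close>.\<close>

lemma minimizer_euler_lagrange:
  fixes u :: "real^'n \<Rightarrow> 'k::euclidean_space"
  assumes u: "u \<in> feasible \<gamma>1 \<gamma>2 c"
    and min: "\<And>w. w \<in> feasible \<gamma>1 \<gamma>2 c \<Longrightarrow> reduced_energy \<gamma>1 \<gamma>2 u \<le> reduced_energy \<gamma>1 \<gamma>2 (w :: real^'n \<Rightarrow> 'k)"
    and \<psi>: "\<psi> \<in> H1"
  shows "first_variation \<gamma>1 \<gamma>2 u \<psi> = first_variation \<gamma>1 \<gamma>2 u u / ip u u * ip u \<psi>"
proof -
  have uH: "u \<in> H1" "0 < ip u u" using u by (auto simp: feasible_def)
  have nonneg: "0 \<le> first_variation \<gamma>1 \<gamma>2 u \<phi>" if \<phi>: "\<phi> \<in> H1" "ip u \<phi> = 0" for \<phi>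
  proof -
    \<comment> \<open>\<open>n\<close> is a large real weight: the perturbed direction is \<phi> -
      u/n, and the inequality has been multiplied by \<open>n\<close>. It keeps the first variation
      at \<phi> from being negative.\<close>
    have "first_variation \<gamma>1 \<gamma>2 u u \<le> n * first_variation \<gamma>1 \<gamma>2 u \<phi>" if "0 < n" for n :: real
    proof -
      have "ip u (\<lambda>x. \<phi> x + (- 1 / n) *\<^sub>R u x) = ip u \<phi> + (- 1 / n) * ip u u"
        using ip_add_right[OF H1_sq[OF \<phi>(1)] sq_scaleR[OF H1_sq[OF uH(1)]] H1_sq[OF uH(1)]] ip_scale_right[of
            u "- 1 / n" u]
        by presburger
      moreover have "(- 1 / n) * ip u u < 0" using that uH by (intro mult_neg_pos) auto
      ultimately have "ip u (\<lambda>x. \<phi> x + (- 1 / n) *\<^sub>R u x) < 0" using \<phi>(2) by simp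
      then have "0 \<le> first_variation \<gamma>1 \<gamma>2 u (\<lambda>x. \<phi> x + (- 1 / n) *\<^sub>R u x)"
        by (intro minimizer_first_variation[OF u min] H1_add H1_scaleR uH(1) \<phi>(1) disjI2)
      then have "0 \<le> n * (first_variation \<gamma>1 \<gamma>2 u \<phi> + (- 1 / n) * first_variation \<gamma>1 \<gamma>2 u u)"
        using that by (subst (asm) first_variation_linear[OF uH(1) \<phi>(1) uH(1)]) simp
      then show ?thesis using that by (simp add: right_diff_distrib)
    qed
    note le = this
    show ?thesis
    proof (rule ccontr)
      assume "\<not> ?thesis"
      then have neg: "first_variation \<gamma>1 \<gamma>2 u \<phi> < 0" by simp
      define n where "n = (\<bar>first_variation \<gamma>1 \<gamma>2 u u\<bar> + 1) / (- first_variation \<gamma>1 \<gamma>2 u \<phi>)"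
      have "0 < n" unfolding n_def using neg by (intro divide_pos_pos) auto
      from le[OF this] have "first_variation \<gamma>1 \<gamma>2 u u \<le> - (\<bar>first_variation \<gamma>1 \<gamma>2 u u\<bar> + 1)"
        using neg by (simp add: n_def)
      then show False by linarith
    qed
  qed
  define \<phi> where "\<phi> x = \<psi> x + (- ip u \<psi> / ip u u) *\<^sub>R u x" for x
  have \<phi>: "\<phi> \<in> H1" "ip u \<phi> = 0" using uH \<psi> by (auto simp: \<phi>_def[abs_def] ip_diff_right)
  have minus: "(\<lambda>x. (0::'k) + (- 1) *\<^sub>R \<phi> x) \<in> H1" using H1_scaleR[OF \<phi>(1), of "-1"] by simp
  have zero: "(\<lambda>x::real^'n. 0::'k) \<in> H1" using H1_scaleR[OF uH(1), of 0] by simp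
  have "first_variation \<gamma>1 \<gamma>2 u (\<lambda>x. 0 + (- 1) *\<^sub>R \<phi> x) = first_variation \<gamma>1 \<gamma>2 u (\<lambda>x. 0)
      + (- 1) * first_variation \<gamma>1 \<gamma>2 u \<phi>"
    by (rule first_variation_linear[OF uH(1) zero \<phi>(1)])
  moreover have "first_variation \<gamma>1 \<gamma>2 u (\<lambda>x. 0) = 0"
    using first_variation_linear[OF uH(1) zero zero, of 1] by simp
  moreover have "0 \<le> first_variation \<gamma>1 \<gamma>2 u (\<lambda>x. 0 + (- 1) *\<^sub>R \<phi> x)"
  proof (rule nonneg[OF minus])
    show "ip u (\<lambda>x. 0 + - 1 *\<^sub>R \<phi> x) = 0" using ip_scale_right[of u "-1" \<phi>] \<phi>(2) by simp
  qed
  ultimately have "first_variation \<gamma>1 \<gamma>2 u \<phi> = 0" using nonneg[OF \<phi>] by linarith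
  then show ?thesis
    unfolding \<phi>_def[abs_def] by (subst (asm) first_variation_linear[OF uH(1) \<psi> uH(1)]) simp
qed

lemma weak_solution_iff:
  fixes u :: "real^'n \<Rightarrow> 'k::euclidean_space"
  shows "weak_solution \<gamma>1 \<gamma>2 lam u \<longleftrightarrow> u \<in> H1 \<and> (\<forall>v\<in>H1. first_variation \<gamma>1 \<gamma>2 u v + lam * ip u v = 0)"
proof -
  have "((LINT x|lborel. weak_gradient u x \<bullet> weak_gradient v x) + lam * (LINT x|lborel. u x \<bullet> v x)
        = (LINT x|lborel. (riesz_conv \<gamma>1 u x *\<^sub>R u x) \<bullet> v x)
            - (LINT x|lborel. (riesz_conv \<gamma>2 u x *\<^sub>R u x) \<bullet> v x))
     \<longleftrightarrow> first_variation \<gamma>1 \<gamma>2 u v + lam * ip u v = 0" if "u \<in> H1" "v \<in> H1" for v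
    unfolding riesz_conv_eq_riesz_form[OF adm1 that] riesz_conv_eq_riesz_form[OF adm2 that]
    by (auto simp: first_variation_def ip_def)
  then show ?thesis by (auto simp: weak_solution_def)
qed

lemma Q_eq_virial: "u \<in> H1 \<Longrightarrow> Q \<gamma>1 \<gamma>2 u = virial \<gamma>1 \<gamma>2 (u :: real^'n \<Rightarrow> 'k::euclidean_space)"
  by (simp add: Q_def virial_def D_eq_riesz_form[OF adm1] D_eq_riesz_form[OF adm2] self_energy_def kinetic_def
      ip_self)

lemma E_eq: "u \<in> H1 \<Longrightarrow> E \<gamma>1 \<gamma>2 u = reduced_energy \<gamma>1 \<gamma>2 u + virial \<gamma>1 \<gamma>2 (u :: real^'n \<Rightarrow> 'k::euclidean_space)
    / \<gamma>1"
  using exponents_pos(1)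
  by (simp add: E_def virial_def reduced_energy_def D_eq_riesz_form[OF adm1] D_eq_riesz_form[OF adm2]
      self_energy_def kinetic_def ip_self field_simps)

theorem minimizer_is_solution:
  "\<exists>c1>0. \<forall>c. 0 < c \<and> c < c1 \<longrightarrow> (\<exists>u :: real^'n \<Rightarrow> 'k::euclidean_space.
     normalized_solution \<gamma>1 \<gamma>2 c u \<and> virial \<gamma>1 \<gamma>2 u = 0 \<and> (\<forall>w\<in>S c. virial \<gamma>1 \<gamma>2 (w :: real^'n \<Rightarrow> 'k) = 0
         \<longrightarrow> E \<gamma>1 \<gamma>2 u \<le> E \<gamma>1 \<gamma>2 w))"
proof -
  obtain c1 where c1: "0 < c1" "\<forall>u\<in>(H1 :: (real^'n \<Rightarrow> 'k) set). 0 < ip u u \<longrightarrow> ip u u < c1 \<longrightarrow> virial \<gamma>1 \<gamma>2 u = 0 \<longrightarrow>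
     kinetic u + self_energy \<gamma>2 u < self_energy \<gamma>1 u"
    using small_mass_contradiction by blast
  have "\<exists>u :: real^'n \<Rightarrow> 'k. normalized_solution \<gamma>1 \<gamma>2 c u \<and> virial \<gamma>1 \<gamma>2 u = 0 \<and>
     (\<forall>w\<in>S c. virial \<gamma>1 \<gamma>2 (w :: real^'n \<Rightarrow> 'k) = 0 \<longrightarrow> E \<gamma>1 \<gamma>2 u \<le> E \<gamma>1 \<gamma>2 w)"
    if c: "0 < c" "c < c1" for c
  proof -
    obtain u :: "real^'n \<Rightarrow> 'k" where u: "u \<in> feasible \<gamma>1 \<gamma>2 c"
      and min: "\<And>w. w \<in> feasible \<gamma>1 \<gamma>2 c \<Longrightarrow> reduced_energy \<gamma>1 \<gamma>2 u \<le> reduced_energy \<gamma>1 \<gamma>2 (w :: real^'n \<Rightarrow> 'k)"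
      using minimizer_exists[OF c(1), where 'k='k] by blast
    have uH: "u \<in> H1" "0 < ip u u" "ip u u \<le> c" using u by (auto simp: feasible_def)
    have Q: "virial \<gamma>1 \<gamma>2 u = 0" by (rule minimizer_virial[OF u min])
    have mass: "ip u u = c"
    proof (rule ccontr)
      assume "ip u u \<noteq> c"
      then have "ip u u < c" using uH by simp
      \<comment> \<open>With slack in the mass, the outward direction \<open>u\<close> is allowed.
        This one-sided inequality already conflicts with the strict inequality valid at small
        mass.\<close>
      then have "0 \<le> first_variation \<gamma>1 \<gamma>2 u u"
        by (intro minimizer_first_variation[OF u min uH(1)]) auto
      moreover have "kinetic u + self_energy \<gamma>2 u < self_energy \<gamma>1 u" using c1(2) uH Q c by simp
      ultimately show False by (simp add: first_variation_def kinetic_def self_energy_def)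
    qed
    have S_iff: "w \<in> S c \<longleftrightarrow> w \<in> H1 \<and> ip w w = c" for w :: "real^'n \<Rightarrow> 'k"
      by (simp add: S_def ip_self)
    have "weak_solution \<gamma>1 \<gamma>2 (- (first_variation \<gamma>1 \<gamma>2 u u / ip u u)) u"
      unfolding weak_solution_iff
    proof (intro conjI ballI uH(1))
      fix v :: "real^'n \<Rightarrow> 'k" assume "v \<in> H1"
      from minimizer_euler_lagrange[OF u min this]
      show "first_variation \<gamma>1 \<gamma>2 u v + - (first_variation \<gamma>1 \<gamma>2 u u / ip u u) * ip u v = 0" by simp
    qed
    then have "normalized_solution \<gamma>1 \<gamma>2 c u"
      unfolding normalized_solution_def S_iff using uH mass by blast
    moreover have "E \<gamma>1 \<gamma>2 u \<le> E \<gamma>1 \<gamma>2 w" if "w \<in> S c" "virial \<gamma>1 \<gamma>2 w = 0" for w :: "real^'n \<Rightarrow> 'k"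
    proof -
      have w: "w \<in> H1" "ip w w = c" using that(1) by (auto simp: S_iff)
      then have "w \<in> feasible \<gamma>1 \<gamma>2 c" using that(2) c by (simp add: feasible_def)
      from min[OF this] show ?thesis using that(2) Q w uH by (simp add: E_eq)
    qed
    ultimately show ?thesis using Q by blast
  qed
  with c1(1) show ?thesis by blast
qed

end

section \<open>The Pohozaev identity\<close>

context hartree_exponents
begin

text \<open>The linearised potential is form-bounded with relative bound zero, so testing the equation with
  differences of translates controls \<open>\<nabla>(v(\<cdot> + h) - v)\<close> in \<open>L\<^sup>2\<close>: weak solutions lie in \<open>H\<^sup>2\<close>.\<close>

lemma weak_solution_translation_bound:
  fixes v :: "real^'n \<Rightarrow> 'k::euclidean_space"
  assumes v: "v \<in> H1" and eq: "\<And>\<phi>. \<phi> \<in> H1 \<Longrightarrow> first_variation \<gamma>1 \<gamma>2 v \<phi> + lam * ip v \<phi> = 0"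
  shows "\<exists>C. \<forall>h. ip (\<lambda>x. weak_gradient v (x + h) - weak_gradient v x) (\<lambda>x. weak_gradient v (x + h)
      - weak_gradient v x) \<le> C * (norm h)\<^sup>2"
proof -
  define H where "H = h1sq v"
  \<comment> \<open>The fraction 1/12 is fixed by the count below: three terms for each of the two
    exponents add up to half of the kinetic energy, which is absorbed.\<close>
  obtain C1 where C1: "0 \<le> C1" and b1: "\<And>(u :: real^'n \<Rightarrow> 'k) (w :: real^'n \<Rightarrow> 'k). u \<in> H1 \<Longrightarrow> w \<in> H1
      \<Longrightarrow> h1sq u \<le> H \<Longrightarrow>
     riesz_form \<gamma>1 u u w w \<le> 1/12 * kinetic w + C1 * ip w w"
    using riesz_form_bound_small[OF adm1, of "1/12" H] by auto
  obtain C2 where C2: "0 \<le> C2" and b2: "\<And>(u :: real^'n \<Rightarrow> 'k) (w :: real^'n \<Rightarrow> 'k). u \<in> H1 \<Longrightarrow> w \<in> H1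
      \<Longrightarrow> h1sq u \<le> H \<Longrightarrow>
     riesz_form \<gamma>2 u u w w \<le> 1/12 * kinetic w + C2 * ip w w"
    using riesz_form_bound_small[OF adm2, of "1/12" H] by auto
  define C where "C = 2 * (3 * (C1 + C2) + \<bar>lam\<bar>)"
  have C: "0 \<le> C" using C1 C2 by (simp add: C_def)
  have "ip (\<lambda>x. weak_gradient v (x + h) - weak_gradient v x) (\<lambda>x. weak_gradient v (x + h) - weak_gradient v x)
      \<le> (C * kinetic v) * (norm h)\<^sup>2" for h
  proof -
    define vh where "vh x = v (x + h)" for x
    define w where "w x = vh x - v x" for x
    define Dw where "Dw x = weak_gradient v (x + h) - weak_gradient v x" for x
    have vh: "vh \<in> H1" using v by (simp add: vh_def[abs_def])
    have w: "w \<in> H1" using v vh by (simp add: w_def[abs_def])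
    have sqDw: "sq Dw" using v by (simp add: Dw_def[abs_def])
    have hgw: "has_gradient w Dw"
      unfolding w_def[abs_def] vh_def[abs_def] Dw_def[abs_def]
      by (intro has_gradient_diff has_gradient_translate has_gradient_weak_gradient v)
    have kin: "kinetic w = ip Dw Dw" by (rule kinetic_eq[OF hgw])
    have vhH: "h1sq vh \<le> H" "h1sq v \<le> H" using h1sq_translate[OF v, of h]
        by (simp_all add: H_def vh_def[abs_def])
    have G1: "ip (weak_gradient v) (weak_gradient w) = ip (weak_gradient v) Dw"
      by (rule ip_weak_gradient[OF has_gradient_weak_gradient[OF v] hgw])
    \<comment> \<open>Testing with the back-translated increment amounts to testing the translated
      equation with \<open>w\<close>; the difference to the equation tested with \<open>w\<close>
      contains only increments.\<close>
    define w' where "w' x = w (x - h)" for x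
    have w': "w' \<in> H1" using H1_translate[OF w, of "-h"] by (simp add: w'_def[abs_def])
    have hgw': "has_gradient w' (\<lambda>x. Dw (x - h))" using has_gradient_translate[OF hgw, of "-h"]
        by (simp add: w'_def[abs_def])
    have G2: "ip (weak_gradient v) (weak_gradient w') = ip (\<lambda>x. weak_gradient v (x + h)) Dw"
      using ip_weak_gradient[OF has_gradient_weak_gradient[OF v] hgw'] ip_translate_left[of "weak_gradient v"
          Dw h] v sqDw by simp
    have M2: "ip v w' = ip vh w"
      using ip_translate_left[of v w h] v w by (simp add: w'_def[abs_def] vh_def[abs_def])
    have R2: "riesz_form \<gamma> v w' v v = riesz_form \<gamma> vh w vh vh" if adm: "admissible TYPE('n) \<gamma>" for \<gamma>
      using riesz_form_translate[OF adm v w' v v, of h] by (simp add: w'_def vh_def[abs_def])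
    have e1: "ip (weak_gradient v) Dw + riesz_form \<gamma>2 v w v v - riesz_form \<gamma>1 v w v v + lam * ip v w = 0"
      using eq[OF w] by (simp add: first_variation_def G1)
    have e2: "ip (\<lambda>x. weak_gradient v (x + h)) Dw + riesz_form \<gamma>2 vh w vh vh - riesz_form \<gamma>1 vh w vh vh
        + lam * ip vh w = 0"
      using eq[OF w'] by (simp add: first_variation_def G2 M2 R2 adm1 adm2)
    have "ip Dw Dw = ip (\<lambda>x. weak_gradient v (x + h)) Dw - ip (weak_gradient v) Dw"
      using ip_diff_left[of "\<lambda>x. weak_gradient v (x + h)" "weak_gradient v" Dw] v sqDw
          by (simp add: Dw_def[abs_def])
    moreover have "ip w w = ip vh w - ip v w"
      using ip_diff_left[of vh v w] v vh w by (simp add: w_def[abs_def])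
    ultimately have key: "kinetic w + lam * ip w w
       = (riesz_form \<gamma>1 vh w vh vh - riesz_form \<gamma>1 v w v v)
           - (riesz_form \<gamma>2 vh w vh vh - riesz_form \<gamma>2 v w v v)"
      using e1 e2 unfolding kin by (simp add: right_diff_distrib)
    have diff: "\<bar>riesz_form \<gamma> vh w vh vh - riesz_form \<gamma> v w v v\<bar> \<le> 3 * (1/12 * kinetic w + K * ip w w)"
      if adm: "admissible TYPE('n) \<gamma>" and b: "\<And>u. u \<in> H1 \<Longrightarrow> h1sq u \<le> H
          \<Longrightarrow> riesz_form \<gamma> u u w w \<le> 1/12 * kinetic w + K * ip w w" for \<gamma> K
    proof -
      \<comment> \<open>Substituting one slot at a time leaves three forms in which \<open>w\<close>
        occurs twice, so each is bounded by diagonal forms carrying |w|^2.\<close>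
      have vh_eq: "vh = (\<lambda>x. v x + w x)" by (simp add: w_def fun_eq_iff)
      have "riesz_form \<gamma> vh w vh vh = riesz_form \<gamma> v w vh vh + riesz_form \<gamma> w w vh vh"
        by (subst (1) vh_eq) (rule riesz_form_add(1)[OF adm v w w vh vh])
      moreover have "riesz_form \<gamma> v w vh vh = riesz_form \<gamma> v w v vh + riesz_form \<gamma> v w w vh"
        by (subst (1) vh_eq) (rule riesz_form_add(3)[OF adm v w vh v w])
      moreover have "riesz_form \<gamma> v w v vh = riesz_form \<gamma> v w v v + riesz_form \<gamma> v w v w"
        by (subst (1) vh_eq) (rule riesz_form_add(4)[OF adm v w v v w])
      moreover have "riesz_form \<gamma> v w v w = riesz_form \<gamma> v w w v" by (rule riesz_form_commute2[OF adm])
      moreover have "\<bar>riesz_form \<gamma> v w w v\<bar> \<le> riesz_form \<gamma> v v w w / 2 + riesz_form \<gamma> w w v v / 2"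
        by (rule riesz_form_abs_le[OF adm v w w v])
      moreover have "\<bar>riesz_form \<gamma> v w w vh\<bar> \<le> riesz_form \<gamma> v v w w / 2 + riesz_form \<gamma> w w vh vh / 2"
        by (rule riesz_form_abs_le[OF adm v w w vh])
      moreover have "riesz_form \<gamma> w w v v = riesz_form \<gamma> v v w w" by (rule riesz_form_swap[OF adm w w v v])
      moreover have "riesz_form \<gamma> w w vh vh = riesz_form \<gamma> vh vh w w"
          by (rule riesz_form_swap[OF adm w w vh vh])
      moreover have "a + (t + (s + m)) - a \<le> 3 * X \<and> - (a + (t + (s + m)) - a) \<le> 3 * X"
        if "\<bar>t\<bar> \<le> l / 2 + l / 2" "\<bar>s\<bar> \<le> l / 2 + m / 2" "l \<le> X" "m \<le> X" "0 \<le> m" for a t s l m X :: real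
        using that by linarith
      moreover note b[OF v vhH(2)] b[OF vh vhH(1)] riesz_form_nonneg[of \<gamma> vh w]
      ultimately show ?thesis unfolding abs_le_iff by (simp add: add.assoc)
    qed
    have "kinetic w \<le> 1/2 * kinetic w + (3 * (C1 + C2) + \<bar>lam\<bar>) * ip w w"
    proof -
      have "- lam * ip w w \<le> \<bar>lam\<bar> * ip w w" by (intro mult_right_mono) auto
      moreover have "\<bar>riesz_form \<gamma>1 vh w vh vh - riesz_form \<gamma>1 v w v v\<bar>
          \<le> 3 * (1/12 * kinetic w + C1 * ip w w)"
        by (rule diff[OF adm1 b1[OF _ w]])
      moreover have "\<bar>riesz_form \<gamma>2 vh w vh vh - riesz_form \<gamma>2 v w v v\<bar>
          \<le> 3 * (1/12 * kinetic w + C2 * ip w w)"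
        by (rule diff[OF adm2 b2[OF _ w]])
      ultimately show ?thesis using key by (simp add: distrib_left distrib_right abs_le_iff)
    qed
    then have "kinetic w \<le> 2 * ((3 * (C1 + C2) + \<bar>lam\<bar>) * ip w w)" by linarith
    then have "kinetic w \<le> C * ip w w" unfolding C_def by (simp only: mult.assoc)
    also have "\<dots> \<le> C * ((norm h)\<^sup>2 * kinetic v)"
      using ip_translate_diff_kinetic[OF v, of h] C unfolding w_def[abs_def] vh_def[abs_def]
          by (intro mult_left_mono) auto
    finally show ?thesis unfolding kin Dw_def[abs_def] by (simp add: mult_ac)
  qed
  then show ?thesis by blast
qed

end

text \<open>The discrete identity 2 f (f_h - f) = f_h^2 - f^2 - (f_h - f)^2 is integrated against
  the weight and divided by twice the step. A shift moves the first difference onto the weight; the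
  last square is of second order in the step by the translation bound. Only weak convergence of the
  quotients is used.\<close>

lemma integration_by_parts_square:
  fixes f Z :: "real^'n::finite \<Rightarrow> 'b::euclidean_space" and e :: "real^'n"
  assumes f: "sq f" and Z: "sq Z" and bound: "\<And>h. ip (\<lambda>x. f (x + h *\<^sub>R e) - f x) (\<lambda>x. f (x + h *\<^sub>R e) - f x)
      \<le> C * h\<^sup>2"
    and s: "\<And>n::nat. 0 < s n" "s \<longlonglongrightarrow> 0" and weak: "wconv (\<lambda>n x. (1 / s n) *\<^sub>R (f (x + s n *\<^sub>R e) - f x)) Z"
    and [measurable]: "\<mu> \<in> borel_measurable borel" "\<mu>' \<in> borel_measurable borel"
    and B: "\<And>x. \<bar>\<mu> x\<bar> \<le> B" and lip: "\<And>x h. \<bar>\<mu> (x + h *\<^sub>R e) - \<mu> x\<bar> \<le> L * \<bar>h\<bar>"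
    and deriv: "\<And>x. ((\<lambda>h. \<mu> (x + h *\<^sub>R e)) has_real_derivative \<mu>' x) (at 0)"
  shows "(LINT x|lborel. \<mu> x * (f x \<bullet> Z x)) = - (1/2) * (LINT x|lborel. \<mu>' x * (f x \<bullet> f x))"
proof -
  have [measurable]: "f \<in> borel_measurable borel" using f by measurable
  have B0: "0 \<le> B" using B[of 0] by linarith
  have sq\<mu>: "sq (\<lambda>x. \<mu> x *\<^sub>R g x)" if g: "sq g" for g :: "real^'n \<Rightarrow> 'b"
  proof -
    have [measurable]: "g \<in> borel_measurable borel" using g by measurable
    show ?thesis by (rule sq_dominated[OF g, of _ B]) (use B in \<open>auto intro: mult_right_mono\<close>)
  qed
  define fh where "fh n x = f (x + s n *\<^sub>R e)" for n x
  have fh: "sq (fh n)" for n using f by (simp add: fh_def[abs_def])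
  have [measurable]: "fh n \<in> borel_measurable borel" for n using fh by measurable
  have int\<mu>: "integrable lborel (\<lambda>x. \<mu> x * (g x \<bullet> k x))" if "sq g" "sq k" for g k :: "real^'n \<Rightarrow> 'b"
    using integrable_inner[OF sq\<mu>[OF that(1)] that(2)] by simp
  define X where "X n = (1 / s n) * (LINT x|lborel. \<mu> x * (f x \<bullet> (fh n x - f x)))" for n
  have X1: "X \<longlonglongrightarrow> (LINT x|lborel. \<mu> x * (f x \<bullet> Z x))"
  proof -
    have "(\<lambda>n. ip (\<lambda>x. (1 / s n) *\<^sub>R (f (x + s n *\<^sub>R e) - f x)) (\<lambda>x. \<mu> x *\<^sub>R f x)) \<longlonglongrightarrow> ip Z (\<lambda>x. \<mu> x *\<^sub>R f x)"
      using weak sq\<mu>[OF f] unfolding wconv_def by blast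
    moreover have "ip (\<lambda>x. (1 / s n) *\<^sub>R (f (x + s n *\<^sub>R e) - f x)) (\<lambda>x. \<mu> x *\<^sub>R f x) = X n" for n
      unfolding X_def ip_scale_left by (simp add: ip_def fh_def inner_commute)
    ultimately show ?thesis by (simp add: ip_def inner_commute)
  qed
  \<comment> \<open>The shift produces a backward increment divided by a positive step, hence the
    limit is minus the derivative of the weight.\<close>
  define q where "q n x = (\<mu> (x + (- s n) *\<^sub>R e) - \<mu> x) / s n" for n x
  have [measurable]: "q n \<in> borel_measurable borel" for n unfolding q_def by measurable
  have q_bound: "\<bar>q n x\<bar> \<le> L" for n x
    using lip[of x "- s n"] s(1)[of n] by (simp add: q_def abs_divide divide_le_eq)
  have q_lim: "(\<lambda>n. q n x) \<longlonglongrightarrow> - \<mu>' x" for x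
  proof -
    have d: "((\<lambda>h. (\<mu> (x + h *\<^sub>R e) - \<mu> x) / h) \<longlongrightarrow> \<mu>' x) (at 0)" using deriv[of x] by (simp add: DERIV_def)
    have ms: "(\<lambda>n. - s n) \<longlonglongrightarrow> 0" using tendsto_minus[OF s(2)] by simp
    have "((\<lambda>h. (\<mu> (x + h *\<^sub>R e) - \<mu> x) / h) \<circ> (\<lambda>n. - s n)) \<longlonglongrightarrow> \<mu>' x"
      using d ms s(1) unfolding tendsto_at_iff_sequentially by (auto simp: less_imp_neq[symmetric])
    then have "(\<lambda>n. - ((\<mu> (x + (- s n) *\<^sub>R e) - \<mu> x) / (- s n))) \<longlonglongrightarrow> - \<mu>' x"
      by (intro tendsto_minus) (simp add: o_def)
    then show ?thesis by (simp add: q_def)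
  qed
  have X2: "X n = 1/2 * (LINT x|lborel. q n x * (f x \<bullet> f x)) - 1 / (2 * s n)
      * (LINT x|lborel. \<mu> x * ((fh n x - f x) \<bullet> (fh n x - f x)))" for n
  proof -
    have shift: "(LINT x|lborel. \<mu> x * (fh n x \<bullet> fh n x)) = (LINT x|lborel. \<mu> (x - s n *\<^sub>R e) * (f x \<bullet> f x))"
    proof -
      have "(LINT x|lborel. \<mu> x * (fh n x \<bullet> fh n x)) = \<bar>1\<bar> ^ DIM(real^'n) *\<^sub>R
         (LINT x|lborel. \<mu> (- (s n *\<^sub>R e) + 1 *\<^sub>R x)
             * (fh n (- (s n *\<^sub>R e) + 1 *\<^sub>R x) \<bullet> fh n (- (s n *\<^sub>R e) + 1 *\<^sub>R x)))"
        by (rule lborel_integral_affine) auto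
      then show ?thesis by (simp add: fh_def)
    qed
    have i1: "integrable lborel (\<lambda>x. \<mu> (x - s n *\<^sub>R e) * (f x \<bullet> f x))"
    proof (rule Bochner_Integration.integrable_bound)
      show "integrable lborel (\<lambda>x. B * (f x \<bullet> f x))" using sq_integrable[OF f] by simp
      show "AE x in lborel. norm (\<mu> (x - s n *\<^sub>R e) * (f x \<bullet> f x)) \<le> norm (B * (f x \<bullet> f x))"
        using B B0 by (auto intro!: AE_I2 mult_right_mono simp: abs_mult)
    qed measurable
    have "(LINT x|lborel. \<mu> x * (f x \<bullet> (fh n x - f x)))
       = (LINT x|lborel. 1/2 * (\<mu> x * (fh n x \<bullet> fh n x)) - 1/2 * (\<mu> x * (f x \<bullet> f x)) - 1/2
           * (\<mu> x * ((fh n x - f x) \<bullet> (fh n x - f x))))"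
      by (intro Bochner_Integration.integral_cong refl) (simp add: inner_diff inner_commute algebra_simps)
    also have "\<dots> = 1/2 * (LINT x|lborel. \<mu> x * (fh n x \<bullet> fh n x)) - 1/2 * (LINT x|lborel. \<mu> x * (f x \<bullet> f x))
       - 1/2 * (LINT x|lborel. \<mu> x * ((fh n x - f x) \<bullet> (fh n x - f x)))"
      using int\<mu>[OF fh fh, of n n] int\<mu>[OF f f] int\<mu>[OF sq_diff[OF fh f] sq_diff[OF fh f], of n n] by simp
    also have "1/2 * (LINT x|lborel. \<mu> x * (fh n x \<bullet> fh n x)) - 1/2 * (LINT x|lborel. \<mu> x * (f x \<bullet> f x))
       = 1/2 * (s n * (LINT x|lborel. q n x * (f x \<bullet> f x)))"
    proof -
      have "s n * (LINT x|lborel. q n x * (f x \<bullet> f x))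
          = (LINT x|lborel. \<mu> (x - s n *\<^sub>R e) * (f x \<bullet> f x) - \<mu> x * (f x \<bullet> f x))"
        unfolding integral_mult_right_zero[symmetric] q_def
        using s(1)[of n] by (intro Bochner_Integration.integral_cong refl) (simp add: left_diff_distrib)
      also have "\<dots> = (LINT x|lborel. \<mu> x * (fh n x \<bullet> fh n x)) - (LINT x|lborel. \<mu> x * (f x \<bullet> f x))"
        unfolding shift by (rule Bochner_Integration.integral_diff[OF i1 int\<mu>[OF f f]])
      finally show ?thesis by simp
    qed
    finally show ?thesis using s(1)[of n] by (simp add: X_def right_diff_distrib)
  qed
  have l1: "(\<lambda>n. LINT x|lborel. q n x * (f x \<bullet> f x)) \<longlonglongrightarrow> (LINT x|lborel. - \<mu>' x * (f x \<bullet> f x))"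
  proof (rule integral_dominated_convergence)
    show "integrable lborel (\<lambda>x. L * (f x \<bullet> f x))" using sq_integrable[OF f] by simp
    show "AE x in lborel. (\<lambda>n. q n x * (f x \<bullet> f x)) \<longlonglongrightarrow> - \<mu>' x * (f x \<bullet> f x)"
      by (intro AE_I2 tendsto_mult tendsto_const q_lim)
    show "AE x in lborel. norm (q n x * (f x \<bullet> f x)) \<le> L * (f x \<bullet> f x)" for n
      using q_bound by (auto intro!: AE_I2 mult_right_mono simp: abs_mult)
  qed measurable
  have l2: "(\<lambda>n. 1 / (2 * s n) * (LINT x|lborel. \<mu> x * ((fh n x - f x) \<bullet> (fh n x - f x)))) \<longlonglongrightarrow> 0"
  proof (rule Lim_null_comparison)
    show "\<forall>\<^sub>F n in sequentially. norm (1 / (2 * s n)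
        * (LINT x|lborel. \<mu> x * ((fh n x - f x) \<bullet> (fh n x - f x)))) \<le> B * C / 2 * s n"
    proof (intro always_eventually allI)
      fix n
      have sd: "sq (\<lambda>x. fh n x - f x)" using fh f by simp
      have "\<bar>LINT x|lborel. \<mu> x * ((fh n x - f x) \<bullet> (fh n x - f x))\<bar>
          \<le> (LINT x|lborel. \<bar>\<mu> x * ((fh n x - f x) \<bullet> (fh n x - f x))\<bar>)"
        by (rule integral_abs_bound)
      also have "\<dots> \<le> (LINT x|lborel. B * ((fh n x - f x) \<bullet> (fh n x - f x)))"
      proof (rule integral_mono)
        show "integrable lborel (\<lambda>x. \<bar>\<mu> x * ((fh n x - f x) \<bullet> (fh n x - f x))\<bar>)"
            by (intro integrable_abs int\<mu> sd)
        show "integrable lborel (\<lambda>x. B * ((fh n x - f x) \<bullet> (fh n x - f x)))" using sq_integrable[OF sd]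
            by simp
        show "\<bar>\<mu> x * ((fh n x - f x) \<bullet> (fh n x - f x))\<bar> \<le> B * ((fh n x - f x) \<bullet> (fh n x - f x))" for x
          using B[of x] by (simp add: abs_mult mult_right_mono)
      qed
      also have "\<dots> = B * ip (\<lambda>x. fh n x - f x) (\<lambda>x. fh n x - f x)" by (simp add: ip_def)
      also have "\<dots> \<le> B * (C * (s n)\<^sup>2)" unfolding fh_def by (intro mult_left_mono bound B0)
      finally have "\<bar>LINT x|lborel. \<mu> x * ((fh n x - f x) \<bullet> (fh n x - f x))\<bar> \<le> B * (C * (s n)\<^sup>2)" .
      then have "1 / (2 * s n) * \<bar>LINT x|lborel. \<mu> x * ((fh n x - f x) \<bullet> (fh n x - f x))\<bar>
          \<le> 1 / (2 * s n) * (B * (C * (s n)\<^sup>2))"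
        using s(1)[of n] by (intro mult_left_mono) auto
      also have "\<dots> = B * C / 2 * s n" using s(1)[of n] by (simp add: power2_eq_square)
      finally show "norm (1 / (2 * s n) * (LINT x|lborel. \<mu> x * ((fh n x - f x) \<bullet> (fh n x - f x))))
          \<le> B * C / 2 * s n"
        using s(1)[of n] by (simp add: abs_mult)
    qed
    show "(\<lambda>n. B * C / 2 * s n) \<longlonglongrightarrow> 0" using tendsto_mult[OF tendsto_const s(2), of "B * C / 2"] by simp
  qed
  have "X \<longlonglongrightarrow> 1/2 * (LINT x|lborel. - \<mu>' x * (f x \<bullet> f x)) - 0"
    unfolding X2 by (intro tendsto_diff tendsto_mult tendsto_const l1 l2)
  from LIMSEQ_unique[OF X1 this] show ?thesis by simp
qed

lemma integration_by_parts_gradient: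
  fixes v :: "real^'n::finite \<Rightarrow> 'k::euclidean_space"
  assumes hg: "has_gradient v G"
    and \<mu>: "\<mu> \<in> borel_measurable borel" "\<mu>' \<in> borel_measurable borel"
    and B: "\<And>x. \<bar>\<mu> x\<bar> \<le> B" and lip: "\<And>x h. \<bar>\<mu> (x + h *\<^sub>R axis i 1) - \<mu> x\<bar> \<le> L * \<bar>h\<bar>"
    and deriv: "\<And>x. ((\<lambda>h. \<mu> (x + h *\<^sub>R axis i 1)) has_real_derivative \<mu>' x) (at 0)"
  shows "(LINT x|lborel. \<mu> x * (v x \<bullet> G x $ i)) = - (1/2) * (LINT x|lborel. \<mu>' x * (v x \<bullet> v x))"
proof (rule integration_by_parts_square[OF _ _ _ _ _ _ \<mu> B lip deriv])
  show "sq v" "sq (\<lambda>x. G x $ i)" using hg by (auto simp: has_gradient_def)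
  show "ip (\<lambda>x. v (x + h *\<^sub>R axis i 1) - v x) (\<lambda>x. v (x + h *\<^sub>R axis i 1) - v x) \<le> ip G G * h\<^sup>2" for h
    using ip_translate_diff_le[OF hg, of "h *\<^sub>R axis i 1"] by (simp add: mult.commute)
  show "(\<lambda>n. 1 / real (Suc n)) \<longlonglongrightarrow> 0" using LIMSEQ_inverse_real_of_nat by (simp add: inverse_eq_divide)
  then show "wconv (\<lambda>n x. (1 / (1 / real (Suc n))) *\<^sub>R (v (x + (1 / real (Suc n)) *\<^sub>R axis i 1)
      - v x)) (\<lambda>x. G x $ i)"
    using has_gradient_quotient[OF hg, of "\<lambda>n. 1 / real (Suc n)" "axis i 1"] by simp
qed simp

lemma borel_measurable_vec_nth [measurable (raw)]:
  fixes f :: "'a \<Rightarrow> 'b::euclidean_space^'n::finite"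
  assumes [measurable]: "f \<in> borel_measurable M" shows "(\<lambda>x. f x $ i) \<in> borel_measurable M"
  by (rule borel_measurable_continuous_on[of "\<lambda>v. v $ i"]) (auto intro: continuous_intros)

text \<open>A bounded substitute for the coordinate x_i, with Lipschitz constant 1 uniformly in
  \<epsilon> and derivative cos(\<epsilon> x_i). As \<epsilon> tends to 0 it tends to x_i and its
  derivative to 1.\<close>

definition sine_coordinate :: "real \<Rightarrow> 'n::finite \<Rightarrow> real^'n \<Rightarrow> real" where
  "sine_coordinate \<epsilon> i x = sin (\<epsilon> * x $ i) / \<epsilon>"

lemma sine_coordinate_measurable [measurable]: "sine_coordinate \<epsilon> i \<in> borel_measurable borel"
  unfolding sine_coordinate_def by measurable

lemma sine_coordinate_bound: "0 < \<epsilon> \<Longrightarrow> \<bar>sine_coordinate \<epsilon> i x\<bar> \<le> 1 / \<epsilon>"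
  by (simp add: sine_coordinate_def abs_divide divide_right_mono)

lemma sine_coordinate_lipschitz:
  assumes "0 < \<epsilon>" shows "\<bar>sine_coordinate \<epsilon> i x - sine_coordinate \<epsilon> i y\<bar> \<le> \<bar>x $ i - y $ i\<bar>"
proof -
  have "\<bar>sin (\<epsilon> * x $ i) - sin (\<epsilon> * y $ i)\<bar> \<le> 1 * \<bar>\<epsilon> * x $ i - \<epsilon> * y $ i\<bar>"
    using field_differentiable_bound[of UNIV sin cos 1 "\<epsilon> * x $ i" "\<epsilon> * y $ i"] by (auto intro: DERIV_subset)
  also have "\<dots> = \<epsilon> * \<bar>x $ i - y $ i\<bar>" using assms by (simp add: right_diff_distrib[symmetric] abs_mult)
  finally show ?thesis using assms
    by (simp add: sine_coordinate_def diff_divide_distrib[symmetric] abs_divide divide_le_eq mult.commute)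
qed

lemma sine_coordinate_deriv:
  "0 < \<epsilon> \<Longrightarrow> ((\<lambda>h. sine_coordinate \<epsilon> i (x + h *\<^sub>R axis j 1)) has_real_derivative (if j
      = i then cos (\<epsilon> * x $ i) else 0)) (at 0)"
  unfolding sine_coordinate_def by (auto intro!: derivative_eq_intros simp: axis_def)

lemma sine_coordinate_tendsto: "(\<lambda>n. sine_coordinate (1 / real (Suc n)) i x) \<longlonglongrightarrow> x $ i"
proof -
  have "((\<lambda>h. sin (h * x $ i)) has_real_derivative x $ i) (at 0)" by (auto intro!: derivative_eq_intros)
  then have "((\<lambda>h. sin (h * x $ i) / h) \<longlongrightarrow> x $ i) (at 0)" by (simp add: DERIV_def)
  moreover have "(\<lambda>n. 1 / real (Suc n)) \<longlonglongrightarrow> 0" using LIMSEQ_inverse_real_of_nat by (simp add: inverse_eq_divide)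
  ultimately have "((\<lambda>h. sin (h * x $ i) / h) \<circ> (\<lambda>n. 1 / real (Suc n))) \<longlonglongrightarrow> x $ i"
    unfolding tendsto_at_iff_sequentially by auto
  then show ?thesis by (simp add: o_def sine_coordinate_def)
qed

text \<open>The kernel is regularised to \<open>(|x|\<^sup>2 + \<delta>\<^sup>2)\<close> to the power \<open>-\<gamma>/2\<close> to make it an admissible multiplier
  in the integration by parts; the resulting singular term is antisymmetrised before \<open>\<delta> \<rightarrow> 0\<close>.\<close>

lemma riesz_form_by_parts:
  fixes v :: "real^'n::finite \<Rightarrow> 'k::euclidean_space"
  assumes adm: "admissible TYPE('n) \<gamma>" and hg: "has_gradient v G" and z: "(\<lambda>x. G x $ i) \<in> H1" and \<epsilon>: "0 < \<epsilon>"
  shows "riesz_form \<gamma> v (\<lambda>x. sine_coordinate \<epsilon> i x *\<^sub>R G x $ i) v v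
    = - (1/2) * (LINT p|lborel2. cos (\<epsilon> * fst p $ i) * riesz_integrand \<gamma> v v v v p)
      + \<gamma>/4 * (LINT p|lborel2. (sine_coordinate \<epsilon> i (fst p) - sine_coordinate \<epsilon> i (snd p))
          * (fst p $ i - snd p $ i)
           / (norm (fst p - snd p))\<^sup>2 * riesz_integrand \<gamma> v v v v p)"
proof -
  have vH: "v \<in> H1" using hg by (auto simp: H1_iff)
  have \<gamma>: "0 < \<gamma>" using adm by (simp add: admissible_def)
  note [measurable] = H1_measurable[OF vH] H1_measurable[OF z]
  let ?\<eta> = "sine_coordinate \<epsilon> i"
  define \<delta> where "\<delta> n = 1 / real (Suc n)" for n
  have \<delta>: "0 < \<delta> n" for n by (simp add: \<delta>_def)
  have \<delta>_lim: "\<delta> \<longlonglongrightarrow> 0" using LIMSEQ_inverse_real_of_nat by (simp add: \<delta>_def[abs_def] inverse_eq_divide)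
  define k where "k n x = ((norm x)\<^sup>2 + (\<delta> n)\<^sup>2) powr (- \<gamma>/2)" for n and x :: "real^'n"
  \<comment> \<open>The power produced by differentiation: the i-th partial derivative of
    \<open>k n\<close> is -\<gamma> x_i l. Multiplying \<open>l n\<close> by its base gives back
    \<open>k n\<close>.\<close>
  define l where "l n x = ((norm x)\<^sup>2 + (\<delta> n)\<^sup>2) powr (- \<gamma>/2 - 1)" for n and x :: "real^'n"
  have [measurable]: "k n \<in> borel_measurable borel" "l n \<in> borel_measurable borel" for n
    unfolding k_def l_def by measurable
  have base_pos: "0 < (norm x)\<^sup>2 + (\<delta> n)\<^sup>2" for n and x :: "real^'n" using \<delta>[of n]
      by (simp add: add_nonneg_pos)
  have k0: "0 \<le> k n x" and l0: "0 \<le> l n x" for n x by (simp_all add: k_def l_def)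
  have k_bound: "k n x \<le> \<delta> n powr (- \<gamma>)" for n x
  proof -
    have "k n x \<le> ((\<delta> n)\<^sup>2) powr (- \<gamma>/2)" unfolding k_def using \<delta>[of n] \<gamma> by (intro powr_mono2') auto
    also have "\<dots> = \<delta> n powr (- \<gamma>)" using \<delta>[of n] by (simp add: powr_powr flip: powr_numeral)
    finally show ?thesis .
  qed
  have kl: "((norm x)\<^sup>2 + (\<delta> n)\<^sup>2) * l n x = k n x" for n x
    using base_pos[of x n] by (simp add: k_def l_def powr_diff)
  have xl_bound: "\<bar>x $ i\<bar> * l n x \<le> \<delta> n powr (- \<gamma>) / \<delta> n" for n x
  proof -
    have "\<delta> n * \<bar>x $ i\<bar> \<le> (norm x)\<^sup>2 + (\<delta> n)\<^sup>2"
    proof -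
      have "\<delta> n * \<bar>x $ i\<bar> \<le> \<delta> n * norm x" using component_le_norm_cart[of x i] \<delta>[of n]
          by (intro mult_left_mono) auto
      also have "\<dots> \<le> (norm x)\<^sup>2 + (\<delta> n)\<^sup>2" using sum_squares_bound[of "norm x" "\<delta> n"] mult_nonneg_nonneg[OF
          norm_ge_zero[of x] less_imp_le[OF \<delta>[of n]]]
        by (simp add: mult_ac)
      finally show ?thesis .
    qed
    then have "\<delta> n * \<bar>x $ i\<bar> * l n x \<le> ((norm x)\<^sup>2 + (\<delta> n)\<^sup>2) * l n x" by (intro mult_right_mono l0)
    also have "\<dots> \<le> \<delta> n powr (- \<gamma>)" unfolding kl by (rule k_bound)
    finally show ?thesis using \<delta>[of n] by (simp add: le_divide_eq mult_ac)
  qed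
  have k_le: "k n x \<le> 1 / norm x powr \<gamma>" if "x \<noteq> 0" for n x
  proof -
    have "k n x \<le> ((norm x)\<^sup>2) powr (- \<gamma>/2)" unfolding k_def using that \<gamma> by (intro powr_mono2') auto
    also have "\<dots> = norm x powr (- \<gamma>)" using that by (simp add: powr_powr flip: powr_numeral)
    finally show ?thesis by (simp add: powr_minus_divide)
  qed
  have k_lim: "(\<lambda>n. k n x) \<longlonglongrightarrow> 1 / norm x powr \<gamma>" if "x \<noteq> 0" for x
  proof -
    have "(\<lambda>n. k n x) \<longlonglongrightarrow> ((norm x)\<^sup>2 + 0\<^sup>2) powr (- \<gamma>/2)"
      unfolding k_def using that by (intro tendsto_intros \<delta>_lim) auto
    moreover have "((norm x)\<^sup>2 + 0\<^sup>2) powr (- \<gamma>/2) = 1 / norm x powr \<gamma>"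
      using that by (simp add: powr_powr powr_minus_divide[symmetric] flip: powr_numeral)
    ultimately show ?thesis by simp
  qed
  have l_lim: "(\<lambda>n. l n x) \<longlonglongrightarrow> 1 / norm x powr \<gamma> / (norm x)\<^sup>2" if "x \<noteq> 0" for x
  proof -
    have eq: "l n x = k n x / ((norm x)\<^sup>2 + (\<delta> n)\<^sup>2)" for n
      unfolding kl[symmetric] by (metis base_pos less_irrefl nonzero_mult_div_cancel_left)
    have "(\<lambda>n. k n x / ((norm x)\<^sup>2 + (\<delta> n)\<^sup>2)) \<longlonglongrightarrow> (1 / norm x powr \<gamma>) / ((norm x)\<^sup>2 + 0\<^sup>2)"
      using that by (intro tendsto_intros k_lim \<delta>_lim) auto
    then show ?thesis unfolding eq by simp
  qed
  define f where "f x = v x \<bullet> v x" for x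
  define g where "g x = v x \<bullet> G x $ i" for x
  have [measurable]: "f \<in> borel_measurable borel" "g \<in> borel_measurable borel" unfolding f_def g_def
      by measurable
  have f0: "0 \<le> f x" for x by (simp add: f_def)
  have int_f: "integrable lborel f" and int_g: "integrable lborel g"
    unfolding f_def g_def using vH z by (auto intro: integrable_inner)
  have int_ff: "integrable lborel2 (\<lambda>p. f (fst p) * f (snd p))"
      by (rule lborel2_product_integral(1)[OF int_f int_f])
  have int_gf: "integrable lborel2 (\<lambda>p. g (fst p) * f (snd p))"
      by (rule lborel2_product_integral(1)[OF int_g int_f])
  have int_mult: "integrable lborel2 (\<lambda>p. m p * (a (fst p) * f (snd p)))"
    if [measurable]: "m \<in> borel_measurable lborel2" and m: "\<And>p. \<bar>m p\<bar> \<le> c"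
        and a: "integrable lborel2 (\<lambda>p. a (fst p) * f (snd p))"
    for m c and a :: "real^'n \<Rightarrow> real"
  proof (rule Bochner_Integration.integrable_bound[OF integrable_mult_right[OF a, of c]])
    have "0 \<le> c" using m[of undefined] by linarith
    then show "AE p in lborel2. norm (m p * (a (fst p) * f (snd p))) \<le> norm (c * (a (fst p) * f (snd p)))"
      using m by (auto intro!: AE_I2 mult_right_mono simp: abs_mult)
  qed (use borel_measurable_integrable[OF a] in measurable)
  have identity: "(LINT p|lborel2. ?\<eta> (fst p) * k n (fst p - snd p) * (g (fst p) * f (snd p)))
    = - (1/2) * (LINT p|lborel2. cos (\<epsilon> * fst p $ i) * k n (fst p - snd p) * (f (fst p) * f (snd p)))
      + \<gamma>/4 * (LINT p|lborel2. (?\<eta> (fst p) - ?\<eta> (snd p)) * (fst p $ i - snd p $ i) * l n (fst p - snd p)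
          * (f (fst p) * f (snd p)))" for n
  proof -
    \<comment> \<open>Lipschitz constant of the regularised multiplier. It blows up with
      \<open>n\<close>, which is harmless because the integration by parts is done at fixed
      \<open>n\<close>.\<close>
    define L where "L = \<delta> n powr (- \<gamma>) + \<gamma> / \<epsilon> * (\<delta> n powr (- \<gamma>) / \<delta> n)"
    define m1 where "m1 p = ?\<eta> (fst p) * k n (fst p - snd p)" for p :: "(real^'n) \<times> (real^'n)"
    define m2 where "m2 p = cos (\<epsilon> * fst p $ i) * k n (fst p - snd p)" for p :: "(real^'n) \<times> (real^'n)"
    define m3 where "m3 p = ?\<eta> (fst p) * (fst p $ i - snd p $ i)
        * l n (fst p - snd p)" for p :: "(real^'n) \<times> (real^'n)"
    define m3' where "m3' p = ?\<eta> (snd p) * (fst p $ i - snd p $ i)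
        * l n (fst p - snd p)" for p :: "(real^'n) \<times> (real^'n)"
    have [measurable]: "m1 \<in> borel_measurable lborel2" "m2 \<in> borel_measurable lborel2" "m3 \<in> borel_measurable
        lborel2" "m3' \<in> borel_measurable lborel2"
      unfolding m1_def m2_def m3_def m3'_def by measurable
    have b1: "\<bar>m1 p\<bar> \<le> 1 / \<epsilon> * \<delta> n powr (- \<gamma>)" for p
      unfolding m1_def abs_mult using sine_coordinate_bound[OF \<epsilon>] k_bound k0 \<epsilon> by (intro mult_mono) auto
    have b2: "\<bar>m2 p\<bar> \<le> 1 * \<delta> n powr (- \<gamma>)" for p
      unfolding m2_def abs_mult using k_bound k0 by (intro mult_mono) auto
    have b3: "\<bar>m3 p\<bar> \<le> 1 / \<epsilon> * (\<delta> n powr (- \<gamma>) / \<delta> n)" "\<bar>m3' p\<bar> \<le> 1 / \<epsilon> * (\<delta> n powr (- \<gamma>) / \<delta> n)" for p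
    proof -
      have "\<bar>?\<eta> y\<bar> * (\<bar>fst p $ i - snd p $ i\<bar> * \<bar>l n (fst p - snd p)\<bar>) \<le> 1 / \<epsilon> * (\<delta> n powr (- \<gamma>) / \<delta> n)" for y
      proof (rule mult_mono)
        show "\<bar>fst p $ i - snd p $ i\<bar> * \<bar>l n (fst p - snd p)\<bar> \<le> \<delta> n powr (- \<gamma>) / \<delta> n"
          using xl_bound[of "fst p - snd p" n] l0[of n "fst p - snd p"] by simp
      qed (use sine_coordinate_bound[OF \<epsilon>] \<epsilon> in auto)
      then show "\<bar>m3 p\<bar> \<le> 1 / \<epsilon> * (\<delta> n powr (- \<gamma>) / \<delta> n)" "\<bar>m3' p\<bar> \<le> 1 / \<epsilon> * (\<delta> n powr (- \<gamma>) / \<delta> n)"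
        unfolding m3_def m3'_def abs_mult mult.assoc by blast+
    qed
    have I1: "integrable lborel2 (\<lambda>p. m1 p * (g (fst p) * f (snd p)))"
        by (rule int_mult[OF _ b1 int_gf]) measurable
    have I2: "integrable lborel2 (\<lambda>p. m2 p * (f (fst p) * f (snd p)))"
        by (rule int_mult[OF _ b2 int_ff]) measurable
    have I3: "integrable lborel2 (\<lambda>p. m3 p * (f (fst p) * f (snd p)))"
        by (rule int_mult[OF _ b3(1) int_ff]) measurable
    have I3': "integrable lborel2 (\<lambda>p. m3' p * (f (fst p) * f (snd p)))"
        by (rule int_mult[OF _ b3(2) int_ff]) measurable
    \<comment> \<open>The integration by parts is in the first variable only; the second is a frozen
      parameter.\<close>
    have parts: "(LINT x|lborel. m1 (x, y) * g x)
        = - (1/2) * (LINT x|lborel. (m2 (x, y) - \<gamma> * m3 (x, y)) * f x)" for y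
      unfolding f_def g_def
    proof (rule integration_by_parts_gradient[OF hg, of "\<lambda>x. m1 (x, y)" "\<lambda>x. m2 (x, y)
        - \<gamma> * m3 (x, y)" _ i L])
      show "(\<lambda>x. m1 (x, y)) \<in> borel_measurable borel" "(\<lambda>x. m2 (x, y)
          - \<gamma> * m3 (x, y)) \<in> borel_measurable borel"
        unfolding m1_def m2_def m3_def fst_conv snd_conv by measurable
      show "\<bar>m1 (x, y)\<bar> \<le> 1 / \<epsilon> * \<delta> n powr (- \<gamma>)" for x by (rule b1)
      have d: "((\<lambda>h. m1 (x + h *\<^sub>R axis i 1, y)) has_real_derivative
          (m2 (x + t *\<^sub>R axis i 1, y) - \<gamma> * m3 (x + t *\<^sub>R axis i 1, y))) (at t)" for x t
      proof -
        define a where "a = x - y"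
        have nrm: "(norm (a + h *\<^sub>R axis i 1))\<^sup>2 = (norm a)\<^sup>2 + 2 * a $ i * h + h\<^sup>2" for h
          unfolding power2_norm_eq_inner by (simp add: inner_add inner_axis inner_axis' algebra_simps) (simp
              add: power2_eq_square)
        have dn: "((\<lambda>h. (norm (a + h *\<^sub>R axis i 1))\<^sup>2 + (\<delta> n)\<^sup>2) has_real_derivative 2 * (a $ i + t)) (at t)"
          unfolding nrm by (auto intro!: derivative_eq_intros simp: power2_eq_square)
        have dk: "((\<lambda>h. k n (a + h *\<^sub>R axis i 1)) has_real_derivative - \<gamma> * (a $ i + t)
            * l n (a + t *\<^sub>R axis i 1)) (at t)"
          unfolding k_def l_def using DERIV_fun_powr[OF dn base_pos, of "- \<gamma>/2"]
          by (rule DERIV_cong) (simp add: field_simps)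
        have d\<eta>: "((\<lambda>h. ?\<eta> (x + h *\<^sub>R axis i 1)) has_real_derivative cos (\<epsilon>
            * (x + t *\<^sub>R axis i 1) $ i)) (at t)"
          unfolding sine_coordinate_def using \<epsilon> by (auto intro!: derivative_eq_intros simp: axis_def)
        have sub: "x + h *\<^sub>R axis i 1 - y = a + h *\<^sub>R axis i 1" for h by (simp add: a_def)
        from DERIV_mult[OF d\<eta> dk] show ?thesis
          unfolding m1_def m2_def m3_def fst_conv snd_conv sub
          by (rule DERIV_cong) (simp add: a_def algebra_simps)
      qed
      show "((\<lambda>h. m1 (x + h *\<^sub>R axis i 1, y)) has_real_derivative m2 (x, y) - \<gamma> * m3 (x, y)) (at 0)" for x
        using d[of x 0] by simp
      have dbound: "\<bar>m2 p - \<gamma> * m3 p\<bar> \<le> L" for p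
      proof -
        have "\<bar>m2 p - \<gamma> * m3 p\<bar> \<le> \<bar>m2 p\<bar> + \<gamma> * \<bar>m3 p\<bar>" using \<gamma> abs_triangle_ineq4[of "m2 p" "\<gamma> * m3 p"]
            by (simp add: abs_mult)
        also have "\<dots> \<le> 1 * \<delta> n powr (- \<gamma>) + \<gamma> * (1 / \<epsilon> * (\<delta> n powr (- \<gamma>) / \<delta> n))"
          using \<gamma> by (intro add_mono mult_left_mono b2 b3) auto
        finally show ?thesis by (simp add: L_def)
      qed
      show "\<bar>m1 (x + h *\<^sub>R axis i 1, y) - m1 (x, y)\<bar> \<le> L * \<bar>h\<bar>" for x h
        using field_differentiable_bound[of UNIV "\<lambda>t. m1 (x + t *\<^sub>R axis i 1, y)" "\<lambda>t. m2 (x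
            + t *\<^sub>R axis i 1, y) - \<gamma> * m3 (x + t *\<^sub>R axis i 1, y)" L h 0]
          d dbound by simp
    qed
    have snd_int: "(LINT y|lborel. LINT x|lborel. F (x, y))
        = (LINT p|lborel2. F p)" if "integrable lborel2 F" for F :: "(real^'n) \<times> (real^'n) \<Rightarrow> real"
      using lborel_pair.integral_snd[of "\<lambda>x y. F (x, y)"] that by simp
    have I23: "integrable lborel2 (\<lambda>p. (m2 p - \<gamma> * m3 p) * (f (fst p) * f (snd p)))"
      unfolding left_diff_distrib mult.assoc[of \<gamma>]
          by (intro Bochner_Integration.integrable_diff I2 integrable_mult_right I3)
    have "(LINT p|lborel2. m1 p * (g (fst p) * f (snd p)))
        = (LINT y|lborel. LINT x|lborel. m1 (x, y) * (g x * f y))"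
      using snd_int[OF I1] by simp
    also have "\<dots> = (LINT y|lborel. (LINT x|lborel. m1 (x, y) * g x) * f y)"
      unfolding mult.assoc[symmetric] by simp
    also have "\<dots> = (LINT y|lborel. - (1/2) * (LINT x|lborel. (m2 (x, y) - \<gamma> * m3 (x, y)) * (f x * f y)))"
      unfolding parts mult.assoc[symmetric] by simp
    also have "\<dots> = - (1/2) * (LINT p|lborel2. (m2 p - \<gamma> * m3 p) * (f (fst p) * f (snd p)))"
      using snd_int[OF I23] by simp
    also have "(LINT p|lborel2. (m2 p - \<gamma> * m3 p) * (f (fst p) * f (snd p)))
      = (LINT p|lborel2. m2 p * (f (fst p) * f (snd p)))
          - \<gamma> * (LINT p|lborel2. m3 p * (f (fst p) * f (snd p)))"
      unfolding left_diff_distrib mult.assoc[of \<gamma>]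
      by (simp only: Bochner_Integration.integral_diff[OF I2 integrable_mult_right[OF I3]]
          integral_mult_right_zero)
    finally have eq1: "(LINT p|lborel2. m1 p * (g (fst p) * f (snd p)))
      = - (1/2) * ((LINT p|lborel2. m2 p * (f (fst p) * f (snd p)))
          - \<gamma> * (LINT p|lborel2. m3 p * (f (fst p) * f (snd p))))" .
    \<comment> \<open>Exchanging the variables flips the sign of the coordinate difference, so the
      integral is half of that with \<open>m3 - m3'\<close>. The factor with the difference of the
      truncated coordinates compensates the stronger singularity of \<open>l\<close>.\<close>
    have swap: "(LINT p|lborel2. m3 p * (f (fst p) * f (snd p)))
        = - (LINT p|lborel2. m3' p * (f (fst p) * f (snd p)))"
    proof -
      have "(LINT p|lborel2. m3 p * (f (fst p) * f (snd p)))
          = (LINT p|lborel2. m3 (snd p, fst p) * (f (snd p) * f (fst p)))"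
        using lborel_pair.integral_product_swap[of "\<lambda>p. m3 p * (f (fst p) * f (snd p))"]
            by (simp add: case_prod_beta')
      also have "(\<lambda>p. m3 (snd p, fst p) * (f (snd p) * f (fst p)))
          = (\<lambda>p. - (m3' p * (f (fst p) * f (snd p))))"
      proof
        fix p :: "(real^'n) \<times> (real^'n)"
        have "l n (snd p - fst p) = l n (fst p - snd p)" by (simp add: l_def norm_minus_commute)
        then show "m3 (snd p, fst p) * (f (snd p) * f (fst p)) = - (m3' p * (f (fst p) * f (snd p)))"
          by (simp add: m3_def m3'_def algebra_simps)
      qed
      finally show ?thesis by simp
    qed
    have "(LINT p|lborel2. (m3 p - m3' p) * (f (fst p) * f (snd p)))
        = 2 * (LINT p|lborel2. m3 p * (f (fst p) * f (snd p)))"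
      unfolding left_diff_distrib by (simp add: Bochner_Integration.integral_diff[OF I3 I3'] swap)
    moreover have "m3 p - m3' p = (?\<eta> (fst p) - ?\<eta> (snd p)) * (fst p $ i - snd p $ i)
        * l n (fst p - snd p)" for p
      by (simp add: m3_def m3'_def algebra_simps)
    ultimately show ?thesis using eq1 by (simp add: m1_def m2_def diff_divide_distrib)
  qed
  have int_R: "integrable lborel2 (riesz_integrand \<gamma> v v v v)" by (rule riesz_diag_integrable[OF adm vH vH])
  have R_eq: "riesz_integrand \<gamma> v v v v p = 1 / norm (fst p - snd p) powr \<gamma> * (f (fst p) * f (snd p))" for p
    by (simp add: riesz_integrand_def riesz_kernel_def f_def)
  have lim1: "(\<lambda>n. LINT p|lborel2. ?\<eta> (fst p) * k n (fst p - snd p) * (g (fst p) * f (snd p)))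
     \<longlonglongrightarrow> (LINT p|lborel2. ?\<eta> (fst p) * (1 / norm (fst p - snd p) powr \<gamma>) * (g (fst p) * f (snd p)))"
  proof (rule integral_dominated_convergence)
    show "integrable lborel2 (\<lambda>p. 1 / \<epsilon> * (norm (v (fst p)) * norm (G (fst p) $ i)
        * (norm (v (snd p)) * norm (v (snd p))) * riesz_kernel \<gamma> p))"
      using riesz_abs_integrable[OF adm vH z vH vH] by simp
    show "AE p in lborel2. (\<lambda>n. ?\<eta> (fst p) * k n (fst p - snd p) * (g (fst p) * f (snd p)))
       \<longlonglongrightarrow> ?\<eta> (fst p) * (1 / norm (fst p - snd p) powr \<gamma>) * (g (fst p) * f (snd p))"
      using AE_off_diagonal by eventually_elim (intro tendsto_intros k_lim, simp)
    show "AE p in lborel2. norm (?\<eta> (fst p) * k n (fst p - snd p) * (g (fst p) * f (snd p)))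
       \<le> 1 / \<epsilon> * (norm (v (fst p)) * norm (G (fst p) $ i) * (norm (v (snd p)) * norm (v (snd p)))
           * riesz_kernel \<gamma> p)" for n
      using AE_off_diagonal
    proof eventually_elim
      case (elim p)
      have "\<bar>?\<eta> (fst p)\<bar> * \<bar>k n (fst p - snd p)\<bar> * (\<bar>g (fst p)\<bar> * \<bar>f (snd p)\<bar>)
        \<le> 1 / \<epsilon> * riesz_kernel \<gamma> p * ((norm (v (fst p)) * norm (G (fst p) $ i))
            * (norm (v (snd p)) * norm (v (snd p))))"
        unfolding riesz_kernel_def g_def f_def
        using sine_coordinate_bound[OF \<epsilon>] k_le[of "fst p - snd p" n] k0 elim \<epsilon>
        by (intro mult_mono Cauchy_Schwarz_ineq2) auto
      then show ?case by (simp add: abs_mult mult_ac)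
    qed
  qed measurable
  have lim2: "(\<lambda>n. LINT p|lborel2. cos (\<epsilon> * fst p $ i) * k n (fst p - snd p) * (f (fst p) * f (snd p)))
     \<longlonglongrightarrow> (LINT p|lborel2. cos (\<epsilon> * fst p $ i) * riesz_integrand \<gamma> v v v v p)"
  proof (rule integral_dominated_convergence[OF _ _ int_R])
    show "AE p in lborel2. (\<lambda>n. cos (\<epsilon> * fst p $ i) * k n (fst p - snd p) * (f (fst p) * f (snd p)))
       \<longlonglongrightarrow> cos (\<epsilon> * fst p $ i) * riesz_integrand \<gamma> v v v v p"
      using AE_off_diagonal unfolding R_eq mult.assoc[symmetric]
          by eventually_elim (intro tendsto_intros k_lim, simp)
    show "AE p in lborel2. norm (cos (\<epsilon> * fst p $ i) * k n (fst p - snd p) * (f (fst p) * f (snd p)))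
        \<le> riesz_integrand \<gamma> v v v v p" for n
      using AE_off_diagonal
    proof eventually_elim
      case (elim p)
      have "\<bar>cos (\<epsilon> * fst p $ i)\<bar> * k n (fst p - snd p) \<le> 1 * (1 / norm (fst p - snd p) powr \<gamma>)"
        using k_le[of "fst p - snd p" n] k0 elim by (intro mult_mono) auto
      then have "\<bar>cos (\<epsilon> * fst p $ i)\<bar> * k n (fst p - snd p) * (f (fst p) * f (snd p))
          \<le> 1 * (1 / norm (fst p - snd p) powr \<gamma>) * (f (fst p) * f (snd p))"
        using f0 by (intro mult_right_mono mult_nonneg_nonneg)
      then show ?case unfolding R_eq using f0 k0 by (simp add: abs_mult)
    qed
  qed measurable
  have lim3: "(\<lambda>n. LINT p|lborel2. (?\<eta> (fst p) - ?\<eta> (snd p)) * (fst p $ i - snd p $ i) * l n (fst p - snd p)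
      * (f (fst p) * f (snd p)))
     \<longlonglongrightarrow> (LINT p|lborel2. (?\<eta> (fst p) - ?\<eta> (snd p)) * (fst p $ i - snd p $ i) / (norm (fst p - snd p))\<^sup>2
         * riesz_integrand \<gamma> v v v v p)"
  proof (rule integral_dominated_convergence[OF _ _ int_R])
    show "AE p in lborel2. (\<lambda>n. (?\<eta> (fst p) - ?\<eta> (snd p)) * (fst p $ i - snd p $ i) * l n (fst p - snd p)
        * (f (fst p) * f (snd p)))
       \<longlonglongrightarrow> (?\<eta> (fst p) - ?\<eta> (snd p)) * (fst p $ i - snd p $ i) / (norm (fst p - snd p))\<^sup>2
           * riesz_integrand \<gamma> v v v v p"
      using AE_off_diagonal
    proof eventually_elim
      case (elim p)
      have "(\<lambda>n. (?\<eta> (fst p) - ?\<eta> (snd p)) * (fst p $ i - snd p $ i) * l n (fst p - snd p)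
          * (f (fst p) * f (snd p)))
       \<longlonglongrightarrow> (?\<eta> (fst p) - ?\<eta> (snd p)) * (fst p $ i - snd p $ i)
           * (1 / norm (fst p - snd p) powr \<gamma> / (norm (fst p - snd p))\<^sup>2) * (f (fst p) * f (snd p))"
        using elim by (intro tendsto_intros l_lim) simp
      then show ?case unfolding R_eq by (simp add: mult_ac)
    qed
    show "AE p in lborel2. norm ((?\<eta> (fst p) - ?\<eta> (snd p)) * (fst p $ i - snd p $ i) * l n (fst p - snd p)
        * (f (fst p) * f (snd p))) \<le> riesz_integrand \<gamma> v v v v p" for n
      using AE_off_diagonal
    proof eventually_elim
      case (elim p)
      \<comment> \<open>The antisymmetrised weight is at most the base of \<open>l\<close>, so the
        product is at most \<open>k\<close> and hence the Riesz kernel, a bound independent of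
        \<open>n\<close>.\<close>
      have "\<bar>?\<eta> (fst p) - ?\<eta> (snd p)\<bar> * \<bar>fst p $ i - snd p $ i\<bar> \<le> \<bar>fst p $ i - snd p $ i\<bar> * \<bar>fst p $ i
          - snd p $ i\<bar>"
        using sine_coordinate_lipschitz[OF \<epsilon>] by (intro mult_right_mono) auto
      also have "\<dots> \<le> norm (fst p - snd p) * norm (fst p - snd p)"
        using component_le_norm_cart[of "fst p - snd p" i] by (intro mult_mono) auto
      also have "\<dots> \<le> (norm (fst p - snd p))\<^sup>2 + (\<delta> n)\<^sup>2" by (simp add: power2_eq_square)
      finally have "\<bar>?\<eta> (fst p) - ?\<eta> (snd p)\<bar> * \<bar>fst p $ i - snd p $ i\<bar> * l n (fst p - snd p)
          \<le> k n (fst p - snd p)"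
        unfolding kl[symmetric] by (intro mult_right_mono l0)
      also have "\<dots> \<le> 1 / norm (fst p - snd p) powr \<gamma>" using elim by (intro k_le) simp
      finally have "\<bar>?\<eta> (fst p) - ?\<eta> (snd p)\<bar> * \<bar>fst p $ i - snd p $ i\<bar> * l n (fst p - snd p)
          * (f (fst p) * f (snd p))
         \<le> 1 / norm (fst p - snd p) powr \<gamma> * (f (fst p) * f (snd p))"
        using f0 by (intro mult_right_mono mult_nonneg_nonneg)
      then show ?case unfolding R_eq using f0 l0 by (simp add: abs_mult)
    qed
  qed measurable
  have "riesz_form \<gamma> v (\<lambda>x. ?\<eta> x *\<^sub>R G x $ i) v v
      = (LINT p|lborel2. ?\<eta> (fst p) * (1 / norm (fst p - snd p) powr \<gamma>) * (g (fst p) * f (snd p)))"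
    unfolding riesz_form_def by (simp add: riesz_integrand_def[abs_def] riesz_kernel_def g_def f_def mult_ac)
  also have "\<dots> = - (1/2) * (LINT p|lborel2. cos (\<epsilon> * fst p $ i) * riesz_integrand \<gamma> v v v v p)
      + \<gamma>/4 * (LINT p|lborel2. (?\<eta> (fst p) - ?\<eta> (snd p)) * (fst p $ i - snd p $ i)
           / (norm (fst p - snd p))\<^sup>2 * riesz_integrand \<gamma> v v v v p)"
  proof (rule LIMSEQ_unique[OF lim1])
    show "(\<lambda>n. LINT p|lborel2. ?\<eta> (fst p) * k n (fst p - snd p) * (g (fst p) * f (snd p)))
       \<longlonglongrightarrow> - (1/2) * (LINT p|lborel2. cos (\<epsilon> * fst p $ i) * riesz_integrand \<gamma> v v v v p)
      + \<gamma>/4 * (LINT p|lborel2. (?\<eta> (fst p) - ?\<eta> (snd p)) * (fst p $ i - snd p $ i)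
           / (norm (fst p - snd p))\<^sup>2 * riesz_integrand \<gamma> v v v v p)"
      unfolding identity by (intro tendsto_add tendsto_mult tendsto_const lim2 lim3)
  qed
  finally show ?thesis .
qed

section \<open>Removing the truncation of the coordinates\<close>

lemma cos_weighted_integral_tendsto:
  fixes F :: "'a \<Rightarrow> real"
  assumes F: "integrable M F" and [measurable]: "a \<in> borel_measurable M"
  shows "(\<lambda>n. LINT p|M. cos (1 / real (Suc n) * a p) * F p) \<longlonglongrightarrow> (LINT p|M. F p)"
proof (rule integral_dominated_convergence)
  show "integrable M (\<lambda>p. \<bar>F p\<bar>)" using F by simp
  have "(\<lambda>n. cos (1 / real (Suc n) * a p) * F p) \<longlonglongrightarrow> cos (0 * a p) * F p" for p
    using LIMSEQ_inverse_real_of_nat by (intro tendsto_intros) (simp add: inverse_eq_divide)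
  then show "AE p in M. (\<lambda>n. cos (1 / real (Suc n) * a p) * F p) \<longlonglongrightarrow> F p" by simp
  have "\<bar>cos t\<bar> * \<bar>r\<bar> \<le> 1 * \<bar>r\<bar>" for t r :: real by (intro mult_right_mono) auto
  then show "AE p in M. norm (cos (1 / real (Suc n) * a p) * F p) \<le> \<bar>F p\<bar>" for n by (simp add: abs_mult)
qed (use borel_measurable_integrable[OF F] in measurable)

context hartree_exponents
begin

text \<open>Each coordinate is treated separately, by testing with a truncation of
  \<open>x_i\<close> times the i-th partial derivative of \<open>v\<close>. Only this component
  needs a further derivative, and the kernel contributes the share (x_i - y_i)^2 / |x -
  y|^2.\<close>

lemma pohozaev_coordinate:
  fixes v :: "real^'n \<Rightarrow> 'k::euclidean_space" and i :: 'n
  assumes v: "v \<in> H1" and eq: "\<And>\<phi>. \<phi> \<in> H1 \<Longrightarrow> first_variation \<gamma>1 \<gamma>2 v \<phi> + lam * ip v \<phi> = 0"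
  defines "W \<equiv> \<lambda>\<gamma>. LINT p|lborel2. (fst p $ i - snd p $ i)\<^sup>2 / (norm (fst p - snd p))\<^sup>2
      * riesz_integrand \<gamma> v v v v p"
  shows "ip (\<lambda>x. weak_gradient v x $ i) (\<lambda>x. weak_gradient v x $ i) + \<gamma>2/4 * W \<gamma>2 - \<gamma>1/4 * W \<gamma>1 = 0"
proof -
  define G where "G = weak_gradient v"
  have hg: "has_gradient v G" using v by (simp add: G_def has_gradient_weak_gradient)
  have sqv: "sq v" and sqG: "sq G" using hg by (auto simp: has_gradient_def)
  note [measurable] = sq_measurable[OF sqv] sq_measurable[OF sqG]
  obtain C where C: "\<And>h. ip (\<lambda>x. G (x + h) - G x) (\<lambda>x. G (x + h) - G x) \<le> C * (norm h)\<^sup>2"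
    using weak_solution_translation_bound[OF v eq] unfolding G_def by blast
  have bound: "ip (\<lambda>x. G (x + h *\<^sub>R axis i 1) - G x) (\<lambda>x. G (x + h *\<^sub>R axis i 1) - G x) \<le> C * h\<^sup>2" for h
    using C[of "h *\<^sub>R axis i 1"] by simp
  obtain s Z where s: "\<And>n::nat. 0 < s n" "s \<longlonglongrightarrow> 0" and Z: "sq Z"
    and weak: "wconv (\<lambda>n x. (1 / s n) *\<^sub>R (G (x + s n *\<^sub>R axis i 1) - G x)) Z"
    using bounded_quotients_weak_limit[OF sqG, of "axis i 1" C] bound by blast
  have s0: "s n \<noteq> 0" for n using s(1)[of n] by simp
  \<comment> \<open>The quotients of \<open>v\<close> in direction \<open>i\<close> converge weakly
    to \<open>G $ i\<close>, and their gradients, the quotients of \<open>G\<close>, to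
    \<open>Z\<close>; the graph of the gradient is weakly closed.\<close>
  have hgz: "has_gradient (\<lambda>x. G x $ i) Z"
  proof (rule has_gradient_wconv[OF _ _ Z _ weak])
    show "has_gradient (\<lambda>x. (1 / s n) *\<^sub>R (v (x + s n *\<^sub>R axis i 1) - v x)) (\<lambda>x. (1
        / s n) *\<^sub>R (G (x + s n *\<^sub>R axis i 1) - G x))" for n
      by (intro has_gradient_scaleR has_gradient_diff has_gradient_translate hg)
    show "sq (\<lambda>x. G x $ i)" using sqG by simp
    show "wconv (\<lambda>n x. (1 / s n) *\<^sub>R (v (x + s n *\<^sub>R axis i 1) - v x)) (\<lambda>x. G x $ i)"
      using has_gradient_quotient[OF hg s0 s(2), of "axis i 1"] by simp
  qed
  have z: "(\<lambda>x. G x $ i) \<in> H1" using hgz by (auto simp: H1_iff)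
  let ?\<eta> = "\<lambda>n::nat. sine_coordinate (1 / real (Suc n)) i"
  define c where "c n x = cos (1 / real (Suc n) * x $ i)" for n and x :: "real^'n"
  have [measurable]: "c n \<in> borel_measurable borel" for n unfolding c_def by measurable
  define U where "U \<gamma> n = (LINT p|lborel2. c n (fst p) * riesz_integrand \<gamma> v v v v p)" for \<gamma> n
  define V where "V \<gamma> n = (LINT p|lborel2. (?\<eta> n (fst p) - ?\<eta> n (snd p)) * (fst p $ i - snd p $ i)
           / (norm (fst p - snd p))\<^sup>2 * riesz_integrand \<gamma> v v v v p)" for \<gamma> n
  define A where "A n = (LINT x|lborel. c n x * (G x \<bullet> G x))" for n
  define B where "B n = (LINT x|lborel. c n x * (G x $ i \<bullet> G x $ i))" for n
  define M where "M n = (LINT x|lborel. c n x * (v x \<bullet> v x))" for n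
  have identity: "- (1/2) * A n + B n + (- (1/2) * U \<gamma>2 n + \<gamma>2/4 * V \<gamma>2 n)
      - (- (1/2) * U \<gamma>1 n + \<gamma>1/4 * V \<gamma>1 n)
      + lam * (- (1/2) * M n) = 0" for n
  proof -
    define \<epsilon> where "\<epsilon> = 1 / real (Suc n)"
    have \<epsilon>: "0 < \<epsilon>" by (simp add: \<epsilon>_def)
    let ?e = "sine_coordinate \<epsilon> i :: real^'n \<Rightarrow> real"
    have lip: "\<bar>?e (x + h *\<^sub>R axis j 1) - ?e x\<bar> \<le> 1 * \<bar>h\<bar>" for x h j
    proof -
      have "\<bar>(h *\<^sub>R axis j 1 :: real^'n) $ i\<bar> \<le> \<bar>h\<bar>" by (simp add: axis_def)
      then show ?thesis using sine_coordinate_lipschitz[OF \<epsilon>, of i "x + h *\<^sub>R axis j 1" x] by simp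
    qed
    have cn: "c n x = cos (\<epsilon> * x $ i)" for x by (simp add: c_def \<epsilon>_def)
    have deriv: "((\<lambda>h. ?e (x + h *\<^sub>R axis j 1)) has_real_derivative (if j
        = i then c n x else 0)) (at 0)" for x j
      unfolding cn by (rule sine_coordinate_deriv[OF \<epsilon>])
    have deriv_i: "((\<lambda>h. ?e (x + h *\<^sub>R axis i 1)) has_real_derivative c n x) (at 0)" for x
      using deriv[of x i] by simp
    define \<phi> where "\<phi> x = ?e x *\<^sub>R G x $ i" for x
    define D\<phi> where "D\<phi> x = (\<chi> j. ?e x *\<^sub>R Z x $ j + (if j = i then c n x else 0) *\<^sub>R G x $ i)" for x
    have hg\<phi>: "has_gradient \<phi> D\<phi>"
      unfolding \<phi>_def[abs_def] D\<phi>_def[abs_def]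
      by (rule has_gradient_mult[OF hgz _ _ sine_coordinate_bound[OF \<epsilon>] lip deriv]) measurable
    have \<phi>: "\<phi> \<in> H1" using hg\<phi> by (auto simp: H1_iff)
    \<comment> \<open>The term with \<open>Z\<close> is half the i-th derivative of |G|^2 and is
      integrated by parts; the other term carries the i-th component.\<close>
    have D\<phi>_inner: "G x \<bullet> D\<phi> x = ?e x * (G x \<bullet> Z x) + c n x * (G x $ i \<bullet> G x $ i)" for x
    proof -
      have "G x \<bullet> D\<phi> x = (\<Sum>j\<in>UNIV. ?e x * (G x $ j \<bullet> Z x $ j)
          + (if j = i then c n x * (G x $ i \<bullet> G x $ i) else 0))"
        unfolding inner_vec_def D\<phi>_def by (intro sum.cong) (auto simp: inner_add_right)
      then show ?thesis by (simp add: sum.distrib inner_vec_def sum_distrib_left)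
    qed
    have weight: "integrable lborel (\<lambda>x. m x * (f x \<bullet> g x))"
      if "sq f" "sq g" and [measurable]: "m \<in> borel_measurable borel" and m: "\<And>x. \<bar>m x\<bar> \<le> K"
      for m :: "real^'n \<Rightarrow> real" and K and f g :: "real^'n \<Rightarrow> 'b::euclidean_space"
    proof (rule Bochner_Integration.integrable_bound)
      show "integrable lborel (\<lambda>x. K * (f x \<bullet> g x))" using integrable_inner[OF that(1,2)] by simp
      have "0 \<le> K" using m[of 0] by linarith
      then show "AE x in lborel. norm (m x * (f x \<bullet> g x)) \<le> norm (K * (f x \<bullet> g x))"
        using m by (auto intro!: AE_I2 mult_right_mono simp: abs_mult)
    qed (use sq_measurable[OF that(1)] sq_measurable[OF that(2)] in measurable)
    have "ip G (weak_gradient \<phi>) = ip G D\<phi>"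
      unfolding G_def by (rule ip_weak_gradient[OF has_gradient_weak_gradient[OF v] hg\<phi>])
    also have "\<dots> = (LINT x|lborel. ?e x * (G x \<bullet> Z x)) + B n"
      unfolding ip_def D\<phi>_inner B_def
    proof (rule Bochner_Integration.integral_add)
      show "integrable lborel (\<lambda>x. ?e x * (G x \<bullet> Z x))"
          by (rule weight[OF sqG Z _ sine_coordinate_bound[OF \<epsilon>]]) measurable
      show "integrable lborel (\<lambda>x. c n x * (G x $ i \<bullet> G x $ i))"
        by (rule weight[of _ _ _ 1]) (use sqG in \<open>auto simp: c_def\<close>)
    qed
    also have "(LINT x|lborel. ?e x * (G x \<bullet> Z x)) = - (1/2) * A n"
      unfolding A_def
      by (rule integration_by_parts_square[OF sqG Z bound s weak _ _ sine_coordinate_bound[OF \<epsilon>] lip deriv_i])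
          measurable
    finally have 1: "ip G (weak_gradient \<phi>) = - (1/2) * A n + B n" .
    have "ip v \<phi> = (LINT x|lborel. ?e x * (v x \<bullet> G x $ i))" by (simp add: ip_def \<phi>_def)
    also have "\<dots> = - (1/2) * M n"
      unfolding M_def
      by (rule integration_by_parts_gradient[OF hg _ _ sine_coordinate_bound[OF \<epsilon>] lip deriv_i]) measurable
    finally have 2: "ip v \<phi> = - (1/2) * M n" .
    have 3: "riesz_form \<gamma> v \<phi> v v = - (1/2) * U \<gamma> n + \<gamma>/4 * V \<gamma> n" if "admissible TYPE('n) \<gamma>" for \<gamma>
      using riesz_form_by_parts[OF that hg z \<epsilon>] unfolding U_def V_def \<phi>_def[abs_def] cn \<epsilon>_def .
    show ?thesis using eq[OF \<phi>] unfolding first_variation_def G_def[symmetric] 1 2 3[OF adm1] 3[OF adm2] .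
  qed
  have int_R: "integrable lborel2 (riesz_integrand \<gamma> v v v v)" if "admissible TYPE('n) \<gamma>" for \<gamma>
    by (rule riesz_diag_integrable[OF that v v])
  have limU: "U \<gamma> \<longlonglongrightarrow> self_energy \<gamma> v" if "admissible TYPE('n) \<gamma>" for \<gamma>
    unfolding U_def[abs_def] c_def self_energy_def riesz_form_def
    by (rule cos_weighted_integral_tendsto[OF int_R[OF that]]) measurable
  have limA: "A \<longlonglongrightarrow> kinetic v" and limB: "B \<longlonglongrightarrow> ip (\<lambda>x. G x $ i) (\<lambda>x. G x $ i)" and limM: "M \<longlonglongrightarrow> ip v v"
    unfolding A_def[abs_def] B_def[abs_def] M_def[abs_def] c_def kinetic_def G_def[symmetric] ip_def
    by (intro cos_weighted_integral_tendsto integrable_inner sq_vec_nth sqv sqG, measurable)+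
  have limV: "V \<gamma> \<longlonglongrightarrow> W \<gamma>" if adm: "admissible TYPE('n) \<gamma>" for \<gamma>
    unfolding V_def[abs_def] W_def
  proof (rule integral_dominated_convergence[OF _ _ int_R[OF adm]])
    show "AE p in lborel2. (\<lambda>n. (?\<eta> n (fst p) - ?\<eta> n (snd p)) * (fst p $ i - snd p $ i)
        / (norm (fst p - snd p))\<^sup>2 * riesz_integrand \<gamma> v v v v p)
       \<longlonglongrightarrow> (fst p $ i - snd p $ i)\<^sup>2 / (norm (fst p - snd p))\<^sup>2 * riesz_integrand \<gamma> v v v v p"
      unfolding power2_eq_square[of "_ $ i - _ $ i"] divide_inverse[of _ "(norm _)\<^sup>2"]
      by (intro AE_I2 tendsto_mult tendsto_diff tendsto_const sine_coordinate_tendsto)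
    show "AE p in lborel2. norm ((?\<eta> n (fst p) - ?\<eta> n (snd p)) * (fst p $ i - snd p $ i)
        / (norm (fst p - snd p))\<^sup>2 * riesz_integrand \<gamma> v v v v p)
       \<le> riesz_integrand \<gamma> v v v v p" for n
    proof (rule AE_I2)
      fix p :: "(real^'n) \<times> (real^'n)"
      have "\<bar>?\<eta> n (fst p) - ?\<eta> n (snd p)\<bar> * \<bar>fst p $ i - snd p $ i\<bar> \<le> \<bar>fst p $ i - snd p $ i\<bar> * \<bar>fst p $ i
          - snd p $ i\<bar>"
        by (intro mult_right_mono sine_coordinate_lipschitz) auto
      also have "\<dots> \<le> norm (fst p - snd p) * norm (fst p - snd p)"
        using component_le_norm_cart[of "fst p - snd p" i] by (intro mult_mono) auto
      finally have "\<bar>?\<eta> n (fst p) - ?\<eta> n (snd p)\<bar> * \<bar>fst p $ i - snd p $ i\<bar> / (norm (fst p - snd p))\<^sup>2 \<le> 1"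
        by (simp add: power2_eq_square divide_le_eq_1 zero_less_mult_iff)
      moreover have R0: "0 \<le> riesz_integrand \<gamma> v v v v p" by (simp add: riesz_integrand_def)
      ultimately have "\<bar>?\<eta> n (fst p) - ?\<eta> n (snd p)\<bar> * \<bar>fst p $ i - snd p $ i\<bar> / (norm (fst p - snd p))\<^sup>2
          * riesz_integrand \<gamma> v v v v p
          \<le> 1 * riesz_integrand \<gamma> v v v v p" by (rule mult_right_mono)
      then show "norm ((?\<eta> n (fst p) - ?\<eta> n (snd p)) * (fst p $ i - snd p $ i) / (norm (fst p - snd p))\<^sup>2
          * riesz_integrand \<gamma> v v v v p)
          \<le> riesz_integrand \<gamma> v v v v p" using R0 by (simp add: abs_mult)
    qed
  qed measurable
  have "(\<lambda>n. - (1/2) * A n + B n + (- (1/2) * U \<gamma>2 n + \<gamma>2/4 * V \<gamma>2 n) - (- (1/2) * U \<gamma>1 n + \<gamma>1/4 * V \<gamma>1 n)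
      + lam * (- (1/2) * M n))
    \<longlonglongrightarrow> - (1/2) * kinetic v + ip (\<lambda>x. G x $ i) (\<lambda>x. G x $ i) + (- (1/2) * self_energy \<gamma>2 v + \<gamma>2/4 * W \<gamma>2)
      - (- (1/2) * self_energy \<gamma>1 v + \<gamma>1/4 * W \<gamma>1) + lam * (- (1/2) * ip v v)"
    by (intro tendsto_add tendsto_diff tendsto_mult tendsto_const limA limB limM limU limV adm1 adm2)
  then have "- (1/2) * kinetic v + ip (\<lambda>x. G x $ i) (\<lambda>x. G x $ i) + (- (1/2) * self_energy \<gamma>2 v + \<gamma>2/4 * W \<gamma>2)
      - (- (1/2) * self_energy \<gamma>1 v + \<gamma>1/4 * W \<gamma>1) + lam * (- (1/2) * ip v v) = 0"
    unfolding identity by (rule LIMSEQ_unique[OF tendsto_const, symmetric])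
  \<comment> \<open>The equation tested with \<open>v\<close>. Adding half of it cancels the
    kinetic, mass and self-energy terms produced by the derivative of the weight, and with them the
    unknown \<open>lam\<close>.\<close>
  moreover have "kinetic v + self_energy \<gamma>2 v - self_energy \<gamma>1 v + lam * ip v v = 0"
    using eq[OF v] by (simp add: first_variation_def kinetic_def self_energy_def)
  ultimately show ?thesis unfolding G_def[symmetric] by linarith
qed

text \<open>The coordinate identities add up to the virial because the shares (x_i - y_i)^2 / |x -
  y|^2 sum to 1 off the diagonal, a null set.\<close>

theorem pohozaev:
  fixes v :: "real^'n \<Rightarrow> 'k::euclidean_space"
  assumes v: "v \<in> H1" and eq: "\<And>\<phi>. \<phi> \<in> H1 \<Longrightarrow> first_variation \<gamma>1 \<gamma>2 v \<phi> + lam * ip v \<phi> = 0"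
  shows "virial \<gamma>1 \<gamma>2 v = 0"
proof -
  define W where "W \<gamma> i = (LINT p|lborel2. (fst p $ i - snd p $ i)\<^sup>2 / (norm (fst p - snd p))\<^sup>2
      * riesz_integrand \<gamma> v v v v p)" for \<gamma> i
  note [measurable] = H1_measurable[OF v]
  have sum_W: "(\<Sum>i\<in>UNIV. W \<gamma> i) = self_energy \<gamma> v" if adm: "admissible TYPE('n) \<gamma>" for \<gamma>
  proof -
    have int: "integrable lborel2 (\<lambda>p. (fst p $ i - snd p $ i)\<^sup>2 / (norm (fst p - snd p))\<^sup>2
        * riesz_integrand \<gamma> v v v v p)" for i
    proof (rule Bochner_Integration.integrable_bound[OF riesz_diag_integrable[OF adm v v]])
      show "AE p in lborel2. norm ((fst p $ i - snd p $ i)\<^sup>2 / (norm (fst p - snd p))\<^sup>2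
          * riesz_integrand \<gamma> v v v v p) \<le> norm (riesz_integrand \<gamma> v v v v p)"
      proof (rule AE_I2)
        fix p :: "(real^'n) \<times> (real^'n)"
        have "(fst p $ i - snd p $ i)\<^sup>2 \<le> (norm (fst p - snd p))\<^sup>2"
          using component_le_norm_cart[of "fst p - snd p" i] by (simp add: abs_le_square_iff[symmetric])
        then have "(fst p $ i - snd p $ i)\<^sup>2 / (norm (fst p - snd p))\<^sup>2 \<le> 1" by (simp add: divide_le_eq_1)
        then have "(fst p $ i - snd p $ i)\<^sup>2 / (norm (fst p - snd p))\<^sup>2 * \<bar>riesz_integrand \<gamma> v v v v p\<bar>
            \<le> 1 * \<bar>riesz_integrand \<gamma> v v v v p\<bar>"
          by (intro mult_right_mono) auto
        then show "norm ((fst p $ i - snd p $ i)\<^sup>2 / (norm (fst p - snd p))\<^sup>2 * riesz_integrand \<gamma> v v v v p)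
            \<le> norm (riesz_integrand \<gamma> v v v v p)"
          by (simp add: abs_mult)
      qed
    qed measurable
    have "(\<Sum>i\<in>UNIV. W \<gamma> i) = (LINT p|lborel2. (\<Sum>i\<in>UNIV. (fst p $ i - snd p $ i)\<^sup>2 / (norm (fst p - snd p))\<^sup>2
        * riesz_integrand \<gamma> v v v v p))"
      unfolding W_def by (rule Bochner_Integration.integral_sum[symmetric]) (rule int)
    also have "\<dots> = (LINT p|lborel2. riesz_integrand \<gamma> v v v v p)"
    proof (rule integral_cong_AE)
      show "AE p in lborel2. (\<Sum>i\<in>UNIV. (fst p $ i - snd p $ i)\<^sup>2 / (norm (fst p - snd p))\<^sup>2
          * riesz_integrand \<gamma> v v v v p)
         = riesz_integrand \<gamma> v v v v p"
        using AE_off_diagonal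
      proof eventually_elim
        case (elim p)
        have "(\<Sum>i\<in>UNIV. (fst p $ i - snd p $ i)\<^sup>2) = (norm (fst p - snd p))\<^sup>2"
          unfolding power2_norm_eq_inner inner_vec_def by (simp add: power2_eq_square)
        then show ?case using elim by (simp add: sum_distrib_right[symmetric] sum_divide_distrib[symmetric])
      qed
    qed measurable
    finally show ?thesis by (simp add: self_energy_def riesz_form_def)
  qed
  have sqG: "sq (weak_gradient v)" using has_gradient_weak_gradient[OF v] by (simp add: has_gradient_def)
  have "virial \<gamma>1 \<gamma>2 v = (\<Sum>i\<in>UNIV. ip (\<lambda>x. weak_gradient v x $ i) (\<lambda>x. weak_gradient v x $ i) + \<gamma>2/4 * W \<gamma>2 i
      - \<gamma>1/4 * W \<gamma>1 i)"
    by (simp add: virial_def kinetic_def ip_vec[OF sqG sqG] sum_W[OF adm1, symmetric] sum_W[OF adm2,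
        symmetric]
        sum.distrib sum_subtractf sum_distrib_left)
  also have "\<dots> = 0"
    unfolding W_def by (intro sum.neutral ballI pohozaev_coordinate[OF v eq])
  finally show ?thesis .
qed

end

theorem theorem1p4:
  fixes \<gamma>1 \<gamma>2 :: real
  assumes "CARD('n::finite) \<ge> 3"
    and "0 < \<gamma>2" and "\<gamma>2 < \<gamma>1" and "\<gamma>1 < min (real CARD('n)) 4" and "\<gamma>1 > 2"
  shows "\<exists>c1>0. \<forall>c. 0 < c \<and> c < c1 \<longrightarrow>
           (\<exists>u :: real^'n \<Rightarrow> 'k::{real_normed_field, euclidean_space}.
              ground_state \<gamma>1 \<gamma>2 c u \<and>
              ereal (E \<gamma>1 \<gamma>2 u) = Gamma_inf TYPE(real^'n \<Rightarrow> 'k) \<gamma>1 \<gamma>2 c)"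
proof -
  interpret hartree_exponents \<gamma>1 \<gamma>2 "TYPE('n)"
    using assms by unfold_locales (auto simp: admissible_def)
  have virial: "virial \<gamma>1 \<gamma>2 v = 0" if "normalized_solution \<gamma>1 \<gamma>2 c v" for v :: "real^'n \<Rightarrow> 'k" and c
    using that pohozaev[of v] unfolding normalized_solution_def weak_solution_iff by blast
  have P_iff: "w \<in> P \<gamma>1 \<gamma>2 c \<longleftrightarrow> w \<in> S c \<and> virial \<gamma>1 \<gamma>2 w = 0" for w :: "real^'n \<Rightarrow> 'k" and c
    by (auto simp: P_def S_def Q_eq_virial)
  obtain c1 where c1: "0 < c1" and minimiser: "\<forall>c. 0 < c \<and> c < c1 \<longrightarrow> (\<exists>u :: real^'n \<Rightarrow> 'k.
      normalized_solution \<gamma>1 \<gamma>2 c u \<and> virial \<gamma>1 \<gamma>2 u = 0 \<and> (\<forall>w\<in>S c. virial \<gamma>1 \<gamma>2 (w :: real^'n \<Rightarrow> 'k) = 0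
          \<longrightarrow> E \<gamma>1 \<gamma>2 u \<le> E \<gamma>1 \<gamma>2 w))"
    using minimizer_is_solution[where 'k = 'k] by (elim exE conjE) (rule that)
  show ?thesis
  proof (intro exI[of _ c1] conjI c1 allI impI)
    fix c assume "0 < c \<and> c < c1"
    then obtain u :: "real^'n \<Rightarrow> 'k" where sol: "normalized_solution \<gamma>1 \<gamma>2 c u" and u0: "virial \<gamma>1 \<gamma>2 u = 0"
      and least: "\<And>w :: real^'n \<Rightarrow> 'k. w \<in> S c \<Longrightarrow> virial \<gamma>1 \<gamma>2 w = 0 \<Longrightarrow> E \<gamma>1 \<gamma>2 u \<le> E \<gamma>1 \<gamma>2 w"
      using minimiser[rule_format, of c] by blast
    have "ground_state \<gamma>1 \<gamma>2 c u"
      unfolding ground_state_def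
    proof (intro conjI allI impI sol)
      fix v :: "real^'n \<Rightarrow> 'k" assume "normalized_solution \<gamma>1 \<gamma>2 c v"
      then show "E \<gamma>1 \<gamma>2 u \<le> E \<gamma>1 \<gamma>2 v" by (intro least virial) (auto simp: normalized_solution_def)
    qed
    moreover have "u \<in> P \<gamma>1 \<gamma>2 c" using sol u0 by (simp add: P_iff normalized_solution_def)
    then have "ereal (E \<gamma>1 \<gamma>2 u) = Gamma_inf TYPE(real^'n \<Rightarrow> 'k) \<gamma>1 \<gamma>2 c"
      unfolding Gamma_inf_def by (intro antisym INF_lower INF_greatest) (auto simp: P_iff intro: least)
    ultimately show "\<exists>u :: real^'n \<Rightarrow> 'k. ground_state \<gamma>1 \<gamma>2 c u \<and> ereal (E \<gamma>1 \<gamma>2 u)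
        = Gamma_inf TYPE(real^'n \<Rightarrow> 'k) \<gamma>1 \<gamma>2 c"
      by blast
  qed
qed

end
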